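(* Let $\widetilde\Pi_h$ be the auxiliary interpolation operator on the extended region $\widetilde\Omega_h$. For any cell $T\in\mathcal{G}_h$ the following hold, with constants $C>0$ that may depend on the shape-regularity constant $\gamma_0$ but not on the mesh size, on $T$ or on $v$ ($k$ and $s$ integers): (a) $(\widetilde\Pi_h v)|_T=v|_T$ for every $v\in L^1(\widetilde\Omega_h)$ such that $v|_{\Delta_T}\in P_2(\Delta_T)$; (b) $|\widetilde\Pi_h v|_{k,T}\le C\,h_T^{-k}\,\|v\|_{0,\Delta_T}$ for $0\le k\le2$ and every $v\in L^1(\widetilde\Omega_h)$ with $v|_{\Delta_T}\in L^2(\Delta_T)$; (c) $|v-\widetilde\Pi_h v|_{k,T}\le C\,h_T^{s-k}\,|v|_{s,\Delta_T}$ for $v\in H^s(\Delta_T)$ and $0\le k\le s\le3$. (In (c), $\widetilde\Pi_h v|_T$ depends only on $v|_{\Delta_T}$.)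
   Context: Grid. $\Omega\subset\mathbb{R}^2$ is a simply-connected (not necessarily convex) polygon that can be subdivided into rectangles with sides parallel to the axes; $\mathcal{G}_h$ is a (conforming) subdivision into such rectangles. $h_K$ is the larger side length of a cell $K$, $\rho_K$ its inscribed circle radius, and $h_K/\rho_K\le\gamma_0$ for all cells with $\gamma_0$ independent of the mesh. A cell is interior if none of its vertices is on $\partial\Omega$, otherwise it is a boundary cell; $\mathcal{K}_h^i,\mathcal{K}_h^b$ are the sets of interior and boundary cells. A boundary vertex is a (convex or concave) corner node if two sides of $\partial\Omega$ not on one line meet there; no cell contains two corner nodes. A boundary edge is a corner edge if one endpoint is a corner node, and otherwise a non-corner boundary edge. Patches. For a cell $K$, $\mathcal{M}_K$ is a $3\times3$ patch of rectangles centered at $K$, with column lengths (left to right) $L_{K,-1},L_K,L_{K,1}$ and row heights (bottom to top) $H_{K,-1},H_K,H_{K,1}$. For interior $K$ it consists of cells of $\mathcal{G}_h$. For boundary cells, cells are added (virtually) outside $\Omega$ as follows (other orientations by symmetry). (i) Convex upper-right corner, $K$ the cell at the corner: choose $L_{K,1},L_{K,2},H_{K,1},H_{K,2}>0$ comparable to the size of $K$, add columns of lengths $L_{K,1},L_{K,2}$ to the right and rows of heights $H_{K,1},H_{K,2}$ above; let $K_r,K_u,K_{ur}$ be the added cells to the right of, above, and diagonally opposite to $K$. Then $\mathcal{M}_K,\mathcal{M}_{K_r},\mathcal{M}_{K_u},\mathcal{M}_{K_{ur}}$ have column lengths $\{L_{K,-1},L_K,L_{K,1}\}$ (for $K,K_u$)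 or $\{L_K,L_{K,1},L_{K,2}\}$ (for $K_r,K_{ur}$) and row heights $\{H_{K,-1},H_K,H_{K,1}\}$ (for $K,K_r$) or $\{H_K,H_{K,1},H_{K,2}\}$ (for $K_u,K_{ur}$). (ii) Concave corner with cells $K,K_r,K_u\in\mathcal{G}_h$ meeting there, the upper-right quadrant being outside $\Omega$: the cell $K_{ur}$ filling this quadrant at the corner (with the length of $K_r$ and the height of $K_u$) is added, together with the cells (with column lengths and row heights inherited from the adjacent grid) needed to complete the four $3\times3$ patches centered at $K,K_r,K_u,K_{ur}$. (iii) Non-corner boundary edge, e.g. the top edge of $K$: choose $H_{K,1},H_{K,2}>0$ comparable to $H_K$, add two rows of these heights above; $K_u$ is the added cell above $K$; $\mathcal{M}_K$ and $\mathcal{M}_{K_u}$ have the column lengths of $K$ and its left and right neighbours, and row heights $\{H_{K,-1},H_K,H_{K,1}\}$ and $\{H_K,H_{K,1},H_{K,2}\}$ respectively. These choices are local, may differ from one boundary cell to another, and are made so that the regularity bound with $\gamma_0$ holds for all cells of all patches. $\mathcal{K}_h^{\rm ex}$ is the set of all added center cells ($K_r,K_u,K_{ur}$ in (i); $K_{ur}$ in (ii); the added neighbour in (iii)). $\mathcal{J}_h:=\mathcal{K}_h^i\cup\mathcal{K}_h^b\cup\mathcal{K}_h^{\rm ex}$ and $\widetilde\Omega_h:=\bigcup_{K\in\mathcal{J}_h}\mathcal{M}_K$. For $T\in\mathcal{G}_h$, $\Delta_T:=\bigcup\{\mathcal{M}_K: K\in\mathcal{J}_h,\ \mathcal{M}_K\supset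 T\}$. Functions. For a nine-cell grid $\mathcal{M}_K$, $V_{h0}^{\rm R}(\mathcal{M}_K)$ is the (one-dimensional) space of functions that are $P_2$ on each cell, continuous at interior vertices, with mean normal derivative over each interior edge continuous across it, zero at boundary vertices, and with zero mean normal derivative on each boundary edge. $\varphi_K$ vanishes outside $\mathcal{M}_K$, $\varphi_K|_{\mathcal{M}_K}\in V_{h0}^{\rm R}(\mathcal{M}_K)$, and at the lower-left vertex of $K$ its value is $\frac{L_{K,-1}}{L_{K,-1}+L_K}\cdot\frac{H_{K,-1}}{H_{K,-1}+H_K}$. Operator. Let $S_1^K,\dots,S_4^K$ be the left, right, lower, upper neighbours of $K$ in $\mathcal{M}_K$ and $S_5^K=K$; $\lambda_K(v)=\sum_{\mu=1}^5w_\mu^K\frac{1}{|S_\mu^K|}\int_{S_\mu^K}v\,dx\,dy$ with $w_1^K=\frac{-L_K^2}{(L_{K,-1}+L_K)(L_{K,-1}+L_K+L_{K,1})}$, $w_2^K=\frac{-L_K^2}{(L_K+L_{K,1})(L_{K,-1}+L_K+L_{K,1})}$, $w_3^K=\frac{-H_K^2}{(H_{K,-1}+H_K)(H_{K,-1}+H_K+H_{K,1})}$, $w_4^K=\frac{-H_K^2}{(H_K+H_{K,1})(H_{K,-1}+H_K+H_{K,1})}$, $w_5^K=1-\sum_{\mu=1}^4w_\mu^K$. Then $\widetilde\Pi_hv:=\sum_{K\in\mathcal{J}_h}\lambda_K(v)\varphi_K$ for $v\in L^1(\widetilde\Omega_h)$. *)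

theory Defs
  imports "HOL-Analysis.Analysis"
begin

type_synonym pt = "real \<times> real"

text \<open>A cell is given by its lower-left and its upper-right vertex.\<close>

type_synonym cell = "pt \<times> pt"

definition region :: "cell \<Rightarrow> pt set" where
  "region K = cbox (fst K) (snd K)"

definition nondegenerate :: "cell \<Rightarrow> bool" where
  "nondegenerate K \<longleftrightarrow> fst (fst K) < fst (snd K) \<and> snd (fst K) < snd (snd K)"

definition width :: "cell \<Rightarrow> real" where
  "width K = fst (snd K) - fst (fst K)"

definition height :: "cell \<Rightarrow> real" where
  "height K = snd (snd K) - snd (fst K)"

definition diam_cell :: "cell \<Rightarrow> real" where
  "diam_cell K = max (width K) (height K)"

definition inradius :: "cell \<Rightarrow> real" where
  "inradius K = min (width K) (height K) / 2"

text \<open>Directions are encoded by signs: in the first coordinate -1 is left and 1 is right, in the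
  second one -1 is down and 1 is up; 0 stands for the centre.\<close>

abbreviation signs :: "int set" where "signs \<equiv> {-1, 1}"

abbreviation offs :: "int set" where "offs \<equiv> {-1, 0, 1}"

definition vertex :: "cell \<Rightarrow> int \<Rightarrow> int \<Rightarrow> pt" where
  "vertex K \<sigma> \<tau> = (if \<sigma> = -1 then fst (fst K) else fst (snd K),
                   if \<tau> = -1 then snd (fst K) else snd (snd K))"

definition xside :: "cell \<Rightarrow> int \<Rightarrow> pt set" where
  "xside K \<sigma> = closed_segment (vertex K \<sigma> (-1)) (vertex K \<sigma> 1)"

definition yside :: "cell \<Rightarrow> int \<Rightarrow> pt set" where
  "yside K \<tau> = closed_segment (vertex K (-1) \<tau>) (vertex K 1 \<tau>)"


definition polygon_side :: "pt list \<Rightarrow> nat \<Rightarrow> pt set" where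
  "polygon_side vs i = closed_segment (vs ! i) (vs ! (Suc i mod length vs))"

definition simple_polygon :: "pt list \<Rightarrow> bool" where
  "simple_polygon vs \<longleftrightarrow> length vs \<ge> 3 \<and> distinct vs \<and>
     (\<forall>i<length vs. \<forall>j<length vs. i \<noteq> j \<longrightarrow>
        polygon_side vs i \<inter> polygon_side vs j =
          {vs ! i, vs ! (Suc i mod length vs)} \<inter> {vs ! j, vs ! (Suc j mod length vs)})"

definition polygonal_domain :: "pt set \<Rightarrow> bool" where
  "polygonal_domain \<Omega> \<longleftrightarrow> open \<Omega> \<and> bounded \<Omega> \<and> connected \<Omega> \<and> simply_connected \<Omega> \<and>
     (\<exists>vs. simple_polygon vs \<and> frontier \<Omega> = (\<Union>i<length vs. polygon_side vs i))"

definition corner_node :: "pt set \<Rightarrow> pt \<Rightarrow> bool" where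
  "corner_node \<Omega> p \<longleftrightarrow> (\<exists>a b. \<not> collinear {a, p, b} \<and>
     closed_segment p a \<subseteq> frontier \<Omega> \<and> closed_segment p b \<subseteq> frontier \<Omega>)"

text \<open>At a corner node of a rectilinear polygon, \<open>\<Omega>\<close> is locally convex iff the interior angle is
  \<open>\<pi>/2\<close>, the other possible angle being \<open>3\<pi>/2\<close>.\<close>

definition convex_corner :: "pt set \<Rightarrow> pt \<Rightarrow> bool" where
  "convex_corner \<Omega> p \<longleftrightarrow> corner_node \<Omega> p \<and> (\<exists>e>0. convex (\<Omega> \<inter> ball p e))"

definition concave_corner :: "pt set \<Rightarrow> pt \<Rightarrow> bool" where
  "concave_corner \<Omega> p \<longleftrightarrow> corner_node \<Omega> p \<and> \<not> convex_corner \<Omega> p"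

definition boundary_cell :: "pt set \<Rightarrow> cell \<Rightarrow> bool" where
  "boundary_cell \<Omega> K \<longleftrightarrow> (\<exists>\<sigma>\<in>signs. \<exists>\<tau>\<in>signs. vertex K \<sigma> \<tau> \<in> frontier \<Omega>)"

definition interior_cells :: "pt set \<Rightarrow> cell set \<Rightarrow> cell set" where
  "interior_cells \<Omega> G = {K \<in> G. \<not> boundary_cell \<Omega> K}"

definition boundary_cells :: "pt set \<Rightarrow> cell set \<Rightarrow> cell set" where
  "boundary_cells \<Omega> G = {K \<in> G. boundary_cell \<Omega> K}"

definition shape_regular :: "real \<Rightarrow> cell \<Rightarrow> bool" where
  "shape_regular \<gamma>0 K \<longleftrightarrow> diam_cell K / inradius K \<le> \<gamma>0"

text \<open>Conformity: two cells meet in a common face (nothing, a vertex or a full edge), so that in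
  particular distinct cells have disjoint interiors.\<close>

definition rectangular_grid :: "real \<Rightarrow> pt set \<Rightarrow> cell set \<Rightarrow> bool" where
  "rectangular_grid \<gamma>0 \<Omega> G \<longleftrightarrow> polygonal_domain \<Omega> \<and> finite G \<and>
     (\<forall>K\<in>G. nondegenerate K \<and> shape_regular \<gamma>0 K) \<and>
     (\<Union>K\<in>G. region K) = closure \<Omega> \<and>
     (\<forall>K\<in>G. \<forall>K'\<in>G. (region K \<inter> region K') face_of region K \<and>
                      (region K \<inter> region K') face_of region K') \<and>
     (\<forall>K\<in>G. \<forall>p\<in>region K. \<forall>q\<in>region K. corner_node \<Omega> p \<and> corner_node \<Omega> q \<longrightarrow> p = q)"


text \<open>The patches are given by two functions \<open>L\<close> and \<open>H\<close>: for a cell \<open>K\<close>, the numbers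
  \<open>L K (-1)\<close>, \<open>L K 0\<close>, \<open>L K 1\<close> are the column lengths of the patch centred at \<open>K\<close> (left to right)
  and \<open>H K (-1)\<close>, \<open>H K 0\<close>, \<open>H K 1\<close> its row heights (bottom to top). The grid lines of the patch
  are numbered -1, 0, 1, 2, so that column \<open>\<sigma>\<close> lies between the lines \<open>\<sigma>\<close> and \<open>\<sigma> + 1\<close>.\<close>

type_synonym lengths = "cell \<Rightarrow> int \<Rightarrow> real"

definition xknot :: "lengths \<Rightarrow> cell \<Rightarrow> int \<Rightarrow> real" where
  "xknot L K i = (if i = -1 then fst (fst K) - L K (-1)
                  else if i = 0 then fst (fst K)
                  else if i = 1 then fst (snd K)
                  else fst (snd K) + L K 1)"

definition yknot :: "lengths \<Rightarrow> cell \<Rightarrow> int \<Rightarrow> real" where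
  "yknot H K j = (if j = -1 then snd (fst K) - H K (-1)
                  else if j = 0 then snd (fst K)
                  else if j = 1 then snd (snd K)
                  else snd (snd K) + H K 1)"

definition patch_cell :: "lengths \<Rightarrow> lengths \<Rightarrow> cell \<Rightarrow> int \<Rightarrow> int \<Rightarrow> cell" where
  "patch_cell L H K \<sigma> \<tau> =
     ((xknot L K \<sigma>, yknot H K \<tau>), (xknot L K (\<sigma> + 1), yknot H K (\<tau> + 1)))"

definition patch :: "lengths \<Rightarrow> lengths \<Rightarrow> cell \<Rightarrow> pt set" where
  "patch L H K = (\<Union>\<sigma>\<in>offs. \<Union>\<tau>\<in>offs. region (patch_cell L H K \<sigma> \<tau>))"

definition convex_at :: "pt set \<Rightarrow> cell \<Rightarrow> int \<Rightarrow> int \<Rightarrow> bool" where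
  "convex_at \<Omega> K \<sigma> \<tau> \<longleftrightarrow> convex_corner \<Omega> (vertex K \<sigma> \<tau>)"

text \<open>Of the three cells at a concave corner, \<open>K\<close> is the one opposite to the quadrant outside
  \<open>\<Omega>\<close>: both its horizontal and its vertical neighbour at the corner belong to the grid.\<close>

definition concave_at ::
  "pt set \<Rightarrow> cell set \<Rightarrow> lengths \<Rightarrow> lengths \<Rightarrow> cell \<Rightarrow> int \<Rightarrow> int \<Rightarrow> bool" where
  "concave_at \<Omega> G L H K \<sigma> \<tau> \<longleftrightarrow> concave_corner \<Omega> (vertex K \<sigma> \<tau>) \<and>
     patch_cell L H K \<sigma> 0 \<in> G \<and> patch_cell L H K 0 \<tau> \<in> G"

definition noncorner_xside :: "pt set \<Rightarrow> cell \<Rightarrow> int \<Rightarrow> bool" where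
  "noncorner_xside \<Omega> K \<sigma> \<longleftrightarrow> xside K \<sigma> \<subseteq> frontier \<Omega> \<and>
     \<not> corner_node \<Omega> (vertex K \<sigma> (-1)) \<and> \<not> corner_node \<Omega> (vertex K \<sigma> 1)"

definition noncorner_yside :: "pt set \<Rightarrow> cell \<Rightarrow> int \<Rightarrow> bool" where
  "noncorner_yside \<Omega> K \<tau> \<longleftrightarrow> yside K \<tau> \<subseteq> frontier \<Omega> \<and>
     \<not> corner_node \<Omega> (vertex K (-1) \<tau>) \<and> \<not> corner_node \<Omega> (vertex K 1 \<tau>)"

definition extension_cells ::
  "pt set \<Rightarrow> cell set \<Rightarrow> lengths \<Rightarrow> lengths \<Rightarrow> cell set" where
  "extension_cells \<Omega> G L H =
     {K'. \<exists>K\<in>G. \<exists>\<sigma>\<in>signs. \<exists>\<tau>\<in>signs. convex_at \<Omega> K \<sigma> \<tau> \<and>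
            K' \<in> {patch_cell L H K \<sigma> 0, patch_cell L H K 0 \<tau>, patch_cell L H K \<sigma> \<tau>}} \<union>
     {patch_cell L H K \<sigma> \<tau> |K \<sigma> \<tau>. K \<in> G \<and> \<sigma> \<in> signs \<and> \<tau> \<in> signs \<and> concave_at \<Omega> G L H K \<sigma> \<tau>} \<union>
     {patch_cell L H K \<sigma> 0 |K \<sigma>. K \<in> G \<and> \<sigma> \<in> signs \<and> noncorner_xside \<Omega> K \<sigma>} \<union>
     {patch_cell L H K 0 \<tau> |K \<tau>. K \<in> G \<and> \<tau> \<in> signs \<and> noncorner_yside \<Omega> K \<tau>}"

definition centers :: "pt set \<Rightarrow> cell set \<Rightarrow> lengths \<Rightarrow> lengths \<Rightarrow> cell set" where
  "centers \<Omega> G L H = interior_cells \<Omega> G \<union> boundary_cells \<Omega> G \<union> extension_cells \<Omega> G L H"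

definition outside_domain :: "pt set \<Rightarrow> cell \<Rightarrow> bool" where
  "outside_domain \<Omega> K \<longleftrightarrow> interior (region K) \<inter> \<Omega> = {}"

text \<open>The four orientations of a corner are the sign pairs \<open>(\<sigma>, \<tau>)\<close>; the names \<open>Kr\<close>, \<open>Ku\<close>, \<open>Kur\<close>
  refer to the upper-right one. In both corner conditions and both edge conditions the
  requirements \<open>outside_domain\<close> list the added cells: no added cell may overlap \<open>\<Omega>\<close>, not even a
  part of it on the other side of a narrow gap, whereas cells added for different boundary cells
  may overlap each other.\<close>

definition convex_patches ::
  "pt set \<Rightarrow> lengths \<Rightarrow> lengths \<Rightarrow> cell \<Rightarrow> int \<Rightarrow> int \<Rightarrow> bool" where
  "convex_patches \<Omega> L H K \<sigma> \<tau> \<longleftrightarrow>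
     (let Kr = patch_cell L H K \<sigma> 0; Ku = patch_cell L H K 0 \<tau>; Kur = patch_cell L H K \<sigma> \<tau> in
        L Kr (-\<sigma>) = L K 0 \<and> (\<forall>\<beta>\<in>offs. H Kr \<beta> = H K \<beta>) \<and>
        (\<forall>\<alpha>\<in>offs. L Ku \<alpha> = L K \<alpha>) \<and> H Ku (-\<tau>) = H K 0 \<and>
        (\<forall>\<alpha>\<in>offs. L Kur \<alpha> = L Kr \<alpha>) \<and> (\<forall>\<beta>\<in>offs. H Kur \<beta> = H Ku \<beta>) \<and>
        (\<forall>\<alpha>\<in>offs. outside_domain \<Omega> (patch_cell L H K \<sigma> \<alpha>) \<and>
                   outside_domain \<Omega> (patch_cell L H K \<alpha> \<tau>) \<and>
                   outside_domain \<Omega> (patch_cell L H Kr \<sigma> \<alpha>) \<and>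
                   outside_domain \<Omega> (patch_cell L H Ku \<alpha> \<tau>)) \<and>
        outside_domain \<Omega> (patch_cell L H Kur \<sigma> \<tau>))"

definition concave_patches ::
  "pt set \<Rightarrow> lengths \<Rightarrow> lengths \<Rightarrow> cell \<Rightarrow> int \<Rightarrow> int \<Rightarrow> bool" where
  "concave_patches \<Omega> L H K \<sigma> \<tau> \<longleftrightarrow>
     (let Kr = patch_cell L H K \<sigma> 0; Ku = patch_cell L H K 0 \<tau>; Kur = patch_cell L H K \<sigma> \<tau> in
        H Kr \<tau> = H K \<tau> \<and> L Ku \<sigma> = L K \<sigma> \<and>
        L Kur (-\<sigma>) = L K 0 \<and> L Kur \<sigma> = L Kr \<sigma> \<and>
        H Kur (-\<tau>) = H K 0 \<and> H Kur \<tau> = H Ku \<tau> \<and>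
        (\<forall>\<alpha>\<in>{0, \<sigma>}. \<forall>\<beta>\<in>{0, \<tau>}. outside_domain \<Omega> (patch_cell L H Kur \<alpha> \<beta>)))"

definition xside_patches :: "pt set \<Rightarrow> lengths \<Rightarrow> lengths \<Rightarrow> cell \<Rightarrow> int \<Rightarrow> bool" where
  "xside_patches \<Omega> L H K \<sigma> \<longleftrightarrow>
     (let Kr = patch_cell L H K \<sigma> 0 in
        L Kr (-\<sigma>) = L K 0 \<and> (\<forall>\<beta>\<in>offs. H Kr \<beta> = H K \<beta>) \<and>
        (\<forall>\<beta>\<in>offs. outside_domain \<Omega> (patch_cell L H K \<sigma> \<beta>) \<and>
                   outside_domain \<Omega> (patch_cell L H Kr \<sigma> \<beta>)))"

definition yside_patches :: "pt set \<Rightarrow> lengths \<Rightarrow> lengths \<Rightarrow> cell \<Rightarrow> int \<Rightarrow> bool" where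
  "yside_patches \<Omega> L H K \<tau> \<longleftrightarrow>
     (let Ku = patch_cell L H K 0 \<tau> in
        H Ku (-\<tau>) = H K 0 \<and> (\<forall>\<alpha>\<in>offs. L Ku \<alpha> = L K \<alpha>) \<and>
        (\<forall>\<alpha>\<in>offs. outside_domain \<Omega> (patch_cell L H K \<alpha> \<tau>) \<and>
                   outside_domain \<Omega> (patch_cell L H Ku \<alpha> \<tau>)))"

text \<open>Lengths not constrained here are free choices. They are comparable to the size of the
  neighbouring cell because of the shape regularity of all patch cells: an added row or column
  contains a cell that shares a full edge with a cell of the same patch. The diagonal cells in the
  patch of a boundary cell need no condition beyond the conformity of the grid.\<close>

definition extended_patches ::
  "real \<Rightarrow> pt set \<Rightarrow> cell set \<Rightarrow> lengths \<Rightarrow> lengths \<Rightarrow> bool" where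
  "extended_patches \<gamma>0 \<Omega> G L H \<longleftrightarrow>
     (\<forall>K\<in>centers \<Omega> G L H. L K 0 = width K \<and> H K 0 = height K \<and>
        (\<forall>\<sigma>\<in>offs. L K \<sigma> > 0 \<and> H K \<sigma> > 0) \<and>
        (\<forall>\<sigma>\<in>offs. \<forall>\<tau>\<in>offs. shape_regular \<gamma>0 (patch_cell L H K \<sigma> \<tau>))) \<and>
     (\<forall>K\<in>interior_cells \<Omega> G. \<forall>\<sigma>\<in>offs. \<forall>\<tau>\<in>offs. patch_cell L H K \<sigma> \<tau> \<in> G) \<and>
     (\<forall>K\<in>boundary_cells \<Omega> G. \<forall>\<sigma>\<in>signs.
        (\<not> xside K \<sigma> \<subseteq> frontier \<Omega> \<longrightarrow> patch_cell L H K \<sigma> 0 \<in> G) \<and>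
        (\<not> yside K \<sigma> \<subseteq> frontier \<Omega> \<longrightarrow> patch_cell L H K 0 \<sigma> \<in> G)) \<and>
     (\<forall>K\<in>G. \<forall>\<sigma>\<in>signs. \<forall>\<tau>\<in>signs.
        (convex_at \<Omega> K \<sigma> \<tau> \<longrightarrow> convex_patches \<Omega> L H K \<sigma> \<tau>) \<and>
        (concave_at \<Omega> G L H K \<sigma> \<tau> \<longrightarrow> concave_patches \<Omega> L H K \<sigma> \<tau>)) \<and>
     (\<forall>K\<in>G. \<forall>\<sigma>\<in>signs.
        (noncorner_xside \<Omega> K \<sigma> \<longrightarrow> xside_patches \<Omega> L H K \<sigma>) \<and>
        (noncorner_yside \<Omega> K \<sigma> \<longrightarrow> yside_patches \<Omega> L H K \<sigma>))"

definition extended_region ::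
  "pt set \<Rightarrow> cell set \<Rightarrow> lengths \<Rightarrow> lengths \<Rightarrow> pt set" where
  "extended_region \<Omega> G L H = (\<Union>K\<in>centers \<Omega> G L H. patch L H K)"

definition Delta :: "pt set \<Rightarrow> cell set \<Rightarrow> lengths \<Rightarrow> lengths \<Rightarrow> cell \<Rightarrow> pt set" where
  "Delta \<Omega> G L H T = \<Union> {patch L H K |K. K \<in> centers \<Omega> G L H \<and> region T \<subseteq> patch L H K}"


definition P2 :: "(pt \<Rightarrow> real) set" where
  "P2 = {p. \<exists>a b c d e f. \<forall>x y. p (x, y) = a + b * x + c * y + d * x\<^sup>2 + e * x * y + f * y\<^sup>2}"

text \<open>Mean normal derivative over the vertical edge \<open>{x} \<times> [y0, y1]\<close>, respectively over the
  horizontal edge \<open>[x0, x1] \<times> {y}\<close>, with the normal in the positive coordinate direction.\<close>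

definition mean_dx :: "(pt \<Rightarrow> real) \<Rightarrow> real \<Rightarrow> real \<Rightarrow> real \<Rightarrow> real" where
  "mean_dx p x y0 y1 = integral {y0..y1} (\<lambda>y. deriv (\<lambda>t. p (t, y)) x) / (y1 - y0)"

definition mean_dy :: "(pt \<Rightarrow> real) \<Rightarrow> real \<Rightarrow> real \<Rightarrow> real \<Rightarrow> real" where
  "mean_dy p y x0 x1 = integral {x0..x1} (\<lambda>x. deriv (\<lambda>t. p (x, t)) y) / (x1 - x0)"

text \<open>A function of the nonconforming space is double-valued on the edges. It is represented by
  the family of its polynomial pieces, where \<open>w \<sigma> \<tau>\<close> belongs to the cell \<open>patch_cell L H K \<sigma> \<tau>\<close>
  (and \<open>w \<sigma> \<tau> = 0\<close> for indices out of range, which makes the representation unique).\<close>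

definition RRM0 :: "lengths \<Rightarrow> lengths \<Rightarrow> cell \<Rightarrow> (int \<Rightarrow> int \<Rightarrow> pt \<Rightarrow> real) set" where
  "RRM0 L H K = {w.
     (\<forall>\<sigma> \<tau>. \<not> (\<sigma> \<in> offs \<and> \<tau> \<in> offs) \<longrightarrow> w \<sigma> \<tau> = (\<lambda>_. 0)) \<and>
     (\<forall>\<sigma>\<in>offs. \<forall>\<tau>\<in>offs. w \<sigma> \<tau> \<in> P2) \<and>
     (\<forall>i\<in>{0, 1}. \<forall>j\<in>{0, 1}. \<forall>\<sigma>\<in>{i - 1, i}. \<forall>\<sigma>'\<in>{i - 1, i}. \<forall>\<tau>\<in>{j - 1, j}. \<forall>\<tau>'\<in>{j - 1, j}.
        w \<sigma> \<tau> (xknot L K i, yknot H K j) = w \<sigma>' \<tau>' (xknot L K i, yknot H K j)) \<and>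
     (\<forall>i\<in>{-1..2}. \<forall>j\<in>{-1..2}. \<not> (i \<in> {0, 1} \<and> j \<in> {0, 1}) \<longrightarrow>
        (\<forall>\<sigma>\<in>{i - 1, i} \<inter> offs. \<forall>\<tau>\<in>{j - 1, j} \<inter> offs.
           w \<sigma> \<tau> (xknot L K i, yknot H K j) = 0)) \<and>
     (\<forall>\<tau>\<in>offs.
        (\<forall>i\<in>{0, 1}. mean_dx (w (i - 1) \<tau>) (xknot L K i) (yknot H K \<tau>) (yknot H K (\<tau> + 1)) =
                     mean_dx (w i \<tau>) (xknot L K i) (yknot H K \<tau>) (yknot H K (\<tau> + 1))) \<and>
        mean_dx (w (-1) \<tau>) (xknot L K (-1)) (yknot H K \<tau>) (yknot H K (\<tau> + 1)) = 0 \<and>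
        mean_dx (w 1 \<tau>) (xknot L K 2) (yknot H K \<tau>) (yknot H K (\<tau> + 1)) = 0) \<and>
     (\<forall>\<sigma>\<in>offs.
        (\<forall>j\<in>{0, 1}. mean_dy (w \<sigma> (j - 1)) (yknot H K j) (xknot L K \<sigma>) (xknot L K (\<sigma> + 1)) =
                     mean_dy (w \<sigma> j) (yknot H K j) (xknot L K \<sigma>) (xknot L K (\<sigma> + 1))) \<and>
        mean_dy (w \<sigma> (-1)) (yknot H K (-1)) (xknot L K \<sigma>) (xknot L K (\<sigma> + 1)) = 0 \<and>
        mean_dy (w \<sigma> 1) (yknot H K 2) (xknot L K \<sigma>) (xknot L K (\<sigma> + 1)) = 0)}"

definition basis_pieces :: "lengths \<Rightarrow> lengths \<Rightarrow> cell \<Rightarrow> int \<Rightarrow> int \<Rightarrow> pt \<Rightarrow> real" where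
  "basis_pieces L H K = (THE w. w \<in> RRM0 L H K \<and>
     w 0 0 (vertex K (-1) (-1)) =
       L K (-1) / (L K (-1) + L K 0) * (H K (-1) / (H K (-1) + H K 0)))"

text \<open>The value 0 on the edges is immaterial: all statements about the interpolant hold almost
  everywhere.\<close>

definition basis :: "lengths \<Rightarrow> lengths \<Rightarrow> cell \<Rightarrow> pt \<Rightarrow> real" where
  "basis L H K p = (\<Sum>\<sigma>\<in>offs. \<Sum>\<tau>\<in>offs.
     if p \<in> interior (region (patch_cell L H K \<sigma> \<tau>)) then basis_pieces L H K \<sigma> \<tau> p else 0)"

definition cell_mean :: "cell \<Rightarrow> (pt \<Rightarrow> real) \<Rightarrow> real" where
  "cell_mean S v = (1 / measure lebesgue (region S)) * (LINT x:region S|lebesgue. v x)"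

definition lam :: "lengths \<Rightarrow> lengths \<Rightarrow> cell \<Rightarrow> (pt \<Rightarrow> real) \<Rightarrow> real" where
  "lam L H K v =
     (let l = L K (-1); c = L K 0; r = L K 1; d = H K (-1); m = H K 0; u = H K 1;
          w1 = - c\<^sup>2 / ((l + c) * (l + c + r));
          w2 = - c\<^sup>2 / ((c + r) * (l + c + r));
          w3 = - m\<^sup>2 / ((d + m) * (d + m + u));
          w4 = - m\<^sup>2 / ((m + u) * (d + m + u));
          w5 = 1 - (w1 + w2 + w3 + w4)
      in w1 * cell_mean (patch_cell L H K (-1) 0) v + w2 * cell_mean (patch_cell L H K 1 0) v +
         w3 * cell_mean (patch_cell L H K 0 (-1)) v + w4 * cell_mean (patch_cell L H K 0 1) v +
         w5 * cell_mean K v)"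

definition interp ::
  "pt set \<Rightarrow> cell set \<Rightarrow> lengths \<Rightarrow> lengths \<Rightarrow> (pt \<Rightarrow> real) \<Rightarrow> pt \<Rightarrow> real" where
  "interp \<Omega> G L H v p = (\<Sum>K\<in>centers \<Omega> G L H. lam L H K v * basis L H K p)"


definition pdx :: "(pt \<Rightarrow> real) \<Rightarrow> pt \<Rightarrow> real" where
  "pdx f p = deriv (\<lambda>t. f (t, snd p)) (fst p)"

definition pdy :: "(pt \<Rightarrow> real) \<Rightarrow> pt \<Rightarrow> real" where
  "pdy f p = deriv (\<lambda>t. f (fst p, t)) (snd p)"

fun Ck :: "nat \<Rightarrow> (pt \<Rightarrow> real) \<Rightarrow> bool" where
  "Ck 0 f \<longleftrightarrow> continuous_on UNIV f"
| "Ck (Suc k) f \<longleftrightarrow> continuous_on UNIV f \<and>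
     (\<forall>x y. (\<lambda>t. f (t, y)) field_differentiable at x \<and>
            (\<lambda>t. f (x, t)) field_differentiable at y) \<and>
     Ck k (pdx f) \<and> Ck k (pdy f)"

definition test_functions :: "pt set \<Rightarrow> (pt \<Rightarrow> real) set" where
  "test_functions U = {\<psi>. (\<forall>k. Ck k \<psi>) \<and> compact (closure {x. \<psi> x \<noteq> 0}) \<and>
     closure {x. \<psi> x \<noteq> 0} \<subseteq> U}"

definition locally_integrable :: "pt set \<Rightarrow> (pt \<Rightarrow> real) \<Rightarrow> bool" where
  "locally_integrable U f \<longleftrightarrow> (\<forall>C. compact C \<and> C \<subseteq> U \<longrightarrow> set_integrable lebesgue C f)"

definition weak_deriv ::
  "pt set \<Rightarrow> nat \<Rightarrow> nat \<Rightarrow> (pt \<Rightarrow> real) \<Rightarrow> (pt \<Rightarrow> real) \<Rightarrow> bool" where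
  "weak_deriv U i j v g \<longleftrightarrow> locally_integrable U v \<and> locally_integrable U g \<and>
     (\<forall>\<psi>\<in>test_functions U. (LINT x:U|lebesgue. v x * (pdx ^^ i) ((pdy ^^ j) \<psi>) x) =
                            (-1) ^ (i + j) * (LINT x:U|lebesgue. g x * \<psi> x))"

definition L2 :: "pt set \<Rightarrow> (pt \<Rightarrow> real) \<Rightarrow> bool" where
  "L2 A f \<longleftrightarrow> set_borel_measurable lebesgue A f \<and> set_integrable lebesgue A (\<lambda>x. (f x)\<^sup>2)"

definition L2_nrm :: "pt set \<Rightarrow> (pt \<Rightarrow> real) \<Rightarrow> real" where
  "L2_nrm A f = sqrt (LINT x:A|lebesgue. (f x)\<^sup>2)"

text \<open>For a closed region the Sobolev space and seminorm are those of its interior.\<close>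

definition Hspace :: "nat \<Rightarrow> pt set \<Rightarrow> (pt \<Rightarrow> real) \<Rightarrow> bool" where
  "Hspace s A v \<longleftrightarrow> (\<forall>i j. i + j \<le> s \<longrightarrow>
     (\<exists>g. weak_deriv (interior A) i j v g \<and> L2 (interior A) g))"

text \<open>Weak derivatives are unique only up to null sets, on which the seminorm does not depend.\<close>

definition Hseminorm :: "nat \<Rightarrow> pt set \<Rightarrow> (pt \<Rightarrow> real) \<Rightarrow> real" where
  "Hseminorm k A v = sqrt (\<Sum>i\<le>k.
     (L2_nrm (interior A) (SOME g. weak_deriv (interior A) i (k - i) v g))\<^sup>2)"

end

theory Submission
  imports Defs
begin

text \<open>
  The operator reproduces quadratics locally, and the norm estimates are consequences of this: on a
  cell \<open>T\<close> the interpolant depends only on the functionals of nine centres, whose patches all contain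
  \<open>T\<close>; a scaling argument bounds it by the norm of the function on these patches; and subtracting
  a suitable quadratic before interpolating turns the bound into the error estimate.

  That there are exactly nine centres around every cell, also at the boundary, is the geometric part
  (\<open>nine_centers\<close>). A simple polygon has no self-contacts and lies on one side of its boundary
  (Jordan curve theorem), so a vertex of the mesh is surrounded by four cells, or by two at a straight
  piece of the boundary, or by one or three at a convex or concave corner. A case analysis then shows
  that the cell \<open>T\<close> occurs once in each of the nine positions of a patch, and that the side lengths in
  neighbouring patches agree, except that at a diagonal neighbour one of the two coordinates may
  disagree.

  The basis function of a patch is, by unisolvence (\<open>RRM0_unique\<close>), given on each cell by the vertex
  values and mean normal derivatives of a product of two quadratic B-splines in one variable. The
  functional of a patch is dual to them: on a monomial it is the product of polar forms, so that
  Marsden's identity in each variable, summed over the nine centres, reproduces quadratics. The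
  disagreement at a diagonal neighbour in one coordinate does no harm, as every product in the sum has
  a factor in the other coordinate that agrees (\<open>nine_products\<close>, \<open>local_interpolant\<close>).

  For the error estimate the quadratic is chosen so that it has, on the middle third of \<open>T\<close>, the same
  mean derivatives as the function. Then the errors of all derivatives of order less than \<open>s\<close> have mean zero there, and the
  Poincare inequality on each of the nine patches, applied repeatedly, bounds them by the
  derivatives of order \<open>s\<close> (\<open>polynomial_error\<close>). The Poincare inequality is derived for weak
  derivatives without smoothing the function: testing with products of bump functions, and passing
  to indicators of boxes, shows that almost everywhere \<open>w\<close> is its mean along a line plus
  an integral of its derivative against a kernel bounded by 1 (\<open>slice_representation\<close>).
\<close>

section \<open>Domains bounded by a simple polygon\<close>

text \<open>By the Jordan curve theorem the complement of the curve has two components, each with the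
  whole curve as its frontier, and a domain with this frontier is one of them. Every point of the curve
  is then also a limit of points of the other component.\<close>

lemma interior_closure_of_jordan_domain_complex:
 fixes c :: "real => complex"
 assumes "simple_path c" "pathfinish c = pathstart c"
  and "open S" "connected S" "bounded S" "frontier S = path_image c"
 shows "interior (closure S) = S"
proof -
 let ?J = "path_image c"
 have J: "frontier (inside ?J) = ?J" "frontier (outside ?J) = ?J"
   "inside ?J \<inter> outside ?J = {}" "inside ?J \<union> outside ?J = - ?J"
   "connected (outside ?J)" "open (outside ?J)" "outside ?J \<noteq> {}"
  using Jordan_inside_outside[OF assms(1,2)] by auto
 have SJ: "S \<inter> ?J = {}"
  using assms(3,6) by (metis frontier_disjoint_eq inf_commute)
 have "bounded ?J"
  using assms(1) by (simp add: bounded_simple_path_image)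
 then have unb: "\<not> bounded (outside ?J)"
  by (rule unbounded_outside)
 have "outside ?J \<inter> S = {}"
 proof (rule ccontr)
  assume "outside ?J \<inter> S \<noteq> {}"
  moreover have "outside ?J \<inter> frontier S = {}"
   using J(4) assms(6) by auto
  ultimately have "outside ?J \<subseteq> S"
   using connected_Int_frontier[OF J(5)] by blast
  then show False
   using unb assms(5) bounded_subset by blast
 qed
 then have out: "outside ?J \<inter> closure S = {}"
  using J(6) open_Int_closure_eq_empty by blast
 have "interior (closure S) \<inter> ?J = {}"
 proof (rule ccontr)
  assume "interior (closure S) \<inter> ?J \<noteq> {}"
  then have "interior (closure S) \<inter> closure (outside ?J) \<noteq> {}"
   using J(2) by (auto simp: frontier_def)
  then have "interior (closure S) \<inter> outside ?J \<noteq> {}"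
   by (metis open_Int_closure_eq_empty open_interior)
  then show False
   using out interior_subset by blast
 qed
 moreover have "closure S = S \<union> ?J"
  using assms(6) closure_Un_frontier by blast
 ultimately have "interior (closure S) \<subseteq> S"
  using interior_subset by blast
 moreover have "S \<subseteq> interior (closure S)"
  using assms(3) closure_subset interior_maximal by blast
 ultimately show ?thesis by blast
qed

text \<open>Transports the Jordan curve theorem from curves in the complex plane.\<close>

definition to_complex :: "pt => complex" where
 "to_complex p = Complex (fst p) (snd p)"

lemma to_complex_linear: "linear to_complex"
 by (rule linearI) (auto simp: to_complex_def complex_eq_iff)

lemma to_complex_bij: "bij to_complex"
 by (rule o_bij[of "\<lambda>z. (Re z, Im z)"]) (auto simp: to_complex_def fun_eq_iff)

lemma interior_closure_of_jordan_domain: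
 fixes c :: "real => pt"
 assumes "simple_path c" "pathfinish c = pathstart c"
  and "open S" "connected S" "bounded S" "frontier S = path_image c"
 shows "interior (closure S) = S"
proof -
 let ?f = to_complex
 have inj: "inj ?f" using to_complex_bij by (simp add: bij_is_inj)
 have cont: "continuous_on A ?f" for A
  using to_complex_linear linear_continuous_on linear_conv_bounded_linear by blast
 have int: "interior (?f ` A) = ?f ` interior A" for A
  by (rule interior_bijective_linear_image[OF to_complex_linear to_complex_bij])
 have clo: "closure (?f ` A) = ?f ` closure A" for A
  by (rule closure_injective_linear_image[OF to_complex_linear inj, symmetric])
 have "interior (closure (?f ` S)) = ?f ` S"
 proof (rule interior_closure_of_jordan_domain_complex[of "?f \<circ> c"])
  show "simple_path (?f \<circ> c)"
   using assms(1) inj to_complex_linear simple_path_linear_image_eq by blast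
  show "pathfinish (?f \<circ> c) = pathstart (?f \<circ> c)"
   using assms(2) by (simp add: pathfinish_def pathstart_def)
  show "open (?f ` S)"
   using assms(3) int[of S] by (metis interior_open open_interior)
  show "connected (?f ` S)"
   using assms(4) cont connected_continuous_image by blast
  show "bounded (?f ` S)"
   using assms(5) bounded_linear_image to_complex_linear linear_conv_bounded_linear by blast
  show "frontier (?f ` S) = path_image (?f \<circ> c)"
   unfolding frontier_def int clo path_image_compose assms(6)[symmetric]
   using inj by (simp add: image_set_diff frontier_def)
 qed
 then have "?f ` interior (closure S) = ?f ` S"
  by (simp add: int clo)
 then show ?thesis
  using inj by (simp add: inj_image_eq_iff)
qed

text \<open>The boundary of a simple polygon is the image of a loop: the sides but the last one are
 joined to an arc, which the last side closes.\<close>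

lemma polygon_side_nth:
 "Suc i < length vs ==> polygon_side vs i = closed_segment (vs ! i) (vs ! Suc i)"
 by (simp add: polygon_side_def)

lemma simple_polygon_arc:
 assumes P: "simple_polygon vs" and "0 < k" "k < length vs"
 shows "\<exists>c. arc c \<and> pathstart c = vs ! 0 \<and> pathfinish c = vs ! k \<and>
       path_image c = (\<Union>i<k. polygon_side vs i)"
 using assms(2,3)
proof (induction k)
 case 0 then show ?case by simp
next
 case (Suc k)
 have d: "distinct vs" and side: "\<And>i j. i < length vs ==> j < length vs ==> i \<noteq> j ==>
    polygon_side vs i \<inter> polygon_side vs j =
     {vs ! i, vs ! (Suc i mod length vs)} \<inter> {vs ! j, vs ! (Suc j mod length vs)}"
  using P unfolding simple_polygon_def by blast+
 have ne: "vs ! k \<noteq> vs ! Suc k"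
  using d Suc.prems by (simp add: nth_eq_iff_index_eq)
 have l: "arc (linepath (vs ! k) (vs ! Suc k))"
  using ne by simp
 show ?case
 proof (cases "k = 0")
  case True
  then show ?thesis
   using l Suc.prems by (intro exI[of _ "linepath (vs ! k) (vs ! Suc k)"])
    (auto simp: polygon_side_nth lessThan_Suc)
 next
  case False
  then obtain c where c: "arc c" "pathstart c = vs ! 0" "pathfinish c = vs ! k"
   "path_image c = (\<Union>i<k. polygon_side vs i)"
   using Suc by auto
  have "path_image c \<inter> path_image (linepath (vs ! k) (vs ! Suc k)) \<subseteq> {vs ! k}"
  proof
   fix z assume z: "z \<in> path_image c \<inter> path_image (linepath (vs ! k) (vs ! Suc k))"
   then obtain i where i: "i < k" "z \<in> polygon_side vs i"
    using c(4) by auto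
   have "z \<in> polygon_side vs k"
    using z Suc.prems by (simp add: polygon_side_nth)
   then have "z \<in> {vs ! i, vs ! (Suc i mod length vs)} \<inter> {vs ! k, vs ! (Suc k mod length vs)}"
    using side[of i k] i Suc.prems by auto
   then have "z \<in> {vs ! i, vs ! Suc i}" "z \<in> {vs ! k, vs ! Suc k}"
    using i Suc.prems by auto
   moreover have "vs ! i \<noteq> vs ! Suc k" "vs ! Suc i \<noteq> vs ! Suc k"
    using d i Suc.prems by (simp_all add: nth_eq_iff_index_eq)
   ultimately show "z \<in> {vs ! k}" by auto
  qed
  then have "arc (c +++ linepath (vs ! k) (vs ! Suc k))"
   using c l by (intro arc_join) auto
  moreover have "path_image (c +++ linepath (vs ! k) (vs ! Suc k)) = (\<Union>i<Suc k. polygon_side vs i)"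
   using c Suc.prems by (subst path_image_join) (auto simp: polygon_side_nth lessThan_Suc)
  ultimately show ?thesis
   using c by (intro exI[of _ "c +++ linepath (vs ! k) (vs ! Suc k)"]) auto
 qed
qed

lemma simple_polygon_loop:
 assumes P: "simple_polygon vs"
 shows "\<exists>c. simple_path c \<and> pathfinish c = pathstart c \<and>
       path_image c = (\<Union>i<length vs. polygon_side vs i)"
proof -
 define n where "n = length vs - 1"
 have n: "length vs = Suc n" "0 < n" "n < length vs" "2 \<le> n"
  using P by (auto simp: n_def simple_polygon_def)
 have d: "distinct vs" and side: "\<And>i j. i < length vs ==> j < length vs ==> i \<noteq> j ==>
    polygon_side vs i \<inter> polygon_side vs j =
     {vs ! i, vs ! (Suc i mod length vs)} \<inter> {vs ! j, vs ! (Suc j mod length vs)}"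
  using P unfolding simple_polygon_def by blast+
 obtain c where c: "arc c" "pathstart c = vs ! 0" "pathfinish c = vs ! n"
   "path_image c = (\<Union>i<n. polygon_side vs i)"
  using simple_polygon_arc[OF P n(2,3)] by auto
 let ?l = "linepath (vs ! n) (vs ! 0)"
 have l: "polygon_side vs n = path_image ?l"
  using n by (simp add: polygon_side_def)
 have ne: "vs ! n \<noteq> vs ! 0"
  using d n by (simp add: nth_eq_iff_index_eq)
 have "path_image c \<inter> path_image ?l \<subseteq> {pathstart c, pathstart ?l}"
 proof
  fix z assume z: "z \<in> path_image c \<inter> path_image ?l"
  then obtain i where i: "i < n" "z \<in> polygon_side vs i"
   using c(4) by auto
  have "z \<in> polygon_side vs n"
   using z l by simp
  then have "z \<in> {vs ! n, vs ! (Suc n mod length vs)}"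
   using side[of i n] i n by auto
  then show "z \<in> {pathstart c, pathstart ?l}"
   using c n by auto
 qed
 then have "simple_path (c +++ ?l)"
  using c ne by (intro simple_path_join_loop) auto
 moreover have "path_image (c +++ ?l) = (\<Union>i<length vs. polygon_side vs i)"
  using c n(1) l by (subst path_image_join) (auto simp: lessThan_Suc)
 ultimately show ?thesis
  using c by (intro exI[of _ "c +++ ?l"]) auto
qed

lemma polygonal_domain_interior_closure:
 assumes "polygonal_domain \<Omega>"
 shows "interior (closure \<Omega>) = \<Omega>"
proof -
 obtain vs where vs: "simple_polygon vs" "frontier \<Omega> = (\<Union>i<length vs. polygon_side vs i)"
  using assms by (auto simp: polygonal_domain_def)
 obtain c where "simple_path c" "pathfinish c = pathstart c"
   "path_image c = (\<Union>i<length vs. polygon_side vs i)"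
  using simple_polygon_loop[OF vs(1)] by blast
 then show ?thesis
  using assms vs(2) interior_closure_of_jordan_domain[of c \<Omega>] by (simp add: polygonal_domain_def)
qed

text \<open>The four axis directions at a point of the boundary cannot all run inside the boundary. Near
 the point only the sides through it matter. There are at most two of these, each of
 which contains at most two of the directions, and then opposite ones; but two sides that both
 run straight through the point would cross there.\<close>

lemma simple_polygon_no_cross:
 assumes P: "simple_polygon vs" and "0 < \<delta>"
  and fr: "\<And>s. 0 < s ==> s < \<delta> ==> {(x + s, y), (x - s, y), (x, y + s), (x, y - s)} \<subseteq> (\<Union>i<length vs. polygon_side vs i)"
 shows False
proof -
 let ?n = "length vs" and ?S = "polygon_side vs" and ?p = "(x, y)"
 have side: "\<And>i j. i < ?n ==> j < ?n ==> i \<noteq> j ==>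
    ?S i \<inter> ?S j = {vs ! i, vs ! (Suc i mod ?n)} \<inter> {vs ! j, vs ! (Suc j mod ?n)}"
  and d: "distinct vs" and n3: "3 \<le> ?n"
  using P unfolding simple_polygon_def by blast+
 define F where "F = (\<Union>i\<in>{i. i < ?n \<and> ?p \<notin> ?S i}. ?S i)"
 have "closed F"
  unfolding F_def by (intro closed_UN) (auto simp: polygon_side_def)
 moreover have "?p \<notin> F" by (auto simp: F_def)
 ultimately obtain e where e: "e > 0" "\<And>z. dist ?p z < e ==> z \<notin> F"
  by (metis ComplI dist_commute open_Compl open_dist ComplD)
 define s where "s = min \<delta> e / 2"
 have s: "0 < s" "s < \<delta>" "s < e"
  using e(1) \<open>0 < \<delta>\<close> by (auto simp: s_def)
 have near: "\<exists>i<?n. z \<in> ?S i \<and> ?p \<in> ?S i"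
  if "z \<in> {(x + s, y), (x - s, y), (x, y + s), (x, y - s)}" for z
 proof -
  have "dist ?p z < e"
   using that s by (auto simp: dist_Pair_Pair dist_real_def)
  then have "z \<notin> F" by (rule e(2))
  then show ?thesis
   using fr[OF s(1,2)] that by (auto simp: F_def)
 qed
 obtain i where i: "i < ?n" "(x + s, y) \<in> ?S i" "?p \<in> ?S i" using near by blast
 obtain i' where i': "i' < ?n" "(x - s, y) \<in> ?S i'" "?p \<in> ?S i'" using near by blast
 obtain j where j: "j < ?n" "(x, y + s) \<in> ?S j" "?p \<in> ?S j" using near by blast
 obtain j' where j': "j' < ?n" "(x, y - s) \<in> ?S j'" "?p \<in> ?S j'" using near by blast
 have notboth: False if "k < ?n" "?p \<in> ?S k" "(x + a, y) \<in> ?S k" "(x, y + b) \<in> ?S k" "a \<noteq> 0" "b \<noteq> 0" for k a b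
 proof -
  have "collinear {(x + a, y), (x, y), (x, y + b)}"
   using that collinear_closed_segment collinear_subset
   by (metis (no_types, lifting) empty_subsetI insert_subset polygon_side_def)
  then have "collinear {0, (x + a, y) - (x, y), (x, y + b) - (x, y)}"
   using collinear_3[of "(x + a, y)" "(x, y)" "(x, y + b)"] by (simp only: NO_MATCH_def simp_thms)
  then show False
   using that(5,6) unfolding collinear_lemma by (auto simp: zero_prod_def)
 qed
 have endp: "\<exists>k\<in>{vs ! i, vs ! (Suc i mod ?n)}. ?p = k" if "i < ?n" "j < ?n" "i \<noteq> j" "?p \<in> ?S i" "?p \<in> ?S j" for i j
  using side[OF that(1-3)] that(4,5) by blast
 have ij: "i \<noteq> j" "i \<noteq> j'" "i' \<noteq> j" "i' \<noteq> j'"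
  using notboth[of i s s] notboth[of i s "-s"] notboth[of i' "-s" s] notboth[of i' "-s" "-s"]
   i i' j j' s by auto
 have ext: False if "k < ?n" "l < ?n" "k \<noteq> l" "?p \<in> ?S k" "?p \<in> ?S l"
   "?p - v \<in> ?S k" "?p + v \<in> ?S k" "v \<noteq> 0" for k l v
 proof -
  have "?p extreme_point_of ?S k"
   using endp[OF that(1-5)] extreme_point_of_segment unfolding polygon_side_def by blast
  moreover have "?p \<in> open_segment (?p - v) (?p + v)"
   using midpoint_in_open_segment[of "?p - v" "?p + v"] that(8)
   by (simp add: midpoint_def algebra_simps scaleR_2[symmetric] del: midpoint_in_open_segment)
  ultimately show False
   using that(6,7) by (auto simp: extreme_point_of_def)
 qed
 have "i \<noteq> i'"
  using ext[of i j "(s, 0)"] i i' j ij s by (auto simp: zero_prod_def)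
 have "j \<noteq> j'"
  using ext[of j i "(0, s)"] i j j' ij s by (auto simp: zero_prod_def)
 \<comment> \<open>now four different sides contain the point, while a vertex lies on two sides only\<close>
 have idx: "k = m \<or> Suc k mod ?n = m" if "k < ?n" "vs ! m = ?p" "m < ?n" "l < ?n" "l \<noteq> k" "?p \<in> ?S k" "?p \<in> ?S l" for k l m
 proof -
  have "?p \<in> {vs ! k, vs ! (Suc k mod ?n)}" using endp[of k l] that by auto
  moreover have "Suc k mod ?n < ?n" using n3 by (intro mod_less_divisor) auto
  ultimately show ?thesis
   using nth_eq_iff_index_eq[OF d that(1,3)] nth_eq_iff_index_eq[OF d _ that(3), of "Suc k mod ?n"]
    that(2) by auto
 qed
 obtain m where m: "m < ?n" "vs ! m = ?p"
  using endp[of i j] i j ij by (metis insert_iff mod_less_divisor singletonD gr_implies_not0 not_gr_zero)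
 have inj: "k = l" if "Suc k mod ?n = Suc l mod ?n" "k < ?n" "l < ?n" for k l
  using that by (metis Suc_inject Suc_lessI mod_less mod_self nat.distinct(1))
 show False
  using idx[OF i(1) m(2,1), of j] idx[OF i'(1) m(2,1), of j] idx[OF j(1) m(2,1), of i] idx[OF j'(1) m(2,1), of i]
   i i' j j' ij \<open>i \<noteq> i'\<close> \<open>j \<noteq> j'\<close> inj by metis
qed

section \<open>The combinatorics of patches\<close>

lemma offs_signs: "x \<in> offs \<longleftrightarrow> x = 0 \<or> x \<in> signs" by auto

text \<open>The facts on mesh cells and added cells that the search for all patches around a cell uses, with
  the geometry forgotten: \<open>pc K j k\<close> is the cell of the patch of \<open>K\<close> at position \<open>(j, k)\<close>; \<open>fx\<close> and \<open>fy\<close>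
  say that a vertical or horizontal side of a cell lies on the boundary, \<open>nx\<close> and \<open>ny\<close> that it is a
  non-corner boundary side; \<open>cv\<close> and \<open>cc\<close> mark convex and concave corners, and \<open>out\<close> the cells that do not
  overlap the domain. The list is invariant under exchanging the coordinates. The locales below, each of
  which contains its own mirror image, use this to transfer every lemma to the other
  coordinate.\<close>

locale patch_system =
 fixes G C :: "'c set" and pc :: "'c => int => int => 'c" and L H :: "'c => int => real"
  and fx fy nx ny :: "'c => int => bool" and cv cc :: "'c => int => int => bool" and out :: "'c => bool"
 assumes GC: "K \<in> G ==> K \<in> C"
  and pc00: "K \<in> C ==> pc K 0 0 = K"
  and lenx: "[| K \<in> C; j \<in> offs; k \<in> offs; pc K j k \<in> C |] ==> L (pc K j k) 0 = L K j"
  and leny: "[| K \<in> C; j \<in> offs; k \<in> offs; pc K j k \<in> C |] ==> H (pc K j k) 0 = H K k"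
  and shiftx: "[| K \<in> C; j \<in> signs; k \<in> offs; pc K j 0 \<in> C; L (pc K j 0) (-j) = L K 0;
    H (pc K j 0) k = H K k |]
    ==> pc (pc K j 0) (-j) k = pc K 0 k \<and> pc (pc K j 0) 0 k = pc K j k"
  and shifty: "[| K \<in> C; j \<in> offs; k \<in> signs; pc K 0 k \<in> C; H (pc K 0 k) (-k) = H K 0;
    L (pc K 0 k) j = L K j |]
    ==> pc (pc K 0 k) j (-k) = pc K j 0 \<and> pc (pc K 0 k) j 0 = pc K j k"
  and xnb: "[| K \<in> G; j \<in> signs; \<not> fx K j |]
    ==> pc K j 0 \<in> G \<and> \<not> fx (pc K j 0) (-j) \<and> pc (pc K j 0) (-j) 0 = K"
  and ynb: "[| K \<in> G; k \<in> signs; \<not> fy K k |]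
    ==> pc K 0 k \<in> G \<and> \<not> fy (pc K 0 k) (-k) \<and> pc (pc K 0 k) 0 (-k) = K"
  and fx_out: "[| K \<in> G; j \<in> signs; fx K j |] ==> pc K j 0 \<notin> G"
  and fy_out: "[| K \<in> G; k \<in> signs; fy K k |] ==> pc K 0 k \<notin> G"
  and quadrant: "[| K \<in> G; j \<in> signs; k \<in> signs; \<not> fx K j; \<not> fy K k; \<not> cc K j k |]
    ==> \<not> fx (pc K 0 k) j \<and> \<not> fy (pc K j 0) k \<and> pc (pc K 0 k) j 0 = pc (pc K j 0) 0 k"
  and cc_iff: "[| K \<in> G; j \<in> signs; k \<in> signs; cc K j k |]
    ==> \<not> fx K j \<and> \<not> fy K k \<and> fx (pc K 0 k) j \<and> fy (pc K j 0) k"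
  and cc_fx: "[| K \<in> G; j \<in> signs; k \<in> signs; fx K j; \<not> fy K k; \<not> fx (pc K 0 k) j |]
    ==> cc (pc K 0 k) j (-k)"
  and cc_fy: "[| K \<in> G; j \<in> signs; k \<in> signs; fy K k; \<not> fx K j; \<not> fy (pc K j 0) k |]
    ==> cc (pc K j 0) (-j) k"
  and cv_iff: "[| K \<in> G; j \<in> signs; k \<in> signs |] ==> cv K j k \<longleftrightarrow> fx K j \<and> fy K k"
  and fx_cases: "[| K \<in> G; j \<in> signs; fx K j; \<not> nx K j |] ==>
    \<exists>k\<in>signs. cv K j k \<or> \<not> fy K k \<and> \<not> fx (pc K 0 k) j"
  and fy_cases: "[| K \<in> G; k \<in> signs; fy K k; \<not> ny K k |] ==>
    \<exists>j\<in>signs. cv K j k \<or> \<not> fx K j \<and> \<not> fy (pc K j 0) k"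
  and nx_fx: "[| K \<in> G; j \<in> signs; nx K j |] ==> fx K j"
  and ny_fy: "[| K \<in> G; k \<in> signs; ny K k |] ==> fy K k"
  and diagonal: "[| K \<in> G; j \<in> signs; k \<in> signs; pc K j k \<in> G |] ==>
    \<not> fy K k \<and> \<not> fx (pc K 0 k) j \<and> pc (pc K 0 k) j 0 = pc K j k \<or>
    \<not> fx K j \<and> \<not> fy (pc K j 0) k \<and> pc (pc K j 0) 0 k = pc K j k"
  and nx_patch: "[| K \<in> G; j \<in> signs; nx K j |] ==> pc K j 0 \<in> C \<and> L (pc K j 0) (-j) = L K 0 \<and>
    (\<forall>h\<in>offs. H (pc K j 0) h = H K h \<and> out (pc K j h) \<and> out (pc (pc K j 0) j h))"
  and ny_patch: "[| K \<in> G; k \<in> signs; ny K k |] ==> pc K 0 k \<in> C \<and> H (pc K 0 k) (-k) = H K 0 \<and>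
    (\<forall>g\<in>offs. L (pc K 0 k) g = L K g \<and> out (pc K g k) \<and> out (pc (pc K 0 k) g k))"
  and cv_patchx: "[| K \<in> G; j \<in> signs; k \<in> signs; cv K j k |] ==> pc K j 0 \<in> C \<and>
    L (pc K j 0) (-j) = L K 0 \<and>
    (\<forall>h\<in>offs. H (pc K j 0) h = H K h \<and> out (pc K j h) \<and> out (pc (pc K j 0) j h))"
  and cv_patchy: "[| K \<in> G; j \<in> signs; k \<in> signs; cv K j k |] ==> pc K 0 k \<in> C \<and>
    H (pc K 0 k) (-k) = H K 0 \<and>
    (\<forall>g\<in>offs. L (pc K 0 k) g = L K g \<and> out (pc K g k) \<and> out (pc (pc K 0 k) g k))"
  and cv_patch: "[| K \<in> G; j \<in> signs; k \<in> signs; cv K j k |] ==> pc K j k \<in> C \<and>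
    (\<forall>g\<in>offs. L (pc K j k) g = L (pc K j 0) g) \<and>
    (\<forall>h\<in>offs. H (pc K j k) h = H (pc K 0 k) h) \<and> out (pc (pc K j k) j k)"
  and cc_patchx: "[| K \<in> G; j \<in> signs; k \<in> signs; cc K j k |] ==> H (pc K j 0) k = H K k \<and>
    L (pc K j k) (-j) = L K 0 \<and> L (pc K j k) j = L (pc K j 0) j"
  and cc_patchy: "[| K \<in> G; j \<in> signs; k \<in> signs; cc K j k |] ==> L (pc K 0 k) j = L K j \<and>
    H (pc K j k) (-k) = H K 0 \<and> H (pc K j k) k = H (pc K 0 k) k"
  and cc_patch: "[| K \<in> G; j \<in> signs; k \<in> signs; cc K j k |] ==> pc K j k \<in> C \<and>
    (\<forall>g\<in>{0,j}. \<forall>h\<in>{0,k}. out (pc (pc K j k) g h))"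
  and centers_cases: "E \<in> C ==> E \<in> G \<or>
    (\<exists>K\<in>G. \<exists>j\<in>signs. nx K j \<and> E = pc K j 0) \<or> (\<exists>K\<in>G. \<exists>k\<in>signs. ny K k \<and> E = pc K 0 k) \<or>
    (\<exists>K\<in>G. \<exists>j\<in>signs. \<exists>k\<in>signs. cv K j k \<and> E \<in> {pc K j 0, pc K 0 k, pc K j k} \<or>
      cc K j k \<and> E = pc K j k)"
  and out_notin: "K \<in> G ==> \<not> out K"

lemma patch_system_swap:
 assumes "patch_system G C pc L H fx fy nx ny cv cc out"
 shows "patch_system G C (\<lambda>K j k. pc K k j) H L fy fx ny nx (\<lambda>K j k. cv K k j) (\<lambda>K j k. cc K k j) out"
proof -
 interpret patch_system G C pc L H fx fy nx ny cv cc out by fact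
 show ?thesis
 proof (unfold_locales, goal_cases)
  case 1 then show ?case by (rule GC)
 next case 2 then show ?case by (rule pc00)
 next case 3 then show ?case using leny by blast
 next case 4 then show ?case using lenx by blast
 next case 5 then show ?case using shifty by blast
 next case 6 then show ?case using shiftx by blast
 next case 7 then show ?case using ynb by blast
 next case 8 then show ?case using xnb by blast
 next case 9 then show ?case using fy_out by blast
 next case 10 then show ?case using fx_out by blast
 next case (11 K j k) then show ?case using quadrant[of K k j] by auto
 next case (12 K j k) then show ?case using cc_iff[of K k j] by auto
 next case 13 then show ?case using cc_fy by blast
 next case 14 then show ?case using cc_fx by blast
 next case (15 K j k) then show ?case using cv_iff[of K k j] by auto
 next case 16 then show ?case using fy_cases by blast
 next case 17 then show ?case using fx_cases by blast
 next case 18 then show ?case using ny_fy by blast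
 next case 19 then show ?case using nx_fx by blast
 next case (20 K j k) then show ?case using diagonal[of K k j] by auto
 next case 21 then show ?case using ny_patch by blast
 next case 22 then show ?case using nx_patch by blast
 next case 23 then show ?case using cv_patchy by blast
 next case 24 then show ?case using cv_patchx by blast
 next case (25 K j k) then show ?case using cv_patch[of K k j] by blast
 next case (26 K j k) then show ?case using cc_patchy[of K k j] by blast
 next case (27 K j k) then show ?case using cc_patchx[of K k j] by blast
 next case (28 K j k) then show ?case using cc_patch[of K k j] by blast
 next case (29 E) then show ?case using centers_cases[of E] by blast
 next case 30 then show ?case using out_notin by blast
 qed
qed

context patch_system
begin

lemma neighbour_x:
 assumes "K \<in> G" "j \<in> signs" "\<not> fx K j"
 shows "pc K j 0 \<in> G" "\<not> fx (pc K j 0) (-j)" "pc (pc K j 0) (-j) 0 = K"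
  "L (pc K j 0) (-j) = L K 0" "L (pc K j 0) 0 = L K j" "H (pc K j 0) 0 = H K 0"
proof -
 note n = xnb[OF assms]
 then show "pc K j 0 \<in> G" "\<not> fx (pc K j 0) (-j)" "pc (pc K j 0) (-j) 0 = K" by auto
 show "L (pc K j 0) (-j) = L K 0"
  using n lenx[of "pc K j 0" "-j" 0] GC assms by auto
 show "L (pc K j 0) 0 = L K j" "H (pc K j 0) 0 = H K 0"
  using n lenx[of K j 0] leny[of K j 0] GC assms by auto
qed

text \<open>At a concave corner the added diagonal cell continues the patch of the horizontal neighbour upwards,
  so the two patches share their columns.\<close>

lemma concave_x:
 assumes K: "K \<in> G" "j \<in> signs" "k \<in> signs" and c: "cc K j k"
 shows "pc K j k = pc (pc K j 0) 0 k"
  "\<forall>g\<in>offs. L (pc K j k) g = L (pc K j 0) g"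
  "H (pc K j k) (-k) = H (pc K j 0) 0"
  "\<And>g. g \<in> offs ==> pc (pc K j k) g (-k) = pc (pc K j 0) g 0 \<and> pc (pc K j k) g 0 = pc (pc K j 0) g k"
proof -
 have nf: "\<not> fx K j" "\<not> fy K k" "fy (pc K j 0) k" using cc_iff[OF K c] by auto
 note n = neighbour_x[OF K(1,2) nf(1)]
 note p = cc_patchx[OF K c] cc_patchy[OF K c] cc_patch[OF K c]
 show eq: "pc K j k = pc (pc K j 0) 0 k"
  using shiftx[of K j k] n p K GC by auto
 have L0: "L (pc K j k) 0 = L K j"
  using lenx[of K j k] p K GC by auto
 show Lall: "\<forall>g\<in>offs. L (pc K j k) g = L (pc K j 0) g"
  using p n L0 K(2) by auto
 show Hm: "H (pc K j k) (-k) = H (pc K j 0) 0" using p n by auto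
 show "pc (pc K j k) g (-k) = pc (pc K j 0) g 0 \<and> pc (pc K j k) g 0 = pc (pc K j 0) g k" if "g \<in> offs" for g
  using shifty[of "pc K j 0" g k] that n(1) GC p K Hm Lall unfolding eq by auto
qed

end

locale patch_system2 = patch_system +
 sw: patch_system G C "\<lambda>K j k. pc K k j" H L fy fx ny nx "\<lambda>K j k. cv K k j" "\<lambda>K j k. cc K k j" out
begin

lemmas neighbour_y = sw.neighbour_x
lemmas concave_y = sw.concave_x

text \<open>Whatever the ends of a boundary side look like, the cell added across it continues the patch.\<close>

lemma across_x:
 assumes K: "K \<in> G" "j \<in> signs" "fx K j"
 shows "pc K j 0 \<in> C \<and> L (pc K j 0) (-j) = L K 0 \<and> (\<forall>h\<in>offs. H (pc K j 0) h = H K h) \<and>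
  (\<forall>g\<in>{0,j}. \<forall>h\<in>offs. out (pc (pc K j 0) g h) \<or>
    (\<exists>D\<in>G. h \<in> signs \<and> fy D (-h) \<and> pc K j 0 = pc D 0 (-h) \<and> pc (pc K j 0) g h = pc D g 0))"
proof -
 have base: ?thesis if "pc K j 0 \<in> C" "L (pc K j 0) (-j) = L K 0"
   "\<forall>h\<in>offs. H (pc K j 0) h = H K h \<and> out (pc K j h) \<and> out (pc (pc K j 0) j h)"
 proof -
  have "pc (pc K j 0) 0 h = pc K j h" if "h \<in> offs" for h
   using shiftx[of K j h] that K GC \<open>pc K j 0 \<in> C\<close> \<open>L (pc K j 0) (-j) = L K 0\<close>
    \<open>\<forall>h\<in>offs. _\<close> by blast
  then show ?thesis using that by simp
 qed
 consider "nx K j" | k where "k \<in> signs" "cv K j k"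
  | k where "k \<in> signs" "\<not> fy K k" "\<not> fx (pc K 0 k) j"
  using fx_cases[OF K] by blast
 then show ?thesis
 proof cases
  case 1 then show ?thesis using nx_patch[OF K(1,2)] base by blast
 next
  case 2 then show ?thesis using cv_patchx[OF K(1,2)] base by blast
 next
  case (3 k)
  define U where "U = pc K 0 k"
  define \<upsilon> where "\<upsilon> = - k"
  have s: "\<upsilon> \<in> signs" "k = -\<upsilon>" using 3(1) by (auto simp: \<upsilon>_def)
  note u = neighbour_y[OF K(1) 3(1,2), folded U_def, folded \<upsilon>_def]
  have c: "cc U j \<upsilon>"
   using cc_fx[OF K(1,2) 3(1) K(3) 3(2,3)] by (simp add: U_def \<upsilon>_def)
  define D where "D = pc U j 0"
  note i = cc_iff[OF u(1) K(2) s(1) c]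
  have D: "D \<in> G" "fy D \<upsilon>" using neighbour_x[OF u(1) K(2)] i by (auto simp: D_def)
  have Kd: "pc U 0 \<upsilon> = K" using u by simp
  have eqy: "pc U j \<upsilon> = pc K j 0"
   and Hs: "\<forall>h\<in>offs. H (pc K j 0) h = H K h"
   and Lm: "L (pc K j 0) (-j) = L K 0"
   using concave_y[OF u(1) s(1) K(2) c] unfolding Kd by auto
  have C: "pc K j 0 \<in> C" and o: "\<forall>g\<in>{0,j}. \<forall>h\<in>{0,\<upsilon>}. out (pc (pc K j 0) g h)"
   using cc_patch[OF u(1) K(2) s(1) c] eqy by auto
  have ED: "pc K j 0 = pc D 0 \<upsilon>" "\<And>g. g \<in> offs ==> pc (pc K j 0) g (-\<upsilon>) = pc D g 0"
   using concave_x[OF u(1) K(2) s(1) c] unfolding eqy D_def by auto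
  have "out (pc (pc K j 0) g h) \<or>
    (\<exists>D\<in>G. h \<in> signs \<and> fy D (-h) \<and> pc K j 0 = pc D 0 (-h) \<and> pc (pc K j 0) g h = pc D g 0)"
   if "g \<in> {0,j}" "h \<in> offs" for g h
  proof (cases "h = -\<upsilon>")
   case True
   have "g \<in> offs" using that K(2) by auto
   then show ?thesis using True D ED s by (intro disjI2 bexI[of _ D]) auto
  next
   case False
   then have "h \<in> {0,\<upsilon>}" using that(2) s(1) by auto
   then show ?thesis using o that(1) by blast
  qed
  then show ?thesis using C Hs Lm by blast
 qed
qed

lemma across_x_shift:
 assumes K: "K \<in> G" "j \<in> signs" "fx K j" "h \<in> offs"
 shows "pc (pc K j 0) (-j) h = pc K 0 h" "pc (pc K j 0) 0 h = pc K j h"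
 using across_x[OF K(1-3)] shiftx[of K j h] K GC by auto

lemma beside_x:
 assumes K: "K \<in> G" "j \<in> signs"
 shows "pc K j 0 \<in> C" "pc (pc K j 0) (-j) 0 = K" "L (pc K j 0) (-j) = L K 0"
  "L (pc K j 0) 0 = L K j" "H (pc K j 0) 0 = H K 0"
proof -
 have "pc K j 0 \<in> C \<and> pc (pc K j 0) (-j) 0 = K \<and> L (pc K j 0) (-j) = L K 0"
  using across_x[OF K] across_x_shift(1)[OF K, of 0] neighbour_x[OF K] GC pc00 K by (cases "fx K j") auto
 then show "pc K j 0 \<in> C" "pc (pc K j 0) (-j) 0 = K" "L (pc K j 0) (-j) = L K 0" by auto
 then show "L (pc K j 0) 0 = L K j" "H (pc K j 0) 0 = H K 0"
  using lenx[of K j 0] leny[of K j 0] K GC by auto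
qed

end

locale patch_system3 = patch_system2 +
 sw2: patch_system2 G C "\<lambda>K j k. pc K k j" H L fy fx ny nx "\<lambda>K j k. cv K k j" "\<lambda>K j k. cc K k j" out
begin

lemmas across_y = sw2.across_x
lemmas across_y_shift = sw2.across_x_shift
lemmas beside_y = sw2.beside_x

text \<open>Together with the next lemmas, up to \<open>covered\<close>: no cell of any patch overlaps the domain unless it is a
  mesh cell. Hence a patch that meets the interior of a mesh cell shows the whole cell.\<close>

lemma fx_row_covered:
 assumes K: "K \<in> G" "j \<in> signs" "fx K j" "h \<in> offs"
 shows "pc K j h \<in> G \<or> out (pc K j h)"
proof -
 have "out (pc (pc K j 0) 0 h) \<or> (\<exists>D\<in>G. pc (pc K j 0) 0 h = pc D 0 0)"
  using across_x[OF K(1-3)] K(4) by blast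
 then show ?thesis
  using pc00 GC across_x_shift(2)[OF K] by auto
qed

end

locale patch_system4 = patch_system3 +
 sw3: patch_system3 G C "\<lambda>K j k. pc K k j" H L fy fx ny nx "\<lambda>K j k. cv K k j" "\<lambda>K j k. cc K k j" out
begin

lemma covered_mesh:
 assumes K: "K \<in> G" "g \<in> offs" "h \<in> offs"
 shows "pc K g h \<in> G \<or> out (pc K g h)"
proof -
 consider "g = 0" "h = 0" | "g \<in> signs" "fx K g" | "h \<in> signs" "fy K h"
  | "g \<in> signs" "h = 0" "\<not> fx K g" | "g = 0" "h \<in> signs" "\<not> fy K h"
  | "g \<in> signs" "h \<in> signs" "\<not> fx K g" "\<not> fy K h"
  using K unfolding offs_signs by blast
 then show ?thesis
 proof cases
  case 1 then show ?thesis using pc00 GC K by auto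
 next
  case 2 then show ?thesis using fx_row_covered K by blast
 next
  case 3 then show ?thesis using sw3.fx_row_covered[OF K(1) 3 K(2)] by blast
 next
  case 4 then show ?thesis using neighbour_x K by blast
 next
  case 5 then show ?thesis using neighbour_y K by blast
 next
  case 6
  show ?thesis
  proof (cases "cc K g h")
   case True
   have "out (pc (pc K g h) 0 0)" "pc K g h \<in> C" using cc_patch[OF K(1) 6(1,2) True] by auto
   then show ?thesis using pc00 by auto
  next
   case False
   note q = quadrant[OF K(1) 6 False]
   note u = neighbour_y[OF K(1) 6(2,4)] and n = neighbour_x[OF K(1) 6(1,3)]
   note d = neighbour_x[OF u(1) 6(1)] and d' = neighbour_y[OF n(1) 6(2)]
   have "H (pc K g 0) h = H K h"
    using q d d' u n by metis
   then have "pc (pc K g 0) 0 h = pc K g h"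
    using shiftx[of K g h] 6 n GC K by auto
   then show ?thesis using d' q by metis
  qed
 qed
qed

lemma covered_x:
 assumes K: "K \<in> G" "j \<in> signs" "fx K j" "g \<in> offs" "h \<in> offs"
 shows "pc (pc K j 0) g h \<in> G \<or> out (pc (pc K j 0) g h)"
proof (cases "g = -j")
 case True
 then show ?thesis using across_x_shift[OF K(1-3,5)] covered_mesh[of K 0 h] K by auto
next
 case False
 then have "g \<in> {0,j}" using K by auto
 then consider "out (pc (pc K j 0) g h)" | D where "D \<in> G" "pc (pc K j 0) g h = pc D g 0"
  using across_x[OF K(1-3)] K(5) by blast
 then show ?thesis
 proof cases
  case (2 D) then show ?thesis using covered_mesh[of D g 0] K(4) by simp
 qed simp
qed

text \<open>The centres are, besides the mesh cells, the cells added across a boundary side and those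
 added diagonally at a convex corner.\<close>

lemma center_forms:
 assumes "E \<in> C"
 obtains "E \<in> G" | K j where "K \<in> G" "j \<in> signs" "fx K j" "E = pc K j 0"
  | K k where "K \<in> G" "k \<in> signs" "fy K k" "E = pc K 0 k"
  | K j k where "K \<in> G" "j \<in> signs" "k \<in> signs" "cv K j k" "E = pc K j k"
proof -
 have cc: "\<exists>U\<in>G. fx U j \<and> pc K j k = pc U j 0" if "K \<in> G" "j \<in> signs" "k \<in> signs" "cc K j k" for K j k
  using cc_iff[OF that] neighbour_y(1)[OF that(1,3)] concave_y(1)[OF that(1,3,2,4)] by auto
 have "E \<in> G \<or> (\<exists>K\<in>G. \<exists>j\<in>signs. fx K j \<and> E = pc K j 0) \<or> (\<exists>K\<in>G. \<exists>k\<in>signs. fy K k \<and> E = pc K 0 k) \<or>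
  (\<exists>K\<in>G. \<exists>j\<in>signs. \<exists>k\<in>signs. cv K j k \<and> E = pc K j k)"
  using centers_cases[OF assms]
 proof (elim disjE bexE conjE)
  fix K j assume "K \<in> G" "j \<in> signs" "nx K j" "E = pc K j 0"
  then show ?thesis using nx_fx[of K j] by metis
 next
  fix K k assume "K \<in> G" "k \<in> signs" "ny K k" "E = pc K 0 k"
  then show ?thesis using ny_fy[of K k] by metis
 next
  fix K j k assume a: "K \<in> G" "j \<in> signs" "k \<in> signs" "cv K j k" "E \<in> {pc K j 0, pc K 0 k, pc K j k}"
  then have f: "fx K j" "fy K k" using cv_iff by auto
  from a(5) consider "E = pc K j 0" | "E = pc K 0 k" | "E = pc K j k" by blast
  then show ?thesis using a(1-4) f by cases metis+
 next
  fix K j k assume "K \<in> G" "j \<in> signs" "k \<in> signs" "cc K j k" "E = pc K j k"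
  then show ?thesis using cc[of K j k] by metis
 qed simp
 then show ?thesis using that by blast
qed

lemma convex_shift:
 assumes K: "K \<in> G" "j \<in> signs" "k \<in> signs" "cv K j k" "g \<in> offs"
 shows "pc K j k = pc (pc K j 0) 0 k"
  "pc (pc K j k) g (-k) = pc (pc K j 0) g 0" "pc (pc K j k) g 0 = pc (pc K j 0) g k"
proof -
 have f: "fx K j" "fy K k" using cv_iff K by auto
 have t: "k \<in> offs" using K by auto
 show eq: "pc K j k = pc (pc K j 0) 0 k"
  using across_x_shift(2)[OF K(1,2) f(1) t] by simp
 have "H (pc K j k) (-k) = H (pc K j 0) 0"
  using cv_patch[OF K(1-4)] across_y[OF K(1,3) f(2)] beside_x[OF K(1,2)] K(3) by auto
 then show "pc (pc K j k) g (-k) = pc (pc K j 0) g 0" "pc (pc K j k) g 0 = pc (pc K j 0) g k"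
  using shifty[of "pc K j 0" g k] cv_patch[OF K(1-4)] beside_x[OF K(1,2)] K eq by auto
qed

end

locale patch_system5 = patch_system4 +
 sw4: patch_system4 G C "\<lambda>K j k. pc K k j" H L fy fx ny nx "\<lambda>K j k. cv K k j" "\<lambda>K j k. cc K k j" out
begin

lemmas covered_y = sw4.covered_x

lemma convex_out:
 assumes K: "K \<in> G" "j \<in> signs" "k \<in> signs" "cv K j k" and ab: "g \<in> offs" "h \<in> offs" "(g, h) \<noteq> (-j, -k)"
 shows "out (pc (pc K j k) g h)"
proof -
 have f: "fx K j" "fy K k" using cv_iff K by auto
 have oK: "pc (pc K j 0) 0 0 = pc K j 0" "pc (pc K 0 k) 0 0 = pc K 0 k"
  using beside_x(1) beside_y(1) K pc00 by auto
 have row: "out (pc (pc K j 0) g 0) \<and> out (pc (pc K j 0) g k)" if "g \<in> {0, j}" for g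
  using that cv_patchx[OF K] K(3) across_x_shift(2)[OF K(1,2) f(1)] by auto
 have col: "out (pc (pc K 0 k) 0 h) \<and> out (pc (pc K 0 k) j h)" if "h \<in> {0, k}" for h
  using that cv_patchy[OF K] K(2) across_y_shift(2)[OF K(1,3) f(2)] by auto
 have r: "pc (pc K j k) g (-k) = pc (pc K j 0) g 0" "pc (pc K j k) g 0 = pc (pc K j 0) g k"
  using convex_shift[OF K ab(1)] by auto
 have c: "pc (pc K j k) (-j) h = pc (pc K 0 k) 0 h" "pc (pc K j k) 0 h = pc (pc K 0 k) j h"
  using sw4.convex_shift[OF K(1,3,2,4) ab(2)] by auto
 consider "g = j" "h = k" | "g \<in> {0,j}" "h = -k" | "g \<in> {0,j}" "h = 0" | "g = -j" "h \<in> {0,k}" | "g = 0" "h \<in> {0,k}"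
  using K(2,3) ab by auto
 then show ?thesis
 proof cases
  case 1 then show ?thesis using cv_patch[OF K] by simp
 qed (use r c row col in auto)
qed

lemma covered:
 assumes "E \<in> C" "g \<in> offs" "h \<in> offs"
 shows "pc E g h \<in> G \<or> out (pc E g h)"
 using assms(1)
proof (cases rule: center_forms)
 case 1 then show ?thesis using covered_mesh assms by blast
next
 case 2 then show ?thesis using covered_x assms by blast
next
 case 3 then show ?thesis using covered_y assms by blast
next
 case (4 K j k)
 show ?thesis
 proof (cases "(g, h) = (-j, -k)")
  case True
  have "fx K j" using cv_iff 4 by auto
  then have "pc E g h = K"
   using True 4 convex_shift(2)[OF 4(1-4), of "-j"] beside_x(2)[OF 4(1,2)] by auto
  then show ?thesis using 4 by simp
 next
  case False
  then show ?thesis using convex_out[OF 4(1-4) assms(2,3)] 4 by blast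
 qed
qed

text \<open>The centre whose patch shows the cell \<open>T\<close> in the position opposite to \<open>(j, k)\<close>. In a
 diagonal direction one goes through a neighbour in the mesh if there is one.\<close>

definition around where
 "around T j k = (if j = 0 \<or> k = 0 then pc T j k
   else if \<not> fy T k then pc (pc T 0 k) j 0
   else if \<not> fx T j then pc (pc T j 0) 0 k else pc T j k)"

lemma around_commute:
 assumes T: "T \<in> G" "j \<in> signs" "k \<in> signs" "\<not> fx T j" "\<not> fy T k"
 shows "pc (pc T 0 k) j 0 = pc (pc T j 0) 0 k"
proof (cases "cc T j k")
 case True
 then show ?thesis using concave_x(1)[OF T(1-3)] concave_y(1)[OF T(1,3,2)] by metis
next
 case False
 then show ?thesis using quadrant T by blast
qed

lemma around_via_y:
 "[| T \<in> G; j \<in> offs; k \<in> signs; \<not> fy T k |] ==> around T j k = pc (pc T 0 k) j 0"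
 using beside_y(1) pc00 by (auto simp: around_def)

lemma around_via_x:
 "[| T \<in> G; j \<in> signs; k \<in> offs; \<not> fx T j |] ==> around T j k = pc (pc T j 0) 0 k"
 using beside_x(1) pc00 around_commute by (auto simp: around_def)

text \<open>A centre whose patch shows \<open>T\<close> is reached from \<open>T\<close> by undoing the step from the centre to \<open>T\<close>. For a mesh cell
  this is the symmetry of the neighbour relation; for an added cell one first steps back into the mesh.\<close>

lemma around_unique:
 assumes E: "E \<in> C" "g \<in> offs" "h \<in> offs" and T: "T \<in> G" "pc E g h = T"
 shows "E = around T (-g) (-h)"
proof -
 have row: "E = around T (-g) (-h)" if D: "D \<in> G" "h \<in> signs" "pc D 0 (-h) = E" "pc D g 0 = T" for D
 proof (cases "g = 0")
  case True then show ?thesis using D GC pc00 by (auto simp: around_def)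
 next
  case False
  then have a: "g \<in> signs" using E by auto
  have "\<not> fx D g" using fx_out[OF D(1) a] D(4) T(1) by auto
  then have "\<not> fx T (-g)" "pc T (-g) 0 = D"
   using neighbour_x[OF D(1) a] D(4) by auto
  then show ?thesis using around_via_x[OF T(1), of "-g" "-h"] a D by auto
 qed
 have col: "E = around T (-g) (-h)" if D: "D \<in> G" "g \<in> signs" "pc D (-g) 0 = E" "pc D 0 h = T" for D
 proof (cases "h = 0")
  case True then show ?thesis using D GC pc00 by (auto simp: around_def)
 next
  case False
  then have a: "h \<in> signs" using E by auto
  have "\<not> fy D h" using fy_out[OF D(1) a] D(4) T(1) by auto
  then have "\<not> fy T (-h)" "pc T 0 (-h) = D"
   using neighbour_y[OF D(1) a] D(4) by auto
  then show ?thesis using around_via_y[OF T(1), of "-g" "-h"] a D by auto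
 qed
 have nout: "\<not> out T" using out_notin T by blast
 show ?thesis using E(1)
 proof (cases rule: center_forms)
  case 1
  consider "g = 0" "h = 0" | "g \<in> signs" "h = 0" | "g = 0" "h \<in> signs" | "g \<in> signs" "h \<in> signs"
   using E by auto
  then show ?thesis
  proof cases
   case a: 1
   then show ?thesis using T E pc00 by (auto simp: around_def)
  next
   case 2
   have "\<not> fx E g" using fx_out[OF 1 2(1)] T 2 by auto
   then show ?thesis using neighbour_x[OF 1 2(1)] T 2 by (auto simp: around_def)
  next
   case 3
   have "\<not> fy E h" using fy_out[OF 1 3(2)] T 3 by auto
   then show ?thesis using neighbour_y[OF 1 3(2)] T 3 by (auto simp: around_def)
  next
   case 4
   consider "\<not> fy E h" "\<not> fx (pc E 0 h) g" "pc (pc E 0 h) g 0 = T"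
    | "\<not> fx E g" "\<not> fy (pc E g 0) h" "pc (pc E g 0) 0 h = T"
    using diagonal[OF 1 4] T by auto
   then show ?thesis
   proof cases
    case a: 1
    show ?thesis
     using neighbour_y[OF 1 4(2) a(1)] a by (intro row[of "pc E 0 h"] 4) auto
   next
    case a: 2
    show ?thesis
     using neighbour_x[OF 1 4(1) a(1)] a by (intro col[of "pc E g 0"] 4) auto
   qed
  qed
 next
  case (2 K j)
  show ?thesis
  proof (cases "g = -j")
   case True
   then show ?thesis
    using 2 across_x_shift(1)[OF 2(1-3) E(3)] T by (intro col[of K]) auto
  next
   case False
   then have "g \<in> {0,j}" using E 2 by auto
   then obtain D where "D \<in> G" "h \<in> signs" "E = pc D 0 (-h)" "T = pc D g 0"
    using across_x[OF 2(1-3)] E(3) nout T(2) 2(4) by metis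
   then show ?thesis by (intro row[of D]) auto
  qed
 next
  case (3 K k)
  show ?thesis
  proof (cases "h = -k")
   case True
   then show ?thesis
    using 3 across_y_shift(1)[OF 3(1-3) E(2)] T by (intro row[of K]) auto
  next
   case False
   then have "h \<in> {0,k}" using E 3 by auto
   then obtain D where "D \<in> G" "g \<in> signs" "E = pc D (-g) 0" "T = pc D 0 h"
    using across_y[OF 3(1-3)] E(2) nout T(2) 3(4) by metis
   then show ?thesis by (intro col[of D]) auto
  qed
 next
  case (4 K j k)
  have ab: "g = -j" "h = -k"
   using convex_out[OF 4(1-4) E(2,3)] nout T 4(5) by auto
  have f: "fx K j" "fy K k" using cv_iff 4 by auto
  have "K = T"
   using ab T 4 convex_shift(2)[OF 4(1-4), of "-j"] beside_x(2)[OF 4(1,2)] by auto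
  then show ?thesis using ab f 4 by (auto simp: around_def)
 qed
qed

text \<open>The last statement is what survives of tensor product structure at the boundary: in a diagonal
  direction the free lengths chosen for the two neighbours of \<open>T\<close> may differ, but the patch of the
  diagonal cell inherits one of its lengths from the horizontal or the vertical neighbour.\<close>

lemma around_spec:
 assumes T: "T \<in> G" and st: "j \<in> offs" "k \<in> offs"
 shows "around T j k \<in> C" "pc (around T j k) (-j) (-k) = T"
  "j \<noteq> 0 ==> L (around T 0 k) j = L (around T j k) 0"
  "k \<noteq> 0 ==> H (around T j 0) k = H (around T j k) 0"
  "j \<noteq> 0 ==> k \<noteq> 0 ==> L (around T j k) 0 = L (around T j 0) 0 \<or> H (around T j k) 0 = H (around T 0 k) 0"
proof -
 have T0: "pc T 0 0 = T" "T \<in> C" using pc00 GC T by auto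
 let ?P = "around T j k \<in> C \<and> pc (around T j k) (-j) (-k) = T \<and>
  (j \<noteq> 0 --> L (around T 0 k) j = L (around T j k) 0) \<and>
  (k \<noteq> 0 --> H (around T j 0) k = H (around T j k) 0) \<and>
  (j \<noteq> 0 --> k \<noteq> 0 --> L (around T j k) 0 = L (around T j 0) 0 \<or> H (around T j k) 0 = H (around T 0 k) 0)"
 consider "j = 0" "k = 0" | "j \<in> signs" "k = 0" | "j = 0" "k \<in> signs"
  | "j \<in> signs" "k \<in> signs" "\<not> fy T k" | "j \<in> signs" "k \<in> signs" "fy T k" "\<not> fx T j"
  | "j \<in> signs" "k \<in> signs" "fy T k" "fx T j"
  using st by blast
 then have ?P
 proof cases
  case 1 then show ?thesis using T0 by (simp add: around_def)
 next
  case 2 then show ?thesis using T0 beside_x[OF T 2(1)] by (simp add: around_def)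
 next
  case 3 then show ?thesis using T0 beside_y[OF T 3(2)] by (simp add: around_def)
 next
  case 4
  define U where "U = pc T 0 k"
  note u = neighbour_y[OF T 4(2,3), folded U_def]
  note b = beside_x[OF u(1) 4(1)]
  have eq: "around T j k = pc U j 0" "around T 0 k = U" "around T j 0 = pc T j 0"
   using around_via_y[OF T st(1) 4(2,3)] by (auto simp: U_def around_def)
  have key: "pc (pc U j 0) (-j) (-k) = T \<and> H (pc T j 0) k = H (pc U j 0) 0"
  proof (cases "fx U j")
   case True
   have "pc (pc U j 0) (-j) (-k) = T"
    using across_x_shift(1)[OF u(1) 4(1) True, of "-k"] u 4 by auto
   moreover have "H (pc T j 0) k = H T k"
   proof (cases "fx T j")
    case True then show ?thesis using across_x[OF T 4(1)] st by auto
   next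
    case False
    have "cc T j k"
     using quadrant[OF T 4(1,2) False 4(3)] True by (auto simp: U_def)
    then show ?thesis using cc_patchx[OF T 4(1,2)] by auto
   qed
   ultimately show ?thesis using b u by auto
  next
   case False
   define D where "D = pc U j 0"
   note d = neighbour_x[OF u(1) 4(1) False, folded D_def]
   have "H D (-k) = H U (-k) \<and> H (pc T j 0) k = H D 0"
   proof (cases "fx T j")
    case True
    have c: "cc U j (-k)" using cc_fx[OF T 4(1,2) True 4(3)] False by (auto simp: U_def)
    have m: "-k \<in> signs" using 4 by auto
    have "H D (-k) = H U (-k)" using cc_patchx[OF u(1) 4(1) m c] by (simp add: D_def)
    moreover have "pc T j 0 = pc U j (-k)"
     using concave_y(1)[OF u(1) m 4(1) c] u by auto
    ultimately show ?thesis using cc_patchy[OF u(1) 4(1) m c] d by simp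
   next
    case False': False
    have "\<not> cc T j k" using cc_iff[OF T 4(1,2)] False by (auto simp: U_def)
    note q = quadrant[OF T 4(1,2) False' 4(3) this]
    note n = neighbour_x[OF T 4(1) False']
    note e = neighbour_y[OF n(1) 4(2)]
    have e': "pc (pc T j 0) 0 k = D" using q by (simp add: D_def U_def)
    show ?thesis using e q e' n u d by auto
   qed
   then show ?thesis
    using shiftx[of U j "-k"] u(1) d(1,4) GC 4 u(3) unfolding D_def by auto
  qed
  show ?thesis using key b u unfolding eq by (auto simp: around_def)
 next
  case 5
  define N where "N = pc T j 0"
  note n = neighbour_x[OF T 5(1,4), folded N_def]
  note b = beside_y[OF n(1) 5(2)]
  have eq: "around T j k = pc N 0 k" "around T 0 k = pc T 0 k" "around T j 0 = N"
   using around_via_x[OF T 5(1) st(2) 5(4)] by (auto simp: N_def around_def)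
  have key: "pc (pc N 0 k) (-j) (-k) = T \<and> L (pc T 0 k) j = L (pc N 0 k) 0"
  proof (cases "fy N k")
   case True
   have "pc (pc N 0 k) (-j) (-k) = T"
    using across_y_shift(1)[OF n(1) 5(2) True, of "-j"] n 5 by auto
   moreover have "L (pc T 0 k) j = L T j"
    using across_y[OF T 5(2,3)] st by auto
   ultimately show ?thesis using b n by auto
  next
   case False
   define D where "D = pc N 0 k"
   note d = neighbour_y[OF n(1) 5(2) False, folded D_def]
   have c: "cc N (-j) k" using cc_fy[OF T 5(1,2,3,4)] False by (auto simp: N_def)
   have m: "-j \<in> signs" using 5 by auto
   have "L D (-j) = L N (-j)" using cc_patchy[OF n(1) m 5(2) c] by (simp add: D_def)
   moreover have "pc T 0 k = pc N (-j) k"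
    using concave_x(1)[OF n(1) m 5(2) c] n by auto
   ultimately have "L D (-j) = L N (-j) \<and> L (pc T 0 k) j = L D 0"
    using cc_patchx[OF n(1) m 5(2) c] d by simp
   then show ?thesis
    using shifty[of N "-j" k] n(1) d(1,4) GC 5 n(3) unfolding D_def by auto
  qed
  show ?thesis using key b n unfolding eq by (auto simp: around_def)
 next
  case 6
  have c: "cv T j k" using cv_iff[OF T 6(1,2)] 6 by blast
  have eq: "around T j k = pc T j k" "around T 0 k = pc T 0 k" "around T j 0 = pc T j 0"
   using 6 by (auto simp: around_def)
  note p = cv_patch[OF T 6(1,2) c] cv_patchx[OF T 6(1,2) c] cv_patchy[OF T 6(1,2) c]
  have "pc (pc T j k) (-j) (-k) = T"
   using convex_shift(2)[OF T 6(1,2) c, of "-j"] beside_x(2)[OF T 6(1)] 6 by auto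
  then show ?thesis using p beside_x[OF T 6(1)] beside_y[OF T 6(2)] st unfolding eq by auto
 qed
 then show "around T j k \<in> C" "pc (around T j k) (-j) (-k) = T"
  "j \<noteq> 0 ==> L (around T 0 k) j = L (around T j k) 0"
  "k \<noteq> 0 ==> H (around T j 0) k = H (around T j k) 0"
  "j \<noteq> 0 ==> k \<noteq> 0 ==> L (around T j k) 0 = L (around T j 0) 0 \<or> H (around T j k) 0 = H (around T 0 k) 0"
  by auto
qed

end

section \<open>The geometry of the mesh\<close>

lemma mem_region:
 "p \<in> region K \<longleftrightarrow> fst (fst K) \<le> fst p \<and> fst p \<le> fst (snd K) \<and> snd (fst K) \<le> snd p \<and> snd p \<le> snd (snd K)"
 by (cases p, cases "fst K", cases "snd K") (simp add: region_def)

lemma interior_region: "interior (region K) = box (fst K) (snd K)"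
 by (simp add: region_def)

lemma mem_interior_region:
 "p \<in> interior (region K) \<longleftrightarrow> fst (fst K) < fst p \<and> fst p < fst (snd K) \<and> snd (fst K) < snd p \<and> snd p < snd (snd K)"
 unfolding interior_region by (cases p, cases "fst K", cases "snd K") (auto simp: box_def Basis_prod_def)

lemma closed_segment_vertical: "closed_segment (x, a) (x, b) = {x} \<times> closed_segment a (b::real)" for x :: real
 by (auto simp: closed_segment_def algebra_simps) (metis add.commute diff_add_cancel distrib_right mult.left_neutral)

lemma closed_segment_horizontal: "closed_segment (a, y) (b, y) = closed_segment a (b::real) \<times> {y}" for y :: real
 by (auto simp: closed_segment_def algebra_simps) (metis add.commute diff_add_cancel distrib_right mult.left_neutral)

lemma mem_xside:
 assumes "nondegenerate K"
 shows "z \<in> xside K j \<longleftrightarrow> fst z = fst (vertex K j 1) \<and> snd (fst K) \<le> snd z \<and> snd z \<le> snd (snd K)"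
 using assms unfolding xside_def vertex_def nondegenerate_def
 by (cases z) (auto simp: closed_segment_vertical closed_segment_eq_real_ivl)

lemma mem_yside:
 assumes "nondegenerate K"
 shows "z \<in> yside K k \<longleftrightarrow> snd z = snd (vertex K 1 k) \<and> fst (fst K) \<le> fst z \<and> fst z \<le> fst (snd K)"
 using assms unfolding yside_def vertex_def nondegenerate_def
 by (cases z) (auto simp: closed_segment_horizontal closed_segment_eq_real_ivl)

lemma xside_from_vertex: "k \<in> signs ==> xside K j = closed_segment (vertex K j k) (vertex K j (-k))"
 by (auto simp: xside_def closed_segment_commute)

lemma yside_from_vertex: "j \<in> signs ==> yside K k = closed_segment (vertex K j k) (vertex K (-j) k)"
 by (auto simp: yside_def closed_segment_commute)

locale extended_mesh =
 fixes \<gamma>0 :: real and \<Omega> :: "pt set" and G :: "cell set" and L H :: lengths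
 assumes grid: "rectangular_grid \<gamma>0 \<Omega> G" and ext: "extended_patches \<gamma>0 \<Omega> G L H"
begin

abbreviation "pc \<equiv> patch_cell L H"
abbreviation "C \<equiv> centers \<Omega> G L H"
abbreviation fx where "fx K j \<equiv> xside K j \<subseteq> frontier \<Omega>"
abbreviation fy where "fy K k \<equiv> yside K k \<subseteq> frontier \<Omega>"

lemma domain: "open \<Omega>" "interior (closure \<Omega>) = \<Omega>" "frontier \<Omega> \<inter> \<Omega> = {}"
 and cover: "(\<Union>K\<in>G. region K) = closure \<Omega>" and fin: "finite G"
 using grid polygonal_domain_interior_closure frontier_disjoint_eq[of \<Omega>]
 unfolding rectangular_grid_def polygonal_domain_def by auto

lemma nondeg: "K \<in> G ==> nondegenerate K"
 using grid by (auto simp: rectangular_grid_def)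

lemma open_in_closure: "open U ==> U \<subseteq> closure \<Omega> ==> U \<subseteq> \<Omega>"
 using interior_maximal domain(2) by blast

lemma region_closure: "K \<in> G ==> region K \<subseteq> closure \<Omega>"
 using cover by blast

lemma interior_region_domain: "K \<in> G ==> interior (region K) \<subseteq> \<Omega>"
 using region_closure interior_subset by (intro open_in_closure) blast+

lemma region_inj:
 assumes "K \<in> G" "K' \<in> G" "region K = region K'"
 shows "K = K'"
proof -
 have "fst K \<in> region K" using nondeg[OF assms(1)] by (simp add: mem_region nondegenerate_def)
 then show ?thesis
  using assms(3) unfolding region_def by (auto simp: eq_cbox prod_eq_iff)
qed

text \<open>A face of a cell that meets its interior is the whole cell.\<close>

lemma overlap_eq:
 assumes "K \<in> G" "K' \<in> G" "interior (region K) \<inter> interior (region K') \<noteq> {}"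
 shows "K = K'"
proof -
 let ?F = "region K \<inter> region K'"
 have f: "?F face_of region K" "?F face_of region K'"
  using grid assms by (auto simp: rectangular_grid_def)
 have "?F \<inter> interior (region K) \<noteq> {}" "?F \<inter> interior (region K') \<noteq> {}"
  using assms(3) interior_subset by blast+
 then have "?F = region K" "?F = region K'"
  using f face_of_disjoint_interior by blast+
 then show ?thesis using region_inj assms by simp
qed

lemma no_cross:
 assumes "0 < \<delta>" "\<And>s. 0 < s ==> s < \<delta> ==> {(x + s, y), (x - s, y), (x, y + s), (x, y - s)} \<subseteq> frontier \<Omega>"
 shows False
 using assms simple_polygon_no_cross[of _ \<delta> x y] grid
 unfolding rectangular_grid_def polygonal_domain_def by metis

text \<open>The common face contains a vertex of \<open>K\<close>, so this vertex is an extreme point of the other cell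
  as well.\<close>

lemma vertex_of_both:
 assumes K: "K \<in> G" "K' \<in> G" and st: "j \<in> signs" "k \<in> signs" and p: "vertex K j k \<in> region K'"
 shows "\<exists>j'\<in>signs. \<exists>k'\<in>signs. vertex K j k = vertex K' j' k'"
proof -
 define q where "q = vertex K j k"
 let ?F = "region K \<inter> region K'"
 have f: "?F face_of region K'"
  using grid K by (auto simp: rectangular_grid_def)
 have n: "nondegenerate K" using nondeg K by blast
 have qF: "q \<in> ?F"
  using p n by (auto simp: q_def mem_region vertex_def nondegenerate_def)
 have sym: "q - v \<in> region K" "q + v \<in> region K" if "q - v \<in> region K'" "q + v \<in> region K'" "v \<noteq> 0" for v
 proof -
  have "q \<in> open_segment (q - v) (q + v)"
   using midpoint_in_open_segment[of "q - v" "q + v"] that(3)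
   by (simp add: midpoint_def algebra_simps scaleR_2[symmetric] del: midpoint_in_open_segment)
  then have "q - v \<in> ?F \<and> q + v \<in> ?F"
   using f qF that unfolding face_of_def by blast
  then show "q - v \<in> region K" "q + v \<in> region K" by auto
 qed
 have "\<not> (fst (fst K') < fst q \<and> fst q < fst (snd K'))"
 proof
  assume a: "fst (fst K') < fst q \<and> fst q < fst (snd K')"
  define d where "d = min (fst q - fst (fst K')) (fst (snd K') - fst q)"
  have "0 < d" using a by (auto simp: d_def)
  moreover have "q - (d, 0) \<in> region K'" "q + (d, 0) \<in> region K'"
   using a qF \<open>0 < d\<close> by (auto simp: mem_region d_def)
  ultimately have "q - (d, 0) \<in> region K" "q + (d, 0) \<in> region K"
   using sym[of "(d, 0)"] by (auto simp: zero_prod_def)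
  then show False
   using \<open>0 < d\<close> by (auto simp: mem_region q_def vertex_def split: if_splits)
 qed
 moreover have "\<not> (snd (fst K') < snd q \<and> snd q < snd (snd K'))"
 proof
  assume a: "snd (fst K') < snd q \<and> snd q < snd (snd K')"
  define d where "d = min (snd q - snd (fst K')) (snd (snd K') - snd q)"
  have "0 < d" using a by (auto simp: d_def)
  moreover have "q - (0, d) \<in> region K'" "q + (0, d) \<in> region K'"
   using a qF \<open>0 < d\<close> by (auto simp: mem_region d_def)
  ultimately have "q - (0, d) \<in> region K" "q + (0, d) \<in> region K"
   using sym[of "(0, d)"] by (auto simp: zero_prod_def)
  then show False
   using \<open>0 < d\<close> by (auto simp: mem_region q_def vertex_def split: if_splits)
 qed
 ultimately have "fst q \<in> {fst (fst K'), fst (snd K')}" "snd q \<in> {snd (fst K'), snd (snd K')}"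
  using qF by (auto simp: mem_region)
 then have "q = vertex K' (if fst q = fst (fst K') then -1 else 1) (if snd q = snd (fst K') then -1 else 1)"
  by (auto simp: vertex_def prod_eq_iff)
 moreover have "(if b then -1 else 1) \<in> signs" for b by simp
 ultimately show ?thesis
  unfolding q_def[symmetric] by (intro bexI)
qed

section \<open>Quadrants at a vertex\<close>

text \<open>A quadrant at \<open>p\<close> is occupied if a mesh cell with vertex \<open>p\<close> lies in it; \<open>(j, k)\<close> are the directions
  from \<open>p\<close>, hence the opposite signs.\<close>

definition occupied :: "pt => int => int => bool" where
 "occupied p s t \<longleftrightarrow> (\<exists>K\<in>G. vertex K (-s) (-t) = p)"

lemma occupied_self: "K \<in> G ==> occupied (vertex K j k) (-j) (-k)"
 unfolding occupied_def by auto

lemma same_quadrant: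
 assumes K: "K \<in> G" "K' \<in> G" and st: "j \<in> signs" "k \<in> signs" and eq: "vertex K j k = vertex K' j k"
 shows "K = K'"
proof (rule overlap_eq[OF K])
 define e where "e = min (min (width K) (width K')) (min (height K) (height K')) / 2"
 have n: "nondegenerate K" "nondegenerate K'" using nondeg K by auto
 then have e: "0 < e" "e < width K" "e < width K'" "e < height K" "e < height K'"
  by (auto simp: e_def nondegenerate_def width_def height_def)
 let ?z = "(fst (vertex K j k) - j * e, snd (vertex K j k) - k * e)"
 have "?z \<in> interior (region K)"
  using e st by (auto simp: mem_interior_region vertex_def width_def height_def)
 moreover have "?z \<in> interior (region K')"
  using e st unfolding eq by (auto simp: mem_interior_region vertex_def width_def height_def)
 ultimately show "interior (region K) \<inter> interior (region K') \<noteq> {}" by blast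
qed

lemma shared_xside:
 assumes K: "K \<in> G" "K' \<in> G" and st: "j \<in> signs" "k \<in> signs" and eq: "vertex K j k = vertex K' (-j) k"
 shows "vertex K j (-k) = vertex K' (-j) (-k)"
proof -
 have *: "vertex K j (-k) = vertex K' (-j) (-k)"
  if K: "K \<in> G" "K' \<in> G" and st: "j \<in> signs" "k \<in> signs" and eq: "vertex K j k = vertex K' (-j) k"
   and le: "height K \<le> height K'" for K K' j k
 proof -
  have n: "nondegenerate K" "nondegenerate K'" using nondeg K by auto
  have "vertex K j (-k) \<in> region K'"
   using n st eq le by (auto simp: mem_region vertex_def height_def nondegenerate_def)
  then obtain j' k' where "j' \<in> signs" "k' \<in> signs" "vertex K j (-k) = vertex K' j' k'"
   using vertex_of_both[OF K st(1), of "-k"] st by auto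
  then show ?thesis
   using n st eq by (auto simp: vertex_def nondegenerate_def)
 qed
 show ?thesis
 proof (cases "height K \<le> height K'")
  case True then show ?thesis using *[OF K st eq] by blast
 next
  case False
  then show ?thesis using *[OF K(2,1), of "-j" k] st eq by auto
 qed
qed

lemma shared_yside:
 assumes K: "K \<in> G" "K' \<in> G" and st: "j \<in> signs" "k \<in> signs" and eq: "vertex K j k = vertex K' j (-k)"
 shows "vertex K (-j) k = vertex K' (-j) (-k)"
proof -
 have *: "vertex K (-j) k = vertex K' (-j) (-k)"
  if K: "K \<in> G" "K' \<in> G" and st: "j \<in> signs" "k \<in> signs" and eq: "vertex K j k = vertex K' j (-k)"
   and le: "width K \<le> width K'" for K K' j k
 proof -
  have n: "nondegenerate K" "nondegenerate K'" using nondeg K by auto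
  have "vertex K (-j) k \<in> region K'"
   using n st eq le by (auto simp: mem_region vertex_def width_def nondegenerate_def)
  then obtain j' k' where "j' \<in> signs" "k' \<in> signs" "vertex K (-j) k = vertex K' j' k'"
   using vertex_of_both[OF K, of "-j" k] st by auto
  then show ?thesis
   using n st eq by (auto simp: vertex_def nondegenerate_def)
 qed
 show ?thesis
 proof (cases "width K \<le> width K'")
  case True then show ?thesis using *[OF K st eq] by blast
 next
  case False
  then show ?thesis using *[OF K(2,1), of j "-k"] st eq by auto
 qed
qed

lemma shared_xside_interior:
 assumes K: "K \<in> G" "K' \<in> G" and st: "j \<in> signs" "k \<in> signs" and eq: "vertex K j k = vertex K' (-j) k"
 shows "\<not> fx K j"
proof -
 note eq' = shared_xside[OF assms]
 have n: "nondegenerate K" "nondegenerate K'" using nondeg K by auto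
 define e where "e = min (width K) (width K')"
 have e: "0 < e" using n by (auto simp: e_def width_def nondegenerate_def)
 define x where "x = fst (vertex K j k)"
 let ?U = "box (x - e, snd (fst K)) (x + e, snd (snd K))"
 have "?U \<subseteq> region K \<union> region K'"
 proof
  fix z assume "z \<in> ?U"
  then have z: "x - e < fst z" "fst z < x + e" "snd (fst K) < snd z" "snd z < snd (snd K)"
   by (cases z; auto simp: box_def Basis_prod_def)+
  show "z \<in> region K \<union> region K'"
   using z eq eq' st n by (auto simp: mem_region x_def e_def vertex_def width_def nondegenerate_def)
 qed
 then have "?U \<subseteq> \<Omega>"
  using region_closure[OF K(1)] region_closure[OF K(2)] by (intro open_in_closure open_box) blast
 moreover have "(x, (snd (fst K) + snd (snd K)) / 2) \<in> ?U"
  using e n by (auto simp: box_def Basis_prod_def nondegenerate_def)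
 moreover have "(x, (snd (fst K) + snd (snd K)) / 2) \<in> xside K j"
  using n by (auto simp: mem_xside x_def vertex_def nondegenerate_def)
 ultimately show ?thesis using domain(3) by blast
qed

lemma shared_yside_interior:
 assumes K: "K \<in> G" "K' \<in> G" and st: "j \<in> signs" "k \<in> signs" and eq: "vertex K j k = vertex K' j (-k)"
 shows "\<not> fy K k"
proof -
 note eq' = shared_yside[OF assms]
 have n: "nondegenerate K" "nondegenerate K'" using nondeg K by auto
 define e where "e = min (height K) (height K')"
 have e: "0 < e" using n by (auto simp: e_def height_def nondegenerate_def)
 define y where "y = snd (vertex K j k)"
 let ?U = "box (fst (fst K), y - e) (fst (snd K), y + e)"
 have "?U \<subseteq> region K \<union> region K'"
 proof
  fix z assume "z \<in> ?U"
  then have z: "y - e < snd z" "snd z < y + e" "fst (fst K) < fst z" "fst z < fst (snd K)"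
   by (cases z; auto simp: box_def Basis_prod_def)+
  show "z \<in> region K \<union> region K'"
   using z eq eq' st n by (auto simp: mem_region y_def e_def vertex_def height_def nondegenerate_def)
 qed
 then have "?U \<subseteq> \<Omega>"
  using region_closure[OF K(1)] region_closure[OF K(2)] by (intro open_in_closure open_box) blast
 moreover have "((fst (fst K) + fst (snd K)) / 2, y) \<in> ?U"
  using e n by (auto simp: box_def Basis_prod_def nondegenerate_def)
 moreover have "((fst (fst K) + fst (snd K)) / 2, y) \<in> yside K k"
  using n by (auto simp: mem_yside y_def vertex_def nondegenerate_def)
 ultimately show ?thesis using domain(3) by blast
qed

lemma G_subset_C: "K \<in> G ==> K \<in> C"
 by (auto simp: centers_def interior_cells_def boundary_cells_def)

lemma sizes:
 assumes "K \<in> C"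
 shows "L K 0 = width K" "H K 0 = height K" "j \<in> offs ==> L K j > 0" "j \<in> offs ==> H K j > 0"
 using ext assms unfolding extended_patches_def by blast+

lemma neighbour_in_mesh_x:
 assumes "K \<in> G" "j \<in> signs" "\<not> fx K j" shows "pc K j 0 \<in> G"
proof (cases "K \<in> interior_cells \<Omega> G")
 case True
 moreover have "j \<in> offs" "(0::int) \<in> offs" using assms(2) by auto
 ultimately show ?thesis using ext unfolding extended_patches_def by blast
next
 case False
 then have "K \<in> boundary_cells \<Omega> G" using assms(1) by (auto simp: interior_cells_def boundary_cells_def)
 then show ?thesis using ext assms(2,3) unfolding extended_patches_def by blast
qed

lemma neighbour_in_mesh_y:
 assumes "K \<in> G" "k \<in> signs" "\<not> fy K k" shows "pc K 0 k \<in> G"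
proof (cases "K \<in> interior_cells \<Omega> G")
 case True
 moreover have "k \<in> offs" "(0::int) \<in> offs" using assms(2) by auto
 ultimately show ?thesis using ext unfolding extended_patches_def by blast
next
 case False
 then have "K \<in> boundary_cells \<Omega> G" using assms(1) by (auto simp: interior_cells_def boundary_cells_def)
 then show ?thesis using ext assms(2,3) unfolding extended_patches_def by blast
qed

lemma vertex_patch_cell:
 assumes "j \<in> signs" "k \<in> signs"
 shows "vertex (pc K j 0) (-j) k = vertex K j k" "vertex (pc K 0 k) j (-k) = vertex K j k"
  "vertex (pc K j k) (-j) (-k) = vertex K j k"
 using assms by (auto simp: vertex_def patch_cell_def xknot_def yknot_def)

lemma fx_iff:
 assumes "K \<in> G" "j \<in> signs" "k \<in> signs"
 shows "fx K j \<longleftrightarrow> \<not> occupied (vertex K j k) j (-k)"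
 using shared_xside_interior[OF assms(1) _ assms(2,3)] neighbour_in_mesh_x[OF assms(1,2)]
  vertex_patch_cell(1)[OF assms(2,3), of K] unfolding occupied_def by (metis minus_minus)

lemma fy_iff:
 assumes "K \<in> G" "j \<in> signs" "k \<in> signs"
 shows "fy K k \<longleftrightarrow> \<not> occupied (vertex K j k) (-j) k"
 using shared_yside_interior[OF assms(1) _ assms(2,3)] neighbour_in_mesh_y[OF assms(1,3)]
  vertex_patch_cell(2)[OF assms(2,3), of K] unfolding occupied_def by (metis minus_minus)

lemma neighbour_eq_x:
 assumes "K \<in> G" "K' \<in> G" "j \<in> signs" "k \<in> signs" "vertex K j k = vertex K' (-j) k"
 shows "pc K j 0 = K'" "\<not> fx K j"
proof -
 show nf: "\<not> fx K j" using shared_xside_interior assms by blast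
 have "-j \<in> signs" using assms by auto
 then show "pc K j 0 = K'"
  using same_quadrant[OF neighbour_in_mesh_x[OF assms(1,3) nf] assms(2) _ assms(4)]
   vertex_patch_cell(1)[OF assms(3,4), of K] assms(5) by metis
qed

lemma neighbour_eq_y:
 assumes "K \<in> G" "K' \<in> G" "j \<in> signs" "k \<in> signs" "vertex K j k = vertex K' j (-k)"
 shows "pc K 0 k = K'" "\<not> fy K k"
proof -
 show nf: "\<not> fy K k" using shared_yside_interior assms by blast
 have "-k \<in> signs" using assms by auto
 then show "pc K 0 k = K'"
  using same_quadrant[OF neighbour_in_mesh_y[OF assms(1,4) nf] assms(2,3)]
   vertex_patch_cell(2)[OF assms(3,4), of K] assms(5) by metis
qed

text \<open>Near a vertex only cells having it as a vertex matter, and each of these looks like a quadrant.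
  The following lemmas go through the possible sets of occupied quadrants.\<close>

lemma local_structure:
 fixes p :: pt
 assumes K: "K \<in> G" "j \<in> signs" "k \<in> signs" and p: "p = vertex K j k"
 obtains e where "0 < e" "\<And>z :: pt. z \<in> ball p e ==> z \<in> closure \<Omega> \<longleftrightarrow>
  (\<exists>s\<in>signs. \<exists>t\<in>signs. occupied p s t \<and> 0 \<le> s * (fst z - fst p) \<and> 0 \<le> t * (snd z - snd p))"
proof -
 have "\<forall>\<^sub>F z in nhds p. z \<in> region K' \<longleftrightarrow> (\<exists>s\<in>signs. \<exists>t\<in>signs. vertex K' (-s) (-t) = p \<and>
   0 \<le> s * (fst z - fst p) \<and> 0 \<le> t * (snd z - snd p))" if K': "K' \<in> G" for K'
 proof -
  have n: "nondegenerate K'" using nondeg K' by blast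
  show ?thesis
  proof (cases "p \<in> region K'")
   case False
   have "open (- region K')" unfolding region_def by (intro open_Compl closed_cbox)
   then have near: "\<forall>\<^sub>F z in nhds p. z \<notin> region K'"
    using False eventually_nhds_in_open[of "- region K'" p] by simp
   have nv: "vertex K' (-s) (-t) \<noteq> p" for s t
    using False n by (auto simp: mem_region vertex_def nondegenerate_def)
   show ?thesis
    using near
   proof eventually_elim
    case (elim z) then show ?case using nv by blast
   qed
  next
   case True
   then obtain j' k' where s: "j' \<in> signs" "k' \<in> signs" "p = vertex K' j' k'"
    using vertex_of_both[OF K(1) K' K(2,3)] p by blast
   have w: "0 < width K'" "0 < height K'" using n by (auto simp: nondegenerate_def width_def height_def)
   have uniq: "vertex K' (-s) (-t) = p \<longleftrightarrow> s = -j' \<and> t = -k'" if "s \<in> signs" "t \<in> signs" for s t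
    using s that n by (auto simp: vertex_def nondegenerate_def)
   have "\<forall>\<^sub>F z in nhds p. dist z p < min (width K') (height K')"
    using w by (intro eventually_nhds_metric[THEN iffD2]) (auto intro!: exI[of _ "min (width K') (height K')"])
   then show ?thesis
   proof eventually_elim
    case (elim z)
    then have d: "\<bar>fst z - fst p\<bar> < width K'" "\<bar>snd z - snd p\<bar> < height K'"
     using dist_fst_le[of z p] dist_snd_le[of z p] by (auto simp: dist_real_def)
    have "(\<exists>s\<in>signs. \<exists>t\<in>signs. vertex K' (-s) (-t) = p \<and>
      0 \<le> s * (fst z - fst p) \<and> 0 \<le> t * (snd z - snd p)) \<longleftrightarrow>
      0 \<le> (-j') * (fst z - fst p) \<and> 0 \<le> (-k') * (snd z - snd p)"
     using uniq s(1,2) by auto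
    also have "\<dots> \<longleftrightarrow> z \<in> region K'"
     using d s by (auto simp: mem_region vertex_def width_def height_def)
    finally show ?case by blast
   qed
  qed
 qed
 then have "\<forall>\<^sub>F z in nhds p. \<forall>K'\<in>G. z \<in> region K' \<longleftrightarrow> (\<exists>s\<in>signs. \<exists>t\<in>signs. vertex K' (-s) (-t) = p \<and>
   0 \<le> s * (fst z - fst p) \<and> 0 \<le> t * (snd z - snd p))"
  by (intro eventually_ball_finite[OF fin] ballI)
 then obtain e where e: "0 < e" "\<forall>z. dist z p < e --> (\<forall>K'\<in>G.
   z \<in> region K' \<longleftrightarrow> (\<exists>s\<in>signs. \<exists>t\<in>signs. vertex K' (-s) (-t) = p \<and>
   0 \<le> s * (fst z - fst p) \<and> 0 \<le> t * (snd z - snd p)))"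
  unfolding eventually_nhds_metric by (elim exE conjE)
 show ?thesis
 proof (rule that[OF e(1)])
  fix z assume "z \<in> ball p e"
  then have z: "dist z p < e" by (simp add: dist_commute)
  have "z \<in> closure \<Omega> \<longleftrightarrow> (\<exists>K'\<in>G. z \<in> region K')" using cover by blast
  also have "\<dots> \<longleftrightarrow> (\<exists>K'\<in>G. \<exists>s\<in>signs. \<exists>t\<in>signs. vertex K' (-s) (-t) = p \<and>
   0 \<le> s * (fst z - fst p) \<and> 0 \<le> t * (snd z - snd p))" by (rule bex_cong[OF refl e(2)[rule_format, OF z]])
  finally show "z \<in> closure \<Omega> \<longleftrightarrow>
   (\<exists>s\<in>signs. \<exists>t\<in>signs. occupied p s t \<and> 0 \<le> s * (fst z - fst p) \<and> 0 \<le> t * (snd z - snd p))"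
   unfolding occupied_def by blast
 qed
qed

lemma four_quadrants:
 assumes K: "K \<in> G" "j \<in> signs" "k \<in> signs" and p: "p = vertex K j k"
  and o: "occupied p j (-k)" "occupied p (-j) k" "occupied p j k"
 shows "p \<in> \<Omega>"
proof -
 obtain e where e: "0 < e" "\<And>z :: pt. z \<in> ball p e ==> z \<in> closure \<Omega> \<longleftrightarrow>
  (\<exists>s\<in>signs. \<exists>t\<in>signs. occupied p s t \<and> 0 \<le> s * (fst z - fst p) \<and> 0 \<le> t * (snd z - snd p))"
  using local_structure[OF K p] by blast
 have all: "occupied p s t" if "s \<in> signs" "t \<in> signs" for s t
 proof -
  have "s = j \<or> s = -j" "t = k \<or> t = -k" using that K by auto
  then show ?thesis using o occupied_self[OF K(1), of j k] p by auto
 qed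
 have "ball p e \<subseteq> closure \<Omega>"
 proof
  fix z assume z: "z \<in> ball p e"
  define s t :: int where "s = (if fst z \<ge> fst p then 1 else -1)" and "t = (if snd z \<ge> snd p then 1 else -1)"
  have "s \<in> signs" "t \<in> signs" "0 \<le> s * (fst z - fst p)" "0 \<le> t * (snd z - snd p)"
   by (auto simp: s_def t_def)
  then show "z \<in> closure \<Omega>" unfolding e(2)[OF z] using all by blast
 qed
 then show ?thesis using open_in_closure e(1) by (meson centre_in_ball open_ball subsetD)
qed

lemma corner_of_sides:
 assumes "closed_segment p a \<subseteq> frontier \<Omega>" "closed_segment p b \<subseteq> frontier \<Omega>"
  "fst a = fst p" "snd a \<noteq> snd p" "snd b = snd p" "fst b \<noteq> fst p"
 shows "corner_node \<Omega> p"
proof -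
 have "\<not> collinear {a, p, b}"
 proof
  assume "collinear {a, p, b}"
  then have "collinear {0, a - p, b - p}"
   using collinear_3[of a p b] by (simp only: NO_MATCH_def simp_thms)
  then show False
   using assms(3-) unfolding collinear_lemma by (auto simp: prod_eq_iff)
 qed
 then show ?thesis using assms(1,2) unfolding corner_node_def by blast
qed

lemma corner_in_frontier: "corner_node \<Omega> p ==> p \<in> frontier \<Omega>"
 unfolding corner_node_def by (meson ends_in_segment(1) subsetD)

lemma vertex_coords:
 assumes "K \<in> G" "j \<in> signs" "k \<in> signs"
 shows "fst (vertex K j (-k)) = fst (vertex K j k)" "snd (vertex K j (-k)) \<noteq> snd (vertex K j k)"
  "snd (vertex K (-j) k) = snd (vertex K j k)" "fst (vertex K (-j) k) \<noteq> fst (vertex K j k)"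
 using nondeg[OF assms(1)] assms(2,3) by (auto simp: vertex_def nondegenerate_def)

lemma three_quadrants:
 assumes K: "K \<in> G" "j \<in> signs" "k \<in> signs" and p: "p = vertex K j k"
  and o: "occupied p j (-k)" "occupied p (-j) k" "\<not> occupied p j k"
 shows "concave_corner \<Omega> p"
proof -
 obtain N where N: "N \<in> G" "vertex N (-j) k = p" using o(1) by (auto simp: occupied_def)
 obtain U where U: "U \<in> G" "vertex U j (-k) = p" using o(2) by (auto simp: occupied_def)
 have m: "-j \<in> signs" "-k \<in> signs" using K by auto
 have "fy N k" using fy_iff[OF N(1) m(1) K(3)] N(2) o(3) by auto
 then have b: "closed_segment p (vertex N j k) \<subseteq> frontier \<Omega>"
  using yside_from_vertex[OF m(1), of N k] N by auto
 have "fx U j" using fx_iff[OF U(1) K(2) m(2)] U(2) o(3) by auto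
 then have a: "closed_segment p (vertex U j k) \<subseteq> frontier \<Omega>"
  using xside_from_vertex[OF m(2), of U j] U by auto
 have corner: "corner_node \<Omega> p"
  using corner_of_sides[OF a b] vertex_coords[OF N(1) m(1) K(3)] vertex_coords[OF U(1) K(2) m(2)] N U by auto
 have "\<not> convex (\<Omega> \<inter> ball p e)" if "e > 0" for e
 proof
  assume conv: "convex (\<Omega> \<inter> ball p e)"
  define d where "d = min (min (width N) (height N)) (min (min (width U) (height U)) e) / 2"
  have n: "nondegenerate N" "nondegenerate U" using nondeg N U by auto
  then have d: "0 < d" "d < width N" "d < height N" "d < width U" "d < height U" "2 * d \<le> e"
   using that by (auto simp: d_def nondegenerate_def width_def height_def)
  define v where "v = (j * d, - k * d)"
  have nv: "norm v < e"
  proof -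
   have "norm v = sqrt (d\<^sup>2 + d\<^sup>2)" using K by (auto simp: v_def norm_Pair)
   also have "\<dots> < sqrt ((2 * d)\<^sup>2)" using d by (intro real_sqrt_less_mono) (auto simp: power2_eq_square)
   also have "sqrt ((2 * d)\<^sup>2) = 2 * d" by (rule real_sqrt_unique) (use d in auto)
   finally show ?thesis using d by simp
  qed
  have "p + v \<in> interior (region N)"
   using N(2) d K n by (auto simp: v_def mem_interior_region vertex_def width_def height_def)
  moreover have "p - v \<in> interior (region U)"
   using U(2) d K n by (auto simp: v_def mem_interior_region vertex_def width_def height_def)
  ultimately have "p + v \<in> \<Omega> \<inter> ball p e" "p - v \<in> \<Omega> \<inter> ball p e"
   using subsetD[OF interior_region_domain[OF N(1)]] subsetD[OF interior_region_domain[OF U(1)]] nv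
   by (simp_all add: dist_norm)
  then have "(1/2) *\<^sub>R (p + v) + (1/2) *\<^sub>R (p - v) \<in> \<Omega> \<inter> ball p e"
   using conv by (intro convexD) auto
  moreover have "(1/2) *\<^sub>R (p + v) + (1/2) *\<^sub>R (p - v) = p"
   by (simp add: algebra_simps flip: scaleR_add_left)
  ultimately have "p \<in> \<Omega>" by simp
  then show False using corner_in_frontier[OF corner] domain(3) by blast
 qed
 then show ?thesis
  using corner unfolding concave_corner_def convex_corner_def by blast
qed

lemma one_quadrant:
 assumes K: "K \<in> G" "j \<in> signs" "k \<in> signs" and p: "p = vertex K j k"
  and o: "\<not> occupied p j (-k)" "\<not> occupied p (-j) k" "\<not> occupied p j k"
 shows "convex_corner \<Omega> p"
proof -
 have "fx K j" "fy K k" using fx_iff[OF K] fy_iff[OF K] o p by auto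
 then have ab: "closed_segment p (vertex K j (-k)) \<subseteq> frontier \<Omega>" "closed_segment p (vertex K (-j) k) \<subseteq> frontier \<Omega>"
  using xside_from_vertex[OF K(3), of K j] yside_from_vertex[OF K(2), of K k] p by auto
 have corner: "corner_node \<Omega> p"
  using corner_of_sides[OF ab] vertex_coords[OF K] p by auto
 obtain e where e: "0 < e" "\<And>z :: pt. z \<in> ball p e ==> z \<in> closure \<Omega> \<longleftrightarrow>
  (\<exists>s\<in>signs. \<exists>t\<in>signs. occupied p s t \<and> 0 \<le> s * (fst z - fst p) \<and> 0 \<le> t * (snd z - snd p))"
  using local_structure[OF K p] by blast
 have only: "occupied p s t \<longleftrightarrow> s = -j \<and> t = -k" if "s \<in> signs" "t \<in> signs" for s t
 proof -
  have "s = j \<or> s = -j" "t = k \<or> t = -k" "j \<noteq> - j" "k \<noteq> - k" using that K by auto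
  then show ?thesis using o occupied_self[OF K(1), of j k] p by auto
 qed
 have "-j \<in> signs" "-k \<in> signs" using K by auto
 then have cl: "z \<in> closure \<Omega> \<longleftrightarrow> 0 \<le> -j * (fst z - fst p) \<and> 0 \<le> -k * (snd z - snd p)" if "z \<in> ball p e" for z :: pt
  unfolding e(2)[OF that] using only by auto
 define A where "A = {z. inner (- real_of_int j, 0) z > -j * fst p} \<inter> {z. inner (0, - real_of_int k) z > -k * snd p} \<inter> ball p e"
 have A: "z \<in> A \<longleftrightarrow> z \<in> ball p e \<and> 0 < -j * (fst z - fst p) \<and> 0 < -k * (snd z - snd p)" for z :: pt
  by (cases z) (auto simp: A_def algebra_simps)
 have "open A" unfolding A_def by (intro open_Int open_halfspace_gt open_ball)
 moreover have "A \<subseteq> closure \<Omega>" using cl A by auto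
 ultimately have "A \<subseteq> \<Omega> \<inter> ball p e" using open_in_closure A by blast
 moreover have "\<Omega> \<inter> ball p e \<subseteq> A"
 proof
  fix z assume z: "z \<in> \<Omega> \<inter> ball p e"
  moreover have "open (\<Omega> \<inter> ball p e)" using domain by auto
  ultimately obtain d where d: "0 < d" "ball z d \<subseteq> \<Omega> \<inter> ball p e" by (meson open_contains_ball)
  have "z + (j * (d/2), 0) \<in> ball z d" "z + (0, k * (d/2)) \<in> ball z d"
   using d K by (auto simp: dist_norm norm_Pair)
  then have q: "z + (j * (d/2), 0) \<in> \<Omega> \<inter> ball p e" "z + (0, k * (d/2)) \<in> \<Omega> \<inter> ball p e" using d by blast+
  then have "z + (j * (d/2), 0) \<in> closure \<Omega>" "z + (0, k * (d/2)) \<in> closure \<Omega>"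
   using closure_subset by blast+
  then have "0 \<le> -j * (fst z + j * (d/2) - fst p)" "0 \<le> -k * (snd z + k * (d/2) - snd p)"
   using cl q by auto
  then show "z \<in> A" unfolding A using z d K by (auto simp: algebra_simps)
 qed
 moreover have "convex A" unfolding A_def by (intro convex_Int convex_halfspace_gt convex_ball)
 ultimately have "convex (\<Omega> \<inter> ball p e)" by (metis subset_antisym)
 then show ?thesis using corner e(1) unfolding convex_corner_def by blast
qed

text \<open>If just two opposite quadrants were occupied, the boundary would contain a cross at \<open>p\<close>.\<close>

lemma opposite_quadrants:
 assumes K: "K \<in> G" "j \<in> signs" "k \<in> signs" and p: "p = vertex K j k"
  and o: "\<not> occupied p j (-k)" "\<not> occupied p (-j) k" "occupied p j k"
 shows False
proof -
 obtain D where D: "D \<in> G" "vertex D (-j) (-k) = p" using o(3) by (auto simp: occupied_def)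
 have m: "-j \<in> signs" "-k \<in> signs" using K by auto
 have f: "fx K j" "fy K k" "fx D (-j)" "fy D (-k)"
  using fx_iff[OF K] fy_iff[OF K] fx_iff[OF D(1) m] fy_iff[OF D(1) m] D(2) o p by auto
 define d where "d = min (min (width K) (height K)) (min (width D) (height D))"
 have n: "nondegenerate K" "nondegenerate D" using nondeg K D by auto
 then have d: "0 < d" by (auto simp: d_def nondegenerate_def width_def height_def)
 show False
 proof (rule no_cross[of d "fst p" "snd p"])
  show "0 < d" by fact
  fix s assume s: "0 < s" "s < d"
  then have s': "s < width K" "s < height K" "s < width D" "s < height D" by (auto simp: d_def)
  have "(fst p, snd p - k * s) \<in> xside K j" "(fst p - j * s, snd p) \<in> yside K k"
   using s s' K n p by (auto simp: mem_xside mem_yside vertex_def width_def height_def)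
  moreover have "(fst p, snd p + k * s) \<in> xside D (-j)" "(fst p + j * s, snd p) \<in> yside D (-k)"
   using s s' K n D(2) by (auto simp: mem_xside mem_yside vertex_def width_def height_def)
  ultimately have "{(fst p, snd p - k * s), (fst p - j * s, snd p), (fst p, snd p + k * s), (fst p + j * s, snd p)} \<subseteq> frontier \<Omega>"
   using f by blast
  then show "{(fst p + s, snd p), (fst p - s, snd p), (fst p, snd p + s), (fst p, snd p - s)} \<subseteq> frontier \<Omega>"
   using K by auto
 qed
qed

text \<open>Sides of the polygon at a point where the boundary is straight lie on one line.\<close>

lemma not_corner_on_line:
 assumes "0 < e" "linear f" "\<And>z :: pt. z \<in> ball p e ==> z \<in> frontier \<Omega> ==> f z = f p"
  and f: "f = fst \<or> f = (snd :: pt => real)"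
 shows "\<not> corner_node \<Omega> p"
proof
 assume "corner_node \<Omega> p"
 then obtain a b where ab: "\<not> collinear {a, p, b}" "closed_segment p a \<subseteq> frontier \<Omega>" "closed_segment p b \<subseteq> frontier \<Omega>"
  unfolding corner_node_def by blast
 have eq: "f a = f p" if "closed_segment p a \<subseteq> frontier \<Omega>" for a
 proof -
  define d where "d = min 1 (e / (2 * (norm (a - p) + 1)))"
  have np: "0 < norm (a - p) + 1" by (smt (verit) norm_ge_zero)
  have d: "0 < d" "d \<le> 1" using np \<open>0 < e\<close> by (auto simp: d_def)
  have "d * norm (a - p) \<le> e / (2 * (norm (a - p) + 1)) * norm (a - p)"
   by (intro mult_right_mono) (auto simp: d_def)
  also have "\<dots> < e" using np \<open>0 < e\<close> by (simp add: divide_simps)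
  finally have "p + d *\<^sub>R (a - p) \<in> ball p e" using d by (simp add: dist_norm)
  moreover have "p + d *\<^sub>R (a - p) \<in> closed_segment p a"
   unfolding closed_segment_def using d by (auto intro!: exI[of _ d] simp: algebra_simps)
  ultimately have "f (p + d *\<^sub>R (a - p)) = f p" using assms(3) that by blast
  then have "d * (f a - f p) = 0"
   using f by auto
  then show ?thesis using d by simp
 qed
 have "f (a - p) = 0" "f (b - p) = 0" using eq[OF ab(2)] eq[OF ab(3)] f by auto
 moreover have ex: "x = 0 \<or> (\<exists>c. y = c * x)" for x y :: real
  by (cases "x = 0") (auto intro: exI[of _ "y / x"])
 ultimately have "collinear {0, a - p, b - p}"
  using f ex[of "snd a - snd p" "snd b - snd p"] ex[of "fst a - fst p" "fst b - fst p"]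
  by (auto simp: collinear_lemma prod_eq_iff)
 then have "collinear {a, p, b}"
  using collinear_3[of a p b] by (simp only: NO_MATCH_def simp_thms)
 then show False using ab(1) by blast
qed

lemma two_quadrants_x:
 assumes K: "K \<in> G" "j \<in> signs" "k \<in> signs" and p: "p = vertex K j k"
  and o: "\<not> occupied p j (-k)" "occupied p (-j) k" "\<not> occupied p j k"
 shows "\<not> corner_node \<Omega> p"
proof -
 obtain e where e: "0 < e" "\<And>z :: pt. z \<in> ball p e ==> z \<in> closure \<Omega> \<longleftrightarrow>
  (\<exists>s\<in>signs. \<exists>t\<in>signs. occupied p s t \<and> 0 \<le> s * (fst z - fst p) \<and> 0 \<le> t * (snd z - snd p))"
  using local_structure[OF K p] by blast
 have only: "occupied p s t \<longleftrightarrow> s = -j" if "s \<in> signs" "t \<in> signs" for s t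
 proof -
  have "s = j \<or> s = -j" "t = k \<or> t = -k" "j \<noteq> - j" using that K by auto
  then show ?thesis using o occupied_self[OF K(1), of j k] p by auto
 qed
 have cl: "z \<in> closure \<Omega> \<longleftrightarrow> 0 \<le> -j * (fst z - fst p)" if "z \<in> ball p e" for z :: pt
 proof -
  have "\<exists>t\<in>signs. 0 \<le> t * (snd z - snd p)"
   by (cases "snd z \<ge> snd p") auto
  moreover have "-j \<in> signs" using K by auto
  ultimately show ?thesis unfolding e(2)[OF that] using only by auto
 qed
 show ?thesis
 proof (rule not_corner_on_line[OF e(1) linear_fst])
  fix z assume z: "z \<in> ball p e" "z \<in> frontier \<Omega>"
  show "fst z = fst p"
  proof (rule ccontr)
   assume "fst z \<noteq> fst p"
   moreover have "0 \<le> -j * (fst z - fst p)" using cl[OF z(1)] z(2) by (auto simp: frontier_def)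
   ultimately have "0 < -j * (fst z - fst p)" using K by auto
   define A where "A = {z. inner (- real_of_int j, 0) z > -j * fst p} \<inter> ball p e"
   have A: "z \<in> A \<longleftrightarrow> z \<in> ball p e \<and> 0 < -j * (fst z - fst p)" for z :: pt
    by (cases z) (auto simp: A_def algebra_simps)
   have "open A" unfolding A_def by (intro open_Int open_halfspace_gt open_ball)
   moreover have "A \<subseteq> closure \<Omega>" using cl A by auto
   ultimately have "A \<subseteq> \<Omega>" using open_in_closure by blast
   then have "z \<in> \<Omega>" using A z(1) \<open>0 < -j * (fst z - fst p)\<close> by blast
   then show False using z(2) domain(3) by blast
  qed
 qed simp
qed

lemma two_quadrants_y:
 assumes K: "K \<in> G" "j \<in> signs" "k \<in> signs" and p: "p = vertex K j k"
  and o: "occupied p j (-k)" "\<not> occupied p (-j) k" "\<not> occupied p j k"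
 shows "\<not> corner_node \<Omega> p"
proof -
 obtain e where e: "0 < e" "\<And>z :: pt. z \<in> ball p e ==> z \<in> closure \<Omega> \<longleftrightarrow>
  (\<exists>s\<in>signs. \<exists>t\<in>signs. occupied p s t \<and> 0 \<le> s * (fst z - fst p) \<and> 0 \<le> t * (snd z - snd p))"
  using local_structure[OF K p] by blast
 have only: "occupied p s t \<longleftrightarrow> t = -k" if "s \<in> signs" "t \<in> signs" for s t
 proof -
  have "s = j \<or> s = -j" "t = k \<or> t = -k" "k \<noteq> - k" using that K by auto
  then show ?thesis using o occupied_self[OF K(1), of j k] p by auto
 qed
 have cl: "z \<in> closure \<Omega> \<longleftrightarrow> 0 \<le> -k * (snd z - snd p)" if "z \<in> ball p e" for z :: pt
 proof -
  have "\<exists>s\<in>signs. 0 \<le> s * (fst z - fst p)"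
   by (cases "fst z \<ge> fst p") auto
  moreover have "-k \<in> signs" using K by auto
  ultimately show ?thesis unfolding e(2)[OF that] using only by auto
 qed
 show ?thesis
 proof (rule not_corner_on_line[OF e(1) linear_snd])
  fix z assume z: "z \<in> ball p e" "z \<in> frontier \<Omega>"
  show "snd z = snd p"
  proof (rule ccontr)
   assume "snd z \<noteq> snd p"
   moreover have "0 \<le> -k * (snd z - snd p)" using cl[OF z(1)] z(2) by (auto simp: frontier_def)
   ultimately have "0 < -k * (snd z - snd p)" using K by auto
   define A where "A = {z. inner (0, - real_of_int k) z > -k * snd p} \<inter> ball p e"
   have A: "z \<in> A \<longleftrightarrow> z \<in> ball p e \<and> 0 < -k * (snd z - snd p)" for z :: pt
    by (cases z) (auto simp: A_def algebra_simps)
   have "open A" unfolding A_def by (intro open_Int open_halfspace_gt open_ball)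
   moreover have "A \<subseteq> closure \<Omega>" using cl A by auto
   ultimately have "A \<subseteq> \<Omega>" using open_in_closure by blast
   then have "z \<in> \<Omega>" using A z(1) \<open>0 < -k * (snd z - snd p)\<close> by blast
   then show False using z(2) domain(3) by blast
  qed
 qed simp
qed


section \<open>The combinatorics of the extended patches\<close>

lemma straight_or_corner_x:
 assumes K: "K \<in> G" "j \<in> signs" "k \<in> signs" and p: "p = vertex K j k"
  and "fx K j" "corner_node \<Omega> p"
 shows "fy K k \<and> convex_corner \<Omega> p \<or> \<not> fy K k \<and> occupied p j k"
 using assms(5,6) fx_iff[OF K] fy_iff[OF K] one_quadrant[OF K p] opposite_quadrants[OF K p]
  two_quadrants_x[OF K p] p by blast

lemma straight_or_corner_y:
 assumes K: "K \<in> G" "j \<in> signs" "k \<in> signs" and p: "p = vertex K j k"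
  and "fy K k" "corner_node \<Omega> p"
 shows "fx K j \<and> convex_corner \<Omega> p \<or> \<not> fx K j \<and> occupied p j k"
 using assms(5,6) fx_iff[OF K] fy_iff[OF K] one_quadrant[OF K p] opposite_quadrants[OF K p]
  two_quadrants_y[OF K p] p by blast

lemma neighbours:
 assumes K: "K \<in> G" "j \<in> signs" "k \<in> signs" and nf: "\<not> fx K j" "\<not> fy K k" and p: "p = vertex K j k"
 shows "fx (pc K 0 k) j \<longleftrightarrow> \<not> occupied p j k" "fy (pc K j 0) k \<longleftrightarrow> \<not> occupied p j k"
proof -
 have m: "-j \<in> signs" "-k \<in> signs" using K by auto
 note N = neighbour_in_mesh_x[OF K(1,2) nf(1)] and U = neighbour_in_mesh_y[OF K(1,3) nf(2)]
 show "fx (pc K 0 k) j \<longleftrightarrow> \<not> occupied p j k" "fy (pc K j 0) k \<longleftrightarrow> \<not> occupied p j k"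
  using fx_iff[OF U K(2) m(2)] fy_iff[OF N m(1) K(3)] vertex_patch_cell[OF K(2,3), of K] p by auto
qed

lemma diagonal_cell:
 assumes K: "K \<in> G" "j \<in> signs" "k \<in> signs" and D: "D \<in> G" "vertex D (-j) (-k) = vertex K j k"
 shows "\<not> fy K k ==> pc (pc K 0 k) j 0 = D \<and> \<not> fx (pc K 0 k) j"
  "\<not> fx K j ==> pc (pc K j 0) 0 k = D \<and> \<not> fy (pc K j 0) k"
proof -
 have m: "-j \<in> signs" "-k \<in> signs" using K by auto
 show "pc (pc K 0 k) j 0 = D \<and> \<not> fx (pc K 0 k) j" if "\<not> fy K k"
  using neighbour_eq_x[OF neighbour_in_mesh_y[OF K(1,3) that] D(1) K(2) m(2)]
   vertex_patch_cell(2)[OF K(2,3), of K] D(2) by auto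
 show "pc (pc K j 0) 0 k = D \<and> \<not> fy (pc K j 0) k" if "\<not> fx K j"
  using neighbour_eq_y[OF neighbour_in_mesh_x[OF K(1,2) that] D(1) m(1) K(3)]
   vertex_patch_cell(1)[OF K(2,3), of K] D(2) by auto
qed

lemma occupied_diagonal:
 assumes "occupied (vertex K j k) j k"
 obtains D where "D \<in> G" "vertex D (-j) (-k) = vertex K j k"
 using assms unfolding occupied_def by blast

lemma concave_facts:
 assumes K: "K \<in> G" "j \<in> signs" "k \<in> signs" and c: "concave_at \<Omega> G L H K j k"
 shows "\<not> fx K j" "\<not> fy K k" "\<not> occupied (vertex K j k) j k"
proof -
 have N: "pc K j 0 \<in> G" and U: "pc K 0 k \<in> G" and cc: "concave_corner \<Omega> (vertex K j k)"
  using c by (auto simp: concave_at_def)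
 show f: "\<not> fx K j" "\<not> fy K k"
  using neighbour_eq_x(2)[OF K(1) N K(2,3)] neighbour_eq_y(2)[OF K(1) U K(2,3)]
   vertex_patch_cell[OF K(2,3), of K] by auto
 show "\<not> occupied (vertex K j k) j k"
  using four_quadrants[OF K refl] fx_iff[OF K] fy_iff[OF K] f cc corner_in_frontier domain(3)
  unfolding concave_corner_def by blast
qed

lemma patch_lengths:
 assumes "K \<in> C" "j \<in> offs" "k \<in> offs"
 shows "width (pc K j k) = L K j" "height (pc K j k) = H K k"
 using sizes[OF assms(1)] assms(2,3)
 by (auto simp: width_def height_def patch_cell_def xknot_def yknot_def)

theorem patch_system:
 "patch_system G C pc L H fx fy (noncorner_xside \<Omega>) (noncorner_yside \<Omega>) (convex_at \<Omega>)
   (concave_at \<Omega> G L H) (outside_domain \<Omega>)"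
proof (unfold_locales, goal_cases)
 case 1 then show ?case by (rule G_subset_C)
next
 case (2 K) then show ?case
  by (simp add: patch_cell_def xknot_def yknot_def)
next
 case (3 K j k) then show ?case using patch_lengths(1)[OF 3(1,2,3)] sizes(1)[OF 3(4)] by simp
next
 case (4 K j k) then show ?case using patch_lengths(2)[OF 4(1,2,3)] sizes(2)[OF 4(4)] by simp
next
 case (5 K j k)
 note s = sizes(1,2)[OF 5(1)] sizes(1,2)[OF 5(4)]
 note l = patch_lengths[OF 5(1) _ 5(3), of j] patch_lengths[OF 5(1), of j 0]
 show ?case using 5(2,3,5,6) s
  by (auto simp: patch_cell_def xknot_def yknot_def width_def height_def)
next
 case (6 K j k)
 note s = sizes(1,2)[OF 6(1)] sizes(1,2)[OF 6(4)]
 show ?case using 6(2,3,5,6) s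
  by (auto simp: patch_cell_def xknot_def yknot_def width_def height_def)
next
 case (7 K j)
 have o: "(1::int) \<in> signs" "-j \<in> signs" using 7 by auto
 note N = neighbour_in_mesh_x[OF 7]
 show ?case using neighbour_eq_x[OF N 7(1) o(2,1)] vertex_patch_cell(1)[OF 7(2) o(1), of K] N by auto
next
 case (8 K k)
 have o: "(1::int) \<in> signs" "-k \<in> signs" using 8 by auto
 note U = neighbour_in_mesh_y[OF 8]
 show ?case using neighbour_eq_y[OF U 8(1) o] vertex_patch_cell(2)[OF o(1) 8(2), of K] U by auto
next
 case (9 K j)
 have o: "(1::int) \<in> signs" by auto
 show ?case using neighbour_eq_x(2)[OF 9(1) _ 9(2) o] vertex_patch_cell(1)[OF 9(2) o, of K] 9(3) by metis
next
 case (10 K k)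
 have o: "(1::int) \<in> signs" by auto
 show ?case using neighbour_eq_y(2)[OF 10(1) _ o 10(2)] vertex_patch_cell(2)[OF o 10(2), of K] 10(3) by metis
next
 case (11 K j k)
 have o: "occupied (vertex K j k) j k"
  using three_quadrants[OF 11(1-3) refl] fx_iff[OF 11(1-3)] fy_iff[OF 11(1-3)] 11(4-6)
   neighbour_in_mesh_x[OF 11(1,2,4)] neighbour_in_mesh_y[OF 11(1,3,5)] unfolding concave_at_def by blast
 then obtain D where D: "D \<in> G" "vertex D (-j) (-k) = vertex K j k" by (rule occupied_diagonal)
 show ?case using diagonal_cell[OF 11(1-3) D] 11(4,5) by auto
next
 case (12 K j k)
 note f = concave_facts[OF 12]
 show ?case using f neighbours[OF 12(1-3) f(1,2) refl] by blast
next
 case (13 K j k)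
 define U where "U = pc K 0 k"
 have m: "-k \<in> signs" using 13 by auto
 have U: "U \<in> G" using neighbour_in_mesh_y 13 by (simp add: U_def)
 have v: "vertex U j (-k) = vertex K j k" using vertex_patch_cell(2)[OF 13(2,3), of K] by (simp add: U_def)
 have nf: "\<not> fx U j" "\<not> fy U (-k)" "pc U 0 (-k) = K"
  using 13 neighbour_eq_y[OF U 13(1,2) m] v by (auto simp: U_def)
 have "concave_corner \<Omega> (vertex U j (-k))"
  using three_quadrants[OF U 13(2) m refl] fx_iff[OF U 13(2) m] fy_iff[OF U 13(2) m] nf fx_iff[OF 13(1-3)] 13(4) v by auto
 then show ?case
  using neighbour_in_mesh_x[OF U 13(2) nf(1)] nf(3) 13(1) unfolding concave_at_def U_def by simp
next
 case (14 K j k)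
 define N where "N = pc K j 0"
 have m: "-j \<in> signs" using 14 by auto
 have N: "N \<in> G" using neighbour_in_mesh_x 14 by (simp add: N_def)
 have v: "vertex N (-j) k = vertex K j k" using vertex_patch_cell(1)[OF 14(2,3), of K] by (simp add: N_def)
 have nf: "\<not> fy N k" "\<not> fx N (-j)" "pc N (-j) 0 = K"
  using 14 neighbour_eq_x[OF N 14(1) m 14(3)] v by (auto simp: N_def)
 have "concave_corner \<Omega> (vertex N (-j) k)"
  using three_quadrants[OF N m 14(3) refl] fx_iff[OF N m 14(3)] fy_iff[OF N m 14(3)] nf fy_iff[OF 14(1-3)] 14(4) v by auto
 then show ?case
  using neighbour_in_mesh_y[OF N 14(3) nf(1)] nf(3) 14(1) unfolding concave_at_def N_def by simp
next
 case (15 K j k)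
 let ?p = "vertex K j k"
 show ?case
 proof
  assume "convex_at \<Omega> K j k"
  then have c: "corner_node \<Omega> ?p" "\<not> concave_corner \<Omega> ?p" "?p \<notin> \<Omega>"
   using corner_in_frontier domain(3) unfolding convex_at_def concave_corner_def convex_corner_def by blast+
  have nf: "fx K j \<or> fy K k"
   using three_quadrants[OF 15 refl] four_quadrants[OF 15 refl] fx_iff[OF 15] fy_iff[OF 15] c by blast
  have diag: "concave_corner \<Omega> ?p" if "occupied ?p j k" "fx K j" "\<not> fy K k"
  proof -
   have m: "-k \<in> signs" using 15 by auto
   have U: "pc K 0 k \<in> G" using neighbour_in_mesh_y 15 that by simp
   have v: "vertex (pc K 0 k) j (-k) = ?p" using vertex_patch_cell(2)[OF 15(2,3), of K] by simp
   show ?thesis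
    using three_quadrants[OF U 15(2) m v[symmetric]] that fx_iff[OF 15] occupied_self[OF 15(1), of j k] by auto
  qed
  have diag': "concave_corner \<Omega> ?p" if "occupied ?p j k" "fy K k" "\<not> fx K j"
  proof -
   have m: "-j \<in> signs" using 15 by auto
   have N: "pc K j 0 \<in> G" using neighbour_in_mesh_x 15 that by simp
   have v: "vertex (pc K j 0) (-j) k = ?p" using vertex_patch_cell(1)[OF 15(2,3), of K] by simp
   show ?thesis
    using three_quadrants[OF N m 15(3) v[symmetric]] that fy_iff[OF 15] occupied_self[OF 15(1), of j k] by auto
  qed
  show "fx K j \<and> fy K k"
   using nf straight_or_corner_x[OF 15 refl _ c(1)] straight_or_corner_y[OF 15 refl _ c(1)] diag diag' c(2) by blast
 next
  assume "fx K j \<and> fy K k"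
  then show "convex_at \<Omega> K j k"
   using one_quadrant[OF 15 refl] opposite_quadrants[OF 15 refl] fx_iff[OF 15] fy_iff[OF 15]
   unfolding convex_at_def by blast
 qed
next
 case (16 K j)
 then obtain k where t: "k \<in> signs" "corner_node \<Omega> (vertex K j k)"
  unfolding noncorner_xside_def by auto
 have "fy K k \<and> convex_corner \<Omega> (vertex K j k) \<or> \<not> fy K k \<and> occupied (vertex K j k) j k"
  using straight_or_corner_x[OF 16(1,2) t(1) refl 16(3) t(2)] .
 then show ?case
 proof
  assume "fy K k \<and> convex_corner \<Omega> (vertex K j k)"
  then show ?thesis using t unfolding convex_at_def by blast
 next
  assume a: "\<not> fy K k \<and> occupied (vertex K j k) j k"
  then obtain D where "D \<in> G" "vertex D (-j) (-k) = vertex K j k" using occupied_diagonal by blast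
  then show ?thesis using diagonal_cell(1)[OF 16(1,2) t(1)] a t(1) by blast
 qed
next
 case (17 K k)
 then obtain j where t: "j \<in> signs" "corner_node \<Omega> (vertex K j k)"
  unfolding noncorner_yside_def by auto
 have "fx K j \<and> convex_corner \<Omega> (vertex K j k) \<or> \<not> fx K j \<and> occupied (vertex K j k) j k"
  using straight_or_corner_y[OF 17(1) t(1) 17(2) refl 17(3) t(2)] .
 then show ?case
 proof
  assume "fx K j \<and> convex_corner \<Omega> (vertex K j k)"
  then show ?thesis using t unfolding convex_at_def by blast
 next
  assume a: "\<not> fx K j \<and> occupied (vertex K j k) j k"
  then obtain D where "D \<in> G" "vertex D (-j) (-k) = vertex K j k" using occupied_diagonal by blast
  then show ?thesis using diagonal_cell(2)[OF 17(1) t(1) 17(2)] a t(1) by blast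
 qed
next
 case 18 then show ?case by (simp add: noncorner_xside_def)
next
 case 19 then show ?case by (simp add: noncorner_yside_def)
next
 case (20 K j k)
 have v: "vertex (pc K j k) (-j) (-k) = vertex K j k" using vertex_patch_cell(3)[OF 20(2,3)] .
 have "occupied (vertex K j k) j k" using 20(4) v unfolding occupied_def by blast
 then have "\<not> fx K j \<or> \<not> fy K k"
  using opposite_quadrants[OF 20(1-3) refl] fx_iff[OF 20(1-3)] fy_iff[OF 20(1-3)] by blast
 then show ?case using diagonal_cell[OF 20(1-4) v] by blast
next
 case (21 K j)
 have "xside_patches \<Omega> L H K j" using ext 21 unfolding extended_patches_def by blast
 moreover have "pc K j 0 \<in> C" using 21 unfolding centers_def extension_cells_def by blast
 ultimately show ?case unfolding xside_patches_def Let_def by blast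
next
 case (22 K k)
 have "yside_patches \<Omega> L H K k" using ext 22 unfolding extended_patches_def by blast
 moreover have "pc K 0 k \<in> C" using 22 unfolding centers_def extension_cells_def by blast
 ultimately show ?case unfolding yside_patches_def Let_def by blast
next
 case (23 K j k)
 have "convex_patches \<Omega> L H K j k" using ext 23 unfolding extended_patches_def by blast
 moreover have "pc K j 0 \<in> C" using 23 unfolding centers_def extension_cells_def by blast
 ultimately show ?case unfolding convex_patches_def Let_def by blast
next
 case (24 K j k)
 have "convex_patches \<Omega> L H K j k" using ext 24 unfolding extended_patches_def by blast
 moreover have "pc K 0 k \<in> C" using 24 unfolding centers_def extension_cells_def by blast
 ultimately show ?case unfolding convex_patches_def Let_def by blast
next
 case (25 K j k)
 have "convex_patches \<Omega> L H K j k" using ext 25 unfolding extended_patches_def by blast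
 moreover have "pc K j k \<in> C" using 25 unfolding centers_def extension_cells_def by blast
 ultimately show ?case unfolding convex_patches_def Let_def by blast
next
 case (26 K j k)
 have "concave_patches \<Omega> L H K j k" using ext 26 unfolding extended_patches_def by blast
 then show ?case unfolding concave_patches_def Let_def by blast
next
 case (27 K j k)
 have "concave_patches \<Omega> L H K j k" using ext 27 unfolding extended_patches_def by blast
 then show ?case unfolding concave_patches_def Let_def by blast
next
 case (28 K j k)
 have "concave_patches \<Omega> L H K j k" using ext 28 unfolding extended_patches_def by blast
 moreover have "pc K j k \<in> C" using 28 unfolding centers_def extension_cells_def by blast
 ultimately show ?case unfolding concave_patches_def Let_def by blast
next
 case (29 E)
 then show ?case
  unfolding centers_def extension_cells_def interior_cells_def boundary_cells_def by blast
next
 case (30 K)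
 have n: "nondegenerate K" using nondeg 30 by blast
 have "((fst (fst K) + fst (snd K)) / 2, (snd (fst K) + snd (snd K)) / 2) \<in> interior (region K)"
  using n by (auto simp: mem_interior_region nondegenerate_def)
 then show ?case using interior_region_domain[OF 30] unfolding outside_domain_def by blast
qed

text \<open>The last three statements say in which way the lengths in the nine patches agree; the reproduction of
 quadratics uses nothing else about them.\<close>

theorem nine_centers:
 assumes T: "T \<in> G"
 obtains K where
  "\<And>j k. j \<in> offs ==> k \<in> offs ==> K j k \<in> C \<and> pc (K j k) (-j) (-k) = T"
  "\<And>E \<alpha> \<beta>. E \<in> C ==> \<alpha> \<in> offs ==> \<beta> \<in> offs ==>
    interior (region (pc E \<alpha> \<beta>)) \<inter> interior (region T) \<noteq> {} ==> E = K (-\<alpha>) (-\<beta>)"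
  "\<And>j k. j \<in> signs ==> k \<in> offs ==> L (K 0 k) j = L (K j k) 0"
  "\<And>j k. j \<in> offs ==> k \<in> signs ==> H (K j 0) k = H (K j k) 0"
  "\<And>j k. j \<in> signs ==> k \<in> signs ==>
    L (K j k) 0 = L (K j 0) 0 \<or> H (K j k) 0 = H (K 0 k) 0"
proof -
 interpret a: patch_system G C pc L H fx fy "noncorner_xside \<Omega>" "noncorner_yside \<Omega>" "convex_at \<Omega>"
   "concave_at \<Omega> G L H" "outside_domain \<Omega>" by (rule patch_system)
 note s = a.patch_system_axioms
 note s2 = patch_system2.intro[OF s patch_system_swap[OF s]]
 note s2' = patch_system2.intro[OF patch_system_swap[OF s] s]
 note s3 = patch_system3.intro[OF s2 s2']
 note s3' = patch_system3.intro[OF s2' s2]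
 note s4 = patch_system4.intro[OF s3 s3']
 note s4' = patch_system4.intro[OF s3' s3]
 interpret b: patch_system5 G C pc L H fx fy "noncorner_xside \<Omega>" "noncorner_yside \<Omega>" "convex_at \<Omega>"
   "concave_at \<Omega> G L H" "outside_domain \<Omega>" by (rule patch_system5.intro[OF s4 s4'])
 note sp = b.around_spec[OF T]
 show ?thesis
 proof (rule that[of "b.around T"])
  show "b.around T j k \<in> C \<and> pc (b.around T j k) (-j) (-k) = T" if "j \<in> offs" "k \<in> offs" for j k
   using sp(1,2)[OF that] by blast
  show "E = b.around T (-\<alpha>) (-\<beta>)" if E: "E \<in> C" "\<alpha> \<in> offs" "\<beta> \<in> offs"
   and i: "interior (region (pc E \<alpha> \<beta>)) \<inter> interior (region T) \<noteq> {}" for E \<alpha> \<beta>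
  proof -
   have "\<not> outside_domain \<Omega> (pc E \<alpha> \<beta>)"
    using i interior_region_domain[OF T] unfolding outside_domain_def by blast
   then have "pc E \<alpha> \<beta> \<in> G" using b.covered[OF E] by blast
   then have "pc E \<alpha> \<beta> = T" using overlap_eq T i by blast
   then show ?thesis using b.around_unique[OF E T] by blast
  qed
  show "L (b.around T 0 k) j = L (b.around T j k) 0" if "j \<in> signs" "k \<in> offs" for j k
   using sp(3)[of j k] that by auto
  show "H (b.around T j 0) k = H (b.around T j k) 0" if "j \<in> offs" "k \<in> signs" for j k
   using sp(4)[of j k] that by auto
  show "L (b.around T j k) 0 = L (b.around T j 0) 0 \<or> H (b.around T j k) 0 = H (b.around T 0 k) 0"
   if "j \<in> signs" "k \<in> signs" for j k
   using sp(5)[of j k] that by auto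
 qed
qed

end

section \<open>Quadratic pieces on a cell\<close>

definition quad :: "real => real => real => real => real => real => pt => real" where
 "quad a b c d e f = (\<lambda>(x, y). a + b * x + c * y + d * x\<^sup>2 + e * x * y + f * y\<^sup>2)"

lemma P2_iff: "p \<in> P2 \<longleftrightarrow> (\<exists>a b c d e f. p = quad a b c d e f)"
 unfolding P2_def quad_def by (auto simp: fun_eq_iff)

lemma mean_dx_quad:
 assumes "y0 < y1"
 shows "mean_dx (quad a b c d e f) x y0 y1 = b + 2 * d * x + e * ((y0 + y1) / 2)"
proof -
 have "deriv (\<lambda>t. quad a b c d e f (t, y)) x = b + 2 * d * x + e * y" for y
  unfolding quad_def by (rule DERIV_imp_deriv) (auto intro!: derivative_eq_intros simp: algebra_simps)
 moreover have "((\<lambda>y. b + 2 * d * x + e * y) has_integral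
   ((b + 2 * d * x) * y1 + e * y1\<^sup>2 / 2) - ((b + 2 * d * x) * y0 + e * y0\<^sup>2 / 2)) {y0..y1}"
  using assms by (intro fundamental_theorem_of_calculus)
   (auto intro!: derivative_eq_intros simp flip: has_real_derivative_iff_has_vector_derivative)
 ultimately show ?thesis
  using assms unfolding mean_dx_def by (simp add: integral_unique field_simps power2_eq_square)
qed

lemma mean_dy_quad:
 assumes "x0 < x1"
 shows "mean_dy (quad a b c d e f) y x0 x1 = c + 2 * f * y + e * ((x0 + x1) / 2)"
proof -
 have "deriv (\<lambda>t. quad a b c d e f (x, t)) y = c + 2 * f * y + e * x" for x
  unfolding quad_def by (rule DERIV_imp_deriv) (auto intro!: derivative_eq_intros simp: algebra_simps)
 moreover have "((\<lambda>x. c + 2 * f * y + e * x) has_integral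
   ((c + 2 * f * y) * x1 + e * x1\<^sup>2 / 2) - ((c + 2 * f * y) * x0 + e * x0\<^sup>2 / 2)) {x0..x1}"
  using assms by (intro fundamental_theorem_of_calculus)
   (auto intro!: derivative_eq_intros simp flip: has_real_derivative_iff_has_vector_derivative)
 ultimately show ?thesis
  using assms unfolding mean_dy_def by (simp add: integral_unique field_simps power2_eq_square)
qed

text \<open>The quadratic on a rectangle with the vertex values \<open>v\<close> and with second derivatives \<open>2 k\<close>
 and \<open>2 m\<close> in the coordinate directions.\<close>

definition interpolant :: "real => real => real => real => real => real => real => real => real => real => pt => real" where
 "interpolant x0 x1 y0 y1 v00 v10 v01 v11 k m = (\<lambda>(x, y).
   let s = (x - x0) / (x1 - x0); t = (y - y0) / (y1 - y0) in
   v00 * (1 - s) * (1 - t) + v10 * s * (1 - t) + v01 * (1 - s) * t + v11 * s * t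
    + k * (x - x0) * (x - x1) + m * (y - y0) * (y - y1))"

lemma interpolant_vertex:
 assumes "x0 < x1" "y0 < y1"
 shows "interpolant x0 x1 y0 y1 v00 v10 v01 v11 k m (x0, y0) = v00"
  "interpolant x0 x1 y0 y1 v00 v10 v01 v11 k m (x1, y0) = v10"
  "interpolant x0 x1 y0 y1 v00 v10 v01 v11 k m (x0, y1) = v01"
  "interpolant x0 x1 y0 y1 v00 v10 v01 v11 k m (x1, y1) = v11"
 using assms by (auto simp: interpolant_def Let_def)

lemma interpolant_quad:
 fixes x0 x1 y0 y1 :: real
 defines "W \<equiv> 1 / (x1 - x0)" and "Z \<equiv> 1 / (y1 - y0)"
 shows "interpolant x0 x1 y0 y1 v00 v10 v01 v11 k m =
  quad (v00 * (1 + x0 * W) * (1 + y0 * Z) - v10 * x0 * W * (1 + y0 * Z) - v01 * (1 + x0 * W) * y0 * Z + v11 * x0 * W * y0 * Z + k * x0 * x1 + m * y0 * y1)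
   (W * (- v00 * (1 + y0 * Z) + v10 * (1 + y0 * Z) + v01 * y0 * Z - v11 * y0 * Z) - k * (x0 + x1))
   (Z * (- v00 * (1 + x0 * W) + v10 * x0 * W + v01 * (1 + x0 * W) - v11 * x0 * W) - m * (y0 + y1))
   k (W * Z * (v00 - v10 - v01 + v11)) m"
proof -
 have s: "(x - x0) / (x1 - x0) = (x - x0) * W" "(y - y0) / (y1 - y0) = (y - y0) * Z" for x y
  by (simp_all add: W_def Z_def)
 show ?thesis
  unfolding interpolant_def quad_def Let_def s
  by (auto simp: fun_eq_iff algebra_simps power2_eq_square)
qed

lemma interpolant_mean:
 assumes "x0 < x1" "y0 < y1"
 shows "mean_dx (interpolant x0 x1 y0 y1 v00 v10 v01 v11 k m) x0 y0 y1
   = ((v10 + v11) / 2 - (v00 + v01) / 2) / (x1 - x0) - k * (x1 - x0)"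
  "mean_dx (interpolant x0 x1 y0 y1 v00 v10 v01 v11 k m) x1 y0 y1
   = ((v10 + v11) / 2 - (v00 + v01) / 2) / (x1 - x0) + k * (x1 - x0)"
  "mean_dy (interpolant x0 x1 y0 y1 v00 v10 v01 v11 k m) y0 x0 x1
   = ((v01 + v11) / 2 - (v00 + v10) / 2) / (y1 - y0) - m * (y1 - y0)"
  "mean_dy (interpolant x0 x1 y0 y1 v00 v10 v01 v11 k m) y1 x0 x1
   = ((v01 + v11) / 2 - (v00 + v10) / 2) / (y1 - y0) + m * (y1 - y0)"
proof -
 define w h where "w = x1 - x0" and "h = y1 - y0"
 have wh: "x1 = x0 + w" "y1 = y0 + h" "w \<noteq> 0" "h \<noteq> 0" using assms by (auto simp: w_def h_def)
 show "mean_dx (interpolant x0 x1 y0 y1 v00 v10 v01 v11 k m) x0 y0 y1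
   = ((v10 + v11) / 2 - (v00 + v01) / 2) / (x1 - x0) - k * (x1 - x0)"
  "mean_dx (interpolant x0 x1 y0 y1 v00 v10 v01 v11 k m) x1 y0 y1
   = ((v10 + v11) / 2 - (v00 + v01) / 2) / (x1 - x0) + k * (x1 - x0)"
  unfolding interpolant_quad mean_dx_quad[OF assms(2)] unfolding wh using wh(3,4)
  by (simp_all add: field_simps)
 show "mean_dy (interpolant x0 x1 y0 y1 v00 v10 v01 v11 k m) y0 x0 x1
   = ((v01 + v11) / 2 - (v00 + v10) / 2) / (y1 - y0) - m * (y1 - y0)"
  "mean_dy (interpolant x0 x1 y0 y1 v00 v10 v01 v11 k m) y1 x0 x1
   = ((v01 + v11) / 2 - (v00 + v10) / 2) / (y1 - y0) + m * (y1 - y0)"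
  unfolding interpolant_quad mean_dy_quad[OF assms(1)] unfolding wh using wh(3,4)
  by (simp_all add: field_simps)
qed

text \<open>Unisolvence: a quadratic is determined by its vertex values and the jumps of its mean normal
 derivatives.\<close>

lemma P2_eq_interpolant:
 assumes "p \<in> P2" "x0 < x1" "y0 < y1"
 shows "p = interpolant x0 x1 y0 y1 (p (x0, y0)) (p (x1, y0)) (p (x0, y1)) (p (x1, y1))
   ((mean_dx p x1 y0 y1 - mean_dx p x0 y0 y1) / (2 * (x1 - x0)))
   ((mean_dy p y1 x0 x1 - mean_dy p y0 x0 x1) / (2 * (y1 - y0)))"
proof -
 obtain a b c d e f where p: "p = quad a b c d e f" using assms(1) P2_iff by blast
 define w h where "w = x1 - x0" and "h = y1 - y0"
 have wh: "x1 = x0 + w" "y1 = y0 + h" "w \<noteq> 0" "h \<noteq> 0" using assms by (auto simp: w_def h_def)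
 have k: "(mean_dx p x1 y0 y1 - mean_dx p x0 y0 y1) / (2 * (x1 - x0)) = d"
  "(mean_dy p y1 x0 x1 - mean_dy p y0 x0 x1) / (2 * (y1 - y0)) = f"
  unfolding p mean_dx_quad[OF assms(3)] mean_dy_quad[OF assms(2)] using assms(2,3) by (auto simp: field_simps)
 have "p (x, y) = interpolant x0 x1 y0 y1 (p (x0, y0)) (p (x1, y0)) (p (x0, y1)) (p (x1, y1)) d f (x, y)" for x y
 proof -
  define s t where "s = (x - x0) / w" and "t = (y - y0) / h"
  have xy: "x = x0 + s * w" "y = y0 + t * h" using wh by (auto simp: s_def t_def)
  have "(x - x0) / (x1 - x0) = s" "(y - y0) / (y1 - y0) = t" by (simp_all add: s_def t_def w_def h_def)
  then show ?thesis unfolding interpolant_def Let_def p quad_def split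
   by (simp add: xy wh(1,2)) (simp add: algebra_simps power2_eq_square)
 qed
 then have "p z = interpolant x0 x1 y0 y1 (p (x0, y0)) (p (x1, y0)) (p (x0, y1)) (p (x1, y1)) d f z" for z
  by (metis surj_pair)
 then show ?thesis unfolding k by (rule ext)
qed

text \<open>A quadratic in one variable on an interval is recorded by its two end values and half of its
 second derivative; the product of two of them is replaced by its interpolant.\<close>

type_synonym triple = "real \<times> real \<times> real"

definition tensor :: "real => real => real => real => triple => triple => pt => real" where
 "tensor x0 x1 y0 y1 q r = (case q of (q0, q1, k) => case r of (r0, r1, m) =>
   interpolant x0 x1 y0 y1 (q0 * r0) (q1 * r0) (q0 * r1) (q1 * r1) (k * (r0 + r1) / 2) (m * (q0 + q1) / 2))"

lemma tensor_vertex: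
 assumes "x0 < x1" "y0 < y1"
 shows "tensor x0 x1 y0 y1 (q0, q1, k) (r0, r1, m) (x0, y0) = q0 * r0"
  "tensor x0 x1 y0 y1 (q0, q1, k) (r0, r1, m) (x1, y0) = q1 * r0"
  "tensor x0 x1 y0 y1 (q0, q1, k) (r0, r1, m) (x0, y1) = q0 * r1"
  "tensor x0 x1 y0 y1 (q0, q1, k) (r0, r1, m) (x1, y1) = q1 * r1"
 using assms by (simp_all add: tensor_def interpolant_vertex)

lemma tensor_mean:
 assumes "x0 < x1" "y0 < y1"
 shows "mean_dx (tensor x0 x1 y0 y1 (q0, q1, k) (r0, r1, m)) x0 y0 y1
   = ((q1 - q0) / (x1 - x0) - k * (x1 - x0)) * (r0 + r1) / 2"
  "mean_dx (tensor x0 x1 y0 y1 (q0, q1, k) (r0, r1, m)) x1 y0 y1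
   = ((q1 - q0) / (x1 - x0) + k * (x1 - x0)) * (r0 + r1) / 2"
  "mean_dy (tensor x0 x1 y0 y1 (q0, q1, k) (r0, r1, m)) y0 x0 x1
   = ((r1 - r0) / (y1 - y0) - m * (y1 - y0)) * (q0 + q1) / 2"
  "mean_dy (tensor x0 x1 y0 y1 (q0, q1, k) (r0, r1, m)) y1 x0 x1
   = ((r1 - r0) / (y1 - y0) + m * (y1 - y0)) * (q0 + q1) / 2"
 using assms by (simp_all add: tensor_def interpolant_mean field_simps)

lemma tensor_P2: "tensor x0 x1 y0 y1 q r \<in> P2"
 unfolding tensor_def P2_iff by (cases q; cases r) (simp, subst interpolant_quad, blast)

text \<open>Pieces of the quadratic B-spline with the three knot spans \<open>l\<close>, \<open>c\<close>, \<open>r\<close>.\<close>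

definition bval :: "real => real => real => int => real" where
 "bval l c r i = (if i = 0 then l / (l + c) else if i = 1 then r / (c + r) else 0)"

definition bder :: "real => real => real => int => real" where
 "bder l c r i = (if i = 0 then 2 / (l + c) else if i = 1 then - 2 / (c + r) else 0)"

definition span :: "real => real => real => int => real" where
 "span l c r i = (if i = -1 then l else if i = 0 then c else r)"

definition btriple :: "real => real => real => int => triple" where
 "btriple l c r i = (bval l c r i, bval l c r (i + 1), (bder l c r (i + 1) - bder l c r i) / (2 * span l c r i))"

lemma bspline_slopes:
 assumes "0 < l" "0 < c" "0 < r" "i \<in> offs"
 shows "(bval l c r (i + 1) - bval l c r i) / span l c r i
   - (bder l c r (i + 1) - bder l c r i) / (2 * span l c r i) * span l c r i = bder l c r i"
  "(bval l c r (i + 1) - bval l c r i) / span l c r i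
   + (bder l c r (i + 1) - bder l c r i) / (2 * span l c r i) * span l c r i = bder l c r (i + 1)"
proof -
 have "l + c \<noteq> 0" "c + r \<noteq> 0" using assms by auto
 then show "(bval l c r (i + 1) - bval l c r i) / span l c r i
   - (bder l c r (i + 1) - bder l c r i) / (2 * span l c r i) * span l c r i = bder l c r i"
  "(bval l c r (i + 1) - bval l c r i) / span l c r i
   + (bder l c r (i + 1) - bder l c r i) / (2 * span l c r i) * span l c r i = bder l c r (i + 1)"
  using assms by (auto simp: bval_def bder_def span_def divide_simps) (simp_all add: algebra_simps)
qed

text \<open>A quadratic spline on three spans that vanishes with its derivative at both ends is a multiple
 of the B-spline.\<close>

lemma bspline_unique:
 fixes U D :: "int => real"
 assumes pos: "0 < l" "0 < c" "0 < r"
  and ends: "U (-1) = 0" "U 2 = 0" "D (-1) = 0" "D 2 = 0"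
  and rel: "\<And>i. i \<in> offs ==> D i + D (i + 1) = 2 * (U (i + 1) - U i) / span l c r i"
  and i: "i \<in> {-1, 0, 1, 2}"
 shows "U i = U 0 * (l + c) / l * bval l c r i" "D i = U 0 * (l + c) / l * bder l c r i"
proof -
 have r1: "D 0 = 2 * U 0 / l" using rel[of "-1"] ends by (simp add: span_def)
 have r2: "D 0 + D 1 = 2 * (U 1 - U 0) / c" using rel[of 0] by (simp add: span_def)
 have r3: "D 1 = - 2 * U 1 / r" using rel[of 1] ends by (simp add: span_def)
 have "2 * U 0 / l - 2 * U 1 / r = 2 * (U 1 - U 0) / c" using r1 r2 r3 by simp
 then have "U 0 * (l + c) * r = U 1 * (c + r) * l"
  using pos by (simp add: field_simps)
 then have "U 0 * (l + c) / l * (r / (c + r)) = U 1 * (c + r) * l / (l * (c + r))" by simp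
 also have "\<dots> = U 1" using pos by simp
 finally have u1: "U 1 = U 0 * (l + c) / l * (r / (c + r))" by simp
 have ne: "l + c \<noteq> 0" "c + r \<noteq> 0" using pos by auto
 have u0: "U 0 = U 0 * (l + c) / l * (l / (l + c))"
  using pos ne by simp
 have d0: "D 0 = U 0 * (l + c) / l * (2 / (l + c))" using pos r1 ne by simp
 have d1: "D 1 = U 0 * (l + c) / l * (- 2 / (c + r))" unfolding r3 u1 using pos ne by simp
 show "U i = U 0 * (l + c) / l * bval l c r i"
  using i ends u0 u1 by (auto simp: bval_def)
 show "D i = U 0 * (l + c) / l * bder l c r i"
  using i ends d0 d1 by (auto simp: bder_def)
qed

section \<open>The basis function\<close>

locale patch_center =
 fixes L H :: lengths and K :: cell
 assumes L0: "L K 0 = width K" and H0: "H K 0 = height K"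
  and Lpos: "\<And>\<sigma>. \<sigma> \<in> offs ==> 0 < L K \<sigma>" and Hpos: "\<And>\<sigma>. \<sigma> \<in> offs ==> 0 < H K \<sigma>"
begin

abbreviation "X \<equiv> xknot L K"
abbreviation "Y \<equiv> yknot H K"

lemma knots: "\<sigma> \<in> offs ==> X (\<sigma> + 1) - X \<sigma> = L K \<sigma>" "\<sigma> \<in> offs ==> X \<sigma> < X (\<sigma> + 1)"
 "\<sigma> \<in> offs ==> Y (\<sigma> + 1) - Y \<sigma> = H K \<sigma>" "\<sigma> \<in> offs ==> Y \<sigma> < Y (\<sigma> + 1)"
 using L0 H0 Lpos[of \<sigma>] Hpos[of \<sigma>] by (auto simp: xknot_def yknot_def width_def height_def)

definition tx :: "int => triple" where "tx = btriple (L K (-1)) (L K 0) (L K 1)"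
definition ty :: "int => triple" where "ty = btriple (H K (-1)) (H K 0) (H K 1)"

abbreviation "bx \<equiv> bval (L K (-1)) (L K 0) (L K 1)"
abbreviation "by' \<equiv> bval (H K (-1)) (H K 0) (H K 1)"
abbreviation "dx \<equiv> bder (L K (-1)) (L K 0) (L K 1)"
abbreviation "dy \<equiv> bder (H K (-1)) (H K 0) (H K 1)"

definition piece :: "int => int => pt => real" where
 "piece \<sigma> \<tau> = (if \<sigma> \<in> offs \<and> \<tau> \<in> offs
   then tensor (X \<sigma>) (X (\<sigma> + 1)) (Y \<tau>) (Y (\<tau> + 1)) (tx \<sigma>) (ty \<tau>) else (\<lambda>_. 0))"

lemma spans: "\<sigma> \<in> offs ==> span (L K (-1)) (L K 0) (L K 1) \<sigma> = L K \<sigma>"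
 "\<tau> \<in> offs ==> span (H K (-1)) (H K 0) (H K 1) \<tau> = H K \<tau>"
 by (auto simp: span_def)

lemma piece_vertex:
 assumes "\<sigma> \<in> offs" "\<tau> \<in> offs" "i \<in> {\<sigma>, \<sigma> + 1}" "j \<in> {\<tau>, \<tau> + 1}"
 shows "piece \<sigma> \<tau> (X i, Y j) = bx i * by' j"
 using assms(3,4) tensor_vertex[OF knots(2)[OF assms(1)] knots(4)[OF assms(2)]] assms(1,2)
 unfolding piece_def tx_def ty_def btriple_def by auto

lemma piece_mean_dx:
 assumes "\<sigma> \<in> offs" "\<tau> \<in> offs" "i \<in> {\<sigma>, \<sigma> + 1}"
 shows "mean_dx (piece \<sigma> \<tau>) (X i) (Y \<tau>) (Y (\<tau> + 1)) = dx i * (by' \<tau> + by' (\<tau> + 1)) / 2"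
 using assms(3) tensor_mean(1,2)[OF knots(2)[OF assms(1)] knots(4)[OF assms(2)]] assms(1,2)
  bspline_slopes[of "L K (-1)" "L K 0" "L K 1" \<sigma>] Lpos spans[OF assms(1)] knots(1)[OF assms(1)]
 unfolding piece_def tx_def ty_def btriple_def by auto

lemma piece_mean_dy:
 assumes "\<sigma> \<in> offs" "\<tau> \<in> offs" "j \<in> {\<tau>, \<tau> + 1}"
 shows "mean_dy (piece \<sigma> \<tau>) (Y j) (X \<sigma>) (X (\<sigma> + 1)) = dy j * (bx \<sigma> + bx (\<sigma> + 1)) / 2"
 using assms(3) tensor_mean(3,4)[OF knots(2)[OF assms(1)] knots(4)[OF assms(2)]] assms(1,2)
  bspline_slopes[of "H K (-1)" "H K 0" "H K 1" \<tau>] Hpos spans[OF assms(1)] spans(2)[OF assms(2)] knots(3)[OF assms(2)]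
 unfolding piece_def tx_def ty_def btriple_def by auto

lemma piece_in_RRM0: "piece \<in> RRM0 L H K"
proof -
 have 1: "piece \<sigma> \<tau> = (\<lambda>_. 0)" if "\<not> (\<sigma> \<in> offs \<and> \<tau> \<in> offs)" for \<sigma> \<tau>
  using that unfolding piece_def by (rule if_not_P)
 have 2: "piece \<sigma> \<tau> \<in> P2" if "\<sigma> \<in> offs" "\<tau> \<in> offs" for \<sigma> \<tau>
  using that tensor_P2 unfolding piece_def by simp
 have 3: "piece \<sigma> \<tau> (X i, Y j) = piece \<sigma>' \<tau>' (X i, Y j)"
  if "i \<in> {0, 1}" "j \<in> {0, 1}" "\<sigma> \<in> {i - 1, i}" "\<sigma>' \<in> {i - 1, i}" "\<tau> \<in> {j - 1, j}" "\<tau>' \<in> {j - 1, j}"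
  for i j \<sigma> \<sigma>' \<tau> \<tau>'
 proof -
  have "\<sigma> \<in> offs" "\<sigma>' \<in> offs" "\<tau> \<in> offs" "\<tau>' \<in> offs" "i \<in> {\<sigma>, \<sigma> + 1}" "i \<in> {\<sigma>', \<sigma>' + 1}"
   "j \<in> {\<tau>, \<tau> + 1}" "j \<in> {\<tau>', \<tau>' + 1}" using that by auto
  then show ?thesis using piece_vertex[of \<sigma> \<tau> i j] piece_vertex[of \<sigma>' \<tau>' i j] by simp
 qed
 have 4: "piece \<sigma> \<tau> (X i, Y j) = 0"
  if "i \<in> {-1..2}" "j \<in> {-1..2}" "\<not> (i \<in> {0, 1} \<and> j \<in> {0, 1})" "\<sigma> \<in> {i - 1, i} \<inter> offs" "\<tau> \<in> {j - 1, j} \<inter> offs"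
  for i j \<sigma> \<tau>
 proof -
  have "piece \<sigma> \<tau> (X i, Y j) = bx i * by' j" using that by (intro piece_vertex) auto
  also have "\<dots> = 0" using that(1-3) by (auto simp: bval_def)
  finally show ?thesis .
 qed
 have 5: "mean_dx (piece (i - 1) \<tau>) (X i) (Y \<tau>) (Y (\<tau> + 1)) = mean_dx (piece i \<tau>) (X i) (Y \<tau>) (Y (\<tau> + 1))"
  if "\<tau> \<in> offs" "i \<in> {0, 1}" for \<tau> i
  using piece_mean_dx[of "i - 1" \<tau> i] piece_mean_dx[of i \<tau> i] that by auto
 have 6: "mean_dx (piece (-1) \<tau>) (X (-1)) (Y \<tau>) (Y (\<tau> + 1)) = 0" "mean_dx (piece 1 \<tau>) (X 2) (Y \<tau>) (Y (\<tau> + 1)) = 0"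
  if "\<tau> \<in> offs" for \<tau>
  using piece_mean_dx[of "-1" \<tau> "-1"] piece_mean_dx[of 1 \<tau> 2] that by (auto simp: bder_def)
 have 7: "mean_dy (piece \<sigma> (j - 1)) (Y j) (X \<sigma>) (X (\<sigma> + 1)) = mean_dy (piece \<sigma> j) (Y j) (X \<sigma>) (X (\<sigma> + 1))"
  if "\<sigma> \<in> offs" "j \<in> {0, 1}" for \<sigma> j
  using piece_mean_dy[of \<sigma> "j - 1" j] piece_mean_dy[of \<sigma> j j] that by auto
 have 8: "mean_dy (piece \<sigma> (-1)) (Y (-1)) (X \<sigma>) (X (\<sigma> + 1)) = 0" "mean_dy (piece \<sigma> 1) (Y 2) (X \<sigma>) (X (\<sigma> + 1)) = 0"
  if "\<sigma> \<in> offs" for \<sigma>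
  using piece_mean_dy[of \<sigma> "-1" "-1"] piece_mean_dy[of \<sigma> 1 2] that by (auto simp: bder_def)
 show ?thesis
  unfolding RRM0_def mem_Collect_eq
  apply (intro conjI allI ballI impI)
  subgoal by (rule 1)
  subgoal by (rule 2)
  subgoal by (rule 3)
  subgoal by (rule 4)
  subgoal by (rule 5)
  subgoal by (rule 6(1))
  subgoal by (rule 6(2))
  subgoal by (rule 7)
  subgoal by (rule 8(1))
  subgoal by (rule 8(2))
  done
qed

lemma P2_mean_relation:
 assumes "p \<in> P2" "x0 < x1" "y0 < y1"
 shows "mean_dx p x0 y0 y1 + mean_dx p x1 y0 y1
   = 2 * ((p (x1, y0) + p (x1, y1)) / 2 - (p (x0, y0) + p (x0, y1)) / 2) / (x1 - x0)"
  "mean_dy p y0 x0 x1 + mean_dy p y1 x0 x1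
   = 2 * ((p (x0, y1) + p (x1, y1)) / 2 - (p (x0, y0) + p (x1, y0)) / 2) / (y1 - y0)"
proof -
 obtain a b c d e f where p: "p = quad a b c d e f" using assms(1) P2_iff by blast
 show "mean_dx p x0 y0 y1 + mean_dx p x1 y0 y1
   = 2 * ((p (x1, y0) + p (x1, y1)) / 2 - (p (x0, y0) + p (x0, y1)) / 2) / (x1 - x0)"
  "mean_dy p y0 x0 x1 + mean_dy p y1 x0 x1
   = 2 * ((p (x0, y1) + p (x1, y1)) / 2 - (p (x0, y0) + p (x1, y0)) / 2) / (y1 - y0)"
  unfolding p mean_dx_quad[OF assms(3)] mean_dy_quad[OF assms(2)] using assms(2,3)
  by (auto simp: quad_def field_simps power2_eq_square)
qed

text \<open>Averaging a function of the space over the two vertices of a vertical edge gives, in each of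
 the three rows, a quadratic spline in \<open>x\<close> that vanishes to second order at both ends, hence a
 multiple of the B-spline; likewise for columns. As the outer vertex values are zero, this
 determines all values up to one factor.\<close>

lemma RRM0_unique:
 assumes w: "w \<in> RRM0 L H K" and norm: "w 0 0 (vertex K (-1) (-1)) = bx 0 * by' 0"
 shows "w = piece"
proof -
 note w' = w[unfolded RRM0_def mem_Collect_eq]
 note c1 = w'[THEN conjunct1] and c2 = w'[THEN conjunct2, THEN conjunct1]
  and c3 = w'[THEN conjunct2, THEN conjunct2, THEN conjunct1]
  and c4 = w'[THEN conjunct2, THEN conjunct2, THEN conjunct2, THEN conjunct1]
  and c5 = w'[THEN conjunct2, THEN conjunct2, THEN conjunct2, THEN conjunct2, THEN conjunct1]
  and c6 = w'[THEN conjunct2, THEN conjunct2, THEN conjunct2, THEN conjunct2, THEN conjunct2]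
 have w0: "w \<sigma> \<tau> = (\<lambda>_. 0)" if "\<not> (\<sigma> \<in> offs \<and> \<tau> \<in> offs)" for \<sigma> \<tau> using c1 that by blast
 have wP: "w \<sigma> \<tau> \<in> P2" if "\<sigma> \<in> offs" "\<tau> \<in> offs" for \<sigma> \<tau> using c2 that by blast
 have wc: "w \<sigma> \<tau> (X i, Y j) = w \<sigma>' \<tau>' (X i, Y j)"
  if "i \<in> {0, 1}" "j \<in> {0, 1}" "\<sigma> \<in> {i - 1, i}" "\<sigma>' \<in> {i - 1, i}" "\<tau> \<in> {j - 1, j}" "\<tau>' \<in> {j - 1, j}"
  for i j \<sigma> \<sigma>' \<tau> \<tau>' using c3 that by blast
 have wz: "w \<sigma> \<tau> (X i, Y j) = 0"
  if "i \<in> {-1..2}" "j \<in> {-1..2}" "\<not> (i \<in> {0, 1} \<and> j \<in> {0, 1})" "\<sigma> \<in> {i - 1, i} \<inter> offs" "\<tau> \<in> {j - 1, j} \<inter> offs"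
  for i j \<sigma> \<tau> using c4 that by blast
 have wx: "\<forall>i\<in>{0, 1}. mean_dx (w (i - 1) \<tau>) (X i) (Y \<tau>) (Y (\<tau> + 1)) = mean_dx (w i \<tau>) (X i) (Y \<tau>) (Y (\<tau> + 1))"
  "mean_dx (w (-1) \<tau>) (X (-1)) (Y \<tau>) (Y (\<tau> + 1)) = 0" "mean_dx (w 1 \<tau>) (X 2) (Y \<tau>) (Y (\<tau> + 1)) = 0"
  if "\<tau> \<in> offs" for \<tau> using c5 that by blast+
 have wy: "\<forall>j\<in>{0, 1}. mean_dy (w \<sigma> (j - 1)) (Y j) (X \<sigma>) (X (\<sigma> + 1)) = mean_dy (w \<sigma> j) (Y j) (X \<sigma>) (X (\<sigma> + 1))"
  "mean_dy (w \<sigma> (-1)) (Y (-1)) (X \<sigma>) (X (\<sigma> + 1)) = 0" "mean_dy (w \<sigma> 1) (Y 2) (X \<sigma>) (X (\<sigma> + 1)) = 0"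
  if "\<sigma> \<in> offs" for \<sigma> using c6 that by blast+
 define V where "V i j = (if i \<in> {0, 1} \<and> j \<in> {0, 1} then w i j (X i, Y j) else 0)" for i j
 have V: "w \<sigma> \<tau> (X i, Y j) = V i j" if "\<sigma> \<in> offs" "\<tau> \<in> offs" "i \<in> {\<sigma>, \<sigma> + 1}" "j \<in> {\<tau>, \<tau> + 1}" for \<sigma> \<tau> i j
 proof (cases "i \<in> {0, 1} \<and> j \<in> {0, 1}")
  case True
  then show ?thesis using wc[of i j \<sigma> i \<tau> j] that by (auto simp: V_def)
 next
  case False
  then show ?thesis using wz[of i j \<sigma> \<tau>] that unfolding V_def by auto
 qed
 define D where "D \<tau> i = (if i = 2 then 0 else mean_dx (w i \<tau>) (X i) (Y \<tau>) (Y (\<tau> + 1)))" for \<tau> i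
 define E where "E \<sigma> j = (if j = 2 then 0 else mean_dy (w \<sigma> j) (Y j) (X \<sigma>) (X (\<sigma> + 1)))" for \<sigma> j
 have D: "mean_dx (w \<sigma> \<tau>) (X i) (Y \<tau>) (Y (\<tau> + 1)) = D \<tau> i" if "\<sigma> \<in> offs" "\<tau> \<in> offs" "i \<in> {\<sigma>, \<sigma> + 1}" for \<sigma> \<tau> i
  using that wx[OF that(2)] by (auto simp: D_def)
 have E: "mean_dy (w \<sigma> \<tau>) (Y j) (X \<sigma>) (X (\<sigma> + 1)) = E \<sigma> j" if "\<sigma> \<in> offs" "\<tau> \<in> offs" "j \<in> {\<tau>, \<tau> + 1}" for \<sigma> \<tau> j
  using that wy[OF that(1)] by (auto simp: E_def)
 have De: "D \<tau> (-1) = 0" "D \<tau> 2 = 0" if "\<tau> \<in> offs" for \<tau> using wx[OF that] by (auto simp: D_def)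
 have Ee: "E \<sigma> (-1) = 0" "E \<sigma> 2 = 0" if "\<sigma> \<in> offs" for \<sigma> using wy[OF that] by (auto simp: E_def)
 let ?U = "\<lambda>\<tau> i. (V i \<tau> + V i (\<tau> + 1)) / 2" and ?W = "\<lambda>\<sigma> j. (V \<sigma> j + V (\<sigma> + 1) j) / 2"
 have relx: "D \<tau> \<sigma> + D \<tau> (\<sigma> + 1) = 2 * (?U \<tau> (\<sigma> + 1) - ?U \<tau> \<sigma>) / span (L K (-1)) (L K 0) (L K 1) \<sigma>"
  if "\<sigma> \<in> offs" "\<tau> \<in> offs" for \<sigma> \<tau>
  using P2_mean_relation(1)[OF wP[OF that] knots(2)[OF that(1)] knots(4)[OF that(2)]]
   D[OF that, of \<sigma>] D[OF that, of "\<sigma> + 1"] V[OF that] knots(1)[OF that(1)] spans(1)[OF that(1)] by simp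
 have rely: "E \<sigma> \<tau> + E \<sigma> (\<tau> + 1) = 2 * (?W \<sigma> (\<tau> + 1) - ?W \<sigma> \<tau>) / span (H K (-1)) (H K 0) (H K 1) \<tau>"
  if "\<sigma> \<in> offs" "\<tau> \<in> offs" for \<sigma> \<tau>
  using P2_mean_relation(2)[OF wP[OF that] knots(2)[OF that(1)] knots(4)[OF that(2)]]
   E[OF that, of \<tau>] E[OF that, of "\<tau> + 1"] V[OF that] knots(3)[OF that(2)] spans(2)[OF that(2)] by simp
 have pos: "0 < L K (-1)" "0 < L K 0" "0 < L K 1" "0 < H K (-1)" "0 < H K 0" "0 < H K 1"
  using Lpos Hpos by auto
 have V0: "V i j = 0" if "i \<notin> {0, 1} \<or> j \<notin> {0, 1}" for i j using that unfolding V_def by auto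
 define \<alpha> \<beta> where "\<alpha> = (L K (-1) + L K 0) / L K (-1)" and "\<beta> = (H K (-1) + H K 0) / H K (-1)"
 have ax: "?U \<tau> i = ?U \<tau> 0 * \<alpha> * bx i" "D \<tau> i = ?U \<tau> 0 * \<alpha> * dx i" if "\<tau> \<in> offs" "i \<in> {-1, 0, 1, 2}" for \<tau> i
  using bspline_unique[OF pos(1-3), of "?U \<tau>" "D \<tau>" i] V0 De[OF that(1)] relx[OF _ that(1)] that(2)
  by (simp_all add: \<alpha>_def)
 have ay: "?W \<sigma> j = ?W \<sigma> 0 * \<beta> * by' j" "E \<sigma> j = ?W \<sigma> 0 * \<beta> * dy j" if "\<sigma> \<in> offs" "j \<in> {-1, 0, 1, 2}" for \<sigma> j
  using bspline_unique[OF pos(4-6), of "?W \<sigma>" "E \<sigma>" j] V0 Ee[OF that(1)] rely[OF that(1)] that(2)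
  by (simp_all add: \<beta>_def)
 have ab: "\<alpha> * bx 0 = 1" "\<beta> * by' 0 = 1" using pos by (auto simp: \<alpha>_def \<beta>_def bval_def)
 have V00: "V 0 0 = bx 0 * by' 0"
  using norm by (simp add: V_def vertex_def xknot_def yknot_def)
 have "V 1 0 = V 0 0 * \<alpha> * bx 1" using ax(1)[of "-1" 1] V0 by simp
 also have "\<dots> = (\<alpha> * bx 0) * (bx 1 * by' 0)" unfolding V00 by (simp add: mult_ac)
 finally have V10: "V 1 0 = bx 1 * by' 0" unfolding ab by simp
 have "V 0 1 = V 0 0 * \<beta> * by' 1" using ay(1)[of "-1" 1] V0 by simp
 also have "\<dots> = (\<beta> * by' 0) * (bx 0 * by' 1)" unfolding V00 by (simp add: mult_ac)
 finally have V01: "V 0 1 = bx 0 * by' 1" unfolding ab by simp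
 have "V 1 1 = V 0 1 * \<alpha> * bx 1" using ax(1)[of 1 1] V0 by simp
 also have "\<dots> = (\<alpha> * bx 0) * (bx 1 * by' 1)" unfolding V01 by (simp add: mult_ac)
 finally have V11: "V 1 1 = bx 1 * by' 1" unfolding ab by simp
 have Veq: "V i j = bx i * by' j" for i j
  using V0[of i j] V00 V10 V01 V11 by (cases "i \<in> {0, 1} \<and> j \<in> {0, 1}") (auto simp: bval_def)
 have Deq: "D \<tau> i = dx i * (by' \<tau> + by' (\<tau> + 1)) / 2" if "\<tau> \<in> offs" "i \<in> {-1, 0, 1, 2}" for \<tau> i
 proof -
  have "D \<tau> i = (\<alpha> * bx 0) * (by' \<tau> + by' (\<tau> + 1)) / 2 * dx i"
   using ax(2)[OF that] Veq by (simp add: field_simps)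
  then show ?thesis unfolding ab by simp
 qed
 have Eeq: "E \<sigma> j = dy j * (bx \<sigma> + bx (\<sigma> + 1)) / 2" if "\<sigma> \<in> offs" "j \<in> {-1, 0, 1, 2}" for \<sigma> j
 proof -
  have "E \<sigma> j = (\<beta> * by' 0) * (bx \<sigma> + bx (\<sigma> + 1)) / 2 * dy j"
   using ay(2)[OF that] Veq by (simp add: field_simps)
  then show ?thesis unfolding ab by simp
 qed
 have "w \<sigma> \<tau> = piece \<sigma> \<tau>" for \<sigma> \<tau>
 proof (cases "\<sigma> \<in> offs \<and> \<tau> \<in> offs")
  case False
  then show ?thesis using w0 unfolding piece_def by auto
 next
  case True
  then have o: "\<sigma> \<in> offs" "\<tau> \<in> offs" by auto
  have p: "piece \<sigma> \<tau> \<in> P2" using o tensor_P2 unfolding piece_def by simp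
  have v: "w \<sigma> \<tau> (X i, Y j) = piece \<sigma> \<tau> (X i, Y j)" if "i \<in> {\<sigma>, \<sigma> + 1}" "j \<in> {\<tau>, \<tau> + 1}" for i j
   using V[OF o that] piece_vertex[OF o that] Veq by simp
  have m: "mean_dx (w \<sigma> \<tau>) (X i) (Y \<tau>) (Y (\<tau> + 1)) = mean_dx (piece \<sigma> \<tau>) (X i) (Y \<tau>) (Y (\<tau> + 1))"
   if "i \<in> {\<sigma>, \<sigma> + 1}" for i
  proof -
   have "i \<in> {-1, 0, 1, 2}" using that o by auto
   then show ?thesis using D[OF o that] piece_mean_dx[OF o that] Deq[OF o(2)] by simp
  qed
  have m': "mean_dy (w \<sigma> \<tau>) (Y j) (X \<sigma>) (X (\<sigma> + 1)) = mean_dy (piece \<sigma> \<tau>) (Y j) (X \<sigma>) (X (\<sigma> + 1))"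
   if "j \<in> {\<tau>, \<tau> + 1}" for j
  proof -
   have "j \<in> {-1, 0, 1, 2}" using that o by auto
   then show ?thesis using E[OF o that] piece_mean_dy[OF o that] Eeq[OF o(1)] by simp
  qed
  show ?thesis
   by (rule trans[OF P2_eq_interpolant[OF wP[OF o] knots(2)[OF o(1)] knots(4)[OF o(2)]]
      trans[OF _ P2_eq_interpolant[OF p knots(2)[OF o(1)] knots(4)[OF o(2)], symmetric]]])
     (simp add: v m m')
 qed
 then show ?thesis by blast
qed

lemma basis_pieces_eq: "basis_pieces L H K = piece"
proof -
 have n: "bx 0 * by' 0 = L K (-1) / (L K (-1) + L K 0) * (H K (-1) / (H K (-1) + H K 0))"
  by (simp add: bval_def)
 have "piece 0 0 (X 0, Y 0) = bx 0 * by' 0" by (intro piece_vertex) auto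
 then have v: "piece 0 0 (vertex K (-1) (-1)) = bx 0 * by' 0"
  by (simp add: xknot_def yknot_def vertex_def)
 show ?thesis
  unfolding basis_pieces_def n[symmetric]
 proof (rule the_equality)
  show "piece \<in> RRM0 L H K \<and> piece 0 0 (vertex K (-1) (-1)) = bx 0 * by' 0"
   using v piece_in_RRM0 by blast
  fix w assume "w \<in> RRM0 L H K \<and> w 0 0 (vertex K (-1) (-1)) = bx 0 * by' 0"
  then show "w = piece" using RRM0_unique by blast
 qed
qed

end

section \<open>Square integrable functions\<close>

text \<open>The Cauchy-Schwarz inequality against an indicator, from the discriminant of
  \<open>t \<mapsto> \<integral>(f - t 1\<^sub>A)\<^sup>2\<close>; integrability of \<open>f\<close> comes out along the way.\<close>

lemma square_integrable_mean:
 fixes f :: "'a => real"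
 assumes A: "A \<in> sets M" "emeasure M A < \<infinity>" and m: "f \<in> borel_measurable M"
  and i2: "integrable M (\<lambda>x. (f x)\<^sup>2)" and out: "\<And>x. x \<notin> A ==> f x = 0"
 shows "integrable M f" "(LINT x|M. f x)\<^sup>2 \<le> measure M A * (LINT x|M. (f x)\<^sup>2)"
proof -
 have i1: "integrable M (\<lambda>x. indicator A x * c)" for c :: real
  using A by (intro integrable_mult_left integrable_real_indicator) auto
 show i: "integrable M f"
 proof (rule Bochner_Integration.integrable_bound)
  show "integrable M (\<lambda>x. indicator A x * 1 + (f x)\<^sup>2)" using i1[of 1] i2 by simp
  have "\<bar>t\<bar> \<le> 1 + t\<^sup>2" for t :: real
   using sum_squares_bound[of 1 "\<bar>t\<bar>"] abs_ge_zero[of t] by (simp add: power2_eq_square)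
  then have "norm (f x) \<le> norm (indicator A x * 1 + (f x)\<^sup>2)" for x
   using out[of x] by (cases "x \<in> A") auto
  then show "AE x in M. norm (f x) \<le> norm (indicator A x * 1 + (f x)\<^sup>2)" by simp
 qed (rule m)
 define \<mu> I J where "\<mu> = measure M A" and "I = (LINT x|M. f x)" and "J = (LINT x|M. (f x)\<^sup>2)"
 have M: "(LINT x|M. indicator A x * c) = \<mu> * c" for c :: real
  using A sets.sets_into_space[OF A(1)] by (simp add: \<mu>_def Int_absorb2)
 have q: "0 \<le> J - 2 * t * I + t\<^sup>2 * \<mu>" for t
 proof -
  have "0 \<le> (LINT x|M. (f x - indicator A x * t)\<^sup>2)" by simp
  also have "\<dots> = (LINT x|M. (f x)\<^sup>2 + ((- 2 * t) * f x + indicator A x * t\<^sup>2))"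
   using out by (intro Bochner_Integration.integral_cong refl) (auto simp: power2_eq_square algebra_simps indicator_def)
  also have "\<dots> = J + ((- 2 * t) * I + \<mu> * t\<^sup>2)"
   unfolding M[symmetric] I_def J_def
   by (simp only: Bochner_Integration.integral_add[OF i2 Bochner_Integration.integrable_add[OF integrable_mult_right[OF i] i1]]
    Bochner_Integration.integral_add[OF integrable_mult_right[OF i] i1] integral_mult_right_zero)
  finally show ?thesis by (simp add: mult.commute)
 qed
 have M0: "0 \<le> \<mu>" by (simp add: \<mu>_def)
 show "I\<^sup>2 \<le> \<mu> * J"
 proof (cases "\<mu> = 0")
  case True
  have "I = 0"
  proof (rule ccontr)
   assume "I \<noteq> 0"
   then show False using q[of "(J + 1) / (2 * I)"] True by simp
  qed
  then show ?thesis using True by simp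
 next
  case False
  have "2 * (I / \<mu>) * I - (I / \<mu>)\<^sup>2 * \<mu> = I\<^sup>2 / \<mu>" using False by (simp add: power2_eq_square field_simps)
  then have "I\<^sup>2 / \<mu> \<le> J" using q[of "I / \<mu>"] by simp
  then show ?thesis using False M0 by (simp add: field_simps)
 qed
qed

lemma L2_mean:
 assumes "L2 A f" "A \<in> sets lebesgue" "emeasure lebesgue A < \<infinity>"
 shows "set_integrable lebesgue A f"
  "(LINT x:A|lebesgue. f x)\<^sup>2 \<le> measure lebesgue A * (LINT x:A|lebesgue. (f x)\<^sup>2)"
proof -
 have sq: "(indicator A x *\<^sub>R f x)\<^sup>2 = indicator A x *\<^sub>R (f x)\<^sup>2" for x by (simp add: indicator_def)
 have a: "(\<lambda>x. indicator A x *\<^sub>R f x) \<in> borel_measurable lebesgue"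
  "integrable lebesgue (\<lambda>x. (indicator A x *\<^sub>R f x)\<^sup>2)"
  using assms(1) unfolding sq by (auto simp: L2_def set_integrable_def set_borel_measurable_def)
 have out: "indicator A x *\<^sub>R f x = 0" if "x \<notin> A" for x using that by simp
 note m = square_integrable_mean[OF assms(2,3) a out]
 show "set_integrable lebesgue A f" unfolding set_integrable_def by (rule m(1))
 show "(LINT x:A|lebesgue. f x)\<^sup>2 \<le> measure lebesgue A * (LINT x:A|lebesgue. (f x)\<^sup>2)"
  using m(2) unfolding set_lebesgue_integral_def sq .
qed

lemmas L2_integrable = L2_mean(1)
lemmas L2_mean_bound = L2_mean(2)

lemma L2_subset:
 assumes "L2 A f" "B \<subseteq> A" "B \<in> sets lebesgue"
 shows "L2 B f" "(LINT x:B|lebesgue. (f x)\<^sup>2) \<le> (LINT x:A|lebesgue. (f x)\<^sup>2)"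
proof -
 have i: "set_integrable lebesgue A (\<lambda>x. (f x)\<^sup>2)" "set_borel_measurable lebesgue A f" using assms(1) by (auto simp: L2_def)
 then have "set_integrable lebesgue B (\<lambda>x. (f x)\<^sup>2)" using set_integrable_subset assms by blast
 moreover have "set_borel_measurable lebesgue B f" using set_borel_measurable_subset[OF i(2) assms(3,2)] .
 ultimately show "L2 B f" by (simp add: L2_def)
 show "(LINT x:B|lebesgue. (f x)\<^sup>2) \<le> (LINT x:A|lebesgue. (f x)\<^sup>2)"
  using \<open>set_integrable lebesgue B _\<close> i(1) assms(2)
  unfolding set_lebesgue_integral_def set_integrable_def
  by (intro integral_mono) (auto simp: indicator_def)
qed

lemma L2_nrm_sq: "(L2_nrm A f)\<^sup>2 = (LINT x:A|lebesgue. (f x)\<^sup>2)"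
 unfolding L2_nrm_def
 by (intro real_sqrt_pow2) (auto simp: set_lebesgue_integral_def indicator_def intro!: integral_nonneg_AE)

lemma L2_nrm_nonneg: "0 \<le> L2_nrm A f"
 unfolding L2_nrm_def by (auto simp: set_lebesgue_integral_def indicator_def intro!: integral_nonneg_AE)

section \<open>Cell means\<close>

lemma region_measurable [simp]: "region K \<in> sets lebesgue" "region K \<in> sets lborel" "emeasure lebesgue (region K) < \<infinity>"
 by (auto simp: region_def emeasure_lborel_cbox_eq)

lemma measure_region: "nondegenerate K ==> measure lebesgue (region K) = width K * height K"
 unfolding region_def nondegenerate_def width_def height_def
 by (cases "fst K"; cases "snd K") (simp add: content_Pair)

lemma integral_region:
 fixes f :: "pt => real"
 assumes "continuous_on (region K) f"
 shows "set_integrable lebesgue (region K) f"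
  "(LINT x:region K|lebesgue. f x) = integral {fst (fst K)..fst (snd K)} (\<lambda>x. integral {snd (fst K)..snd (snd K)} (\<lambda>y. f (x, y)))"
proof -
 obtain a b c d where K: "K = ((a, b), (c, d))" by (metis surj_pair)
 have c: "continuous_on (cbox (a, b) (c, d)) f" using assms by (simp add: K region_def)
 show i: "set_integrable lebesgue (region K) f"
  using absolutely_integrable_continuous[OF c] by (simp add: K region_def)
 have "(LINT x:region K|lebesgue. f x) = integral (cbox (a, b) (c, d)) f"
  using set_lebesgue_integral_eq_integral(2)[OF i] by (simp add: K region_def)
 also have "\<dots> = integral (cbox a c) (\<lambda>x. integral (cbox b d) (\<lambda>y. f (x, y)))"
  by (rule integral_prod_continuous[OF c])
 finally show "(LINT x:region K|lebesgue. f x) = integral {fst (fst K)..fst (snd K)} (\<lambda>x. integral {snd (fst K)..snd (snd K)} (\<lambda>y. f (x, y)))"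
  by (simp add: K)
qed

lemma quad_continuous: "continuous_on A (quad a b c d e f)"
 unfolding quad_def case_prod_beta by (intro continuous_intros)

lemma cell_mean_quad:
 assumes n: "nondegenerate K"
 defines "u \<equiv> (fst (fst K) + fst (snd K)) / 2" and "v \<equiv> (snd (fst K) + snd (snd K)) / 2"
 shows "cell_mean K (quad a b c d e f) =
  a + b * u + c * v + d * (u\<^sup>2 + (width K)\<^sup>2 / 12) + e * u * v + f * (v\<^sup>2 + (height K)\<^sup>2 / 12)"
proof -
 define w h where "w = width K" and "h = height K"
 define x0 y0 where "x0 = u - w / 2" and "y0 = v - h / 2"
 have K: "fst (fst K) = x0" "fst (snd K) = x0 + w" "snd (fst K) = y0" "snd (snd K) = y0 + h" "0 < w" "0 < h"
  using n by (auto simp: x0_def y0_def u_def v_def w_def h_def width_def height_def nondegenerate_def field_simps)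
 have uv: "u = x0 + w / 2" "v = y0 + h / 2" by (auto simp: x0_def y0_def)
 have I: "integral {z..z + k} (\<lambda>x. p + q * x + r * x\<^sup>2) = k * (p + q * (z + k / 2) + r * ((z + k / 2)\<^sup>2 + k\<^sup>2 / 12))"
  if "0 < k" for z k p q r :: real
 proof -
  have "((\<lambda>x. p + q * x + r * x\<^sup>2) has_integral
    (p * (z + k) + q * (z + k)\<^sup>2 / 2 + r * (z + k) ^ 3 / 3) - (p * z + q * z\<^sup>2 / 2 + r * z ^ 3 / 3)) {z..z + k}"
   using that by (intro fundamental_theorem_of_calculus)
    (auto intro!: derivative_eq_intros simp flip: has_real_derivative_iff_has_vector_derivative)
  then have "integral {z..z + k} (\<lambda>x. p + q * x + r * x\<^sup>2) =
    (p * (z + k) + q * (z + k)\<^sup>2 / 2 + r * (z + k) ^ 3 / 3) - (p * z + q * z\<^sup>2 / 2 + r * z ^ 3 / 3)"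
   by (rule integral_unique)
  then show ?thesis by (simp add: field_simps power2_eq_square power3_eq_cube)
 qed
 have "integral {y0..y0 + h} (\<lambda>y. quad a b c d e f (x, y)) =
   h * (a + c * v + f * (v\<^sup>2 + h\<^sup>2 / 12)) + h * (b + e * v) * x + h * d * x\<^sup>2" for x
 proof -
  have "(\<lambda>y. quad a b c d e f (x, y)) = (\<lambda>y. (a + b * x + d * x\<^sup>2) + (c + e * x) * y + f * y\<^sup>2)"
   by (auto simp: quad_def fun_eq_iff algebra_simps)
  then show ?thesis using I[OF K(6), of y0 "a + b * x + d * x\<^sup>2" "c + e * x" f] uv(2)
   by (simp add: algebra_simps)
 qed
 then have "(LINT x:region K|lebesgue. quad a b c d e f x) =
   w * (h * (a + c * v + f * (v\<^sup>2 + h\<^sup>2 / 12)) + h * (b + e * v) * u + h * d * (u\<^sup>2 + w\<^sup>2 / 12))"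
  using integral_region(2)[OF quad_continuous, of K a b c d e f] I[OF K(5), of x0] uv(1) K by simp
 then show ?thesis
  unfolding cell_mean_def measure_region[OF n] w_def[symmetric] h_def[symmetric]
  using K(5,6) by (simp add: field_simps)
qed

lemma lebesgue_measurable_AE:
 fixes f g :: "'a::euclidean_space => real"
 assumes f: "f \<in> borel_measurable lebesgue" and ae: "AE x in lebesgue. f x = g x"
 shows "g \<in> borel_measurable lebesgue"
proof (rule measurableI)
 fix S :: "real set" assume S: "S \<in> sets borel"
 have "AE x in lebesgue. x \<in> f -` S \<inter> space lebesgue \<longleftrightarrow> x \<in> g -` S \<inter> space lebesgue"
  using ae by eventually_elim auto
 then show "g -` S \<inter> space lebesgue \<in> sets lebesgue"
  using completion.in_sets_AE[of "f -` S \<inter> space lebesgue" "g -` S \<inter> space lebesgue" lborel]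
   measurable_sets[OF f S] by auto
qed simp

lemma lebesgue_integral_AE:
 fixes f g :: "'a::euclidean_space => real"
 assumes ae: "AE x in lebesgue. f x = g x"
 shows "integrable lebesgue f \<longleftrightarrow> integrable lebesgue g" "(LINT x|lebesgue. f x) = (LINT x|lebesgue. g x)"
proof -
 have ae': "AE x in lebesgue. g x = f x" using ae by eventually_elim simp
 have m: "f \<in> borel_measurable lebesgue \<longleftrightarrow> g \<in> borel_measurable lebesgue"
  by (rule iffI; erule lebesgue_measurable_AE; rule ae ae')
 show "integrable lebesgue f \<longleftrightarrow> integrable lebesgue g"
  using integrable_cong_AE[OF _ _ ae] m borel_measurable_integrable by blast
 show "(LINT x|lebesgue. f x) = (LINT x|lebesgue. g x)"
  using integral_cong_AE[OF _ _ ae] m not_integrable_integral_eq borel_measurable_integrable by metis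
qed

lemma set_lebesgue_AE:
 fixes f g :: "'a::euclidean_space => real"
 assumes "AE x in lebesgue. x \<in> A --> f x = g x"
 shows "set_integrable lebesgue A f \<longleftrightarrow> set_integrable lebesgue A g" "(LINT x:A|lebesgue. f x) = (LINT x:A|lebesgue. g x)"
  "set_borel_measurable lebesgue A f \<longleftrightarrow> set_borel_measurable lebesgue A g"
proof -
 have ae: "AE x in lebesgue. indicator A x *\<^sub>R f x = indicator A x *\<^sub>R g x"
  using assms by eventually_elim (auto simp: indicator_def)
 have ae': "AE x in lebesgue. indicator A x *\<^sub>R g x = indicator A x *\<^sub>R f x"
  by (rule eventually_mono[OF ae sym])
 show "set_integrable lebesgue A f \<longleftrightarrow> set_integrable lebesgue A g" "(LINT x:A|lebesgue. f x) = (LINT x:A|lebesgue. g x)"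
  unfolding set_integrable_def set_lebesgue_integral_def using lebesgue_integral_AE[OF ae] by auto
 show "set_borel_measurable lebesgue A f \<longleftrightarrow> set_borel_measurable lebesgue A g"
  unfolding set_borel_measurable_def by (rule iffI; erule lebesgue_measurable_AE; rule ae ae')
qed

lemma L2_AE:
 assumes "AE x in lebesgue. x \<in> A --> f x = g x"
 shows "L2 A f \<longleftrightarrow> L2 A g" "L2_nrm A f = L2_nrm A g"
proof -
 have "AE x in lebesgue. x \<in> A --> (f x)\<^sup>2 = (g x)\<^sup>2" using assms by eventually_elim simp
 note sq = set_lebesgue_AE[OF this]
 show "L2 A f \<longleftrightarrow> L2 A g" using sq(1) set_lebesgue_AE(3)[OF assms] by (simp add: L2_def)
 show "L2_nrm A f = L2_nrm A g" using sq(2) by (simp add: L2_nrm_def)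
qed

lemma cell_mean_cong:
 assumes "AE x in lebesgue. x \<in> region S --> v x = v' x"
 shows "cell_mean S v = cell_mean S v'"
 unfolding cell_mean_def using set_lebesgue_AE(2)[OF assms] by simp

section \<open>The functionals\<close>

lemma cell_mean_linear:
 assumes "set_integrable lebesgue (region S) f" "set_integrable lebesgue (region S) g"
 shows "cell_mean S (\<lambda>x. f x - g x) = cell_mean S f - cell_mean S g"
 unfolding cell_mean_def using assms by (simp add: set_integral_diff right_diff_distrib)

lemma cell_mean_bound:
 assumes "nondegenerate S" "L2 (region S) f"
 shows "\<bar>cell_mean S f\<bar> \<le> L2_nrm (region S) f / sqrt (width S * height S)"
proof -
 have m: "0 < width S * height S" using assms(1) by (simp add: nondegenerate_def width_def height_def)
 have "(LINT x:region S|lebesgue. f x)\<^sup>2 \<le> (width S * height S) * (L2_nrm (region S) f)\<^sup>2"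
  using L2_mean_bound[OF assms(2) region_measurable(1,3)] measure_region[OF assms(1)] by (simp add: L2_nrm_sq)
 also have "\<dots> = (sqrt (width S * height S) * L2_nrm (region S) f)\<^sup>2"
  using m by (simp add: power_mult_distrib)
 finally have "\<bar>LINT x:region S|lebesgue. f x\<bar> \<le> sqrt (width S * height S) * L2_nrm (region S) f"
  using m L2_nrm_nonneg by (simp add: abs_le_square_iff[symmetric] abs_mult)
 then have "\<bar>cell_mean S f\<bar> \<le> (sqrt (width S * height S) * L2_nrm (region S) f) / (width S * height S)"
  unfolding cell_mean_def measure_region[OF assms(1)] using m assms(1)
  by (simp add: abs_mult divide_right_mono abs_of_pos nondegenerate_def width_def height_def)
 also have "\<dots> = L2_nrm (region S) f / sqrt (width S * height S)"
 proof -
  have "sqrt M * N / M = N / sqrt M" if "0 < M" for M N :: real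
  proof -
   have "sqrt M * N / M = sqrt M * N / (sqrt M * sqrt M)" using that by simp
   also have "\<dots> = N / sqrt M" using that by (simp del: real_sqrt_mult_self)
   finally show ?thesis .
  qed
  then show ?thesis using m by blast
 qed
 finally show ?thesis .
qed

context patch_center
begin

lemma patch_cell_coords:
 assumes "\<sigma> \<in> offs" "\<tau> \<in> offs"
 shows "nondegenerate (patch_cell L H K \<sigma> \<tau>)" "width (patch_cell L H K \<sigma> \<tau>) = L K \<sigma>"
  "height (patch_cell L H K \<sigma> \<tau>) = H K \<tau>" "patch_cell L H K 0 0 = K"
 using knots[OF assms(1)] knots[OF assms(2)]
 by (auto simp: patch_cell_def nondegenerate_def width_def height_def xknot_def yknot_def)

text \<open>The functional is dual to the splines: on monomials it gives, in each variable, the polar form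
 at the two end points of the cell.\<close>

lemma lam_quad:
 defines "u \<equiv> (X 0 + X 1) / 2" and "v \<equiv> (Y 0 + Y 1) / 2"
 shows "lam L H K (quad a b c d e f) = a + b * u + c * v + d * (X 0 * X 1) + e * (u * v) + f * (Y 0 * Y 1)"
proof -
 have S: "cell_mean (patch_cell L H K \<sigma> \<tau>) (quad a b c d e f) =
   a + b * ((X \<sigma> + X (\<sigma> + 1)) / 2) + c * ((Y \<tau> + Y (\<tau> + 1)) / 2)
   + d * (((X \<sigma> + X (\<sigma> + 1)) / 2)\<^sup>2 + (L K \<sigma>)\<^sup>2 / 12)
   + e * ((X \<sigma> + X (\<sigma> + 1)) / 2) * ((Y \<tau> + Y (\<tau> + 1)) / 2) + f * (((Y \<tau> + Y (\<tau> + 1)) / 2)\<^sup>2 + (H K \<tau>)\<^sup>2 / 12)"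
  if "\<sigma> \<in> offs" "\<tau> \<in> offs" for \<sigma> \<tau>
  using cell_mean_quad[OF patch_cell_coords(1)[OF that]] patch_cell_coords(2,3)[OF that]
  by (simp add: patch_cell_def)
 define l w r p h q where "l = L K (-1)" and "w = L K 0" and "r = L K 1" and "p = H K (-1)" and "h = H K 0" and "q = H K 1"
 have pos: "0 < l" "0 < w" "0 < r" "0 < p" "0 < h" "0 < q"
  using Lpos Hpos by (auto simp: l_def w_def r_def p_def h_def q_def)
 have Xs: "X (-1) = u - w / 2 - l" "X 0 = u - w / 2" "X 1 = u + w / 2" "X 2 = u + w / 2 + r"
  using L0 by (auto simp: u_def l_def w_def r_def xknot_def width_def field_simps)
 have Ys: "Y (-1) = v - h / 2 - p" "Y 0 = v - h / 2" "Y 1 = v + h / 2" "Y 2 = v + h / 2 + q"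
  using H0 by (auto simp: v_def p_def h_def q_def yknot_def height_def field_simps)
 define w1 w2 w3 w4 where "w1 = - w\<^sup>2 / ((l + w) * (l + w + r))" and "w2 = - w\<^sup>2 / ((w + r) * (l + w + r))"
  and "w3 = - h\<^sup>2 / ((p + h) * (p + h + q))" and "w4 = - h\<^sup>2 / ((h + q) * (p + h + q))"
 have ne: "l + w \<noteq> 0" "w + r \<noteq> 0" "l + w + r \<noteq> 0" "p + h \<noteq> 0" "h + q \<noteq> 0" "p + h + q \<noteq> 0"
  using pos by auto
 have e1: "w1 * (l + w) = w2 * (w + r)" "w3 * (p + h) = w4 * (h + q)"
  using ne by (simp_all add: w1_def w2_def w3_def w4_def)
 have e2: "w1 * (l\<^sup>2 / 12 - w\<^sup>2 / 12 + ((l + w) / 2)\<^sup>2) + w2 * (r\<^sup>2 / 12 - w\<^sup>2 / 12 + ((w + r) / 2)\<^sup>2) = - w\<^sup>2 / 3"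
 proof -
  have A: "w1 * (l\<^sup>2 / 12 - w\<^sup>2 / 12 + ((l + w) / 2)\<^sup>2) = (w1 * (l + w)) * (4 * l + 2 * w) / 12"
   "w2 * (r\<^sup>2 / 12 - w\<^sup>2 / 12 + ((w + r) / 2)\<^sup>2) = (w2 * (w + r)) * (4 * r + 2 * w) / 12"
   by (simp_all add: field_simps power2_eq_square)
  have B: "w1 * (l + w) = - (w\<^sup>2 / (l + w + r))" "w2 * (w + r) = - (w\<^sup>2 / (l + w + r))"
   using ne by (simp_all add: w1_def w2_def)
  have C: "- k * (4 * l + 2 * w) / 12 + - k * (4 * r + 2 * w) / 12 = - (k * (l + w + r)) / 3" for k
   by (simp add: field_simps)
  show ?thesis unfolding A B C using ne by simp
 qed
 have e3: "w3 * (p\<^sup>2 / 12 - h\<^sup>2 / 12 + ((p + h) / 2)\<^sup>2) + w4 * (q\<^sup>2 / 12 - h\<^sup>2 / 12 + ((h + q) / 2)\<^sup>2) = - h\<^sup>2 / 3"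
 proof -
  have A: "w3 * (p\<^sup>2 / 12 - h\<^sup>2 / 12 + ((p + h) / 2)\<^sup>2) = (w3 * (p + h)) * (4 * p + 2 * h) / 12"
   "w4 * (q\<^sup>2 / 12 - h\<^sup>2 / 12 + ((h + q) / 2)\<^sup>2) = (w4 * (h + q)) * (4 * q + 2 * h) / 12"
   by (simp_all add: field_simps power2_eq_square)
  have B: "w3 * (p + h) = - (h\<^sup>2 / (p + h + q))" "w4 * (h + q) = - (h\<^sup>2 / (p + h + q))"
   using ne by (simp_all add: w3_def w4_def)
  have C: "- k * (4 * p + 2 * h) / 12 + - k * (4 * q + 2 * h) / 12 = - (k * (p + h + q)) / 3" for k
   by (simp add: field_simps)
  show ?thesis unfolding A B C using ne by simp
 qed
 define M where "M = (\<lambda>x y w' h'. a + b * x + c * y + d * (x\<^sup>2 + w'\<^sup>2 / 12) + e * x * y + f * (y\<^sup>2 + h'\<^sup>2 / 12))"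
 have mids: "(X (-1) + X 0) / 2 = u - (l + w) / 2" "(X 1 + X 2) / 2 = u + (w + r) / 2"
  "(Y (-1) + Y 0) / 2 = v - (p + h) / 2" "(Y 1 + Y 2) / 2 = v + (h + q) / 2" "(X 0 + X 1) / 2 = u" "(Y 0 + Y 1) / 2 = v"
  by (simp_all add: Xs Ys u_def[symmetric] v_def[symmetric] field_simps)
 have cm: "cell_mean (patch_cell L H K (-1) 0) (quad a b c d e f) = M (u - (l + w) / 2) v l h"
  "cell_mean (patch_cell L H K 1 0) (quad a b c d e f) = M (u + (w + r) / 2) v r h"
  "cell_mean (patch_cell L H K 0 (-1)) (quad a b c d e f) = M u (v - (p + h) / 2) w p"
  "cell_mean (patch_cell L H K 0 1) (quad a b c d e f) = M u (v + (h + q) / 2) w q"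
  "cell_mean K (quad a b c d e f) = M u v w h"
  using S[of "-1" 0] S[of 1 0] S[of 0 "-1"] S[of 0 1] S[of 0 0] patch_cell_coords(4)[of 0 0]
  by (simp_all add: M_def mids l_def w_def r_def p_def h_def q_def)
 have "lam L H K (quad a b c d e f) = w1 * M (u - (l + w) / 2) v l h + w2 * M (u + (w + r) / 2) v r h
   + w3 * M u (v - (p + h) / 2) w p + w4 * M u (v + (h + q) / 2) w q + (1 - (w1 + w2 + w3 + w4)) * M u v w h"
  unfolding lam_def Let_def cm l_def[symmetric] w_def[symmetric] r_def[symmetric] p_def[symmetric] h_def[symmetric] q_def[symmetric]
   w1_def[symmetric] w2_def[symmetric] w3_def[symmetric] w4_def[symmetric] ..
 also have "\<dots> = M u v w h + (b / 2 + d * u + e * v / 2) * (w2 * (w + r) - w1 * (l + w)) + (c / 2 + f * v + e * u / 2) * (w4 * (h + q) - w3 * (p + h))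
   + d * (w1 * (l\<^sup>2 / 12 - w\<^sup>2 / 12 + ((l + w) / 2)\<^sup>2) + w2 * (r\<^sup>2 / 12 - w\<^sup>2 / 12 + ((w + r) / 2)\<^sup>2))
   + f * (w3 * (p\<^sup>2 / 12 - h\<^sup>2 / 12 + ((p + h) / 2)\<^sup>2) + w4 * (q\<^sup>2 / 12 - h\<^sup>2 / 12 + ((h + q) / 2)\<^sup>2))"
  unfolding M_def by (simp add: field_simps power2_eq_square)
 also have "\<dots> = M u v w h - d * w\<^sup>2 / 3 - f * h\<^sup>2 / 3"
  unfolding e1 e2 e3 by simp
 also have "\<dots> = a + b * u + c * v + d * (X 0 * X 1) + e * (u * v) + f * (Y 0 * Y 1)"
  unfolding M_def Xs Ys by (simp add: field_simps power2_eq_square)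
 finally show ?thesis .
qed

lemma lam_cong:
 assumes "AE x in lebesgue. x \<in> patch L H K --> v x = v' x"
 shows "lam L H K v = lam L H K v'"
proof -
 have "cell_mean (patch_cell L H K \<sigma> \<tau>) v = cell_mean (patch_cell L H K \<sigma> \<tau>) v'" if "\<sigma> \<in> offs" "\<tau> \<in> offs" for \<sigma> \<tau>
 proof (rule cell_mean_cong)
  have "region (patch_cell L H K \<sigma> \<tau>) \<subseteq> patch L H K" using that unfolding patch_def by blast
  then show "AE x in lebesgue. x \<in> region (patch_cell L H K \<sigma> \<tau>) --> v x = v' x"
   using assms by (auto elim: eventually_mono)
 qed
 from this[of "-1" 0] this[of 1 0] this[of 0 "-1"] this[of 0 1] this[of 0 0] show ?thesis
  unfolding lam_def Let_def using patch_cell_coords(4)[of 0 0] by simp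
qed

lemma lam_diff:
 assumes "\<And>\<sigma> \<tau>. \<sigma> \<in> offs ==> \<tau> \<in> offs ==> set_integrable lebesgue (region (patch_cell L H K \<sigma> \<tau>)) f \<and>
   set_integrable lebesgue (region (patch_cell L H K \<sigma> \<tau>)) g"
 shows "lam L H K (\<lambda>x. f x - g x) = lam L H K f - lam L H K g"
proof -
 have "cell_mean (patch_cell L H K \<sigma> \<tau>) (\<lambda>x. f x - g x) = cell_mean (patch_cell L H K \<sigma> \<tau>) f - cell_mean (patch_cell L H K \<sigma> \<tau>) g"
  if "\<sigma> \<in> offs" "\<tau> \<in> offs" for \<sigma> \<tau>
  using assms[OF that] by (intro cell_mean_linear) auto
 note d = this
 have A: "cell_mean K (\<lambda>x. f x - g x) = cell_mean K f - cell_mean K g"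
  using d[of 0 0] patch_cell_coords(4)[of 0 0] by simp
 have l: "w1 * (a1 - b1) + w2 * (a2 - b2) + w3 * (a3 - b3) + w4 * (a4 - b4) + w5 * (a5 - b5) =
   (w1 * a1 + w2 * a2 + w3 * a3 + w4 * a4 + w5 * a5) - (w1 * b1 + w2 * b2 + w3 * b3 + w4 * b4 + w5 * b5)"
  for w1 w2 w3 w4 w5 a1 a2 a3 a4 a5 b1 b2 b3 b4 b5 :: real by (simp add: algebra_simps)
 have o: "-1 \<in> offs" "0 \<in> offs" "1 \<in> offs" by auto
 show ?thesis
  unfolding lam_def Let_def d[OF o(1,2)] d[OF o(3,2)] d[OF o(2,1)] d[OF o(2,3)] A by (rule l)
qed

text \<open>The weights are at most 1 in absolute value, the last one at most 5.\<close>

lemma lam_bound: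
 assumes "\<And>\<sigma> \<tau>. \<sigma> \<in> offs ==> \<tau> \<in> offs ==> \<bar>cell_mean (patch_cell L H K \<sigma> \<tau>) v\<bar> \<le> B"
 shows "\<bar>lam L H K v\<bar> \<le> 9 * B"
proof -
 have pos: "0 < L K (-1)" "0 < L K 0" "0 < L K 1" "0 < H K (-1)" "0 < H K 0" "0 < H K 1"
  using Lpos Hpos by auto
 have w: "\<bar>- c\<^sup>2 / ((l + c) * (l + c + r))\<bar> \<le> 1" "\<bar>- c\<^sup>2 / ((c + r) * (l + c + r))\<bar> \<le> 1"
  if "0 < l" "0 < c" "0 < r" for l c r :: real
 proof -
  have "c * c \<le> (l + c) * (l + c + r)" "c * c \<le> (c + r) * (l + c + r)"
   using that by (auto intro!: mult_mono)
  then show "\<bar>- c\<^sup>2 / ((l + c) * (l + c + r))\<bar> \<le> 1" "\<bar>- c\<^sup>2 / ((c + r) * (l + c + r))\<bar> \<le> 1"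
   using that by (auto simp: power2_eq_square abs_mult divide_le_eq)
 qed
 have m: "\<bar>w * z\<bar> \<le> k * B" if "\<bar>w\<bar> \<le> k" "\<bar>z\<bar> \<le> B" for w z k :: real
  unfolding abs_mult using that by (intro mult_mono) auto
 define w1 w2 w3 w4 where "w1 = - (L K 0)\<^sup>2 / ((L K (-1) + L K 0) * (L K (-1) + L K 0 + L K 1))"
  and "w2 = - (L K 0)\<^sup>2 / ((L K 0 + L K 1) * (L K (-1) + L K 0 + L K 1))"
  and "w3 = - (H K 0)\<^sup>2 / ((H K (-1) + H K 0) * (H K (-1) + H K 0 + H K 1))"
  and "w4 = - (H K 0)\<^sup>2 / ((H K 0 + H K 1) * (H K (-1) + H K 0 + H K 1))"
 have ws: "\<bar>w1\<bar> \<le> 1" "\<bar>w2\<bar> \<le> 1" "\<bar>w3\<bar> \<le> 1" "\<bar>w4\<bar> \<le> 1"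
  unfolding w1_def w2_def w3_def w4_def using w pos by auto
 then have w5: "\<bar>1 - (w1 + w2 + w3 + w4)\<bar> \<le> 5" by linarith
 define z1 z2 z3 z4 z5 where "z1 = cell_mean (patch_cell L H K (-1) 0) v" and "z2 = cell_mean (patch_cell L H K 1 0) v"
  and "z3 = cell_mean (patch_cell L H K 0 (-1)) v" and "z4 = cell_mean (patch_cell L H K 0 1) v" and "z5 = cell_mean K v"
 have z: "\<bar>z1\<bar> \<le> B" "\<bar>z2\<bar> \<le> B" "\<bar>z3\<bar> \<le> B" "\<bar>z4\<bar> \<le> B" "\<bar>z5\<bar> \<le> B"
  unfolding z1_def z2_def z3_def z4_def z5_def
  using assms[of "-1" 0] assms[of 1 0] assms[of 0 "-1"] assms[of 0 1] assms[of 0 0] patch_cell_coords(4)[of 0 0] by auto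
 have "lam L H K v = w1 * z1 + w2 * z2 + w3 * z3 + w4 * z4 + (1 - (w1 + w2 + w3 + w4)) * z5"
  unfolding lam_def Let_def w1_def w2_def w3_def w4_def z1_def z2_def z3_def z4_def z5_def ..
 then show ?thesis
  using m[OF ws(1) z(1)] m[OF ws(2) z(2)] m[OF ws(3) z(3)] m[OF ws(4) z(4)] m[OF w5 z(5)] by linarith
qed

end

section \<open>The interpolant on a cell\<close>

lemma tensor_add_left: "tensor x0 x1 y0 y1 (q + q') r z = tensor x0 x1 y0 y1 q r z + tensor x0 x1 y0 y1 q' r z"
 by (cases q; cases q'; cases r; cases z)
   (simp add: tensor_def interpolant_def Let_def distrib_left distrib_right add_divide_distrib)

lemma tensor_add_right: "tensor x0 x1 y0 y1 q (r + r') z = tensor x0 x1 y0 y1 q r z + tensor x0 x1 y0 y1 q r' z"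
 by (cases q; cases r'; cases r; cases z)
   (simp add: tensor_def interpolant_def Let_def distrib_left distrib_right add_divide_distrib)

lemma tensor_scale: "tensor x0 x1 y0 y1 (c *\<^sub>R q) (d *\<^sub>R r) z = c * d * tensor x0 x1 y0 y1 q r z"
 by (cases q; cases r; cases z)
   (simp add: tensor_def interpolant_def Let_def algebra_simps)

text \<open>Nine products whose factors sum to \<open>M\<close> along each row and to \<open>N\<close> along each column sum to
 \<open>B M N\<close>, although neither factor need be the same in all rows or columns: what
 remains is one term for each quadrant, and it vanishes if one of the factors does not jump there.\<close>

lemma nine_products:
 fixes B :: "'a::real_vector => 'b::real_vector => real"
 assumes addl: "\<And>p q r. B (p + q) r = B p r + B q r" and addr: "\<And>p q r. B p (q + r) = B p q + B p r"
  and X: "\<And>\<tau>. \<tau> \<in> offs ==> X (-1) \<tau> + X 0 \<tau> + X 1 \<tau> = M"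
  and Y: "\<And>\<sigma>. \<sigma> \<in> offs ==> Y \<sigma> (-1) + Y \<sigma> 0 + Y \<sigma> 1 = N"
  and jump: "\<And>\<sigma> \<tau>. \<sigma> \<in> signs ==> \<tau> \<in> signs ==> X \<sigma> \<tau> = X \<sigma> 0 \<or> Y \<sigma> \<tau> = Y 0 \<tau>"
 shows "(\<Sum>\<sigma>\<in>offs. \<Sum>\<tau>\<in>offs. B (X \<sigma> \<tau>) (Y \<sigma> \<tau>)) = B M N"
proof -
 have zero: "B 0 r = 0" "B r' 0 = 0" for r r' using addl[of 0 0 r] addr[of r' 0 0] by simp_all
 have minus: "B (- p) r = - B p r" "B p (- r) = - B p r" for p r
  using addl[of "-p" p r] addr[of p "-r" r] zero by simp_all
 have diff: "B (p - q) r = B p r - B q r" "B p (q' - r) = B p q' - B p r" for p q q' r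
  using addl[of p "-q" r] addr[of p q' "-r"] minus by simp_all
 have q: "B (X \<sigma> 0 - X \<sigma> \<tau>) (Y 0 \<tau> - Y \<sigma> \<tau>) = 0" if "\<sigma> \<in> signs" "\<tau> \<in> signs" for \<sigma> \<tau>
  using jump[OF that] zero by auto
 have X0: "X 0 \<tau> = M - X (-1) \<tau> - X 1 \<tau>" if "\<tau> \<in> offs" for \<tau> using X[OF that] by (simp add: algebra_simps eq_diff_eq)
 have Y0: "Y \<sigma> 0 = N - Y \<sigma> (-1) - Y \<sigma> 1" if "\<sigma> \<in> offs" for \<sigma> using Y[OF that] by (simp add: algebra_simps eq_diff_eq)
 have "(\<Sum>\<sigma>\<in>offs. \<Sum>\<tau>\<in>offs. B (X \<sigma> \<tau>) (Y \<sigma> \<tau>)) =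
   B (X (-1) (-1)) (Y (-1) (-1)) + B (X (-1) 0) (N - Y (-1) (-1) - Y (-1) 1) + B (X (-1) 1) (Y (-1) 1)
   + (B (M - X (-1) (-1) - X 1 (-1)) (Y 0 (-1)) + B (M - X (-1) 0 - X 1 0) (N - Y 0 (-1) - Y 0 1) + B (M - X (-1) 1 - X 1 1) (Y 0 1))
   + (B (X 1 (-1)) (Y 1 (-1)) + B (X 1 0) (N - Y 1 (-1) - Y 1 1) + B (X 1 1) (Y 1 1))"
  by (simp add: X0 Y0)
 then show ?thesis
  using q[of "-1" "-1"] q[of "-1" 1] q[of 1 "-1"] q[of 1 1] by (simp add: diff)
qed

section \<open>Marsden's identity\<close>

text \<open>Bounds that do not change when the interval of length \<open>w\<close> is scaled.\<close>

abbreviation tame :: "real => triple => bool" where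
 "tame w q == \<bar>fst q\<bar> \<le> 1 \<and> \<bar>fst (snd q)\<bar> \<le> 1 \<and> \<bar>snd (snd q)\<bar> * w\<^sup>2 \<le> 2"

abbreviation "tensor_on T == tensor (fst (fst T)) (fst (snd T)) (snd (fst T)) (snd (snd T))"

definition mom :: "nat => real => real => real" where
 "mom k u v = (if k = 0 then 1 else if k = 1 then (u + v) / 2 else u * v)"

definition monot :: "nat => real => real => triple" where
 "monot k u v = (if k = 0 then (1, 1, 0) else if k = 1 then (u, v, 0) else (u\<^sup>2, v\<^sup>2, 1))"

text \<open>The restrictions to \<open>[u, v]\<close>, of length \<open>w\<close>, of the three B-splines that do not vanish there;
 the neighbouring spans have the lengths \<open>a\<close> and \<open>b\<close>.\<close>

definition qleft :: "real => real => triple" where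
 "qleft a w = (w / (a + w), 0, 1 / (w * (a + w)))"
definition qright :: "real => real => triple" where
 "qright b w = (0, w / (w + b), 1 / (w * (w + b)))"
definition qmid :: "real => real => real => triple" where
 "qmid a b w = (a / (a + w), b / (w + b), - (1 / (a + w) + 1 / (w + b)) / w)"

lemma btriple_pieces:
 assumes "0 < a" "0 < b" "0 < w"
 shows "btriple l a w 1 = qleft a w" "btriple a w b 0 = qmid a b w" "btriple w b r (-1) = qright b w"
proof -
 have 1: "2 / p / (2 * w) = 1 / (w * p)" for p :: real by (cases "p = 0 \<or> w = 0") (auto simp: field_simps)
 show "btriple l a w 1 = qleft a w"
  using 1[of "a + w"] by (simp add: btriple_def bval_def bder_def span_def qleft_def)
 show "btriple w b r (-1) = qright b w"
  using 1[of "w + b"] by (simp add: btriple_def bval_def bder_def span_def qright_def)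
 have "(- 2 / (w + b) - 2 / (a + w)) / (2 * w) = - (2 / (a + w) / (2 * w) + 2 / (w + b) / (2 * w))"
  by (simp add: diff_divide_distrib)
 also have "\<dots> = - (1 / (a + w) + 1 / (w + b)) / w"
  unfolding 1 by (simp add: add_divide_distrib diff_divide_distrib divide_divide_eq_left' mult.commute)
 finally show "btriple a w b 0 = qmid a b w"
  by (simp add: btriple_def bval_def bder_def span_def qmid_def)
qed

text \<open>Marsden's identity for the monomials.\<close>

lemma marsden:
 assumes "0 < a" "0 < b" "0 < w" "k \<le> 2"
 shows "mom k (u - a) u *\<^sub>R qleft a w + mom k u (u + w) *\<^sub>R qmid a b w + mom k (u + w) (u + w + b) *\<^sub>R qright b w
   = monot k u (u + w)"
proof -
 have ne: "a + w \<noteq> 0" "w + b \<noteq> 0" "w \<noteq> 0" using assms by auto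
 define p q where "p = 1 / (a + w)" and "q = 1 / (w + b)"
 have pq: "p * (a + w) = 1" "q * (w + b) = 1" using ne by (auto simp: p_def q_def)
 have f: "qleft a w = (w * p, 0, p / w)" "qright b w = (0, w * q, q / w)" "qmid a b w = (a * p, b * q, - (p + q) / w)"
  by (simp_all add: qleft_def qright_def qmid_def p_def q_def field_simps)
 consider "k = 0" | "k = 1" | "k = 2" using assms(4) by linarith
 then show ?thesis
 proof cases
  case 1
  have "w * p + a * p = 1" "b * q + w * q = 1" "p / w + (q / w + (- p - q) / w) = 0"
   using pq by (simp_all add: algebra_simps add_divide_distrib diff_divide_distrib)
  then show ?thesis unfolding f 1 by (simp add: mom_def monot_def field_simps)
 next
  case 2
  have "(2 * u - a) / 2 * (w * p) + (2 * u + w) / 2 * (a * p) = u * (p * (a + w))" by (simp add: field_simps)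
  moreover have "(2 * u + w) / 2 * (b * q) + (2 * u + 2 * w + b) / 2 * (w * q) = (u + w) * (q * (w + b))" by (simp add: field_simps)
  moreover have "(2 * u - a) / 2 * (p / w) + (2 * u + w) / 2 * (- (p + q) / w) + (2 * u + 2 * w + b) / 2 * (q / w) = (q * (w + b) - p * (a + w)) / (2 * w)"
   using ne by (simp add: field_simps)
  ultimately show ?thesis unfolding f 2 pq by (simp add: mom_def monot_def algebra_simps)
 next
  case 3
  have "(u - a) * u * (w * p) + u * (u + w) * (a * p) = u\<^sup>2 * (p * (a + w))" by (simp add: algebra_simps power2_eq_square)
  moreover have "u * (u + w) * (b * q) + (u + w) * (u + w + b) * (w * q) = (u + w)\<^sup>2 * (q * (w + b))" by (simp add: algebra_simps power2_eq_square)
  moreover have "(u - a) * u * (p / w) + u * (u + w) * (- (p + q) / w) + (u + w) * (u + w + b) * (q / w) = (u * (q * (w + b) - p * (a + w)) + w * (q * (w + b))) / w"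
   using ne by (simp add: field_simps)
  ultimately show ?thesis unfolding f 3 pq using ne by (simp add: mom_def monot_def)
 qed
qed

lemma interpolant_scaled:
 assumes "w \<noteq> 0" "h \<noteq> 0"
 shows "interpolant x0 (x0 + w) y0 (y0 + h) v00 v10 v01 v11 k m (x0 + s * w, y0 + t * h) =
  v00 * (1 - s) * (1 - t) + v10 * s * (1 - t) + v01 * (1 - s) * t + v11 * s * t
    + k * (s * w) * (s * w - w) + m * (t * h) * (t * h - h)"
 using assms by (simp add: interpolant_def)

lemma tensor_monomials:
 assumes "x0 < x1" "y0 < y1"
 shows "tensor x0 x1 y0 y1 (monot 0 x0 x1) (monot 0 y0 y1) (x, y) = 1"
  "tensor x0 x1 y0 y1 (monot 1 x0 x1) (monot 0 y0 y1) (x, y) = x"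
  "tensor x0 x1 y0 y1 (monot 0 x0 x1) (monot 1 y0 y1) (x, y) = y"
  "tensor x0 x1 y0 y1 (monot 2 x0 x1) (monot 0 y0 y1) (x, y) = x\<^sup>2"
  "tensor x0 x1 y0 y1 (monot 1 x0 x1) (monot 1 y0 y1) (x, y) = x * y"
  "tensor x0 x1 y0 y1 (monot 0 x0 x1) (monot 2 y0 y1) (x, y) = y\<^sup>2"
proof -
 define w h where "w = x1 - x0" and "h = y1 - y0"
 define s t where "s = (x - x0) / w" and "t = (y - y0) / h"
 have wh: "x1 = x0 + w" "y1 = y0 + h" "w \<noteq> 0" "h \<noteq> 0" using assms by (auto simp: w_def h_def)
 have xy: "x = x0 + s * w" "y = y0 + t * h" using wh by (auto simp: s_def t_def)
 show "tensor x0 x1 y0 y1 (monot 0 x0 x1) (monot 0 y0 y1) (x, y) = 1"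
  "tensor x0 x1 y0 y1 (monot 1 x0 x1) (monot 0 y0 y1) (x, y) = x"
  "tensor x0 x1 y0 y1 (monot 0 x0 x1) (monot 1 y0 y1) (x, y) = y"
  "tensor x0 x1 y0 y1 (monot 2 x0 x1) (monot 0 y0 y1) (x, y) = x\<^sup>2"
  "tensor x0 x1 y0 y1 (monot 1 x0 x1) (monot 1 y0 y1) (x, y) = x * y"
  "tensor x0 x1 y0 y1 (monot 0 x0 x1) (monot 2 y0 y1) (x, y) = y\<^sup>2"
  unfolding xy wh(1,2) tensor_def monot_def
  by (simp_all add: interpolant_scaled[OF wh(3,4)]) (simp_all add: algebra_simps power2_eq_square)
qed

lemma triple_bounds:
 assumes "0 < a" "0 < b" "0 < w" "q \<in> {qleft a w, qmid a b w, qright b w}"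
 shows "\<bar>fst q\<bar> \<le> 1" "\<bar>fst (snd q)\<bar> \<le> 1" "\<bar>snd (snd q)\<bar> * w\<^sup>2 \<le> 2"
proof -
 have r: "w / (a + w) \<le> 1" "w / (w + b) \<le> 1" "a / (a + w) \<le> 1" "b / (w + b) \<le> 1" using assms by auto
 have "\<bar>fst q\<bar> \<le> 1 \<and> \<bar>fst (snd q)\<bar> \<le> 1 \<and> \<bar>snd (snd q)\<bar> * w\<^sup>2 \<le> 2"
 proof -
  have k0: "z / w * w\<^sup>2 = z * w" for z using assms(3) by (simp add: power2_eq_square)
  have k1: "1 / (w * (a + w)) * w\<^sup>2 = w / (a + w)" "1 / (w * (w + b)) * w\<^sup>2 = w / (w + b)"
   using assms(1-3) by (simp_all add: power2_eq_square)
  have k1': "(1 / (a + w) + 1 / (w + b)) / w * w\<^sup>2 = w / (a + w) + w / (w + b)"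
   unfolding k0 by (simp add: distrib_right)
  have k2: "\<bar>1 / (w * (a + w))\<bar> = 1 / (w * (a + w))" "\<bar>1 / (w * (w + b))\<bar> = 1 / (w * (w + b))"
   "\<bar>- (1 / (a + w) + 1 / (w + b)) / w\<bar> = (1 / (a + w) + 1 / (w + b)) / w"
  proof -
   have "0 < 1 / (a + w) + 1 / (w + b)" using assms(1-3) by (simp add: add_pos_pos)
   moreover have "\<bar>- S / w\<bar> = S / w" if "0 < S" for S using that assms(3) by simp
   ultimately show "\<bar>- (1 / (a + w) + 1 / (w + b)) / w\<bar> = (1 / (a + w) + 1 / (w + b)) / w" by blast
  qed (use assms(1-3) in auto)
  have k3: "\<bar>1 / (w * (a + w))\<bar> * w\<^sup>2 \<le> 2" "\<bar>1 / (w * (w + b))\<bar> * w\<^sup>2 \<le> 2"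
   "\<bar>- (1 / (a + w) + 1 / (w + b)) / w\<bar> * w\<^sup>2 \<le> 2"
   unfolding k2 k1 k1' using r by auto
  consider "q = qleft a w" | "q = qmid a b w" | "q = qright b w" using assms(4) by blast
  then show ?thesis
   using r assms(1-3) k3 by cases (auto simp only: qleft_def qmid_def qright_def fst_conv snd_conv; simp)+
 qed
 then show "\<bar>fst q\<bar> \<le> 1" "\<bar>fst (snd q)\<bar> \<le> 1" "\<bar>snd (snd q)\<bar> * w\<^sup>2 \<le> 2" by auto
qed

context extended_mesh
begin

abbreviation "Ih == interp \<Omega> G L H"

lemma center: "K \<in> C ==> patch_center L H K"
 using sizes by unfold_locales auto

lemma finite_centers: "finite C"
proof -
 have "C \<subseteq> G \<union> (\<lambda>(K, i, j). pc K i j) ` (G \<times> offs \<times> offs)"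
  unfolding centers_def interior_cells_def boundary_cells_def extension_cells_def by (auto simp: image_iff)
 then show ?thesis by (rule finite_subset) (auto intro!: finite_imageI finite_cartesian_product fin)
qed

lemma basis_eq:
 assumes "K \<in> C"
 shows "basis L H K z = (\<Sum>\<alpha>\<in>offs. \<Sum>\<beta>\<in>offs. if z \<in> interior (region (pc K \<alpha> \<beta>))
   then tensor (fst (fst (pc K \<alpha> \<beta>))) (fst (snd (pc K \<alpha> \<beta>))) (snd (fst (pc K \<alpha> \<beta>))) (snd (snd (pc K \<alpha> \<beta>)))
    (patch_center.tx L K \<alpha>) (patch_center.ty H K \<beta>) z else 0)"
proof -
 interpret patch_center L H K by (rule center[OF assms])
 show ?thesis
  unfolding basis_def basis_pieces_eq piece_def by (intro sum.cong refl) (auto simp: patch_cell_def)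
qed

lemma interp_local:
 assumes T: "T \<in> G" and z: "z \<in> interior (region T)"
  and K1: "\<And>i j. i \<in> offs ==> j \<in> offs ==> K i j \<in> C \<and> pc (K i j) (-i) (-j) = T"
  and K2: "\<And>E \<alpha> \<beta>. E \<in> C ==> \<alpha> \<in> offs ==> \<beta> \<in> offs ==>
    interior (region (pc E \<alpha> \<beta>)) \<inter> interior (region T) \<noteq> {} ==> E = K (-\<alpha>) (-\<beta>)"
 shows "Ih v z = (\<Sum>i\<in>offs. \<Sum>j\<in>offs. lam L H (K i j) v *
   tensor_on T
    (patch_center.tx L (K i j) (-i)) (patch_center.ty H (K i j) (-j)) z)"
proof -
 let ?t = "\<lambda>E \<alpha> \<beta>. tensor (fst (fst (pc E \<alpha> \<beta>))) (fst (snd (pc E \<alpha> \<beta>))) (snd (fst (pc E \<alpha> \<beta>))) (snd (snd (pc E \<alpha> \<beta>)))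
    (patch_center.tx L E \<alpha>) (patch_center.ty H E \<beta>) z"
 have "Ih v z = (\<Sum>E\<in>C. \<Sum>\<alpha>\<in>offs. \<Sum>\<beta>\<in>offs. if z \<in> interior (region (pc E \<alpha> \<beta>))
   then lam L H E v * ?t E \<alpha> \<beta> else 0)"
  unfolding interp_def sum_distrib_left
 proof (rule sum.cong[OF refl])
  fix E assume "E \<in> C"
  then show "lam L H E v * basis L H E z = (\<Sum>\<alpha>\<in>offs. \<Sum>\<beta>\<in>offs. if z \<in> interior (region (pc E \<alpha> \<beta>))
    then lam L H E v * ?t E \<alpha> \<beta> else 0)"
   unfolding basis_eq[OF \<open>E \<in> C\<close>] sum_distrib_left by (intro sum.cong refl) auto
 qed
 also have "\<dots> = (\<Sum>\<alpha>\<in>offs. \<Sum>E\<in>C. \<Sum>\<beta>\<in>offs. if z \<in> interior (region (pc E \<alpha> \<beta>))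
   then lam L H E v * ?t E \<alpha> \<beta> else 0)"
  by (rule sum.swap)
 also have "\<dots> = (\<Sum>\<alpha>\<in>offs. \<Sum>\<beta>\<in>offs. \<Sum>E\<in>C. if z \<in> interior (region (pc E \<alpha> \<beta>))
   then lam L H E v * ?t E \<alpha> \<beta> else 0)"
  by (intro sum.cong refl) (rule sum.swap)
 also have "\<dots> = (\<Sum>\<alpha>\<in>offs. \<Sum>\<beta>\<in>offs. lam L H (K (-\<alpha>) (-\<beta>)) v * ?t (K (-\<alpha>) (-\<beta>)) \<alpha> \<beta>)"
 proof (intro sum.cong refl)
  fix \<alpha> \<beta> :: int assume ab: "\<alpha> \<in> offs" "\<beta> \<in> offs"
  have m: "-\<alpha> \<in> offs" "-\<beta> \<in> offs" using ab by auto
  have k: "K (-\<alpha>) (-\<beta>) \<in> C" "pc (K (-\<alpha>) (-\<beta>)) \<alpha> \<beta> = T" using K1[OF m] by auto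
  have "(\<Sum>E\<in>C. if z \<in> interior (region (pc E \<alpha> \<beta>)) then lam L H E v * ?t E \<alpha> \<beta> else 0)
    = (\<Sum>E\<in>{K (-\<alpha>) (-\<beta>)}. if z \<in> interior (region (pc E \<alpha> \<beta>)) then lam L H E v * ?t E \<alpha> \<beta> else 0)"
  proof (rule sum.mono_neutral_right[OF finite_centers])
   show "{K (-\<alpha>) (-\<beta>)} \<subseteq> C" using k by simp
   show "\<forall>E\<in>C - {K (-\<alpha>) (-\<beta>)}. (if z \<in> interior (region (pc E \<alpha> \<beta>)) then lam L H E v * ?t E \<alpha> \<beta> else 0) = 0"
    using K2[OF _ ab] z by (metis (no_types, lifting) DiffD1 DiffD2 IntI empty_iff singletonI)
  qed
  then show "(\<Sum>E\<in>C. if z \<in> interior (region (pc E \<alpha> \<beta>)) then lam L H E v * ?t E \<alpha> \<beta> else 0) =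
   lam L H (K (-\<alpha>) (-\<beta>)) v * ?t (K (-\<alpha>) (-\<beta>)) \<alpha> \<beta>" using k z by simp
 qed
 also have "\<dots> = (\<Sum>i\<in>offs. \<Sum>j\<in>offs. lam L H (K i j) v * ?t (K i j) (-i) (-j))"
  by simp
 also have "\<dots> = (\<Sum>i\<in>offs. \<Sum>j\<in>offs. lam L H (K i j) v *
   tensor_on T
    (patch_center.tx L (K i j) (-i)) (patch_center.ty H (K i j) (-j)) z)"
  using K1 by (intro sum.cong refl) simp
 finally show ?thesis .
qed

lemma lam_quad_mom:
 assumes "K \<in> C"
 shows "lam L H K (quad a b c d e f) =
  (let p = (\<lambda>k. mom k (fst (fst K)) (fst (snd K))); q = (\<lambda>k. mom k (snd (fst K)) (snd (snd K)))
   in a * (p 0 * q 0) + b * (p 1 * q 0) + c * (p 0 * q 1) + d * (p 2 * q 0) + e * (p 1 * q 1) + f * (p 0 * q 2))"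
proof -
 interpret patch_center L H K by (rule center[OF assms])
 show ?thesis unfolding lam_quad by (simp add: mom_def xknot_def yknot_def)
qed

text \<open>The bounds on the coefficients are independent of the mesh: the B-splines take values in \<open>[0, 1]\<close>, and
  their second derivatives are scaled by the square of the cell width. Reproduction of quadratics
  follows from Marsden's identity in each variable.\<close>

theorem local_interpolant:
 assumes T: "T \<in> G"
 obtains K q r where
  "\<And>i j. i \<in> offs ==> j \<in> offs ==> K i j \<in> C \<and> pc (K i j) (-i) (-j) = T"
  "\<And>v z. z \<in> interior (region T) ==> Ih v z = (\<Sum>i\<in>offs. \<Sum>j\<in>offs. lam L H (K i j) v *
   tensor_on T (q i j) (r i j) z)"
  "\<And>i j. i \<in> offs ==> j \<in> offs ==> tame (width T) (q i j)"
  "\<And>i j. i \<in> offs ==> j \<in> offs ==> tame (height T) (r i j)"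
  "\<And>p z. p \<in> P2 ==> z \<in> interior (region T) ==> Ih p z = p z"
proof -
 obtain K where K:
  "\<And>i j. i \<in> offs ==> j \<in> offs ==> K i j \<in> C \<and> pc (K i j) (-i) (-j) = T"
  "\<And>E \<alpha> \<beta>. E \<in> C ==> \<alpha> \<in> offs ==> \<beta> \<in> offs ==>
    interior (region (pc E \<alpha> \<beta>)) \<inter> interior (region T) \<noteq> {} ==> E = K (-\<alpha>) (-\<beta>)"
  "\<And>i j. i \<in> signs ==> j \<in> offs ==> L (K 0 j) i = L (K i j) 0"
  "\<And>i j. i \<in> offs ==> j \<in> signs ==> H (K i 0) j = H (K i j) 0"
  "\<And>i j. i \<in> signs ==> j \<in> signs ==>
    L (K i j) 0 = L (K i 0) 0 \<or> H (K i j) 0 = H (K 0 j) 0"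
  by (rule nine_centers[OF T]) blast
 define x0 x1 y0 y1 w h where "x0 = fst (fst T)" and "x1 = fst (snd T)" and "y0 = snd (fst T)" and "y1 = snd (snd T)"
  and "w = width T" and "h = height T"
 have n: "nondegenerate T" using nondeg T by blast
 have wh: "x1 = x0 + w" "y1 = y0 + h" "0 < w" "0 < h"
  using n by (auto simp: x0_def x1_def y0_def y1_def w_def h_def width_def height_def nondegenerate_def)
 define a where "a i j = L (K i j) 0" for i j :: int
 define b where "b i j = H (K i j) 0" for i j :: int
 have pos: "0 < a i j" "0 < b i j" if "i \<in> offs" "j \<in> offs" for i j
  using K(1)[OF that] sizes(3,4)[of "K i j" 0] by (simp_all add: a_def b_def)
 have own: "L (K i j) (-i) = w" "H (K i j) (-j) = h" if "i \<in> offs" "j \<in> offs" for i j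
 proof -
  have "-i \<in> offs" "-j \<in> offs" using that by auto
  then show "L (K i j) (-i) = w" "H (K i j) (-j) = h"
   using patch_lengths[of "K i j" "-i" "-j"] K(1)[OF that] by (auto simp: w_def h_def)
 qed
 define q where "q i j = (if i = -1 then qleft (a (-1) j) w else if i = 0 then qmid (a (-1) j) (a 1 j) w else qright (a 1 j) w)" for i j :: int
 define r where "r i j = (if j = -1 then qleft (b i (-1)) h else if j = 0 then qmid (b i (-1)) (b i 1) h else qright (b i 1) h)" for i j :: int
 have tx: "patch_center.tx L (K i j) (-i) = q i j" if "i \<in> offs" "j \<in> offs" for i j
 proof -
  have "patch_center L H (K i j)" using K(1)[OF that] center by blast
  then have "patch_center.tx L (K i j) (-i) = btriple (L (K i j) (-1)) (L (K i j) 0) (L (K i j) 1) (-i)"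
   by (simp add: patch_center.tx_def)
  also have "\<dots> = q i j"
   using that own(1)[OF that] K(3)[OF _ that(2), of 1] K(3)[OF _ that(2), of "-1"] wh pos(1)[OF _ that(2), of 1] pos(1)[OF _ that(2), of "-1"]
   by (auto simp: q_def a_def btriple_pieces)
  finally show ?thesis .
 qed
 have ty: "patch_center.ty H (K i j) (-j) = r i j" if "i \<in> offs" "j \<in> offs" for i j
 proof -
  have "patch_center L H (K i j)" using K(1)[OF that] center by blast
  then have "patch_center.ty H (K i j) (-j) = btriple (H (K i j) (-1)) (H (K i j) 0) (H (K i j) 1) (-j)"
   by (simp add: patch_center.ty_def)
  also have "\<dots> = r i j"
   using that own(2)[OF that] K(4)[OF that(1), of 1] K(4)[OF that(1), of "-1"] wh pos(2)[OF that(1), of 1] pos(2)[OF that(1), of "-1"]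
   by (auto simp: r_def b_def btriple_pieces)
  finally show ?thesis .
 qed
 have loc: "Ih v z = (\<Sum>i\<in>offs. \<Sum>j\<in>offs. lam L H (K i j) v * tensor x0 x1 y0 y1 (q i j) (r i j) z)"
  if "z \<in> interior (region T)" for v z
 proof -
  have "Ih v z = (\<Sum>i\<in>offs. \<Sum>j\<in>offs. lam L H (K i j) v * tensor x0 x1 y0 y1
    (patch_center.tx L (K i j) (-i)) (patch_center.ty H (K i j) (-j)) z)"
   unfolding x0_def x1_def y0_def y1_def by (rule interp_local[OF T that]) (use K(1,2) in blast)+
  also have "\<dots> = (\<Sum>i\<in>offs. \<Sum>j\<in>offs. lam L H (K i j) v * tensor x0 x1 y0 y1 (q i j) (r i j) z)"
   by (intro sum.cong refl) (simp only: tx ty)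
  finally show ?thesis .
 qed
 have sides: "fst (fst (K i j)) = (if i = -1 then x0 - a i j else if i = 0 then x0 else x1)"
   "fst (snd (K i j)) = fst (fst (K i j)) + a i j"
   "snd (fst (K i j)) = (if j = -1 then y0 - b i j else if j = 0 then y0 else y1)"
   "snd (snd (K i j)) = snd (fst (K i j)) + b i j" if "i \<in> offs" "j \<in> offs" for i j
 proof -
  have k: "L (K i j) 0 = width (K i j)" "H (K i j) 0 = height (K i j)" "pc (K i j) (-i) (-j) = T"
   using K(1)[OF that] sizes by auto
  then show "fst (snd (K i j)) = fst (fst (K i j)) + a i j" "snd (snd (K i j)) = snd (fst (K i j)) + b i j"
   by (auto simp: a_def b_def width_def height_def)
  show "fst (fst (K i j)) = (if i = -1 then x0 - a i j else if i = 0 then x0 else x1)"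
   "snd (fst (K i j)) = (if j = -1 then y0 - b i j else if j = 0 then y0 else y1)"
   using that k by (auto simp: x0_def x1_def y0_def y1_def a_def b_def patch_cell_def xknot_def yknot_def width_def height_def)
 qed
 have a0: "a 0 j = w" if "j \<in> offs" for j using own(1)[of 0 j] that by (simp add: a_def)
 have b0: "b i 0 = h" if "i \<in> offs" for i using own(2)[of i 0] that by (simp add: b_def)
 define XX where "XX k i j = mom k (fst (fst (K i j))) (fst (snd (K i j))) *\<^sub>R q i j" for k i j
 define YY where "YY k i j = mom k (snd (fst (K i j))) (snd (snd (K i j))) *\<^sub>R r i j" for k i j
 have mono: "(\<Sum>i\<in>offs. \<Sum>j\<in>offs. tensor x0 x1 y0 y1 (XX k i j) (YY m i j) z) = tensor x0 x1 y0 y1 (monot k x0 x1) (monot m y0 y1) z"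
  if "k \<le> 2" "m \<le> 2" for k m z
 proof (rule nine_products[where B = "\<lambda>p q. tensor x0 x1 y0 y1 p q z"])
  fix j :: int assume t: "j \<in> offs"
  show "XX k (-1) j + XX k 0 j + XX k 1 j = monot k x0 x1"
   using marsden[OF pos(1)[OF _ t] pos(1)[OF _ t] wh(3) that(1), of "-1" 1 x0] sides[OF _ t] a0[OF t] wh(1)
   by (simp add: XX_def q_def)
 next
  fix i :: int assume t: "i \<in> offs"
  show "YY m i (-1) + YY m i 0 + YY m i 1 = monot m y0 y1"
   using marsden[OF pos(2)[OF t] pos(2)[OF t] wh(4) that(2), of "-1" 1 y0] sides[OF t] b0[OF t] wh(2)
   by (simp add: YY_def r_def)
 next
  fix i j :: int assume st: "i \<in> signs" "j \<in> signs"
  have o: "i \<in> offs" "j \<in> offs" "(0::int) \<in> offs" using st by auto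
  have "a i j = a i 0 \<or> b i j = b 0 j" using K(5)[OF st] by (simp add: a_def b_def)
  then show "XX k i j = XX k i 0 \<or> YY m i j = YY m 0 j"
   using st sides[OF o(1,2)] sides[OF o(1,3)] sides[OF o(3,2)] by (auto simp: XX_def YY_def q_def r_def)
 qed (simp_all add: tensor_add_left tensor_add_right)
 have rep: "Ih p z = p z" if p: "p \<in> P2" and z: "z \<in> interior (region T)" for p z
 proof -
  obtain c0 c1 c2 c3 c4 c5 where pq: "p = quad c0 c1 c2 c3 c4 c5" using p P2_iff by blast
  define t where "t k m = (\<lambda>i j. tensor x0 x1 y0 y1 (XX k i j) (YY m i j) z)" for k m
  have "lam L H (K i j) p * tensor x0 x1 y0 y1 (q i j) (r i j) z =
   c0 * t 0 0 i j + c1 * t 1 0 i j + c2 * t 0 1 i j + c3 * t 2 0 i j + c4 * t 1 1 i j + c5 * t 0 2 i j"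
   if "i \<in> offs" "j \<in> offs" for i j
   using K(1)[OF that] unfolding pq t_def XX_def YY_def tensor_scale
   by (simp add: lam_quad_mom Let_def distrib_right)
  then have "Ih p z = (\<Sum>i\<in>offs. \<Sum>j\<in>offs.
   c0 * t 0 0 i j + c1 * t 1 0 i j + c2 * t 0 1 i j + c3 * t 2 0 i j + c4 * t 1 1 i j + c5 * t 0 2 i j)"
   unfolding loc[OF z] by (intro sum.cong refl) blast
  also have "\<dots> = c0 * (\<Sum>i\<in>offs. \<Sum>j\<in>offs. t 0 0 i j) + c1 * (\<Sum>i\<in>offs. \<Sum>j\<in>offs. t 1 0 i j) + c2 * (\<Sum>i\<in>offs. \<Sum>j\<in>offs. t 0 1 i j)
   + c3 * (\<Sum>i\<in>offs. \<Sum>j\<in>offs. t 2 0 i j) + c4 * (\<Sum>i\<in>offs. \<Sum>j\<in>offs. t 1 1 i j) + c5 * (\<Sum>i\<in>offs. \<Sum>j\<in>offs. t 0 2 i j)"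
   unfolding sum.distrib sum_distrib_left ..
  also have "\<dots> = p z"
  proof -
   have le: "(0::nat) \<le> 2" "(1::nat) \<le> 2" "(2::nat) \<le> 2" by auto
   obtain x y where xy: "z = (x, y)" by (metis surj_pair)
   have "x0 < x1" "y0 < y1" using wh by auto
   note m = tensor_monomials[OF this]
   show ?thesis
    unfolding t_def mono[OF le(1,1)] mono[OF le(2,1)] mono[OF le(1,2)] mono[OF le(3,1)] mono[OF le(2,2)] mono[OF le(1,3)]
    unfolding xy m pq quad_def by simp
  qed
  finally show ?thesis .
 qed
 show ?thesis
 proof (rule that[of K q r])
  show "K i j \<in> C \<and> pc (K i j) (-i) (-j) = T" if "i \<in> offs" "j \<in> offs" for i j using K(1)[OF that] .
  show "Ih v z = (\<Sum>i\<in>offs. \<Sum>j\<in>offs. lam L H (K i j) v *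
   tensor_on T (q i j) (r i j) z)" if "z \<in> interior (region T)" for v z
   using loc[OF that] unfolding x0_def x1_def y0_def y1_def .
  show "tame (width T) (q i j)"
   if "i \<in> offs" "j \<in> offs" for i j
  proof -
   have "q i j \<in> {qleft (a (-1) j) w, qmid (a (-1) j) (a 1 j) w, qright (a 1 j) w}" by (simp add: q_def)
   then show ?thesis
    using triple_bounds[OF pos(1)[OF _ that(2)] pos(1)[OF _ that(2)] wh(3), of "-1" 1 "q i j"] unfolding w_def by simp
  qed
  show "tame (height T) (r i j)"
   if "i \<in> offs" "j \<in> offs" for i j
  proof -
   have "r i j \<in> {qleft (b i (-1)) h, qmid (b i (-1)) (b i 1) h, qright (b i 1) h}" by (simp add: r_def)
   then show ?thesis
    using triple_bounds[OF pos(2)[OF that(1)] pos(2)[OF that(1)] wh(4), of "-1" 1 "r i j"] unfolding h_def by simp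
  qed
  show "Ih p z = p z" if "p \<in> P2" "z \<in> interior (region T)" for p z using rep[OF that] .
 qed
qed

end

section \<open>Smooth functions of one variable\<close>

text \<open>A coinductive definition makes a function smooth as soon as it belongs to a class of functions closed
  under differentiation.\<close>

coinductive smooth :: "(real => real) => bool" where
 "(\<And>x. (f has_real_derivative f' x) (at x)) ==> smooth f' ==> smooth f"

text \<open>The closure of the smooth functions under sums and products is closed under
  differentiation.\<close>

inductive smooth_generated :: "(real => real) => bool" where
 "smooth f ==> smooth_generated f"
| "smooth_generated f ==> smooth_generated g ==> smooth_generated (\<lambda>x. f x + g x)"
| "smooth_generated f ==> smooth_generated g ==> smooth_generated (\<lambda>x. f x * g x)"

lemma smooth_generated_derivative:
 "smooth_generated f ==> \<exists>f'. (\<forall>x. (f has_real_derivative f' x) (at x)) \<and> smooth_generated f'"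
proof (induction rule: smooth_generated.induct)
 case (1 f)
 then show ?case by (cases rule: smooth.cases) (blast intro: smooth_generated.intros)
next
 case (2 f g)
 then obtain f' g' where "\<And>x. (f has_real_derivative f' x) (at x)" "smooth_generated f'"
  "\<And>x. (g has_real_derivative g' x) (at x)" "smooth_generated g'" by blast
 then show ?case
  by (intro exI[of _ "\<lambda>x. f' x + g' x"]) (auto intro!: derivative_eq_intros smooth_generated.intros(2))
next
 case (3 f g)
 then obtain f' g' where "\<And>x. (f has_real_derivative f' x) (at x)" "smooth_generated f'"
  "\<And>x. (g has_real_derivative g' x) (at x)" "smooth_generated g'" by blast
 then show ?case using 3(1,2)
  by (intro exI[of _ "\<lambda>x. f' x * g x + g' x * f x"]) (auto intro!: derivative_eq_intros smooth_generated.intros(2,3))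
qed

lemma smooth_of_generated:
 assumes "smooth_generated f" shows "smooth f"
 using assms
proof (coinduction arbitrary: f rule: smooth.coinduct)
 case smooth
 then show ?case using smooth_generated_derivative by blast
qed

lemma smooth_mult: "smooth f ==> smooth g ==> smooth (\<lambda>x. f x * g x)"
 by (rule smooth_of_generated) (blast intro: smooth_generated.intros(1) smooth_generated.intros(3))

lemma smooth_add: "smooth f ==> smooth g ==> smooth (\<lambda>x. f x + g x)"
 by (rule smooth_of_generated) (blast intro: smooth_generated.intros(1) smooth_generated.intros(2))

lemma smooth_const: "smooth (\<lambda>x. c)"
proof (coinduction arbitrary: c rule: smooth.coinduct)
 case smooth
 show ?case by (intro exI[of _ "\<lambda>x. c"] exI[of _ "\<lambda>x. 0::real"]) auto
qed

lemma smooth_affine: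
 assumes "smooth f" shows "smooth (\<lambda>x. f (a * x + b))"
proof -
 have "\<exists>c h. smooth h \<and> (\<lambda>x. f (a * x + b)) = (\<lambda>x. c * h (a * x + b))"
  using assms by (intro exI[of _ 1] exI[of _ f]) auto
 then show ?thesis
 proof (coinduction arbitrary: f rule: smooth.coinduct)
  case smooth
  then obtain c h where h: "smooth h" "(\<lambda>x. f (a * x + b)) = (\<lambda>x. c * h (a * x + b))" by blast
  obtain h' where h': "\<And>x. (h has_real_derivative h' x) (at x)" "smooth h'"
   using h(1) by (cases rule: smooth.cases) blast
  have d: "((\<lambda>x. f (a * x + b)) has_real_derivative c * a * h' (a * x + b)) (at x)" for x
   unfolding h(2) by (auto intro!: derivative_eq_intros DERIV_chain2[OF h'(1)])
  show ?case
  proof (intro exI conjI allI)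
   show "(\<lambda>x. f (a * x + b)) = (\<lambda>x. f (a * x + b))" ..
   show "((\<lambda>x. f (a * x + b)) has_real_derivative (\<lambda>x. c * a * h' (a * x + b)) x) (at x)" for x using d .
   show "(\<exists>g. (\<lambda>x. c * a * h' (a * x + b)) = (\<lambda>x. g (a * x + b)) \<and> (\<exists>c h. smooth h \<and> (\<lambda>x. g (a * x + b)) = (\<lambda>x. c * h (a * x + b)))) \<or> smooth (\<lambda>x. c * a * h' (a * x + b))"
    by (rule disjI1, intro exI[of _ "\<lambda>x. c * a * h' x"] conjI exI[of _ "c * a"] exI[of _ h']) (auto simp: h'(2))
  qed
 qed
qed

lemma smooth_continuous: "smooth f ==> continuous_on A f"
 by (erule smooth.cases) (meson DERIV_isCont continuous_at_imp_continuous_on)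

text \<open>The function \<open>exp (-1/x)\<close>, extended by zero; its derivatives are of the form
 \<open>p (1/x) exp (-1/x)\<close> with a polynomial \<open>p\<close>.\<close>

definition flat :: "real poly => real => real" where
 "flat p x = (if 0 < x then poly p (1 / x) * exp (- 1 / x) else 0)"

lemma poly_exp_tendsto_0: "((\<lambda>x. poly p x * exp (- x)) \<longlongrightarrow> (0::real)) at_top"
proof (induction p)
 case 0 then show ?case by simp
next
 case (pCons a p)
 have e: "((\<lambda>x. exp (- x)) \<longlongrightarrow> (0::real)) at_top"
  using tendsto_power_div_exp_0[of 0] by (simp add: exp_minus inverse_eq_divide)
 have x: "((\<lambda>x. x * (poly p x * exp (- x))) \<longlongrightarrow> (0::real)) at_top"
 proof -
  have "((\<lambda>x. x ^ k * exp (- x)) \<longlongrightarrow> (0::real)) at_top" for k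
   using tendsto_power_div_exp_0[of k] by (simp add: exp_minus divide_inverse)
  then have "((\<lambda>x. \<Sum>i\<le>degree p. coeff p i * (x ^ Suc i * exp (- x))) \<longlongrightarrow> (\<Sum>i\<le>degree p. coeff p i * 0)) at_top"
   by (intro tendsto_sum tendsto_mult tendsto_const)
  moreover have "(\<lambda>x. \<Sum>i\<le>degree p. coeff p i * (x ^ Suc i * exp (- x))) = (\<lambda>x. x * (poly p x * exp (- x)))"
   by (auto simp: poly_altdef sum_distrib_left sum_distrib_right mult_ac fun_eq_iff)
  ultimately show ?thesis by simp
 qed
 show ?case
  using tendsto_add[OF tendsto_mult_left[OF e, of a] x] by (simp add: algebra_simps)
qed

lemma flat_derivative: "(flat p has_real_derivative flat ([:0, 0, 1:] * (p - pderiv p)) x) (at x)"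
proof -
 consider "0 < x" | "x < 0" | "x = 0" by linarith
 then show ?thesis
 proof cases
  case 1
  have "((\<lambda>x. poly p (1 / x) * exp (- 1 / x)) has_real_derivative flat ([:0, 0, 1:] * (p - pderiv p)) x) (at x)"
   using 1 by (auto intro!: derivative_eq_intros DERIV_chain2[OF poly_DERIV] simp: flat_def field_simps power2_eq_square)
  moreover have "\<forall>\<^sub>F t in nhds x. poly p (1 / t) * exp (- 1 / t) = flat p t"
   using eventually_nhds_in_open[of "{0<..}" x] 1 by (auto simp: flat_def elim!: eventually_mono)
  ultimately show ?thesis
   by (subst (asm) DERIV_cong_ev[OF refl _ refl]) auto
 next
  case 2
  have "((\<lambda>x. 0) has_real_derivative flat ([:0, 0, 1:] * (p - pderiv p)) x) (at x)"
   using 2 by (auto simp: flat_def)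
  moreover have "\<forall>\<^sub>F t in nhds x. 0 = flat p t"
   using eventually_nhds_in_open[of "{..<0}" x] 2 by (auto simp: flat_def elim!: eventually_mono)
  ultimately show ?thesis
   by (subst (asm) DERIV_cong_ev[OF refl _ refl]) auto
 next
  case 3
  have "((\<lambda>h. flat p h / h) \<longlongrightarrow> 0) (at 0)"
  proof (rule filterlim_split_at)
   have "((\<lambda>h. flat p h / h) \<longlongrightarrow> 0) (at_left 0) \<longleftrightarrow> ((\<lambda>h. 0::real) \<longlongrightarrow> 0) (at_left (0::real))"
    by (intro filterlim_cong refl) (auto simp: flat_def eventually_at_filter)
   then show "((\<lambda>h. flat p h / h) \<longlongrightarrow> 0) (at_left 0)" by simp
   have "((\<lambda>h. poly ([:0, 1:] * p) (inverse h) * exp (- inverse h)) \<longlongrightarrow> 0) (at_right (0::real))"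
    by (rule filterlim_compose[OF poly_exp_tendsto_0 filterlim_inverse_at_top_right])
   moreover have "\<forall>\<^sub>F h in at_right 0. poly ([:0, 1:] * p) (inverse h) * exp (- inverse h) = flat p h / h"
    by (auto simp: flat_def eventually_at_filter inverse_eq_divide)
   ultimately show "((\<lambda>h. flat p h / h) \<longlongrightarrow> 0) (at_right 0)"
    using filterlim_cong[OF refl refl] by fast
  qed
  then show ?thesis
   using 3 by (simp add: DERIV_def flat_def)
 qed
qed

lemma smooth_flat: "smooth (flat p)"
proof (coinduction arbitrary: p rule: smooth.coinduct)
 case smooth
 show ?case using flat_derivative by blast
qed

text \<open>A product of two smooth steps, placed so that the support lies in \<open>[a, b]\<close> for every \<open>n\<close>. The steps get
  steeper with \<open>n\<close>, and the bumps converge to the indicator of the open interval.\<close>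

definition bump :: "nat => real => real => real => real" where
 "bump n a b x = flat 1 (real (Suc n) * (x - a)) * flat 1 (real (Suc n) * (b - x))"

lemma smooth_bump: "smooth (bump n a b)"
proof -
 have "bump n a b = (\<lambda>x. flat 1 (real (Suc n) * x + (- real (Suc n) * a)) * flat 1 ((- real (Suc n)) * x + real (Suc n) * b))"
  by (auto simp: bump_def fun_eq_iff algebra_simps)
 then show ?thesis using smooth_mult[OF smooth_affine[OF smooth_flat] smooth_affine[OF smooth_flat]] by simp
qed

lemma bump_bounds: "0 \<le> bump n a b x" "bump n a b x \<le> 1"
proof -
 have "0 \<le> flat 1 t \<and> flat 1 t \<le> 1" for t by (auto simp: flat_def)
 then show "0 \<le> bump n a b x" "bump n a b x \<le> 1" by (auto simp: bump_def mult_le_one)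
qed

lemma bump_outside: "x \<notin> {a<..<b} ==> bump n a b x = 0"
 by (auto simp: bump_def flat_def zero_less_mult_iff)

lemma bump_tendsto: "(\<lambda>n. bump n a b x) \<longlonglongrightarrow> indicator {a<..<b} x"
proof (cases "x \<in> {a<..<b}")
 case False
 then have "(\<lambda>n. bump n a b x) = (\<lambda>n. 0)" using bump_outside by blast
 then show ?thesis using False by simp
next
 case True
 have "(\<lambda>n. flat 1 (real (Suc n) * t)) \<longlonglongrightarrow> 1" if "0 < t" for t
 proof -
  have "(\<lambda>n. inverse (real (Suc n))) \<longlonglongrightarrow> 0" by (rule LIMSEQ_inverse_real_of_nat)
  then have "(\<lambda>n. exp (- (inverse (real (Suc n)) * inverse t))) \<longlonglongrightarrow> exp (- (0 * inverse t))"
   by (intro tendsto_intros)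
  moreover have "exp (- (inverse (real (Suc n)) * inverse t)) = flat 1 (real (Suc n) * t)" for n
   using that by (simp add: flat_def inverse_eq_divide del: of_nat_Suc)
  ultimately show ?thesis by simp
 qed
 then have "(\<lambda>n. bump n a b x) \<longlonglongrightarrow> 1 * 1"
  unfolding bump_def using True by (intro tendsto_mult) auto
 then show ?thesis using True by simp
qed

section \<open>Test functions\<close>

lemma pdx_product:
 assumes "\<And>x. (f has_real_derivative f' x) (at x)"
 shows "pdx (\<lambda>p. f (fst p) * g (snd p)) = (\<lambda>p. f' (fst p) * g (snd p))"
proof
 fix p :: pt
 show "pdx (\<lambda>p. f (fst p) * g (snd p)) p = f' (fst p) * g (snd p)"
  unfolding pdx_def fst_conv snd_conv by (rule DERIV_imp_deriv) (auto intro!: derivative_eq_intros assms)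
qed

lemma pdy_product:
 assumes "\<And>x. (g has_real_derivative g' x) (at x)"
 shows "pdy (\<lambda>p. f (fst p) * g (snd p)) = (\<lambda>p. f (fst p) * g' (snd p))"
proof
 fix p :: pt
 show "pdy (\<lambda>p. f (fst p) * g (snd p)) p = f (fst p) * g' (snd p)"
  unfolding pdy_def fst_conv snd_conv by (rule DERIV_imp_deriv) (auto intro!: derivative_eq_intros assms)
qed

lemma product_continuous:
 assumes "smooth f" "smooth g"
 shows "continuous_on A (\<lambda>p::pt. f (fst p) * g (snd p))"
proof (rule continuous_on_mult)
 show "continuous_on A (\<lambda>p::pt. f (fst p))"
  by (rule continuous_on_compose2[OF smooth_continuous[OF assms(1), of UNIV] continuous_on_fst[OF continuous_on_id]]) simp
 show "continuous_on A (\<lambda>p::pt. g (snd p))"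
  by (rule continuous_on_compose2[OF smooth_continuous[OF assms(2), of UNIV] continuous_on_snd[OF continuous_on_id]]) simp
qed

lemma Ck_product: "smooth f ==> smooth g ==> Ck k (\<lambda>p. f (fst p) * g (snd p))"
proof (induction k arbitrary: f g)
 case 0 then show ?case using product_continuous by simp
next
 case (Suc k)
 obtain f' where f': "\<And>x. (f has_real_derivative f' x) (at x)" "smooth f'"
  using Suc.prems(1) by (cases rule: smooth.cases) blast
 obtain g' where g': "\<And>x. (g has_real_derivative g' x) (at x)" "smooth g'"
  using Suc.prems(2) by (cases rule: smooth.cases) blast
 have d1: "(\<lambda>t. f t * g y) field_differentiable at x" for x y
  unfolding field_differentiable_def by (rule exI, rule DERIV_cmult_right[OF f'(1)])
 have d2: "(\<lambda>t. f x * g t) field_differentiable at y" for x y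
  unfolding field_differentiable_def by (rule exI, rule DERIV_cmult[OF g'(1)])
 show ?case
  using d1 d2 product_continuous[OF Suc.prems] Suc.IH[OF f'(2) Suc.prems(2)] Suc.IH[OF Suc.prems(1) g'(2)]
  by (simp add: pdx_product[OF f'(1)] pdy_product[OF g'(1)])
qed

lemma support_box:
 fixes \<psi> :: "pt => real"
 assumes "\<And>z. z \<notin> cbox p q ==> \<psi> z = 0"
 shows "closure {x. \<psi> x \<noteq> 0} \<subseteq> cbox p q" "compact (closure {x. \<psi> x \<noteq> 0})"
proof -
 show s: "closure {x. \<psi> x \<noteq> 0} \<subseteq> cbox p q"
  by (rule closure_minimal) (use assms in auto)
 have "bounded {x. \<psi> x \<noteq> 0}"
  using s closure_subset bounded_cbox bounded_subset by (metis (no_types, lifting))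
 then show "compact (closure {x. \<psi> x \<noteq> 0})"
  using compact_eq_bounded_closed bounded_closure by blast
qed

lemma product_test_function:
 assumes "smooth f" "smooth g" "\<And>x. x \<notin> {a..b} ==> f x = 0" "\<And>y. y \<notin> {c..d} ==> g y = 0"
  and "cbox (a, c) (b, d) \<subseteq> U"
 shows "(\<lambda>p. f (fst p) * g (snd p)) \<in> test_functions U"
proof -
 have z: "f (fst z) * g (snd z) = 0" if "z \<notin> cbox (a, c) (b, d)" for z
  using that assms(3)[of "fst z"] assms(4)[of "snd z"] by (cases z) auto
 show ?thesis
  unfolding test_functions_def mem_Collect_eq
 proof (intro conjI allI)
  show "Ck k (\<lambda>p. f (fst p) * g (snd p))" for k by (rule Ck_product[OF assms(1,2)])
  show "compact (closure {x. f (fst x) * g (snd x) \<noteq> 0})" by (rule support_box(2)) (rule z)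
  show "closure {x. f (fst x) * g (snd x) \<noteq> 0} \<subseteq> U"
   by (rule order_trans[OF support_box(1) assms(5)]) (rule z)
 qed
qed

lemma test_function_continuous: "\<psi> \<in> test_functions U ==> continuous_on A \<psi>"
 unfolding test_functions_def by (auto dest!: spec[of _ 0] intro: continuous_on_subset)

lemma test_function_zero: "\<psi> \<in> test_functions U ==> z \<notin> closure {x. \<psi> x \<noteq> 0} ==> \<psi> z = 0"
 using closure_subset[of "{x. \<psi> x \<noteq> 0}"] by blast

lemma test_function_derivative:
 assumes "\<psi> \<in> test_functions U"
 shows "((\<lambda>t. \<psi> (t, y)) has_real_derivative pdx \<psi> (x, y)) (at x)"
  "((\<lambda>t. \<psi> (x, t)) has_real_derivative pdy \<psi> (x, y)) (at y)"
proof -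
 have "Ck (Suc 0) \<psi>" using assms unfolding test_functions_def by blast
 then have "(\<lambda>t. \<psi> (t, y)) field_differentiable at x" "(\<lambda>t. \<psi> (x, t)) field_differentiable at y" by auto
 then show "((\<lambda>t. \<psi> (t, y)) has_real_derivative pdx \<psi> (x, y)) (at x)"
  "((\<lambda>t. \<psi> (x, t)) has_real_derivative pdy \<psi> (x, y)) (at y)"
  unfolding pdx_def pdy_def using field_differentiable_derivI by auto
qed

lemma support_derivative:
 fixes \<psi> :: "pt => real"
 shows "{z. pdx \<psi> z \<noteq> 0} \<subseteq> closure {z. \<psi> z \<noteq> 0}" "{z. pdy \<psi> z \<noteq> 0} \<subseteq> closure {z. \<psi> z \<noteq> 0}"
proof -
 let ?S = "closure {z. \<psi> z \<noteq> 0}"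
 have zero: "pdx \<psi> z = 0 \<and> pdy \<psi> z = 0" if "z \<notin> ?S" for z
 proof -
  obtain x y where z: "z = (x, y)" by (metis surj_pair)
  have o: "open (- ?S)" by auto
  have ev: "\<forall>\<^sub>F w in nhds z. \<psi> w = 0"
   using eventually_nhds_in_open[OF o, of z] that closure_subset[of "{z. \<psi> z \<noteq> 0}"]
   by (auto elim!: eventually_mono)
  have "\<forall>\<^sub>F t in nhds x. \<psi> (t, y) = 0"
  proof -
   have "((\<lambda>t. (t, y)) \<longlongrightarrow> (x, y)) (nhds x)" by (intro tendsto_intros filterlim_ident)
   then show ?thesis using ev unfolding z filterlim_iff by blast
  qed
  then have "deriv (\<lambda>t. \<psi> (t, y)) x = deriv (\<lambda>t. 0) x" by (intro deriv_cong_ev) auto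
  moreover have "\<forall>\<^sub>F t in nhds y. \<psi> (x, t) = 0"
  proof -
   have "((\<lambda>t. (x, t)) \<longlongrightarrow> (x, y)) (nhds y)" by (intro tendsto_intros filterlim_ident)
   then show ?thesis using ev unfolding z filterlim_iff by blast
  qed
  then have "deriv (\<lambda>t. \<psi> (x, t)) y = deriv (\<lambda>t. 0) y" by (intro deriv_cong_ev) auto
  ultimately show ?thesis by (simp add: pdx_def pdy_def z)
 qed
 show "{z. pdx \<psi> z \<noteq> 0} \<subseteq> ?S" "{z. pdy \<psi> z \<noteq> 0} \<subseteq> ?S" using zero by auto
qed

lemma test_functions_smaller_support:
 assumes \<psi>: "\<psi> \<in> test_functions U" and "\<forall>k. Ck k \<phi>" "{z. \<phi> z \<noteq> 0} \<subseteq> closure {z. \<psi> z \<noteq> 0}"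
 shows "\<phi> \<in> test_functions U"
proof -
 have "closure {z. \<phi> z \<noteq> 0} \<subseteq> closure {z. \<psi> z \<noteq> 0}"
  using assms(3) by (intro closure_minimal) auto
 then show ?thesis
  using \<psi> assms(2) bounded_subset unfolding test_functions_def compact_eq_bounded_closed by blast
qed

lemma test_functions_pd:
 assumes "\<psi> \<in> test_functions U"
 shows "pdx \<psi> \<in> test_functions U" "pdy \<psi> \<in> test_functions U"
proof -
 have "Ck (Suc k) \<psi>" for k using assms unfolding test_functions_def by blast
 then have "Ck k (pdx \<psi>)" "Ck k (pdy \<psi>)" for k by auto
 then show "pdx \<psi> \<in> test_functions U" "pdy \<psi> \<in> test_functions U"
  using test_functions_smaller_support[OF assms] support_derivative by auto
qed

lemma test_functions_iterated:
 assumes "\<psi> \<in> test_functions U"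
 shows "(pdx ^^ i) ((pdy ^^ j) \<psi>) \<in> test_functions U"
proof -
 have "(pdy ^^ j) \<psi> \<in> test_functions U" by (induction j) (auto simp: assms test_functions_pd)
 then show ?thesis by (induction i) (auto simp: test_functions_pd)
qed

lemma test_functions_mono: "U \<subseteq> V ==> \<psi> \<in> test_functions U ==> \<psi> \<in> test_functions V"
 unfolding test_functions_def by auto

lemma test_function_bounded:
 assumes "\<psi> \<in> test_functions U"
 obtains B where "0 \<le> B" "\<And>z. \<bar>\<psi> z\<bar> \<le> B"
proof -
 let ?S = "closure {z. \<psi> z \<noteq> 0}"
 have "compact (\<psi> ` ?S)"
  using assms test_function_continuous[OF assms] unfolding test_functions_def
  by (intro compact_continuous_image) auto
 then have "bounded (\<psi> ` ?S)" by (rule compact_imp_bounded)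
 then obtain B where B: "\<And>z. z \<in> ?S ==> \<bar>\<psi> z\<bar> \<le> B"
  unfolding bounded_iff real_norm_def by blast
 have "\<bar>\<psi> z\<bar> \<le> max B 0" for z
  using B[of z] test_function_zero[OF assms, of z] by (cases "z \<in> ?S") auto
 then show ?thesis using that[of "max B 0"] by auto
qed

lemma test_function_measurable: "\<psi> \<in> test_functions U ==> \<psi> \<in> borel_measurable borel"
 using test_function_continuous borel_measurable_continuous_onI by blast

lemma test_function_integrable:
 assumes v: "locally_integrable U v" and \<psi>: "\<psi> \<in> test_functions U"
 shows "set_integrable lebesgue U (\<lambda>x. v x * \<psi> x)" "integrable lebesgue (\<lambda>x. v x * \<psi> x)"
  "(LINT x:U|lebesgue. v x * \<psi> x) = (LINT x|lebesgue. v x * \<psi> x)"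
proof -
 let ?S = "closure {z. \<psi> z \<noteq> 0}"
 have S: "compact ?S" "?S \<subseteq> U" using \<psi> unfolding test_functions_def by auto
 then have i: "set_integrable lebesgue ?S v" using v unfolding locally_integrable_def by blast
 obtain B where B: "0 \<le> B" "\<And>z. \<bar>\<psi> z\<bar> \<le> B" using test_function_bounded[OF \<psi>] by blast
 have m: "\<psi> \<in> borel_measurable lebesgue"
  using test_function_measurable[OF \<psi>] by (intro measurable_completion) simp
 have eq: "indicator ?S x *\<^sub>R v x * \<psi> x = v x * \<psi> x" for x
  using test_function_zero[OF \<psi>, of x] by (auto simp: indicator_def)
 have eqU: "indicator U x *\<^sub>R (v x * \<psi> x) = v x * \<psi> x" for x
  using test_function_zero[OF \<psi>, of x] S by (auto simp: indicator_def)
 have "integrable lebesgue (\<lambda>x. indicator ?S x *\<^sub>R v x * \<psi> x)"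
 proof (rule Bochner_Integration.integrable_bound)
  show "integrable lebesgue (\<lambda>x. B * (indicator ?S x *\<^sub>R v x))"
   using i unfolding set_integrable_def by simp
  show "(\<lambda>x. indicator ?S x *\<^sub>R v x * \<psi> x) \<in> borel_measurable lebesgue"
   using i m unfolding set_integrable_def by measurable
  show "AE x in lebesgue. norm (indicator ?S x *\<^sub>R v x * \<psi> x) \<le> norm (B * (indicator ?S x *\<^sub>R v x))"
   using B by (intro always_eventually allI) (auto simp: abs_mult mult.commute intro!: mult_right_mono)
 qed
 then show int: "integrable lebesgue (\<lambda>x. v x * \<psi> x)" unfolding eq .
 then show "set_integrable lebesgue U (\<lambda>x. v x * \<psi> x)" unfolding set_integrable_def eqU .
 show "(LINT x:U|lebesgue. v x * \<psi> x) = (LINT x|lebesgue. v x * \<psi> x)"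
  unfolding set_lebesgue_integral_def eqU ..
qed

section \<open>Integration by parts\<close>

lemma integral_box_test:
 fixes f :: "pt => real"
 assumes "continuous_on UNIV f" "\<And>z. z \<notin> cbox (-N, -N) (N, N) ==> f z = 0"
 shows "(LINT z|lebesgue. f z) = integral {-N..N} (\<lambda>x. integral {-N..N} (\<lambda>y. f (x, y)))"
  "(LINT z|lebesgue. f z) = integral {-N..N} (\<lambda>y. integral {-N..N} (\<lambda>x. f (x, y)))"
proof -
 have c: "continuous_on (cbox (-N, -N) (N, N)) f" using assms(1) continuous_on_subset by blast
 have i: "set_integrable lebesgue (cbox (-N, -N) (N, N)) f" by (rule absolutely_integrable_continuous[OF c])
 have "(\<lambda>z. indicator (cbox (-N, -N) (N, N)) z *\<^sub>R f z) = f"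
 proof
  fix z show "indicator (cbox (-N, -N) (N, N)) z *\<^sub>R f z = f z"
   using assms(2)[of z] by (cases "z \<in> cbox (-N, -N) (N, N)") simp_all
 qed
 then have "(LINT z|lebesgue. f z) = (LINT z:cbox (-N, -N) (N, N)|lebesgue. f z)"
  by (simp add: set_lebesgue_integral_def)
 also have "\<dots> = integral (cbox (-N, -N) (N, N)) f" by (rule set_lebesgue_integral_eq_integral(2)[OF i])
 finally have e: "(LINT z|lebesgue. f z) = integral (cbox (-N, -N) (N, N)) f" .
 show 1: "(LINT z|lebesgue. f z) = integral {-N..N} (\<lambda>x. integral {-N..N} (\<lambda>y. f (x, y)))"
  unfolding e using integral_prod_continuous[OF c] by simp
 have "continuous_on (cbox (-N, -N) (N, N)) (\<lambda>(x, y). f (x, y))" using c by simp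
 then show "(LINT z|lebesgue. f z) = integral {-N..N} (\<lambda>y. integral {-N..N} (\<lambda>x. f (x, y)))"
  unfolding 1 using integral_swap_continuous[of "-N" "-N" N N "\<lambda>x y. f (x, y)"] by simp
qed

lemma integral_derivative_zero:
 fixes F :: "real => real"
 assumes "\<And>x. (F has_real_derivative f x) (at x)" "F a = 0" "F b = 0" "a \<le> b"
 shows "integral {a..b} f = 0"
proof -
 have "(f has_integral (F b - F a)) {a..b}"
  using assms by (intro fundamental_theorem_of_calculus)
   (auto simp flip: has_real_derivative_iff_has_vector_derivative intro: has_field_derivative_at_within)
 then show ?thesis using assms by (simp add: integral_unique)
qed

lemma test_function_large_box:
 assumes "\<psi> \<in> test_functions U"
 obtains N where "0 < N" "\<And>z. z \<notin> cbox (-N, -N) (N, N) ==> \<psi> z = 0"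
  "\<And>z. z \<notin> cbox (-N, -N) (N, N) ==> pdx \<psi> z = 0" "\<And>z. z \<notin> cbox (-N, -N) (N, N) ==> pdy \<psi> z = 0"
  "\<And>t. \<psi> (N, t) = 0 \<and> \<psi> (-N, t) = 0 \<and> \<psi> (t, N) = 0 \<and> \<psi> (t, -N) = 0"
proof -
 let ?S = "closure {z. \<psi> z \<noteq> 0}"
 have "bounded ?S" using assms unfolding test_functions_def by (auto intro: compact_imp_bounded)
 then obtain B where B: "\<And>z. z \<in> ?S ==> norm z \<le> B" unfolding bounded_iff by blast
 define N where "N = max B 0 + 1"
 have out: "z \<notin> ?S" if "N \<le> \<bar>fst z\<bar> \<or> N \<le> \<bar>snd z\<bar>" for z
  using B[of z] that norm_fst_le[of "fst z" "snd z"] norm_snd_le[of "snd z" "fst z"] by (auto simp: N_def)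
 have c: "z \<notin> ?S" if "z \<notin> cbox (-N, -N) (N, N)" for z
  using that by (intro out) (cases z, auto)
 have pd: "pdx \<psi> z = 0" "pdy \<psi> z = 0" if "z \<notin> ?S" for z
  using support_derivative[of \<psi>] that by blast+
 have ps: "\<psi> z = 0" if "z \<notin> ?S" for z using test_function_zero[OF assms that] .
 show ?thesis
 proof (rule that[of N])
  show "0 < N" by (simp add: N_def)
  show "\<psi> (N, t) = 0 \<and> \<psi> (-N, t) = 0 \<and> \<psi> (t, N) = 0 \<and> \<psi> (t, -N) = 0" for t
   by (intro conjI ps out) auto
  fix z assume z: "z \<notin> cbox (-N, -N) (N, N)"
  show "\<psi> z = 0" by (rule ps[OF c[OF z]])
  show "pdx \<psi> z = 0" by (rule pd(1)[OF c[OF z]])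
  show "pdy \<psi> z = 0" by (rule pd(2)[OF c[OF z]])
 qed
qed

text \<open>The derivative of \<open>f * \<psi>\<close> has integral zero along each line, as \<open>\<psi>\<close> has compact support; only the
  derivative of \<open>f\<close> in the direction of the line enters.\<close>

lemma integration_by_parts:
 assumes \<psi>: "\<psi> \<in> test_functions U" and f: "continuous_on UNIV f"
 shows "continuous_on UNIV fx ==> (\<And>x y. ((\<lambda>t. f (t, y)) has_real_derivative fx (x, y)) (at x)) ==>
   (LINT z|lebesgue. f z * pdx \<psi> z) = - (LINT z|lebesgue. fx z * \<psi> z)"
  and "continuous_on UNIV fy ==> (\<And>x y. ((\<lambda>t. f (x, t)) has_real_derivative fy (x, y)) (at y)) ==>
   (LINT z|lebesgue. f z * pdy \<psi> z) = - (LINT z|lebesgue. fy z * \<psi> z)"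
proof -
 obtain N where N: "0 < N" "\<And>z. z \<notin> cbox (-N, -N) (N, N) ==> \<psi> z = 0"
  "\<And>z. z \<notin> cbox (-N, -N) (N, N) ==> pdx \<psi> z = 0" "\<And>z. z \<notin> cbox (-N, -N) (N, N) ==> pdy \<psi> z = 0"
  "\<And>t. \<psi> (N, t) = 0 \<and> \<psi> (-N, t) = 0 \<and> \<psi> (t, N) = 0 \<and> \<psi> (t, -N) = 0"
  using test_function_large_box[OF \<psi>] by blast
 note cont = test_function_continuous[OF \<psi>] test_function_continuous[OF test_functions_pd(1)[OF \<psi>]]
  test_function_continuous[OF test_functions_pd(2)[OF \<psi>]]
 have li: "locally_integrable UNIV g" if "continuous_on UNIV g" for g :: "pt => real"
 proof -
  have "set_integrable lebesgue K g" if K: "compact K" for K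
  proof -
   obtain a where "K \<subseteq> cbox (-a) a" using bounded_subset_cbox_symmetric compact_imp_bounded K by blast
   moreover have "set_integrable lebesgue (cbox (-a) a) g"
    using continuous_on_subset[OF \<open>continuous_on UNIV g\<close>] by (intro absolutely_integrable_continuous) auto
   moreover have "K \<in> sets lebesgue" using K by (simp add: compact_imp_closed)
   ultimately show ?thesis using set_integrable_subset by blast
  qed
  then show ?thesis unfolding locally_integrable_def by blast
 qed
 have \<psi>U: "\<psi> \<in> test_functions UNIV" using test_functions_mono[OF _ \<psi>] by simp
 note i = test_function_integrable(2)[OF li]
 {
  assume c: "continuous_on UNIV fx" and d: "\<And>x y. ((\<lambda>t. f (t, y)) has_real_derivative fx (x, y)) (at x)"
  have "(LINT z|lebesgue. f z * pdx \<psi> z + fx z * \<psi> z) =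
    integral {-N..N} (\<lambda>y. integral {-N..N} (\<lambda>x. f (x, y) * pdx \<psi> (x, y) + fx (x, y) * \<psi> (x, y)))"
   using N by (intro integral_box_test(2) continuous_intros f c cont) auto
  also have "\<dots> = integral {-N..N} (\<lambda>y. 0)"
  proof (rule integral_cong)
   fix y
   show "integral {-N..N} (\<lambda>x. f (x, y) * pdx \<psi> (x, y) + fx (x, y) * \<psi> (x, y)) = 0"
    by (rule integral_derivative_zero[of "\<lambda>x. f (x, y) * \<psi> (x, y)"])
     (use N in \<open>auto intro!: derivative_eq_intros d test_function_derivative[OF \<psi>]\<close>)
  qed
  finally show "(LINT z|lebesgue. f z * pdx \<psi> z) = - (LINT z|lebesgue. fx z * \<psi> z)"
   using i[OF f test_functions_pd(1)[OF \<psi>U]] i[OF c \<psi>U] by simp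
 next
  assume c: "continuous_on UNIV fy" and d: "\<And>x y. ((\<lambda>t. f (x, t)) has_real_derivative fy (x, y)) (at y)"
  have "(LINT z|lebesgue. f z * pdy \<psi> z + fy z * \<psi> z) =
    integral {-N..N} (\<lambda>x. integral {-N..N} (\<lambda>y. f (x, y) * pdy \<psi> (x, y) + fy (x, y) * \<psi> (x, y)))"
   using N by (intro integral_box_test(1) continuous_intros f c cont) auto
  also have "\<dots> = integral {-N..N} (\<lambda>y. 0)"
  proof (rule integral_cong)
   fix x
   show "integral {-N..N} (\<lambda>y. f (x, y) * pdy \<psi> (x, y) + fy (x, y) * \<psi> (x, y)) = 0"
    by (rule integral_derivative_zero[of "\<lambda>y. f (x, y) * \<psi> (x, y)"])
     (use N in \<open>auto intro!: derivative_eq_intros d test_function_derivative[OF \<psi>]\<close>)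
  qed
  finally show "(LINT z|lebesgue. f z * pdy \<psi> z) = - (LINT z|lebesgue. fy z * \<psi> z)"
   using i[OF f test_functions_pd(2)[OF \<psi>U]] i[OF c \<psi>U] by simp
 }
qed

section \<open>Functions whose integrals over boxes vanish\<close>

lemma cbox_shrink:
 fixes p q :: pt
 assumes "0 < e" shows "cbox (p + (e, e)) (q - (e, e)) \<subseteq> box p q"
 using assms by (cases p; cases q) (auto simp: box_def Basis_prod_def)

lemma box_limit_of_cboxes:
 fixes p q z :: pt
 shows "(\<lambda>n. indicator (cbox (p + (inverse (real (Suc n)), inverse (real (Suc n)))) (q - (inverse (real (Suc n)), inverse (real (Suc n))))) z :: real)
  \<longlonglongrightarrow> indicator (box p q) z"
proof (cases "z \<in> box p q")
 case False
 have "z \<notin> cbox (p + (inverse (real (Suc n)), inverse (real (Suc n)))) (q - (inverse (real (Suc n)), inverse (real (Suc n))))" for n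
 proof
  assume z: "z \<in> cbox (p + (inverse (real (Suc n)), inverse (real (Suc n)))) (q - (inverse (real (Suc n)), inverse (real (Suc n))))"
  have "0 < inverse (real (Suc n))" by simp
  from subsetD[OF cbox_shrink[OF this] z] show False using False by blast
 qed
 then show ?thesis using False by simp
next
 case True
 then have e: "fst p < fst z" "fst z < fst q" "snd p < snd z" "snd z < snd q"
  by (cases z; cases p; cases q; auto simp: box_def Basis_prod_def)+
 define d where "d = min (min (fst z - fst p) (fst q - fst z)) (min (snd z - snd p) (snd q - snd z))"
 have "0 < d" using e by (auto simp: d_def)
 then have "\<forall>\<^sub>F n in sequentially. inverse (real (Suc n)) < d"
  using LIMSEQ_inverse_real_of_nat order_tendstoD(2) by blast
 then have "\<forall>\<^sub>F n in sequentially. indicator (cbox (p + (inverse (real (Suc n)), inverse (real (Suc n)))) (q - (inverse (real (Suc n)), inverse (real (Suc n))))) z = (1::real)"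
 proof eventually_elim
  case (elim n)
  then show ?case
   by (cases z; cases p; cases q) (auto simp: d_def indicator_def)
 qed
 then show ?thesis using True by (simp add: tendsto_eventually)
qed

text \<open>Closed boxes inside the support exhaust every open box, and the open boxes generate the Borel sets, so
  the positive and the negative part of \<open>h\<close> are densities of the same measure.\<close>

lemma AE_zero_of_box_integrals:
 fixes h :: "pt => real"
 assumes h: "integrable lborel h" and out: "\<And>z. z \<notin> box P Q ==> h z = 0"
  and zero: "\<And>p q. cbox p q \<subseteq> box P Q ==> (LINT z|lborel. indicator (cbox p q) z * h z) = 0"
 shows "AE z in lborel. h z = 0"
proof -
 have [measurable]: "h \<in> borel_measurable borel" using h borel_measurable_integrable by simp
 have boxes: "(LINT z|lborel. indicator (box a b) z * h z) = 0" for a b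
 proof -
  obtain p q where pq: "box a b \<inter> box P Q = box p q"
   by (rule that[OF box_Int_box])
  let ?c = "\<lambda>n. cbox (p + (inverse (real (Suc n)), inverse (real (Suc n)))) (q - (inverse (real (Suc n)), inverse (real (Suc n))))"
  have sub: "?c n \<subseteq> box P Q" for n
  proof -
   have "0 < inverse (real (Suc n))" by simp
   from cbox_shrink[OF this] show ?thesis using pq by blast
  qed
  have "(\<lambda>n. LINT z|lborel. indicator (?c n) z * h z) \<longlonglongrightarrow> (LINT z|lborel. indicator (box p q) z * h z)"
  proof (rule integral_dominated_convergence[where w = "\<lambda>z. \<bar>h z\<bar>"])
   show "integrable lborel (\<lambda>z. \<bar>h z\<bar>)" using h by simp
   show "AE z in lborel. (\<lambda>n. indicator (?c n) z * h z) \<longlonglongrightarrow> indicator (box p q) z * h z"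
    by (intro always_eventually allI tendsto_mult box_limit_of_cboxes tendsto_const)
   show "AE z in lborel. norm (indicator (?c n) z * h z) \<le> \<bar>h z\<bar>" for n
    by (intro always_eventually allI) (auto simp: indicator_def)
  qed (auto intro!: borel_measurable_times borel_measurable_indicator)
  then have "(LINT z|lborel. indicator (box p q) z * h z) = 0"
   unfolding zero[OF sub] by (rule LIMSEQ_unique[OF _ tendsto_const])
  moreover have "(\<lambda>z. indicator (box a b) z * h z) = (\<lambda>z. indicator (box p q) z * h z)"
   using out pq by (intro ext) (auto simp: indicator_def)
  ultimately show ?thesis by simp
 qed
 have pos: "integrable lborel (\<lambda>z. max 0 (h z))" "integrable lborel (\<lambda>z. max 0 (- h z))"
  using h by auto
 have "density lborel (\<lambda>z. ennreal (max 0 (h z))) = density lborel (\<lambda>z. ennreal (max 0 (- h z)))"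
 proof (rule measure_eqI_generator_eq[where E = "range (\<lambda>(a, b). box a b)" and \<Omega> = UNIV
    and A = "\<lambda>n. box (- real n, - real n) (real n, real n)"])
  show "Int_stable (range (\<lambda>(a, b). box a (b::pt)))"
   by (auto simp: Int_stable_def box_Int_box)
  show "sets (density lborel (\<lambda>z. ennreal (max 0 (h z)))) = sigma_sets UNIV (range (\<lambda>(a, b). box a b))"
   "sets (density lborel (\<lambda>z. ennreal (max 0 (- h z)))) = sigma_sets UNIV (range (\<lambda>(a, b). box a b))"
   by (simp_all add: borel_eq_box)
  have em: "emeasure (density lborel (\<lambda>z. ennreal (max 0 (k z)))) (box a b) = ennreal (LINT z|lborel. indicator (box a b) z * max 0 (k z))"
   if k: "integrable lborel (\<lambda>z. max 0 (k z))" and [measurable]: "k \<in> borel_measurable borel" for k :: "pt => real" and a b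
  proof -
   have "emeasure (density lborel (\<lambda>z. ennreal (max 0 (k z)))) (box a b) = (\<integral>\<^sup>+z. ennreal (max 0 (k z)) * indicator (box a b) z \<partial>lborel)"
    by (rule emeasure_density) auto
   also have "\<dots> = (\<integral>\<^sup>+z. ennreal (indicator (box a b) z * max 0 (k z)) \<partial>lborel)"
    by (intro nn_integral_cong) (auto simp: indicator_def)
   also have "\<dots> = ennreal (LINT z|lborel. indicator (box a b) z * max 0 (k z))"
   proof (rule nn_integral_eq_integral)
    show "integrable lborel (\<lambda>z. indicator (box a b) z * max 0 (k z))"
     using integrable_mult_indicator[OF _ k, of "box a b"] by simp
   qed (auto simp: indicator_def)
   finally show ?thesis .
  qed
  show "emeasure (density lborel (\<lambda>z. ennreal (max 0 (h z)))) X = emeasure (density lborel (\<lambda>z. ennreal (max 0 (- h z)))) X"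
   if XE: "X \<in> range (\<lambda>(a, b). box a b)" for X
  proof -
   obtain a b where X: "X = box a b" using XE by auto
   have "(LINT z|lborel. indicator (box a b) z * max 0 (h z)) - (LINT z|lborel. indicator (box a b) z * max 0 (- h z))
     = (LINT z|lborel. indicator (box a b) z * max 0 (h z) - indicator (box a b) z * max 0 (- h z))"
    using integrable_mult_indicator[OF _ pos(1), of "box a b"] integrable_mult_indicator[OF _ pos(2), of "box a b"]
    by (intro Bochner_Integration.integral_diff[symmetric]) auto
   also have "\<dots> = (LINT z|lborel. indicator (box a b) z * h z)"
    by (intro Bochner_Integration.integral_cong) (auto simp: max_def indicator_def)
   finally show ?thesis unfolding X using boxes[of a b] em[OF pos(1)] em[OF pos(2)] by simp
  qed
  show "emeasure (density lborel (\<lambda>z. ennreal (max 0 (h z)))) (box (- real n, - real n) (real n, real n)) \<noteq> \<infinity>" for n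
   using em[OF pos(1)] by simp
  show "(\<Union>n. box (- real n, - real n) (real n, real n)) = (UNIV :: pt set)"
  proof (intro set_eqI iffI UNIV_I)
   fix z :: pt
   obtain n where "max \<bar>fst z\<bar> \<bar>snd z\<bar> < real n" using reals_Archimedean2 by blast
   then have "z \<in> box (- real n, - real n) (real n, real n)"
    by (cases z) (auto simp: box_def Basis_prod_def)
   then show "z \<in> (\<Union>n. box (- real n, - real n) (real n, real n))" by blast
  qed
 qed auto
 then have "AE z in lborel. ennreal (max 0 (h z)) = ennreal (max 0 (- h z))"
  by (intro sigma_finite_measure.density_unique[OF sigma_finite_lborel]) auto
 then show ?thesis by eventually_elim (auto simp: max_def ennreal_eq_0_iff split: if_splits)
qed

section \<open>Borel versions\<close>

lemma lebesgue_borel_version: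
 fixes f :: "'a::euclidean_space => real"
 assumes "integrable lebesgue f"
 obtains f' where "f' \<in> borel_measurable borel" "integrable lborel f'" "AE x in lborel. f x = f' x"
proof -
 obtain f' where f': "f' \<in> borel_measurable lborel" "AE x in lborel. f x = f' x"
  using completion_ex_borel_measurable_real[OF borel_measurable_integrable[OF assms]] by blast
 have "AE x in lebesgue. f x = f' x" using f'(2) by (rule AE_completion)
 then have "integrable lebesgue f'" using lebesgue_integral_AE(1) assms by blast
 then have "integrable lborel f'" using integrable_completion[OF f'(1)] by simp
 then show ?thesis using that f' by simp
qed

lemma cbox_box_AE: "AE z in lborel. indicator (cbox p q) z = (indicator (box p q) z :: real)" for p q :: pt
proof -
 have "cbox p q - box p q \<in> null_sets lebesgue"
  using negligible_frontier_interval negligible_iff_null_sets by blast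
 then have "AE z in lebesgue. z \<notin> cbox p q - box p q" by (rule AE_not_in)
 then have "AE z in lborel. z \<notin> cbox p q - box p q" by (simp add: AE_completion_iff)
 then show ?thesis
 proof eventually_elim
  case (elim z)
  then show ?case using box_subset_cbox[of p q] by (auto simp: indicator_def)
 qed
qed

section \<open>Uniqueness of weak derivatives\<close>

text \<open>The bumps converge to indicators, so the integrals over boxes inside \<open>U\<close> vanish as well, and countably many
  boxes cover \<open>U\<close>.\<close>

lemma AE_zero_of_bump_integrals:
 fixes \<delta> :: "pt => real"
 assumes U: "open U" and li: "locally_integrable U \<delta>"
  and zero: "\<And>n a b c d. cbox (a, c) (b, d) \<subseteq> U ==>
    (LINT z|lebesgue. \<delta> z * (bump n a b (fst z) * bump n c d (snd z))) = 0"
 shows "AE x in lebesgue. x \<in> U --> \<delta> x = 0"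
proof -
 have box: "(LINT z|lebesgue. indicator (box p q) z * \<delta> z) = 0" if sub: "cbox p q \<subseteq> U" for p q
 proof -
  obtain a c b d where pq: "p = (a, c)" "q = (b, d)" by (metis surj_pair)
  have i: "integrable lebesgue (\<lambda>z. indicator (cbox p q) z * \<delta> z)"
  proof -
   have "set_integrable lebesgue (cbox p q) \<delta>"
    using li sub compact_cbox unfolding locally_integrable_def by blast
   then show ?thesis by (simp add: set_integrable_def)
  qed
  let ?\<psi> = "\<lambda>n z. bump n a b (fst z) * bump n c d (snd z)"
  have m: "?\<psi> n \<in> borel_measurable lebesgue" for n
   using borel_measurable_continuous_onI[OF product_continuous[OF smooth_bump smooth_bump]]
   by (intro measurable_completion) simp
  have eq: "\<delta> z * ?\<psi> n z = (indicator (cbox p q) z * \<delta> z) * ?\<psi> n z" for n z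
  proof (cases "z \<in> cbox p q")
   case False
   then have "fst z \<notin> {a<..<b} \<or> snd z \<notin> {c<..<d}" unfolding pq by (cases z) auto
   then show ?thesis using bump_outside by auto
  qed simp
  have "(\<lambda>n. LINT z|lebesgue. \<delta> z * ?\<psi> n z) \<longlonglongrightarrow> (LINT z|lebesgue. indicator (box p q) z * \<delta> z)"
  proof (rule integral_dominated_convergence[where w = "\<lambda>z. \<bar>indicator (cbox p q) z * \<delta> z\<bar>"])
   show "integrable lebesgue (\<lambda>z. \<bar>indicator (cbox p q) z * \<delta> z\<bar>)" using i by (rule integrable_abs)
   show "(\<lambda>z. \<delta> z * ?\<psi> n z) \<in> borel_measurable lebesgue" for n
    unfolding eq by (rule borel_measurable_times[OF borel_measurable_integrable[OF i] m])
   have "(\<lambda>z. indicator (box p q) z * \<delta> z) = (\<lambda>z. (indicator (cbox p q) z * \<delta> z) * indicator (box p q) z)"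
    using box_subset_cbox[of p q] by (intro ext) (auto simp: indicator_def)
   moreover have "(\<lambda>z. (indicator (cbox p q) z * \<delta> z) * indicator (box p q) z) \<in> borel_measurable lebesgue"
    by (rule borel_measurable_times[OF borel_measurable_integrable[OF i] borel_measurable_indicator]) simp
   ultimately show "(\<lambda>z. indicator (box p q) z * \<delta> z) \<in> borel_measurable lebesgue" by simp
   have "(\<lambda>n. \<delta> z * ?\<psi> n z) \<longlonglongrightarrow> \<delta> z * (indicator {a<..<b} (fst z) * indicator {c<..<d} (snd z))" for z
    by (intro tendsto_mult tendsto_const bump_tendsto)
   moreover have "\<delta> z * (indicator {a<..<b} (fst z) * indicator {c<..<d} (snd z)) = indicator (box p q) z * \<delta> z" for z
    unfolding pq by (cases z) (auto simp: indicator_def box_def Basis_prod_def)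
   ultimately show "AE z in lebesgue. (\<lambda>n. \<delta> z * ?\<psi> n z) \<longlonglongrightarrow> indicator (box p q) z * \<delta> z" by simp
   have "\<bar>?\<psi> n z\<bar> \<le> 1" for n z
    using bump_bounds[of n a b "fst z"] bump_bounds[of n c d "snd z"] by (simp add: abs_mult mult_le_one)
   then have "norm (\<delta> z * ?\<psi> n z) \<le> \<bar>indicator (cbox p q) z * \<delta> z\<bar>" for n z
    unfolding eq real_norm_def abs_mult[of "indicator (cbox p q) z * \<delta> z"]
    by (intro mult_left_le) auto
   then show "AE z in lebesgue. norm (\<delta> z * ?\<psi> n z) \<le> \<bar>indicator (cbox p q) z * \<delta> z\<bar>" for n by simp
  qed
  moreover have "(LINT z|lebesgue. \<delta> z * ?\<psi> n z) = 0" for n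
   by (rule zero) (use sub pq in simp)
  ultimately have "(\<lambda>n::nat. 0) \<longlonglongrightarrow> (LINT z|lebesgue. indicator (box p q) z * \<delta> z)"
   by (simp only:)
  then show ?thesis by (rule LIMSEQ_unique) (rule tendsto_const)
 qed
 have local: "AE z in lebesgue. z \<in> cbox P Q --> \<delta> z = 0" if PQ: "cbox P Q \<subseteq> U" for P Q
 proof -
  have "integrable lebesgue (\<lambda>z. indicator (box P Q) z *\<^sub>R \<delta> z)"
  proof -
   have "set_integrable lebesgue (cbox P Q) \<delta>"
    using li PQ compact_cbox unfolding locally_integrable_def by blast
   moreover have "box P Q \<in> sets lebesgue" by simp
   ultimately have "set_integrable lebesgue (box P Q) \<delta>"
    by (rule set_integrable_subset[OF _ _ box_subset_cbox])
   then show ?thesis by (simp add: set_integrable_def)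
  qed
  then obtain h0 where h0: "h0 \<in> borel_measurable borel" "integrable lborel h0" "AE z in lborel. indicator (box P Q) z *\<^sub>R \<delta> z = h0 z"
   by (rule lebesgue_borel_version)
  define h where "h = (\<lambda>z. indicator (box P Q) z * h0 z)"
  have h: "integrable lborel h"
   unfolding h_def using integrable_mult_indicator[OF _ h0(2), of "box P Q"] by simp
  have hd: "AE z in lborel. h z = indicator (box P Q) z * \<delta> z"
   using h0(3) by eventually_elim (auto simp: h_def indicator_def)
  have "AE z in lborel. h z = 0"
  proof (rule AE_zero_of_box_integrals[OF h, of P Q])
   show "h z = 0" if "z \<notin> box P Q" for z using that by (simp add: h_def)
   fix p q :: pt assume sub: "cbox p q \<subseteq> box P Q"
   have hb: "h \<in> borel_measurable borel" using h borel_measurable_integrable by simp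
   have "(LINT z|lborel. indicator (cbox p q) z * h z) = (LINT z|lebesgue. indicator (cbox p q) z * h z)"
    using hb by (intro integral_completion[symmetric] borel_measurable_times borel_measurable_indicator) auto
   also have "\<dots> = (LINT z|lebesgue. indicator (box p q) z * \<delta> z)"
   proof (rule lebesgue_integral_AE(2))
    have "AE z in lborel. indicator (cbox p q) z * h z = indicator (box p q) z * \<delta> z"
     using hd cbox_box_AE[of p q]
    proof eventually_elim
     case (elim z)
     then show ?case using sub box_subset_cbox[of p q] by (auto simp: indicator_def split: if_splits)
    qed
    then show "AE z in lebesgue. indicator (cbox p q) z * h z = indicator (box p q) z * \<delta> z"
     by (rule AE_completion)
   qed
   also have "\<dots> = 0"
    using sub PQ box_subset_cbox[of P Q] by (intro box) blast
   finally show "(LINT z|lborel. indicator (cbox p q) z * h z) = 0" .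
  qed
  then have "AE z in lborel. z \<in> cbox P Q --> \<delta> z = 0"
   using hd cbox_box_AE[of P Q] by eventually_elim (auto simp: indicator_def split: if_splits)
  then show ?thesis by (rule AE_completion)
 qed
 obtain D where D: "countable D" "D \<subseteq> Pow U" "\<And>X. X \<in> D ==> \<exists>a b. X = cbox a b" "\<Union>D = U"
  using open_countable_Union_open_cbox[OF U] by blast
 have "\<forall>X\<in>D. AE z in lebesgue. z \<in> X --> \<delta> z = 0"
  using D(2,3) local by fast
 then have "AE z in lebesgue. \<forall>X\<in>D. z \<in> X --> \<delta> z = 0"
  using AE_ball_countable[OF D(1)] by fast
 then show ?thesis
  by eventually_elim (use D(4) in blast)
qed

text \<open>Test functions vanish outside \<open>U\<close>, so the integrals may be taken over the plane.\<close>

lemma weak_deriv_iff: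
 "weak_deriv U i j v g \<longleftrightarrow> locally_integrable U v \<and> locally_integrable U g \<and>
   (\<forall>\<psi>\<in>test_functions U. (LINT x|lebesgue. v x * (pdx ^^ i) ((pdy ^^ j) \<psi>) x) =
              (-1) ^ (i + j) * (LINT x|lebesgue. g x * \<psi> x))"
proof (cases "locally_integrable U v \<and> locally_integrable U g")
 case True
 have 1: "(LINT x:U|lebesgue. v x * (pdx ^^ i) ((pdy ^^ j) \<psi>) x) = (LINT x|lebesgue. v x * (pdx ^^ i) ((pdy ^^ j) \<psi>) x)"
  if t: "\<psi> \<in> test_functions U" for \<psi>
  by (rule test_function_integrable(3)[OF _ test_functions_iterated[OF t]]) (use True in blast)
 have 2: "(LINT x:U|lebesgue. g x * \<psi> x) = (LINT x|lebesgue. g x * \<psi> x)" if t: "\<psi> \<in> test_functions U" for \<psi>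
  by (rule test_function_integrable(3)[OF _ t]) (use True in blast)
 have 3: "(\<forall>\<psi>\<in>test_functions U. (LINT x:U|lebesgue. v x * (pdx ^^ i) ((pdy ^^ j) \<psi>) x) = (-1) ^ (i + j) * (LINT x:U|lebesgue. g x * \<psi> x))
  \<longleftrightarrow> (\<forall>\<psi>\<in>test_functions U. (LINT x|lebesgue. v x * (pdx ^^ i) ((pdy ^^ j) \<psi>) x) = (-1) ^ (i + j) * (LINT x|lebesgue. g x * \<psi> x))"
  by (rule ball_cong[OF refl]) (simp only: 1 2)
 show ?thesis unfolding weak_deriv_def by (rule conj_cong[OF refl conj_cong[OF refl 3]])
qed (auto simp: weak_deriv_def)

lemma weak_derivD:
 assumes "weak_deriv U i j v g"
 shows "locally_integrable U v" "locally_integrable U g"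
  "\<psi> \<in> test_functions U ==> (LINT x|lebesgue. v x * (pdx ^^ i) ((pdy ^^ j) \<psi>) x) =
              (-1) ^ (i + j) * (LINT x|lebesgue. g x * \<psi> x)"
 using assms unfolding weak_deriv_iff by blast+

lemma weak_derivI:
 assumes "locally_integrable U v" "locally_integrable U g"
  "\<And>\<psi>. \<psi> \<in> test_functions U ==> (LINT x|lebesgue. v x * (pdx ^^ i) ((pdy ^^ j) \<psi>) x) =
              (-1) ^ (i + j) * (LINT x|lebesgue. g x * \<psi> x)"
 shows "weak_deriv U i j v g"
 unfolding weak_deriv_iff using assms by blast

lemma locally_integrable_diff:
 "locally_integrable U v ==> locally_integrable U w ==> locally_integrable U (\<lambda>x. v x - w x)"
 unfolding locally_integrable_def using set_integral_diff(1) by blast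

lemma bump_test_function:
 assumes "cbox (a, c) (b, d) \<subseteq> U"
 shows "(\<lambda>z. bump n a b (fst z) * bump n c d (snd z)) \<in> test_functions U"
 by (rule product_test_function[OF smooth_bump smooth_bump _ _ assms]) (auto intro: bump_outside)

lemma weak_deriv_unique:
 assumes U: "open U" and g: "weak_deriv U i j v g" "weak_deriv U i j v g'"
 shows "AE x in lebesgue. x \<in> U --> g x = g' x"
proof -
 have l: "locally_integrable U g" "locally_integrable U g'" using g weak_derivD(2) by blast+
 have "AE x in lebesgue. x \<in> U --> g x - g' x = 0"
 proof (rule AE_zero_of_bump_integrals[OF U locally_integrable_diff[OF l]])
  fix n a b c d assume sub: "cbox (a, c) (b, d) \<subseteq> U"
  note t = bump_test_function[OF sub, of n]
  have "(-1) ^ (i + j) * (LINT z|lebesgue. g z * (bump n a b (fst z) * bump n c d (snd z))) =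
     (-1) ^ (i + j) * (LINT z|lebesgue. g' z * (bump n a b (fst z) * bump n c d (snd z)))"
   by (rule trans[OF sym[OF weak_derivD(3)[OF g(1) t]] weak_derivD(3)[OF g(2) t]])
  then show "(LINT z|lebesgue. (g z - g' z) * (bump n a b (fst z) * bump n c d (snd z))) = 0"
   using test_function_integrable(2)[OF l(1) t] test_function_integrable(2)[OF l(2) t]
   by (simp add: left_diff_distrib)
 qed
 then show ?thesis by eventually_elim simp
qed

lemma locally_integrable_AE:
 assumes "AE x in lebesgue. x \<in> U --> v x = v' x" "locally_integrable U v"
 shows "locally_integrable U v'"
 unfolding locally_integrable_def
proof (intro allI impI)
 fix K assume K: "compact K \<and> K \<subseteq> U"
 then have "AE x in lebesgue. x \<in> K --> v x = v' x" using assms(1) by (auto elim!: eventually_mono)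
 then show "set_integrable lebesgue K v'"
  using set_lebesgue_AE(1) assms(2) K unfolding locally_integrable_def by blast
qed

lemma weak_deriv_AE:
 assumes ae: "AE x in lebesgue. x \<in> U --> v x = v' x" "AE x in lebesgue. x \<in> U --> g x = g' x"
  and w: "weak_deriv U i j v g"
 shows "weak_deriv U i j v' g'"
proof -
 have l: "locally_integrable U v'" "locally_integrable U g'"
  using locally_integrable_AE[OF ae(1)] locally_integrable_AE[OF ae(2)] w by (auto simp: weak_deriv_def)
 have c: "(LINT x:U|lebesgue. u x * \<phi> x) = (LINT x:U|lebesgue. u' x * \<phi> x)"
  if "AE x in lebesgue. x \<in> U --> u x = u' x" for u u' \<phi> :: "pt => real"
  by (rule set_lebesgue_AE(2)) (use that in \<open>auto elim!: eventually_mono\<close>)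
 show ?thesis
  using w l unfolding weak_deriv_def c[OF ae(1)] c[OF ae(2)] by blast
qed

lemma weak_deriv_diff:
 assumes "weak_deriv U i j v g" "weak_deriv U i j w h"
 shows "weak_deriv U i j (\<lambda>x. v x - w x) (\<lambda>x. g x - h x)"
proof -
 have l: "locally_integrable U v" "locally_integrable U g" "locally_integrable U w" "locally_integrable U h"
  using weak_derivD(1,2)[OF assms(1)] weak_derivD(1,2)[OF assms(2)] by auto
 have "(LINT x|lebesgue. (v x - w x) * (pdx ^^ i) ((pdy ^^ j) \<psi>) x) = (- 1) ^ (i + j) * (LINT x|lebesgue. (g x - h x) * \<psi> x)"
  if t: "\<psi> \<in> test_functions U" for \<psi>
  using weak_derivD(3)[OF assms(1) t] weak_derivD(3)[OF assms(2) t] test_function_integrable(2)[OF l(1) test_functions_iterated[OF t], of i j]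
   test_function_integrable(2)[OF l(3) test_functions_iterated[OF t], of i j]
   test_function_integrable(2)[OF l(2) t] test_function_integrable(2)[OF l(4) t]
  by (simp add: left_diff_distrib right_diff_distrib)
 then show ?thesis by (intro weak_derivI locally_integrable_diff l)
qed

lemma weak_deriv_mono:
 assumes "weak_deriv U i j v g" "V \<subseteq> U"
 shows "weak_deriv V i j v g"
proof -
 have "locally_integrable V v" "locally_integrable V g"
  using assms unfolding weak_deriv_def locally_integrable_def by blast+
 then show ?thesis
  using assms test_functions_mono[OF assms(2)] unfolding weak_deriv_iff by blast
qed

section \<open>Iterated derivatives\<close>

lemma continuous_locally_integrable:
 fixes g :: "pt => real"
 assumes "continuous_on UNIV g" shows "locally_integrable U g"
 unfolding locally_integrable_def
proof (intro allI impI)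
 fix K :: "pt set" assume K: "compact K \<and> K \<subseteq> U"
 then obtain a where "K \<subseteq> cbox (-a) a" using bounded_subset_cbox_symmetric compact_imp_bounded by blast
 moreover have "set_integrable lebesgue (cbox (-a) a) g"
  using continuous_on_subset[OF assms] by (intro absolutely_integrable_continuous) auto
 moreover have "K \<in> sets lebesgue" using K by (simp add: compact_imp_closed)
 ultimately show "set_integrable lebesgue K g" using set_integrable_subset by blast
qed

text \<open>Mixed partial derivatives of a test function commute: after integration by parts against a
 product of functions of one variable the order does not matter.\<close>

lemma test_function_commute:
 assumes \<psi>: "\<psi> \<in> test_functions U"
 shows "pdx (pdy \<psi>) = pdy (pdx \<psi>)"
proof -
 define \<delta> where "\<delta> z = pdx (pdy \<psi>) z - pdy (pdx \<psi>) z" for z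
 note t = test_functions_pd[OF \<psi>]
 have c: "continuous_on UNIV (pdx (pdy \<psi>))" "continuous_on UNIV (pdy (pdx \<psi>))"
  using test_function_continuous test_functions_pd t by blast+
 then have cd: "continuous_on UNIV \<delta>" unfolding \<delta>_def by (intro continuous_intros)
 have "AE x in lebesgue. x \<in> UNIV --> \<delta> x = 0"
 proof (rule AE_zero_of_bump_integrals)
  show "locally_integrable UNIV \<delta>" by (rule continuous_locally_integrable[OF cd])
  fix n a b c d
  define f g where "f = bump n a b" and "g = bump n c d"
  have sm: "smooth f" "smooth g" by (simp_all add: f_def g_def smooth_bump)
  obtain f' where f': "\<And>x. (f has_real_derivative f' x) (at x)" "smooth f'"
   using sm(1) by (cases rule: smooth.cases) blast
  obtain g' where g': "\<And>x. (g has_real_derivative g' x) (at x)" "smooth g'"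
   using sm(2) by (cases rule: smooth.cases) blast
  have d: "((\<lambda>t. p (fst (t, y)) * q (snd (t, y))) has_real_derivative p' (fst (x, y)) * q (snd (x, y))) (at x)"
   if "\<And>x. (p has_real_derivative p' x) (at x)" for p p' q :: "real => real" and x y
   unfolding fst_conv snd_conv by (rule DERIV_cmult_right[OF that])
  have e: "((\<lambda>t. q (fst (x, t)) * p (snd (x, t))) has_real_derivative q (fst (x, y)) * p' (snd (x, y))) (at y)"
   if "\<And>x. (p has_real_derivative p' x) (at x)" for p p' q :: "real => real" and x y
   unfolding fst_conv snd_conv by (rule DERIV_cmult[OF that])
  note pc = product_continuous[where A = UNIV]
  have "(LINT z|lebesgue. f (fst z) * g (snd z) * pdx (pdy \<psi>) z) = - (LINT z|lebesgue. f' (fst z) * g (snd z) * pdy \<psi> z)"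
   by (rule integration_by_parts(1)[OF t(2) pc[OF sm] pc[OF f'(2) sm(2)] d[OF f'(1)]])
  also have "\<dots> = (LINT z|lebesgue. f' (fst z) * g' (snd z) * \<psi> z)"
   using integration_by_parts(2)[OF \<psi> pc[OF f'(2) sm(2)] pc[OF f'(2) g'(2)] e[OF g'(1)]] by simp
  also have "\<dots> = - (LINT z|lebesgue. f (fst z) * g' (snd z) * pdx \<psi> z)"
   using integration_by_parts(1)[OF \<psi> pc[OF sm(1) g'(2)] pc[OF f'(2) g'(2)] d[OF f'(1)]] by simp
  also have "\<dots> = (LINT z|lebesgue. f (fst z) * g (snd z) * pdy (pdx \<psi>) z)"
   using integration_by_parts(2)[OF t(1) pc[OF sm] pc[OF sm(1) g'(2)] e[OF g'(1)]] by simp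
  finally have eq: "(LINT z|lebesgue. f (fst z) * g (snd z) * pdx (pdy \<psi>) z) = (LINT z|lebesgue. f (fst z) * g (snd z) * pdy (pdx \<psi>) z)" .
  have i: "integrable lebesgue (\<lambda>z. f (fst z) * g (snd z) * pdx (pdy \<psi>) z)" "integrable lebesgue (\<lambda>z. f (fst z) * g (snd z) * pdy (pdx \<psi>) z)"
   using test_function_integrable(2)[OF continuous_locally_integrable[OF pc[OF sm]]] test_functions_pd t by blast+
  have "(LINT z|lebesgue. \<delta> z * (f (fst z) * g (snd z))) =
    (LINT z|lebesgue. f (fst z) * g (snd z) * pdx (pdy \<psi>) z - f (fst z) * g (snd z) * pdy (pdx \<psi>) z)"
   by (simp add: \<delta>_def algebra_simps)
  also have "\<dots> = 0" using eq i by simp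
  finally show "(LINT z|lebesgue. \<delta> z * (bump n a b (fst z) * bump n c d (snd z))) = 0" by (simp add: f_def g_def)
 qed simp
 then have ae: "AE x in lebesgue. x \<notin> {z. \<delta> z \<noteq> 0}" by simp
 have op: "open {z. \<delta> z \<noteq> 0}"
  by (rule open_Collect_neq[OF cd continuous_on_const])
 have "{z. \<delta> z \<noteq> 0} \<in> null_sets lebesgue"
  using ae op AE_iff_null_sets[of "{z. \<delta> z \<noteq> 0}" lebesgue] by auto
 then have "negligible {z. \<delta> z \<noteq> 0}" by (simp add: negligible_iff_null_sets)
 then have "{z. \<delta> z \<noteq> 0} = {}" using open_not_negligible[OF op] by blast
 then show ?thesis by (auto simp: \<delta>_def fun_eq_iff)
qed

lemma iterated_pdx:
 assumes "\<psi> \<in> test_functions U"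
 shows "(pdx ^^ i) ((pdy ^^ j) (pdx \<psi>)) = (pdx ^^ Suc i) ((pdy ^^ j) \<psi>)"
proof -
 have "(pdy ^^ j) (pdx \<psi>) = pdx ((pdy ^^ j) \<psi>)"
 proof (induction j)
  case (Suc j)
  have "(pdy ^^ j) \<psi> \<in> test_functions U" using test_functions_iterated[OF assms, of 0 j] by simp
  then show ?case using Suc test_function_commute by simp
 qed simp
 then show ?thesis by (simp add: funpow_swap1)
qed

text \<open>Weak derivatives of higher order are iterated ones: test the derivative of order \<open>(i, j)\<close> with a
  derivative of a test function.\<close>

lemma weak_deriv_step:
 assumes g: "weak_deriv U i j v g"
 shows "weak_deriv U (Suc i) j v g' ==> weak_deriv U 1 0 g g'"
  and "weak_deriv U i (Suc j) v g' ==> weak_deriv U 0 1 g g'"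
proof -
 {
  assume g': "weak_deriv U (Suc i) j v g'"
  have "(LINT x|lebesgue. g x * (pdx ^^ 1) ((pdy ^^ 0) \<psi>) x) = (- 1) ^ (1 + 0) * (LINT x|lebesgue. g' x * \<psi> x)"
   if t: "\<psi> \<in> test_functions U" for \<psi>
  proof -
   have "(- 1) ^ (i + j) * (LINT x|lebesgue. g x * pdx \<psi> x) = (LINT x|lebesgue. v x * (pdx ^^ Suc i) ((pdy ^^ j) \<psi>) x)"
    using weak_derivD(3)[OF g test_functions_pd(1)[OF t]] unfolding iterated_pdx[OF t] by simp
   also have "\<dots> = (- 1) ^ (Suc i + j) * (LINT x|lebesgue. g' x * \<psi> x)"
    by (rule weak_derivD(3)[OF g' t])
   finally have "(- 1) ^ (i + j) * (LINT x|lebesgue. g x * pdx \<psi> x) = (- 1) ^ (i + j) * (- (LINT x|lebesgue. g' x * \<psi> x))" by simp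
   then show ?thesis by (subst (asm) mult_left_cancel) auto
  qed
  then show "weak_deriv U 1 0 g g'" by (rule weak_derivI[OF weak_derivD(2)[OF g] weak_derivD(2)[OF g']])
 next
  assume g': "weak_deriv U i (Suc j) v g'"
  have "(LINT x|lebesgue. g x * (pdx ^^ 0) ((pdy ^^ 1) \<psi>) x) = (- 1) ^ (0 + 1) * (LINT x|lebesgue. g' x * \<psi> x)"
   if t: "\<psi> \<in> test_functions U" for \<psi>
  proof -
   have "(- 1) ^ (i + j) * (LINT x|lebesgue. g x * pdy \<psi> x) = (LINT x|lebesgue. v x * (pdx ^^ i) ((pdy ^^ Suc j) \<psi>) x)"
    using weak_derivD(3)[OF g test_functions_pd(2)[OF t]] by (simp add: funpow_swap1)
   also have "\<dots> = (- 1) ^ (i + Suc j) * (LINT x|lebesgue. g' x * \<psi> x)"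
    by (rule weak_derivD(3)[OF g' t])
   finally have "(- 1) ^ (i + j) * (LINT x|lebesgue. g x * pdy \<psi> x) = (- 1) ^ (i + j) * (- (LINT x|lebesgue. g' x * \<psi> x))" by simp
   then show ?thesis by (subst (asm) mult_left_cancel) auto
  qed
  then show "weak_deriv U 0 1 g g'" by (rule weak_derivI[OF weak_derivD(2)[OF g] weak_derivD(2)[OF g']])
 }
qed

lemma weak_deriv_0: "weak_deriv U 0 0 v g ==> open U ==> AE x in lebesgue. x \<in> U --> g x = v x"
proof -
 assume a: "weak_deriv U 0 0 v g" "open U"
 note l = weak_derivD(1)[OF a(1)]
 have "weak_deriv U 0 0 v v" by (rule weak_derivI[OF l l]) simp
 then show ?thesis using weak_deriv_unique[OF a(2,1)] by blast
qed

section \<open>Quadratic polynomials\<close>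

type_synonym coeffs = "real \<times> real \<times> real \<times> real \<times> real \<times> real"

text \<open>A quadratic polynomial in the coordinates scaled to a cell with lower-left vertex \<open>(x0, y0)\<close>,
 width \<open>w\<close> and height \<open>h\<close>; its derivatives have the same form.\<close>

definition spoly :: "real => real => real => real => coeffs => pt => real" where
 "spoly x0 y0 w h = (\<lambda>(A, B, C, D, E, F) (x, y). let s = (x - x0) / w; t = (y - y0) / h in
   A + B * s + C * t + D * s\<^sup>2 + E * s * t + F * t\<^sup>2)"

definition dxc :: "real => coeffs => coeffs" where
 "dxc w = (\<lambda>(A, B, C, D, E, F). (B / w, 2 * D / w, E / w, 0, 0, 0))"

definition dyc :: "real => coeffs => coeffs" where
 "dyc h = (\<lambda>(A, B, C, D, E, F). (C / h, E / h, 2 * F / h, 0, 0, 0))"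

lemma spoly_continuous: "continuous_on A (spoly x0 y0 w h c)"
 by (cases c) (auto simp: spoly_def Let_def case_prod_beta divide_inverse intro!: continuous_intros)

lemma spoly_derivative:
 "((\<lambda>t. spoly x0 y0 w h c (t, y)) has_real_derivative spoly x0 y0 w h (dxc w c) (x, y)) (at x)"
 "((\<lambda>t. spoly x0 y0 w h c (x, t)) has_real_derivative spoly x0 y0 w h (dyc h c) (x, y)) (at y)"
 by (cases c; auto simp: spoly_def dxc_def dyc_def Let_def divide_inverse
    intro!: derivative_eq_intros; simp add: algebra_simps power2_eq_square)+

lemma spoly_weak_deriv: "weak_deriv U i j (spoly x0 y0 w h c) (spoly x0 y0 w h ((dxc w ^^ i) ((dyc h ^^ j) c)))"
proof -
 let ?p = "spoly x0 y0 w h"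
 have x: "(LINT z|lebesgue. ?p c z * (pdx ^^ i) \<psi> z) = (- 1) ^ i * (LINT z|lebesgue. ?p ((dxc w ^^ i) c) z * \<psi> z)"
  if t: "\<psi> \<in> test_functions U" for \<psi> i c
  using t
 proof (induction i arbitrary: \<psi>)
  case (Suc i)
  have "(LINT z|lebesgue. ?p c z * (pdx ^^ Suc i) \<psi> z) = (LINT z|lebesgue. ?p c z * (pdx ^^ i) (pdx \<psi>) z)"
   by (simp add: funpow_swap1)
  also have "\<dots> = (- 1) ^ i * (LINT z|lebesgue. ?p ((dxc w ^^ i) c) z * pdx \<psi> z)"
   by (rule Suc.IH[OF test_functions_pd(1)[OF Suc.prems]])
  also have "(LINT z|lebesgue. ?p ((dxc w ^^ i) c) z * pdx \<psi> z) = - (LINT z|lebesgue. ?p ((dxc w ^^ Suc i) c) z * \<psi> z)"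
   unfolding funpow.simps comp_def
   by (rule integration_by_parts(1)[OF Suc.prems spoly_continuous spoly_continuous spoly_derivative(1)])
  finally show ?case by simp
 qed simp
 have y: "(LINT z|lebesgue. ?p c z * (pdy ^^ j) \<psi> z) = (- 1) ^ j * (LINT z|lebesgue. ?p ((dyc h ^^ j) c) z * \<psi> z)"
  if t: "\<psi> \<in> test_functions U" for \<psi> j c
  using t
 proof (induction j arbitrary: \<psi>)
  case (Suc i)
  have "(LINT z|lebesgue. ?p c z * (pdy ^^ Suc i) \<psi> z) = (LINT z|lebesgue. ?p c z * (pdy ^^ i) (pdy \<psi>) z)"
   by (simp add: funpow_swap1)
  also have "\<dots> = (- 1) ^ i * (LINT z|lebesgue. ?p ((dyc h ^^ i) c) z * pdy \<psi> z)"
   by (rule Suc.IH[OF test_functions_pd(2)[OF Suc.prems]])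
  also have "(LINT z|lebesgue. ?p ((dyc h ^^ i) c) z * pdy \<psi> z) = - (LINT z|lebesgue. ?p ((dyc h ^^ Suc i) c) z * \<psi> z)"
   unfolding funpow.simps comp_def
   by (rule integration_by_parts(2)[OF Suc.prems spoly_continuous spoly_continuous spoly_derivative(2)])
  finally show ?case by simp
 qed simp
 have comm: "dxc w (dyc h c) = dyc h (dxc w c)" for c
  by (cases c) (simp add: dxc_def dyc_def)
 have comm': "(dyc h ^^ j) ((dxc w ^^ i) c) = (dxc w ^^ i) ((dyc h ^^ j) c)"
 proof (induction i)
  case (Suc i)
  have "(dyc h ^^ j) (dxc w c) = dxc w ((dyc h ^^ j) c)" for c
   by (induction j) (simp_all add: comm)
  then show ?case using Suc by simp
 qed simp
 have "(LINT z|lebesgue. ?p c z * (pdx ^^ i) ((pdy ^^ j) \<psi>) z) = (- 1) ^ (i + j) * (LINT z|lebesgue. ?p ((dxc w ^^ i) ((dyc h ^^ j) c)) z * \<psi> z)"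
  if t: "\<psi> \<in> test_functions U" for \<psi>
 proof -
  have tj: "(pdy ^^ j) \<psi> \<in> test_functions U" using test_functions_iterated[OF t, of 0 j] by simp
  show ?thesis using x[OF tj, of c i] y[OF t, of "(dxc w ^^ i) c" j] comm' by (simp add: power_add)
 qed
 then show ?thesis
  by (rule weak_derivI[OF continuous_locally_integrable[OF spoly_continuous] continuous_locally_integrable[OF spoly_continuous]])
qed

section \<open>Integrals over the plane\<close>

abbreviation ind :: "real => real => real => real" where
 "ind a b == indicator {a<..<b}"

abbreviation nsq :: "(pt => real) => ennreal" where
 "nsq f == \<integral>\<^sup>+z. ennreal ((f z)\<^sup>2) \<partial>lborel"

lemma plane_integral:
 fixes f :: "pt => real"
 assumes "integrable lborel f"
 shows "(LINT y|lborel. LINT x|lborel. f (x, y)) = (LINT z|lborel. f z)"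
  "AE y in lborel. integrable lborel (\<lambda>x. f (x, y))"
  "integrable lborel (\<lambda>y. LINT x|lborel. f (x, y))"
proof -
 have i: "integrable (lborel \<Otimes>\<^sub>M lborel) (case_prod (\<lambda>x y. f (x, y)))"
  using assms by (simp add: lborel_prod)
 show "(LINT y|lborel. LINT x|lborel. f (x, y)) = (LINT z|lborel. f z)"
  using lborel_pair.integral_snd[OF i] by (simp add: lborel_prod)
 show "AE y in lborel. integrable lborel (\<lambda>x. f (x, y))" by (rule lborel_pair.AE_integrable_snd[OF i])
 show "integrable lborel (\<lambda>y. LINT x|lborel. f (x, y))" by (rule lborel_pair.integrable_snd[OF i])
qed

lemma plane_nn_integral:
 fixes f :: "pt => ennreal"
 assumes "f \<in> borel_measurable borel"
 shows "(\<integral>\<^sup>+y. \<integral>\<^sup>+x. f (x, y) \<partial>lborel \<partial>lborel) = (\<integral>\<^sup>+z. f z \<partial>lborel)"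
 using lborel_pair.nn_integral_snd[of f] assms by (simp add: lborel_prod)

lemma section_measurable:
 fixes f :: "pt => 'b::topological_space"
 assumes "f \<in> borel_measurable borel"
 shows "(\<lambda>x. f (x, y)) \<in> borel_measurable borel" "(\<lambda>y. f (x, y)) \<in> borel_measurable borel"
proof -
 have 1: "(\<lambda>x. (x, y)) \<in> borel_measurable borel" "(\<lambda>y. (x, y)) \<in> borel_measurable borel" for x y :: real
  by (intro borel_measurable_continuous_onI continuous_intros)+
 show "(\<lambda>x. f (x, y)) \<in> borel_measurable borel" "(\<lambda>y. f (x, y)) \<in> borel_measurable borel"
  using measurable_compose[OF 1(1) assms] measurable_compose[OF 1(2) assms] by auto
qed

lemma swap_integral:
 fixes f :: "pt => real"
 assumes "f \<in> borel_measurable borel"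
 shows "(LINT z|lborel. f (prod.swap z)) = (LINT z|lborel. f z)"
  "integrable lborel (\<lambda>z. f (prod.swap z)) \<longleftrightarrow> integrable lborel f"
  "(\<lambda>z. f (prod.swap z)) \<in> borel_measurable borel"
proof -
 have s: "(\<lambda>(x, y). f (y, x)) = (\<lambda>z. f (prod.swap z))" by (auto simp: fun_eq_iff)
 show "(LINT z|lborel. f (prod.swap z)) = (LINT z|lborel. f z)"
  using lborel_pair.integral_product_swap[of f] assms by (simp add: lborel_prod s)
 show "integrable lborel (\<lambda>z. f (prod.swap z)) \<longleftrightarrow> integrable lborel f"
  using lborel_pair.integrable_product_swap_iff[of f] by (simp add: lborel_prod s)
 have "prod.swap \<in> borel_measurable (borel :: pt measure)"
  by (intro borel_measurable_continuous_onI continuous_on_swap)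
 then show "(\<lambda>z. f (prod.swap z)) \<in> borel_measurable borel"
  using measurable_compose assms by blast
qed

lemma swap_nn_integral:
 fixes f :: "pt => ennreal"
 assumes "f \<in> borel_measurable borel"
 shows "(\<integral>\<^sup>+z. f (prod.swap z) \<partial>lborel) = (\<integral>\<^sup>+z. f z \<partial>lborel)"
proof -
 have m: "(\<lambda>z. f (prod.swap z)) \<in> borel_measurable borel"
 proof -
  have "prod.swap \<in> borel_measurable (borel :: pt measure)"
   by (intro borel_measurable_continuous_onI continuous_on_swap)
  then show ?thesis using measurable_compose assms by blast
 qed
 have "(\<integral>\<^sup>+z. f (prod.swap z) \<partial>lborel) = (\<integral>\<^sup>+y. \<integral>\<^sup>+x. f (y, x) \<partial>lborel \<partial>lborel)"
  using plane_nn_integral[OF m] by simp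
 also have "\<dots> = (\<integral>\<^sup>+x. \<integral>\<^sup>+y. f (y, x) \<partial>lborel \<partial>lborel)"
  using lborel_pair.Fubini[of f] assms by (simp add: lborel_prod)
 also have "\<dots> = (\<integral>\<^sup>+z. f z \<partial>lborel)" using plane_nn_integral[OF assms] by simp
 finally show ?thesis .
qed

lemma mean_square:
 fixes f :: "real => real"
 assumes m: "f \<in> borel_measurable borel" and out: "\<And>x. x \<notin> {a<..<b} ==> f x = 0" and ab: "a < b"
 shows "ennreal ((LINT x|lborel. f x)\<^sup>2) \<le> ennreal (b - a) * (\<integral>\<^sup>+x. ennreal ((f x)\<^sup>2) \<partial>lborel)"
proof (cases "(\<integral>\<^sup>+x. ennreal ((f x)\<^sup>2) \<partial>lborel) = \<infinity>")
 case True
 then show ?thesis using ab by (simp add: ennreal_mult_top)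
next
 case False
 then have i2: "integrable lborel (\<lambda>x. (f x)\<^sup>2)"
  using m by (intro integrableI_bounded) (auto simp: top.not_eq_extremum)
 have "(LINT x|lborel. f x)\<^sup>2 \<le> measure lborel {a<..<b} * (LINT x|lborel. (f x)\<^sup>2)"
  using m out ab by (intro square_integrable_mean(2) i2) auto
 then have "ennreal ((LINT x|lborel. f x)\<^sup>2) \<le> ennreal ((b - a) * (LINT x|lborel. (f x)\<^sup>2))"
  using ab by (intro ennreal_leI) simp
 also have "\<dots> = ennreal (b - a) * (\<integral>\<^sup>+x. ennreal ((f x)\<^sup>2) \<partial>lborel)"
  using ab i2 by (simp add: ennreal_mult nn_integral_eq_integral)
 finally show ?thesis .
qed

section \<open>Antiderivatives of bumps\<close>

text \<open>The primitive that vanishes at minus infinity.\<close>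

definition anti :: "(real => real) => real => real" where
 "anti f t = (LINT x|lborel. indicator {..t} x * f x)"

lemma anti_derivative:
 assumes f: "continuous_on UNIV f" and out: "\<And>x. x \<notin> {m..M} ==> f x = 0"
 shows "(anti f has_real_derivative f t) (at t)"
proof -
 define p where "p = min m t - 1"
 have "anti f u = integral {p..u} f" for u
 proof -
  have i: "set_integrable lborel {p..u} f"
   using f by (intro borel_integrable_atLeastAtMost') (rule continuous_on_subset, auto)
  have "(\<lambda>x. indicator {..u} x * f x) = (\<lambda>x. indicator {p..u} x *\<^sub>R f x)"
  proof
   fix x show "indicator {..u} x * f x = indicator {p..u} x *\<^sub>R f x"
   proof (cases "x < p")
    case True
    then have "x \<notin> {m..M}" by (auto simp: p_def)
    then show ?thesis using out[of x] by simp
   next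
    case False
    then show ?thesis by (auto simp: indicator_def)
   qed
  qed
  then have "anti f u = (LINT x:{p..u}|lborel. f x)"
   by (simp add: anti_def set_lebesgue_integral_def)
  then show ?thesis using set_borel_integral_eq_integral(2)[OF i] by simp
 qed
 then have eq: "anti f = (\<lambda>u. integral {p..u} f)" by (rule ext)
 have "((\<lambda>u. integral {p..u} f) has_real_derivative f t) (at t within {p..t + 1})"
  using f by (intro integral_has_real_derivative) (auto simp: p_def intro: continuous_on_subset)
 moreover have "at t within {p..t + 1} = at t" by (rule at_within_Icc_at) (auto simp: p_def)
 ultimately show ?thesis unfolding eq by simp
qed

text \<open>The length of \<open>(a, b)\<close> to the left of \<open>t\<close>.\<close>

definition len :: "real => real => real => real" where
 "len a b = anti (ind a b)"

lemma len_bounds: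
 assumes "a \<le> b" shows "0 \<le> len a b t" "len a b t \<le> b - a"
proof -
 show "0 \<le> len a b t" unfolding len_def anti_def by (rule integral_nonneg_AE) simp
 have i: "integrable lborel (\<lambda>x. ind a b x :: real)" using assms by simp
 have "integrable lborel (\<lambda>x. indicator {..t} x * ind a b x :: real)"
  using integrable_real_mult_indicator[OF _ i, of "{..t}"] by (simp add: mult.commute)
 then have "len a b t \<le> (LINT x|lborel. ind a b x)"
  unfolding len_def anti_def by (rule integral_mono[OF _ i]) (auto simp: indicator_def)
 then show "len a b t \<le> b - a" using assms by simp
qed

lemma len_measurable: "len a b \<in> borel_measurable borel"
proof -
 have i: "integrable lborel (\<lambda>x. indicator {..t} x * ind a b x :: real)" for t
 proof -
  have "integrable lborel (\<lambda>x. ind a b x :: real)" by (cases "a \<le> b") auto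
  from integrable_real_mult_indicator[OF _ this, of "{..t}"] show ?thesis by (simp add: mult.commute)
 qed
 have "mono (len a b)"
  unfolding len_def anti_def by (intro monoI integral_mono i) (auto simp: indicator_def)
 then show ?thesis by (rule borel_measurable_mono)
qed

lemma bump_integral:
 assumes "a \<le> b"
 shows "integrable lborel (bump n a b)" "\<bar>LINT x|lborel. bump n a b x\<bar> \<le> b - a"
  "(\<lambda>n. LINT x|lborel. bump n a b x) \<longlonglongrightarrow> b - a"
proof -
 have i: "integrable lborel (\<lambda>x. ind a b x :: real)" using assms by simp
 have m: "bump n a b \<in> borel_measurable borel" for n
  by (rule borel_measurable_continuous_onI[OF smooth_continuous[OF smooth_bump]])
 have le: "\<bar>bump n a b x\<bar> \<le> ind a b x" for n x
  using bump_bounds[of n a b x] bump_outside[of x a b n] by (auto simp: indicator_def)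
 show ib: "integrable lborel (bump n a b)"
  by (rule Bochner_Integration.integrable_bound[OF i]) (use m le in auto)
 have "\<bar>LINT x|lborel. bump n a b x\<bar> \<le> (LINT x|lborel. \<bar>bump n a b x\<bar>)" by (rule integral_abs_bound)
 also have "\<dots> \<le> (LINT x|lborel. ind a b x)"
  by (rule integral_mono[OF integrable_abs[OF ib] i]) (rule le)
 finally show "\<bar>LINT x|lborel. bump n a b x\<bar> \<le> b - a" using assms by simp
 have "(\<lambda>n. LINT x|lborel. bump n a b x) \<longlonglongrightarrow> (LINT x|lborel. ind a b x)"
  by (rule integral_dominated_convergence[where w = "ind a b"])
   (use i m le bump_tendsto in \<open>auto intro!: always_eventually\<close>)
 then show "(\<lambda>n. LINT x|lborel. bump n a b x) \<longlonglongrightarrow> b - a" using assms by simp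
qed

section \<open>Weak derivatives tested with products\<close>

text \<open>Weak differentiability in the first variable, tested with products only. In this form exchanging the
  coordinates turns it into weak differentiability in the second variable.\<close>

definition weak_x :: "pt set => (pt => real) => (pt => real) => bool" where
 "weak_x U w g \<longleftrightarrow> (\<forall>f F h a b c d. smooth f \<and> smooth h \<and> (\<forall>x. (F has_real_derivative f x) (at x)) \<and>
   (\<forall>x. x \<notin> {a..b} --> F x = 0) \<and> (\<forall>y. y \<notin> {c..d} --> h y = 0) \<and> cbox (a, c) (b, d) \<subseteq> U -->
   (LINT z|lborel. w z * (f (fst z) * h (snd z))) = - (LINT z|lborel. g z * (F (fst z) * h (snd z))))"

lemma weak_xI:
 assumes wg: "w \<in> borel_measurable borel" "g \<in> borel_measurable borel" and W: "weak_deriv U 1 0 w g"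
 shows "weak_x U w g"
 unfolding weak_x_def
proof (intro allI impI, elim conjE)
 fix f F h a b c d
 assume sm: "smooth f" "smooth h" and d: "\<forall>x. (F has_real_derivative f x) (at x)"
  and out: "\<forall>x. x \<notin> {a..b} --> F x = 0" "\<forall>y. y \<notin> {c..d} --> h y = 0" and sub: "cbox (a, c) (b, d) \<subseteq> U"
 have dF: "\<And>x. (F has_real_derivative f x) (at x)" using d by blast
 have sF: "smooth F" by (rule smooth.intros[OF dF sm(1)])
 have t: "(\<lambda>p. F (fst p) * h (snd p)) \<in> test_functions U"
  by (rule product_test_function[OF sF sm(2) _ _ sub]) (use out in auto)
 have m: "(\<lambda>z::pt. p (fst z) * q (snd z)) \<in> borel_measurable borel" if "smooth p" "smooth q" for p q
  by (rule borel_measurable_continuous_onI[OF product_continuous[OF that]])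
 have "(LINT z|lebesgue. w z * (f (fst z) * h (snd z))) = - (LINT z|lebesgue. g z * (F (fst z) * h (snd z)))"
  using weak_derivD(3)[OF W t] pdx_product[OF dF, of h] by simp
 moreover have "(LINT z|lebesgue. w z * (f (fst z) * h (snd z))) = (LINT z|lborel. w z * (f (fst z) * h (snd z)))"
  using wg m[OF sm] by (intro integral_completion) simp
 moreover have "(LINT z|lebesgue. g z * (F (fst z) * h (snd z))) = (LINT z|lborel. g z * (F (fst z) * h (snd z)))"
  using wg m[OF sF sm(2)] by (intro integral_completion) simp
 ultimately show "(LINT z|lborel. w z * (f (fst z) * h (snd z))) = - (LINT z|lborel. g z * (F (fst z) * h (snd z)))" by simp
qed

lemma weak_xI_swap:
 assumes wg: "w \<in> borel_measurable borel" "g \<in> borel_measurable borel" and W: "weak_deriv U 0 1 w g"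
 shows "weak_x (prod.swap ` U) (\<lambda>z. w (prod.swap z)) (\<lambda>z. g (prod.swap z))"
 unfolding weak_x_def
proof (intro allI impI, elim conjE)
 fix f F h a b c d
 assume sm: "smooth f" "smooth h" and d: "\<forall>x. (F has_real_derivative f x) (at x)"
  and out: "\<forall>x. x \<notin> {a..b} --> F x = 0" "\<forall>y. y \<notin> {c..d} --> h y = 0" and sub: "cbox (a, c) (b, d) \<subseteq> prod.swap ` U"
 have sub': "cbox (c, a) (d, b) \<subseteq> U"
 proof
  fix z assume "z \<in> cbox (c, a) (d, b)"
  then have "prod.swap z \<in> cbox (a, c) (b, d)" by (cases z) auto
  then have "prod.swap z \<in> prod.swap ` U" using sub by blast
  then show "z \<in> U" by (metis imageE swap_swap)
 qed
 have dF: "\<And>x. (F has_real_derivative f x) (at x)" using d by blast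
 have sF: "smooth F" by (rule smooth.intros[OF dF sm(1)])
 have t: "(\<lambda>p. h (fst p) * F (snd p)) \<in> test_functions U"
  by (rule product_test_function[OF sm(2) sF _ _ sub']) (use out in auto)
 have m: "(\<lambda>z::pt. p (fst z) * q (snd z)) \<in> borel_measurable borel" if "smooth p" "smooth q" for p q
  by (rule borel_measurable_continuous_onI[OF product_continuous[OF that]])
 have "(LINT z|lebesgue. w z * (h (fst z) * f (snd z))) = - (LINT z|lebesgue. g z * (h (fst z) * F (snd z)))"
  using weak_derivD(3)[OF W t] pdy_product[OF dF, of h] by simp
 moreover have wm: "(\<lambda>z. w z * (h (fst z) * f (snd z))) \<in> borel_measurable borel" "(\<lambda>z. g z * (h (fst z) * F (snd z))) \<in> borel_measurable borel"
  using wg m[OF sm(2,1)] m[OF sm(2) sF] by simp_all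
 moreover have "(LINT z|lebesgue. w z * (h (fst z) * f (snd z))) = (LINT z|lborel. w (prod.swap z) * (f (fst z) * h (snd z)))"
  using swap_integral(1)[OF wm(1)] integral_completion[of _ lborel] wm(1) by (simp add: mult.commute)
 moreover have "(LINT z|lebesgue. g z * (h (fst z) * F (snd z))) = (LINT z|lborel. g (prod.swap z) * (F (fst z) * h (snd z)))"
  using swap_integral(1)[OF wm(2)] integral_completion[of _ lborel] wm(2) by (simp add: mult.commute)
 ultimately show "(LINT z|lborel. w (prod.swap z) * (f (fst z) * h (snd z))) = - (LINT z|lborel. g (prod.swap z) * (F (fst z) * h (snd z)))" by simp
qed

text \<open>The difference of two bumps, weighted so that its integral vanishes, has a primitive with compact
  support, which multiplied by a bump in the other variable is an admissible test function. The
  bumps converge to indicators of intervals.\<close>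

lemma box_identity:
 assumes W: "weak_x (box (A1, B1) (A2, B2)) w g" and i: "integrable lborel w" "integrable lborel g"
  and ab: "a \<le> b" "A1 < a" "b < A2" and al: "k \<le> l" "A1 < k" "l < A2" and cd: "B1 < c" "d < B2"
 shows "(l - k) * (LINT z|lborel. w z * (ind a b (fst z) * ind c d (snd z)))
  - (b - a) * (LINT z|lborel. w z * (ind k l (fst z) * ind c d (snd z)))
  = - (LINT z|lborel. g z * (((l - k) * len a b (fst z) - (b - a) * len k l (fst z)) * ind c d (snd z)))"
proof -
 define I J where "I n = (LINT x|lborel. bump n a b x)" and "J n = (LINT x|lborel. bump n k l x)" for n
 define f where "f n x = J n * bump n a b x + (- I n) * bump n k l x" for n x
 define fl where "fl x = (l - k) * ind a b x - (b - a) * ind k l x" for x :: real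
 define m M C where "m = min a k" and "M = max b l" and "C = (l - k) + (b - a)"
 define ch where "ch n = bump n c d" for n
 have mM: "m \<le> M" "0 \<le> C" using ab al by (auto simp: m_def M_def C_def)
 have IJ: "\<bar>I n\<bar> \<le> b - a" "\<bar>J n\<bar> \<le> l - k" "I \<longlonglongrightarrow> b - a" "J \<longlonglongrightarrow> l - k" for n
  using bump_integral[OF ab(1)] bump_integral[OF al(1)] by (simp_all add: I_def[abs_def] J_def[abs_def])
 have sf: "smooth (f n)" for n
  unfolding f_def[abs_def] by (intro smooth_add smooth_mult smooth_const smooth_bump)
 have fm: "f n \<in> borel_measurable borel" for n
  by (rule borel_measurable_continuous_onI[OF smooth_continuous[OF sf]])
 have flm: "fl \<in> borel_measurable borel" unfolding fl_def[abs_def] by simp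
 have fout: "f n x = 0" if x: "x \<notin> {m..M}" for n x
 proof -
  have "x \<notin> {a<..<b}" "x \<notin> {k<..<l}" using x by (auto simp: m_def M_def)
  then show ?thesis using bump_outside[of x a b n] bump_outside[of x k l n] by (simp add: f_def)
 qed
 have fC: "\<bar>f n x\<bar> \<le> C" for n x
 proof -
  have 1: "\<bar>J n * bump n a b x\<bar> \<le> (l - k) * 1"
   unfolding abs_mult using IJ bump_bounds al ab by (intro mult_mono; simp)
  have 2: "\<bar>(- I n) * bump n k l x\<bar> \<le> (b - a) * 1"
   unfolding abs_mult using IJ bump_bounds al ab by (intro mult_mono; simp)
  show ?thesis
   using order_trans[OF abs_triangle_ineq add_mono[OF 1 2]] unfolding f_def C_def by simp
 qed
 have fD: "\<bar>f n x\<bar> \<le> C * indicator {m..M} x" for n x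
  using fC[of n x] fout[of x n] by (auto simp: indicator_def)
 have flim: "(\<lambda>n. f n x) \<longlonglongrightarrow> fl x" for x
 proof -
  have "(\<lambda>n. f n x) \<longlonglongrightarrow> (l - k) * ind a b x + (- (b - a)) * ind k l x"
   unfolding f_def by (intro tendsto_intros IJ bump_tendsto)
  then show ?thesis by (simp add: fl_def algebra_simps)
 qed
 have iC: "integrable lborel (\<lambda>x. C * indicator {m..M} x :: real)"
  using mM by (intro integrable_mult_right integrable_real_indicator) auto
 have iC': "(LINT x|lborel. C * indicator {m..M} x :: real) = C * (M - m)" using mM by simp
 have fi: "integrable lborel (f n)" for n
  by (rule Bochner_Integration.integrable_bound[OF iC]) (use fm fD in \<open>auto simp: mM\<close>)
 have f0: "(LINT x|lborel. f n x) = 0" for n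
 proof -
  have "(LINT x|lborel. f n x) = J n * I n + (- I n) * J n"
   unfolding f_def I_def J_def using bump_integral(1)[OF ab(1)] bump_integral(1)[OF al(1)] by simp
  then show ?thesis by simp
 qed
 define F where "F n = anti (f n)" for n
 have dF: "(F n has_real_derivative f n x) (at x)" for n x
  unfolding F_def by (rule anti_derivative[OF smooth_continuous[OF sf] fout])
 have Fout: "F n t = 0" if "t \<notin> {m..M}" for n t
 proof (cases "t < m")
  case True
  have "(\<lambda>x. indicator {..t} x * f n x) = (\<lambda>x. 0)"
  proof
   fix x show "indicator {..t} x * f n x = 0" using True fout[of x n] by (auto simp: indicator_def)
  qed
  then show ?thesis by (simp add: F_def anti_def)
 next
  case False
  have "(\<lambda>x. indicator {..t} x * f n x) = f n"
  proof
   fix x show "indicator {..t} x * f n x = f n x" using False that fout[of x n] by (auto simp: indicator_def)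
  qed
  then show ?thesis using f0 by (simp add: F_def anti_def)
 qed
 have Fl: "anti fl t = (l - k) * len a b t - (b - a) * len k l t" for t
 proof -
  have ii: "integrable lborel (\<lambda>x. indicator {..t} x * ind p q x :: real)" if "p \<le> q" for p q
  proof -
   have "integrable lborel (\<lambda>x. ind p q x :: real)" using that by simp
   from integrable_real_mult_indicator[OF _ this, of "{..t}"] show ?thesis by (simp add: mult.commute)
  qed
  have "anti fl t = (LINT x|lborel. (l - k) * (indicator {..t} x * ind a b x) - (b - a) * (indicator {..t} x * ind k l x))"
   unfolding anti_def fl_def by (intro Bochner_Integration.integral_cong refl) (simp add: algebra_simps)
  then show ?thesis using ii[OF ab(1)] ii[OF al(1)] by (simp add: len_def anti_def)
 qed
 have ai: "\<bar>indicator {..t} x * f n x\<bar> \<le> C * indicator {m..M} x" for t n x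
  using fD[of n x] by (auto simp: indicator_def)
 have am: "(\<lambda>x. indicator {..t} x * f n x) \<in> borel_measurable borel" for t n
  using fm by (intro borel_measurable_times) auto
 have Flim: "(\<lambda>n. F n t) \<longlonglongrightarrow> anti fl t" for t
  unfolding F_def anti_def
 proof (rule integral_dominated_convergence[OF _ _ iC])
  show "AE x in lborel. (\<lambda>n. indicator {..t} x * f n x) \<longlonglongrightarrow> indicator {..t} x * fl x"
   by (intro always_eventually allI tendsto_mult tendsto_const flim)
  show "AE x in lborel. norm (indicator {..t} x * f n x) \<le> C * indicator {m..M} x" for n
   using ai by simp
 qed (use am flm in \<open>auto intro!: borel_measurable_times\<close>)
 have FD: "\<bar>F n t\<bar> \<le> C * (M - m)" for n t
 proof -
  have "integrable lborel (\<lambda>x. indicator {..t} x * f n x)"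
   by (rule Bochner_Integration.integrable_bound[OF iC]) (use am ai in \<open>auto simp: mM\<close>)
  then have "\<bar>F n t\<bar> \<le> (LINT x|lborel. C * indicator {m..M} x)"
   unfolding F_def anti_def
   by (intro order_trans[OF integral_abs_bound] integral_mono[OF integrable_abs iC] ai)
  then show ?thesis unfolding iC' .
 qed
 have ch: "\<bar>ch n y\<bar> \<le> 1" "(\<lambda>n. ch n y) \<longlonglongrightarrow> ind c d y" for n y
  using bump_bounds[of n c d y] bump_tendsto[of c d y] by (auto simp: ch_def)
 have id: "(LINT z|lborel. w z * (f n (fst z) * ch n (snd z))) = - (LINT z|lborel. g z * (F n (fst z) * ch n (snd z)))" for n
 proof -
  have "cbox (m, c) (M, d) \<subseteq> box (A1, B1) (A2, B2)"
   using ab al cd by (auto simp: m_def M_def box_def Basis_prod_def)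
  moreover have "smooth (ch n)" "\<forall>y. y \<notin> {c..d} --> ch n y = 0" using smooth_bump bump_outside by (auto simp: ch_def)
  ultimately show ?thesis
   by (intro W[unfolded weak_x_def, rule_format, of "f n" "ch n" "F n" m M c d] conjI allI impI sf dF) (use Fout in auto)
 qed
 have wm: "w \<in> borel_measurable borel" "g \<in> borel_measurable borel" using i borel_measurable_integrable by auto
 have cm: "(\<lambda>z::pt. p (fst z)) \<in> borel_measurable borel" "(\<lambda>z::pt. p (snd z)) \<in> borel_measurable borel"
  if "p \<in> borel_measurable borel" for p :: "real => real"
  using measurable_compose[OF borel_measurable_continuous_onI[OF continuous_on_fst[OF continuous_on_id]] that]
   measurable_compose[OF borel_measurable_continuous_onI[OF continuous_on_snd[OF continuous_on_id]] that] by auto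
 have chm: "ch n \<in> borel_measurable borel" for n
  unfolding ch_def by (rule borel_measurable_continuous_onI[OF smooth_continuous[OF smooth_bump]])
 have Fm: "F n \<in> borel_measurable borel" for n
  by (rule borel_measurable_continuous_onI) (meson DERIV_isCont continuous_at_imp_continuous_on dF)
 have afm: "anti fl \<in> borel_measurable borel"
 proof (rule borel_measurable_LIMSEQ_real[where u = F])
  show "F n \<in> borel_measurable borel" for n by (rule Fm)
  show "(\<lambda>n. F n t) \<longlonglongrightarrow> anti fl t" for t by (rule Flim)
 qed
 have DC: "(\<lambda>n. LINT z|lborel. u z * (p n (fst z) * ch n (snd z))) \<longlonglongrightarrow> (LINT z|lborel. u z * (pl (fst z) * ind c d (snd z)))"
  if u: "integrable lborel u" and p: "\<And>n. p n \<in> borel_measurable borel" "pl \<in> borel_measurable borel"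
   "\<And>n x. \<bar>p n x\<bar> \<le> D" "\<And>x. (\<lambda>n. p n x) \<longlonglongrightarrow> pl x" "0 \<le> D"
  for u :: "pt => real" and p :: "nat => real => real" and pl D
 proof (rule integral_dominated_convergence[where w = "\<lambda>z. D * \<bar>u z\<bar>"])
  have um: "u \<in> borel_measurable borel" using u borel_measurable_integrable by auto
  show "(\<lambda>z. u z * (pl (fst z) * ind c d (snd z))) \<in> borel_measurable lborel"
   using um cm(1)[OF p(2)] cm(2)[of "ind c d"] by (simp add: borel_measurable_times)
  show "(\<lambda>z. u z * (p n (fst z) * ch n (snd z))) \<in> borel_measurable lborel" for n
   using um cm(1)[OF p(1)] cm(2)[OF chm] by (simp add: borel_measurable_times)
  show "integrable lborel (\<lambda>z. D * \<bar>u z\<bar>)" using u by simp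
  show "AE z in lborel. (\<lambda>n. u z * (p n (fst z) * ch n (snd z))) \<longlonglongrightarrow> u z * (pl (fst z) * ind c d (snd z))"
   by (intro always_eventually allI tendsto_mult tendsto_const p ch)
  have "\<bar>u z\<bar> * (\<bar>p n (fst z)\<bar> * \<bar>ch n (snd z)\<bar>) \<le> \<bar>u z\<bar> * (D * 1)" for n z
   using p(3,5) ch(1) by (intro mult_left_mono mult_mono) auto
  then show "AE z in lborel. norm (u z * (p n (fst z) * ch n (snd z))) \<le> D * \<bar>u z\<bar>" for n
   by (simp add: abs_mult mult.commute)
 qed
 have L: "(\<lambda>n. LINT z|lborel. w z * (f n (fst z) * ch n (snd z))) \<longlonglongrightarrow> (LINT z|lborel. w z * (fl (fst z) * ind c d (snd z)))"
  by (rule DC[OF i(1) fm flm fC flim mM(2)])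
 have "(\<lambda>n. LINT z|lborel. g z * (F n (fst z) * ch n (snd z))) \<longlonglongrightarrow> (LINT z|lborel. g z * (anti fl (fst z) * ind c d (snd z)))"
  by (rule DC[OF i(2) Fm afm FD Flim]) (use mM in simp)
 then have R: "(\<lambda>n. - (LINT z|lborel. g z * (F n (fst z) * ch n (snd z)))) \<longlonglongrightarrow> - (LINT z|lborel. g z * (anti fl (fst z) * ind c d (snd z)))"
  by (rule tendsto_minus)
 have lim: "(LINT z|lborel. w z * (fl (fst z) * ind c d (snd z))) = - (LINT z|lborel. g z * (anti fl (fst z) * ind c d (snd z)))"
  using LIMSEQ_unique[OF L] R unfolding id[symmetric] by simp
 have wi: "integrable lborel (\<lambda>z. w z * (ind p q (fst z) * ind c d (snd z)))" for p q
 proof (rule Bochner_Integration.integrable_bound[OF i(1)])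
  show "(\<lambda>z. w z * (ind p q (fst z) * ind c d (snd z))) \<in> borel_measurable lborel"
   using wm cm(1)[of "ind p q"] cm(2)[of "ind c d"] by (simp add: borel_measurable_times)
  show "AE z in lborel. norm (w z * (ind p q (fst z) * ind c d (snd z))) \<le> norm (w z)"
   by (intro always_eventually allI) (auto simp: indicator_def)
 qed
 have "(LINT z|lborel. w z * (fl (fst z) * ind c d (snd z))) =
  (LINT z|lborel. (l - k) * (w z * (ind a b (fst z) * ind c d (snd z)))
   - (b - a) * (w z * (ind k l (fst z) * ind c d (snd z))))"
  unfolding fl_def by (intro Bochner_Integration.integral_cong refl) (simp add: algebra_simps)
 then show ?thesis using lim wi by (simp add: Fl)
qed

section \<open>Deviation from the mean along lines\<close>

lemma integrable_product:
 fixes f g :: "real => real"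
 assumes "integrable lborel f" "integrable lborel g"
 shows "integrable lborel (\<lambda>z::pt. f (fst z) * g (snd z))"
proof -
 have "integrable (lborel \<Otimes>\<^sub>M lborel) (\<lambda>z. f (fst z) * g (snd z))"
 proof (rule lborel_pair.Fubini_integrable)
  show "(\<lambda>z. f (fst z) * g (snd z)) \<in> borel_measurable (lborel \<Otimes>\<^sub>M lborel)"
   using assms[THEN borel_measurable_integrable] by measurable
  show "integrable lborel (\<lambda>x. LINT y|lborel. norm (f (fst (x, y)) * g (snd (x, y))))"
   using assms by (simp add: abs_mult)
  show "AE x in lborel. integrable lborel (\<lambda>y. f (fst (x, y)) * g (snd (x, y)))"
   using assms by simp
 qed
 then show ?thesis by (simp add: lborel_prod)
qed

lemma nn_section_measurable:
 fixes f :: "pt => ennreal"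
 assumes f: "f \<in> borel_measurable borel"
 shows "(\<lambda>y. \<integral>\<^sup>+x. f (x, y) \<partial>lborel) \<in> borel_measurable borel"
proof -
 have "prod.swap \<in> borel_measurable (borel :: pt measure)"
  by (intro borel_measurable_continuous_onI continuous_on_swap)
 from measurable_compose[OF this f] have "(\<lambda>(y, x). f (x, y)) \<in> borel_measurable ((borel :: real measure) \<Otimes>\<^sub>M (lborel :: real measure))"
  unfolding measurable_cong_sets[OF sets_pair_measure_cong[OF refl sets_lborel] refl] borel_prod
  by (simp add: case_prod_beta prod.swap_def)
 then show ?thesis by (rule lborel.borel_measurable_nn_integral)
qed

text \<open>The mean over \<open>s\<close> in \<open>(k, l)\<close> of the kernel that recovers \<open>w x - w s\<close> from the derivative of \<open>w\<close>.\<close>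

definition slice_kernel :: "real => real => real => real => real" where
 "slice_kernel k l x t = len k l t / (l - k) - indicator {..t} x"

definition slice_remainder :: "real => real => (pt => real) => pt => real" where
 "slice_remainder k l g z = (LINT t|lborel. slice_kernel k l (fst z) t * g (t, snd z))"

definition slice_mean :: "real => real => (pt => real) => real => real" where
 "slice_mean k l w y = (LINT x|lborel. ind k l x * w (x, y)) / (l - k)"

lemma slice_kernel_bound: assumes "k < l" shows "\<bar>slice_kernel k l x t\<bar> \<le> 1"
proof -
 have "0 \<le> len k l t / (l - k)" "len k l t / (l - k) \<le> 1"
  using len_bounds[of k l t] assms by (simp_all add: divide_le_eq)
 then show ?thesis unfolding slice_kernel_def abs_le_iff by (cases "x \<le> t") (auto simp: indicator_def simp del: divide_le_eq_1_pos)
qed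

lemma slice_kernel_measurable:
 "(\<lambda>z::pt. slice_kernel k l (fst z) (snd z)) \<in> borel_measurable borel"
 "(\<lambda>t. slice_kernel k l x t) \<in> borel_measurable borel"
proof -
 have "{z :: pt. fst z \<le> snd z} \<in> sets borel" by (intro borel_closed closed_Collect_le continuous_intros)
 then have 1: "(\<lambda>z::pt. indicator {z. fst z \<le> snd z} z :: real) \<in> borel_measurable borel" by simp
 have 2: "(indicator {..snd z} (fst z) :: real) = indicator {z. fst z \<le> snd z} z" for z :: pt
  by (auto simp: indicator_def)
 have 3: "(\<lambda>z::pt. len k l (snd z)) \<in> borel_measurable borel"
  by (rule measurable_compose[OF borel_measurable_continuous_onI[OF continuous_on_snd[OF continuous_on_id]] len_measurable])
 show "(\<lambda>z::pt. slice_kernel k l (fst z) (snd z)) \<in> borel_measurable borel"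
  unfolding slice_kernel_def 2 using 1 3 by (intro borel_measurable_diff borel_measurable_divide) auto
 from section_measurable(2)[OF this, of x] show "(\<lambda>t. slice_kernel k l x t) \<in> borel_measurable borel" by simp
qed

lemma slice_remainder_measurable:
 assumes g: "g \<in> borel_measurable borel"
 shows "slice_remainder k l g \<in> borel_measurable borel"
proof -
 have m: "(\<lambda>p::pt \<times> real. (fst (fst p), snd p)) \<in> borel_measurable borel" "(\<lambda>p::pt \<times> real. (snd p, snd (fst p))) \<in> borel_measurable borel"
  by (intro borel_measurable_continuous_onI continuous_intros)+
 have "(\<lambda>p::pt \<times> real. slice_kernel k l (fst (fst p)) (snd p) * g (snd p, snd (fst p))) \<in> borel_measurable borel"
  using measurable_compose[OF m(1) slice_kernel_measurable(1), of k l] measurable_compose[OF m(2) g]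
  by (intro borel_measurable_times) auto
 then have "(\<lambda>(z, t). slice_kernel k l (fst z) t * g (t, snd z)) \<in> borel_measurable ((borel :: pt measure) \<Otimes>\<^sub>M (lborel :: real measure))"
  unfolding measurable_cong_sets[OF sets_pair_measure_cong[OF refl sets_lborel] refl] borel_prod
  by (simp add: case_prod_beta)
 then show ?thesis
  unfolding slice_remainder_def[abs_def] by (rule lborel.borel_measurable_lebesgue_integral)
qed

lemma slice_remainder_bound:
 assumes "k < l"
 shows "ennreal \<bar>slice_remainder k l g z\<bar> \<le> (\<integral>\<^sup>+t. ennreal \<bar>g (t, snd z)\<bar> \<partial>lborel)"
proof -
 let ?f = "\<lambda>t. slice_kernel k l (fst z) t * g (t, snd z)"
 have "ennreal \<bar>slice_remainder k l g z\<bar> \<le> (\<integral>\<^sup>+t. ennreal \<bar>?f t\<bar> \<partial>lborel)"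
 proof (cases "integrable lborel ?f")
  case True
  then show ?thesis using integral_norm_bound_ennreal[OF True] by (simp add: slice_remainder_def)
 next
  case False
  then show ?thesis by (simp add: slice_remainder_def not_integrable_integral_eq)
 qed
 also have "\<dots> \<le> (\<integral>\<^sup>+t. ennreal \<bar>g (t, snd z)\<bar> \<partial>lborel)"
  using mult_right_mono[OF slice_kernel_bound[OF assms] abs_ge_zero]
  by (intro nn_integral_mono ennreal_leI) (simp add: abs_mult)
 finally show ?thesis .
qed

lemma slice_kernel_swap:
 assumes \<gamma>: "integrable lborel \<gamma>" and al: "k < l" and ab: "a \<le> b"
 shows "(LINT x|lborel. ind a b x * (LINT t|lborel. slice_kernel k l x t * \<gamma> t))
  = (LINT t|lborel. \<gamma> t * ((b - a) * len k l t / (l - k) - len a b t))"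
proof -
 define f where "f x t = ind a b x * (slice_kernel k l x t * \<gamma> t)" for x t :: real
 have ii: "integrable lborel (\<lambda>x. ind a b x :: real)" using ab by simp
 have ij: "integrable lborel (\<lambda>x. indicator {..t} x * ind a b x :: real)" for t
  using integrable_real_mult_indicator[OF _ ii, of "{..t}"] by (simp add: mult.commute)
 have "integrable lborel (\<lambda>z::pt. f (fst z) (snd z))"
 proof (rule Bochner_Integration.integrable_bound[OF integrable_product[OF ii \<gamma>]])
  have 1: "(\<lambda>z::pt. ind a b (fst z) :: real) \<in> borel_measurable borel"
   by (rule measurable_compose[OF borel_measurable_continuous_onI[OF continuous_on_fst[OF continuous_on_id]]]) simp
  have "\<gamma> \<in> borel_measurable borel" using borel_measurable_integrable[OF \<gamma>] by simp
  then have 2: "(\<lambda>z::pt. \<gamma> (snd z)) \<in> borel_measurable borel"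
   by (rule measurable_compose[OF borel_measurable_continuous_onI[OF continuous_on_snd[OF continuous_on_id]]])
  show "(\<lambda>z::pt. f (fst z) (snd z)) \<in> borel_measurable lborel"
   unfolding f_def using 1 2 slice_kernel_measurable(1)[of k l] by (simp add: borel_measurable_times)
  have "\<bar>slice_kernel k l x t\<bar> * \<bar>\<gamma> t\<bar> \<le> \<bar>\<gamma> t\<bar>" for x t
   using mult_right_mono[OF slice_kernel_bound[OF al] abs_ge_zero] by simp
  then show "AE z::pt in lborel. norm (f (fst z) (snd z)) \<le> norm (ind a b (fst z) * \<gamma> (snd z))"
   by (intro always_eventually allI) (auto simp: f_def abs_mult indicator_def)
 qed
 then have "integrable (lborel \<Otimes>\<^sub>M lborel) (case_prod f)" by (simp add: lborel_prod case_prod_beta')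
 from lborel_pair.Fubini_integral[OF this]
 have "(LINT x|lborel. LINT t|lborel. f x t) = (LINT t|lborel. LINT x|lborel. f x t)" by simp
 moreover have "(LINT x|lborel. f x t) = \<gamma> t * ((b - a) * len k l t / (l - k) - len a b t)" for t
 proof -
  have "(LINT x|lborel. f x t) = (LINT x|lborel. \<gamma> t * (len k l t / (l - k) * ind a b x - indicator {..t} x * ind a b x))"
   unfolding f_def slice_kernel_def by (intro Bochner_Integration.integral_cong refl) (simp add: algebra_simps)
  also have "\<dots> = \<gamma> t * (len k l t / (l - k) * (LINT x|lborel. ind a b x) - (LINT x|lborel. indicator {..t} x * ind a b x))"
   using ii ij by simp
  also have "(LINT x|lborel. indicator {..t} x * ind a b x) = len a b t" by (simp add: len_def anti_def)
  finally show ?thesis using ab by (simp add: mult.commute)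
 qed
 ultimately show ?thesis unfolding f_def by simp
qed

text \<open>Both sides have the same integral over every box, by \<open>box_identity\<close> and Fubini's theorem.\<close>

lemma slice_representation:
 assumes W: "weak_x (box (A1, B1) (A2, B2)) w g" and i: "integrable lborel w" "integrable lborel g"
  and al: "k < l" "A1 < k" "l < A2" "B1 < B2"
 shows "AE z in lborel. z \<in> box (A1, B1) (A2, B2) --> w z = slice_mean k l w (snd z) + slice_remainder k l g z"
proof -
 define U where "U = box (A1, B1) (A2, B2)"
 have inU: "z \<in> U \<longleftrightarrow> fst z \<in> {A1<..<A2} \<and> snd z \<in> {B1<..<B2}" for z
  by (cases z) (auto simp: U_def mem_box Basis_prod_def)
 have indU: "(indicator U z :: real) = indicator {A1<..<A2} (fst z) * indicator {B1<..<B2} (snd z)" for z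
  using inU[of z] by (auto simp: indicator_def)
 have cm: "(\<lambda>z::pt. p (fst z)) \<in> borel_measurable borel" "(\<lambda>z::pt. p (snd z)) \<in> borel_measurable borel"
  if "p \<in> borel_measurable borel" for p :: "real => real"
  using measurable_compose[OF borel_measurable_continuous_onI[OF continuous_on_fst[OF continuous_on_id]] that]
   measurable_compose[OF borel_measurable_continuous_onI[OF continuous_on_snd[OF continuous_on_id]] that] by auto
 have wm: "w \<in> borel_measurable borel" "g \<in> borel_measurable borel" using i borel_measurable_integrable by auto
 have cut: "integrable lborel (\<lambda>z. p (fst z) * q (snd z) * u z)"
  if u: "integrable lborel u" and p: "p \<in> borel_measurable borel" "q \<in> borel_measurable borel"
   "\<And>x. \<bar>p x\<bar> \<le> D" "\<And>y. \<bar>q y\<bar> \<le> 1" for u :: "pt => real" and p q D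
 proof (rule Bochner_Integration.integrable_bound[where f = "\<lambda>z. D * u z"])
  show "integrable lborel (\<lambda>z. D * u z)" using u by simp
  show "(\<lambda>z. p (fst z) * q (snd z) * u z) \<in> borel_measurable lborel"
   using borel_measurable_integrable[OF u] cm(1)[OF p(1)] cm(2)[OF p(2)] by (simp add: borel_measurable_times)
  have D: "0 \<le> D" using p(3)[of 0] by linarith
  have "\<bar>p x\<bar> * \<bar>q y\<bar> \<le> D * 1" for x y using D by (intro mult_mono p) auto
  then have "\<bar>p x\<bar> * \<bar>q y\<bar> * \<bar>u z\<bar> \<le> D * 1 * \<bar>u z\<bar>" for x y z by (rule mult_right_mono) simp
  then show "AE z in lborel. norm (p (fst z) * q (snd z) * u z) \<le> norm (D * u z)"
   using D by (simp add: abs_mult)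
 qed
 have ind: "(\<lambda>x. ind a b x :: real) \<in> borel_measurable borel" "\<bar>ind a b x :: real\<bar> \<le> 1" for a b x :: real
  by (auto simp: indicator_def)
 have cutI: "integrable lborel (\<lambda>z. ind a b (fst z) * ind c d (snd z) * u z)"
  if "integrable lborel u" for u :: "pt => real" and a b c d
  by (rule cut[OF that ind(1) ind(1) ind(2) ind(2)])
 have iI: "integrable lborel (\<lambda>x. ind a b x :: real)" for a b :: real by (cases "a \<le> b") auto
 define av where "av = slice_mean k l w"
 define rr where "rr = slice_remainder k l g"
 have av: "integrable lborel av"
 proof -
  have "integrable lborel (\<lambda>z. ind k l (fst z) * 1 * w z)"
   by (rule cut[OF i(1) ind(1) _ ind(2)]) auto
  from plane_integral(3)[OF this] show ?thesis unfolding av_def slice_mean_def[abs_def] by simp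
 qed
 have iav: "integrable lborel (\<lambda>z. indicator {A1<..<A2} (fst z) * av (snd z))"
  by (rule integrable_product[OF iI av])
 have rm: "rr \<in> borel_measurable borel" unfolding rr_def by (rule slice_remainder_measurable[OF wm(2)])
 \<comment> \<open>this also covers sections on which the integral defining the remainder is 0 by default\<close>
 have irr: "integrable lborel (\<lambda>z. indicator {A1<..<A2} (fst z) * rr z)"
 proof (rule integrableI_bounded)
  show "(\<lambda>z. indicator {A1<..<A2} (fst z) * rr z) \<in> borel_measurable lborel"
   using rm cm(1)[OF ind(1)] by (simp add: borel_measurable_times)
  define Q where "Q y = (\<integral>\<^sup>+t. ennreal \<bar>g (t, y)\<bar> \<partial>lborel)" for y
  have gb: "(\<lambda>z. ennreal \<bar>g z\<bar>) \<in> borel_measurable borel" using wm(2) by simp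
  have Qm: "Q \<in> borel_measurable borel"
   unfolding Q_def by (rule nn_section_measurable[OF gb])
  have "(\<integral>\<^sup>+z. ennreal (norm (indicator {A1<..<A2} (fst z) * rr z)) \<partial>lborel) \<le> (\<integral>\<^sup>+z. indicator {A1<..<A2} (fst z) * Q (snd z) \<partial>(lborel :: pt measure))"
   using slice_remainder_bound[OF al(1), of g] by (intro nn_integral_mono) (auto simp: indicator_def Q_def rr_def)
  also have "\<dots> = (\<integral>\<^sup>+y. \<integral>\<^sup>+x. indicator {A1<..<A2} x * Q y \<partial>lborel \<partial>lborel)"
  proof (subst plane_nn_integral[symmetric])
   have "(\<lambda>z::pt. Q (snd z)) \<in> borel_measurable borel"
    by (rule measurable_compose[OF borel_measurable_continuous_onI[OF continuous_on_snd[OF continuous_on_id]] Qm])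
   moreover have "(\<lambda>z::pt. indicator {A1<..<A2} (fst z) :: ennreal) \<in> borel_measurable borel"
    by (rule measurable_compose[OF borel_measurable_continuous_onI[OF continuous_on_fst[OF continuous_on_id]]]) simp
   ultimately show "(\<lambda>z::pt. indicator {A1<..<A2} (fst z) * Q (snd z)) \<in> borel_measurable borel" by (intro borel_measurable_times_ennreal)
  qed simp
  also have "\<dots> = ennreal (A2 - A1) * (\<integral>\<^sup>+y. Q y \<partial>lborel)"
   using Qm al by (simp add: nn_integral_multc nn_integral_cmult)
  also have "(\<integral>\<^sup>+y. Q y \<partial>lborel) = (\<integral>\<^sup>+z. ennreal \<bar>g z\<bar> \<partial>lborel)" unfolding Q_def by (rule plane_nn_integral[OF gb])
  also have "ennreal (A2 - A1) * \<dots> < \<infinity>"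
   using i(2) by (simp add: ennreal_mult_less_top integrable_iff_bounded)
  finally show "(\<integral>\<^sup>+z. ennreal (norm (indicator {A1<..<A2} (fst z) * rr z)) \<partial>lborel) < \<infinity>" .
 qed
 define h where "h z = indicator U z * (w z - av (snd z) - rr z)" for z
 have h_eq: "h = (\<lambda>z. indicator {A1<..<A2} (fst z) * indicator {B1<..<B2} (snd z) * w z
   - 1 * indicator {B1<..<B2} (snd z) * (indicator {A1<..<A2} (fst z) * av (snd z))
   - 1 * indicator {B1<..<B2} (snd z) * (indicator {A1<..<A2} (fst z) * rr z))"
  by (rule ext) (simp only: h_def indU right_diff_distrib left_diff_distrib mult_1 mult.assoc mult.left_commute mult.commute)
 have ih: "integrable lborel h"
  unfolding h_eq by (intro Bochner_Integration.integrable_diff cutI i cut[OF iav _ ind(1) _ ind(2), where D = 1 and p = "\<lambda>x. 1"]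
   cut[OF irr _ ind(1) _ ind(2), where D = 1 and p = "\<lambda>x. 1"]) auto
 have "AE z in lborel. h z = 0"
 proof (rule AE_zero_of_box_integrals[OF ih])
  show "h z = 0" if "z \<notin> box (A1, B1) (A2, B2)" for z using that by (simp add: h_def U_def)
  fix p q :: pt assume sub: "cbox p q \<subseteq> box (A1, B1) (A2, B2)"
  obtain a c b d where pq: "p = (a, c)" "q = (b, d)" by (metis surj_pair)
  show "(LINT z|lborel. indicator (cbox p q) z * h z) = 0"
  proof (cases "a \<le> b \<and> c \<le> d")
   case False
   then have "cbox p q = {}" by (auto simp: pq)
   then show ?thesis by simp
  next
   case True
   have "(a, c) \<in> cbox p q" "(b, d) \<in> cbox p q" using True by (auto simp: pq)
   then have in2: "(a, c) \<in> U" "(b, d) \<in> U" using sub by (auto simp: U_def)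
   then have ab: "a \<le> b" "A1 < a" "b < A2" "B1 < c" "d < B2" using True inU[of "(a, c)"] inU[of "(b, d)"] by auto
   let ?x = "\<lambda>z::pt. ind a b (fst z) :: real" and ?y = "\<lambda>z::pt. ind c d (snd z) :: real"
   let ?\<kappa> = "\<lambda>t. (b - a) * len k l t / (l - k) - len a b t"
   have xA: "ind a b x = (ind a b x * indicator {A1<..<A2} x :: real)" for x
    using ab by (auto simp: indicator_def)
   have i1: "integrable lborel (\<lambda>z. ?x z * ?y z * w z)" by (rule cutI[OF i(1)])
   have i2: "integrable lborel (\<lambda>z. ?x z * ?y z * av (snd z))"
    using cutI[OF iav, of a b c d] by (subst xA) (simp add: ac_simps)
   have i3: "integrable lborel (\<lambda>z. ?x z * ?y z * rr z)"
    using cutI[OF irr, of a b c d] by (subst xA) (simp add: ac_simps)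
   have "(LINT z|lborel. indicator (cbox p q) z * h z) = (LINT z|lborel. ?x z * ?y z * w z - ?x z * ?y z * av (snd z) - ?x z * ?y z * rr z)"
   proof (rule integral_cong_AE)
    show "AE z in lborel. indicator (cbox p q) z * h z = ?x z * ?y z * w z - ?x z * ?y z * av (snd z) - ?x z * ?y z * rr z"
     using cbox_box_AE[of p q]
    proof eventually_elim
     case (elim z)
     have "(indicator (box p q) z :: real) = ?x z * ?y z"
      by (cases z) (auto simp: pq mem_box Basis_prod_def indicator_def)
     then have "indicator (cbox p q) z * h z = ?x z * ?y z * indicator U z * (w z - av (snd z) - rr z)"
      unfolding elim h_def by simp
     also have "?x z * ?y z * indicator U z = ?x z * ?y z"
      using ab inU[of z] by (auto simp: indicator_def)
     finally show ?case by (simp only: right_diff_distrib)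
    qed
    show "(\<lambda>z. indicator (cbox p q) z * h z) \<in> borel_measurable lborel"
     using borel_measurable_integrable[OF ih] by (intro borel_measurable_times) auto
   qed (rule borel_measurable_integrable[OF Bochner_Integration.integrable_diff[OF Bochner_Integration.integrable_diff[OF i1 i2] i3]])
   also have "\<dots> = (LINT z|lborel. ?x z * ?y z * w z) - (LINT z|lborel. ?x z * ?y z * av (snd z)) - (LINT z|lborel. ?x z * ?y z * rr z)"
    using i1 i2 i3 by simp
   finally have split: "(LINT z|lborel. indicator (cbox p q) z * h z) = \<dots>" .
   have e2: "(LINT z|lborel. ?x z * ?y z * av (snd z)) = (b - a) / (l - k) * (LINT z|lborel. ind k l (fst z) * ?y z * w z)"
   proof -
    have "(LINT z|lborel. ?x z * ?y z * av (snd z)) = (LINT y|lborel. (b - a) * (ind c d y * av y))"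
     using plane_integral(1)[OF i2] ab(1) by (simp add: mult.assoc)
    also have "\<dots> = (LINT y|lborel. (b - a) / (l - k) * (LINT x|lborel. ind k l x * ind c d y * w (x, y)))"
    proof (intro Bochner_Integration.integral_cong refl)
     fix y :: real
     have "(LINT x|lborel. ind k l x * ind c d y * w (x, y)) = (LINT x|lborel. ind c d y * (ind k l x * w (x, y)))"
      by (simp only: ac_simps)
     also have "\<dots> = ind c d y * (LINT x|lborel. ind k l x * w (x, y))" by (rule integral_mult_right_zero)
     finally show "(b - a) * (ind c d y * av y) = (b - a) / (l - k) * (LINT x|lborel. ind k l x * ind c d y * w (x, y))"
      by (simp add: av_def slice_mean_def)
    qed
    also have "\<dots> = (b - a) / (l - k) * (LINT y|lborel. LINT x|lborel. ind k l x * ind c d y * w (x, y))"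
     by (rule integral_mult_right_zero)
    also have "(LINT y|lborel. LINT x|lborel. ind k l x * ind c d y * w (x, y)) = (LINT z|lborel. ind k l (fst z) * ?y z * w z)"
     using plane_integral(1)[OF cutI[OF i(1), of k l c d]] by simp
    finally show ?thesis .
   qed
   have \<kappa>m: "?\<kappa> \<in> borel_measurable borel" using len_measurable by (intro borel_measurable_diff borel_measurable_divide borel_measurable_times) auto
   have \<kappa>b: "\<bar>?\<kappa> t\<bar> \<le> (b - a) + (b - a)" for t
   proof -
    have q: "\<bar>(b - a) * (len k l t / (l - k))\<bar> \<le> b - a"
    proof -
     have "\<bar>(b - a) * (len k l t / (l - k))\<bar> \<le> (b - a) * 1"
      unfolding abs_mult using len_bounds[of k l t] al ab(1) by (intro mult_mono) auto
     then show ?thesis by (simp only: mult_1_right)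
    qed
    have "\<bar>x - y\<bar> \<le> c + c" if "\<bar>x\<bar> \<le> c" "0 \<le> y" "y \<le> c" for x y c :: real using that by linarith
    from this[OF q len_bounds[OF ab(1)]] show ?thesis unfolding times_divide_eq_right .
   qed
   have i4: "integrable lborel (\<lambda>z. ?\<kappa> (fst z) * ?y z * g z)" by (rule cut[OF i(2) \<kappa>m ind(1) \<kappa>b ind(2)])
   have e3: "(LINT z|lborel. ?x z * ?y z * rr z) = (LINT z|lborel. ?\<kappa> (fst z) * ?y z * g z)"
   proof -
    have "(LINT z|lborel. ?x z * ?y z * rr z) = (LINT y|lborel. LINT x|lborel. ind a b x * ind c d y * rr (x, y))"
     using plane_integral(1)[OF i3] by simp
    also have "\<dots> = (LINT y|lborel. LINT t|lborel. ?\<kappa> t * ind c d y * g (t, y))"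
    proof (rule integral_cong_AE)
     show "(\<lambda>y. LINT x|lborel. ind a b x * ind c d y * rr (x, y)) \<in> borel_measurable lborel"
      using borel_measurable_integrable[OF plane_integral(3)[OF i3]] by simp
     show "(\<lambda>y. LINT t|lborel. ?\<kappa> t * ind c d y * g (t, y)) \<in> borel_measurable lborel"
      using borel_measurable_integrable[OF plane_integral(3)[OF i4]] by simp
     show "AE y in lborel. (LINT x|lborel. ind a b x * ind c d y * rr (x, y)) = (LINT t|lborel. ?\<kappa> t * ind c d y * g (t, y))"
      using plane_integral(2)[OF i(2)]
     proof eventually_elim
      case (elim y)
      have "(LINT x|lborel. ind a b x * ind c d y * rr (x, y)) = (LINT x|lborel. ind c d y * (ind a b x * rr (x, y)))"
       by (simp only: ac_simps)
      also have "\<dots> = ind c d y * (LINT x|lborel. ind a b x * rr (x, y))" by (rule integral_mult_right_zero)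
      also have "(LINT x|lborel. ind a b x * rr (x, y)) = (LINT t|lborel. g (t, y) * ?\<kappa> t)"
       using slice_kernel_swap[OF elim al(1) ab(1)] by (simp add: rr_def slice_remainder_def)
      also have "ind c d y * \<dots> = (LINT t|lborel. ind c d y * (g (t, y) * ?\<kappa> t))" by (rule integral_mult_right_zero[symmetric])
      also have "\<dots> = (LINT t|lborel. ?\<kappa> t * ind c d y * g (t, y))" by (intro Bochner_Integration.integral_cong refl) (simp only: ac_simps)
      finally show ?case .
     qed
    qed
    also have "\<dots> = (LINT z|lborel. ?\<kappa> (fst z) * ?y z * g z)" using plane_integral(1)[OF i4] by simp
    finally show ?thesis .
   qed
   have e4: "(LINT z|lborel. g z * (((l - k) * len a b (fst z) - (b - a) * len k l (fst z)) * ?y z)) = - (l - k) * (LINT z|lborel. ?\<kappa> (fst z) * ?y z * g z)"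
   proof -
    have "(LINT z|lborel. g z * (((l - k) * len a b (fst z) - (b - a) * len k l (fst z)) * ?y z)) = (LINT z|lborel. - (l - k) * (?\<kappa> (fst z) * ?y z * g z))"
     using al(1) by (intro Bochner_Integration.integral_cong refl) (simp add: field_simps)
    then show ?thesis by simp
   qed
   have "(l - k) * (LINT z|lborel. ?x z * ?y z * w z) - (b - a) * (LINT z|lborel. ind k l (fst z) * ?y z * w z) = (l - k) * (LINT z|lborel. ?\<kappa> (fst z) * ?y z * g z)"
    using box_identity[OF W i ab(1,2,3) less_imp_le[OF al(1)] al(2,3) ab(4,5)] unfolding e4 by (simp add: mult.commute left_diff_distrib)
   note bal = this
   have solve: "X = q / p * Y + Z" if "p * X - q * Y = p * Z" "0 < p" for p q X Y Z :: real
    using that by (simp add: field_simps)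
   have "(LINT z|lborel. ?x z * ?y z * w z) = (b - a) / (l - k) * (LINT z|lborel. ind k l (fst z) * ?y z * w z) + (LINT z|lborel. ?\<kappa> (fst z) * ?y z * g z)"
    by (rule solve[OF bal]) (use al(1) in simp)
   then show ?thesis unfolding split e2 e3 by simp
  qed
 qed
 then show ?thesis
 proof eventually_elim
  case (elim z)
  then show ?case by (auto simp: h_def U_def av_def rr_def indicator_def)
 qed
qed

lemma slice_remainder_square:
 assumes g: "g \<in> borel_measurable borel" and out: "\<And>z. fst z \<notin> {A1<..<A2} ==> g z = 0" and al: "k < l" "A1 < A2"
 shows "ennreal ((slice_remainder k l g z)\<^sup>2) \<le> ennreal (A2 - A1) * (\<integral>\<^sup>+t. ennreal ((g (t, snd z))\<^sup>2) \<partial>lborel)"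
proof -
 let ?f = "\<lambda>t. slice_kernel k l (fst z) t * g (t, snd z)"
 have "ennreal ((slice_remainder k l g z)\<^sup>2) \<le> ennreal (A2 - A1) * (\<integral>\<^sup>+t. ennreal ((?f t)\<^sup>2) \<partial>lborel)"
  unfolding slice_remainder_def
 proof (rule mean_square[OF _ _ al(2)])
  show "?f \<in> borel_measurable borel"
   using slice_kernel_measurable(2) section_measurable(1)[OF g] by (intro borel_measurable_times)
 qed (use out in auto)
 also have "\<dots> \<le> ennreal (A2 - A1) * (\<integral>\<^sup>+t. ennreal ((g (t, snd z))\<^sup>2) \<partial>lborel)"
 proof (intro mult_left_mono nn_integral_mono ennreal_leI)
  fix t
  have "(slice_kernel k l (fst z) t)\<^sup>2 \<le> 1"
   using slice_kernel_bound[OF al(1)] by (simp add: abs_square_le_1)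
  then show "(?f t)\<^sup>2 \<le> (g (t, snd z))\<^sup>2"
   using mult_right_mono[of "(slice_kernel k l (fst z) t)\<^sup>2" 1 "(g (t, snd z))\<^sup>2"] by (simp add: power_mult_distrib)
 qed simp
 finally show ?thesis .
qed

section \<open>The Poincare inequality\<close>

lemma AE_slice:
 fixes R :: "pt => bool"
 assumes "AE z in lborel. R z"
 shows "AE y in lborel. AE x in lborel. R (x, y)"
proof -
 obtain N where N: "{z \<in> space lborel. \<not> R z} \<subseteq> N" "emeasure lborel N = 0" "N \<in> sets lborel"
  by (rule AE_E[OF assms])
 have m: "(indicator N :: pt => ennreal) \<in> borel_measurable borel" using N(3) by simp
 have "(\<integral>\<^sup>+y. \<integral>\<^sup>+x. indicator N (x, y) \<partial>lborel \<partial>lborel) = 0"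
  using plane_nn_integral[OF m] N(2,3) by simp
 then have "AE y in lborel. (\<integral>\<^sup>+x. indicator N (x, y) \<partial>lborel) = 0"
  by (subst (asm) nn_integral_0_iff_AE) (use nn_section_measurable[OF m] in auto)
 then show ?thesis
 proof eventually_elim
  case (elim y)
  then have "AE x in lborel. indicator N (x, y) = (0::ennreal)"
   by (subst (asm) nn_integral_0_iff_AE) (use section_measurable(1)[OF m] in auto)
  then show ?case
  proof eventually_elim
   case (elim x)
   then show ?case using N(1) by (auto simp: indicator_def split: if_splits)
  qed
 qed
qed

text \<open>Write \<open>w\<close> as its mean \<open>c y\<close> on a horizontal segment plus a remainder bounded by \<open>g\<close>. The same
  representation in the vertical direction, averaged over the horizontal segment, bounds \<open>c y\<close> by
  \<open>g'\<close>, because the mean over the small box vanishes.\<close>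

lemma poincare_borel:
 assumes wm: "w \<in> borel_measurable borel" "g \<in> borel_measurable borel" "g' \<in> borel_measurable borel"
  and i: "integrable lborel w" "integrable lborel g" "integrable lborel g'"
  and out: "\<And>z. z \<notin> box (A1, B1) (A2, B2) ==> w z = 0" "\<And>z. z \<notin> box (A1, B1) (A2, B2) ==> g z = 0"
   "\<And>z. z \<notin> box (A1, B1) (A2, B2) ==> g' z = 0"
  and W: "weak_deriv (box (A1, B1) (A2, B2)) 1 0 w g" "weak_deriv (box (A1, B1) (A2, B2)) 0 1 w g'"
  and al: "k1 < l1" "A1 < k1" "l1 < A2" "k2 < l2" "B1 < k2" "l2 < B2"
  and mean: "(LINT z|lborel. ind k1 l1 (fst z) * ind k2 l2 (snd z) * w z) = 0"
 shows "nsq w \<le>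
  ennreal (2 * (A2 - A1)\<^sup>2) * nsq g
  + ennreal (2 * (A2 - A1) * (B2 - B1)\<^sup>2 / (l1 - k1)) * nsq g'"
proof -
 define sw where "sw f = (\<lambda>z. f (prod.swap z))" for f :: "pt => real"
 define av where "av = slice_mean k1 l1 w"
 define bv where "bv = slice_mean k2 l2 (sw w)"
 define ss where "ss = slice_remainder k2 l2 (sw g')"
 have AB: "A1 < A2" "B1 < B2" using al by auto
 have inU: "z \<in> box (A1, B1) (A2, B2) \<longleftrightarrow> fst z \<in> {A1<..<A2} \<and> snd z \<in> {B1<..<B2}" for z
  by (cases z) (auto simp: mem_box Basis_prod_def)
 have swU: "prod.swap ` box (A1, B1) (A2, B2) = box (B1, A1) (B2, A2)"
 proof -
  have "z \<in> prod.swap ` box (A1, B1) (A2, B2) \<longleftrightarrow> prod.swap z \<in> box (A1, B1) (A2, B2)" for z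
   by (metis imageE imageI swap_swap)
  then show ?thesis by (auto simp: mem_box Basis_prod_def)
 qed
 have si: "integrable lborel (sw w)" "integrable lborel (sw g')"
  using swap_integral(2) wm i by (auto simp: sw_def)
 have sm: "sw g' \<in> borel_measurable borel" unfolding sw_def by (rule swap_integral(3)[OF wm(3)])
 have rep: "AE z in lborel. z \<in> box (A1, B1) (A2, B2) --> w z = av (snd z) + slice_remainder k1 l1 g z"
  unfolding av_def by (rule slice_representation[OF weak_xI[OF wm(1,2) W(1)] i(1,2) al(1,2,3) AB(2)])
 have "weak_x (box (B1, A1) (B2, A2)) (sw w) (sw g')"
  using weak_xI_swap[OF wm(1,3) W(2)] unfolding swU sw_def .
 then have "AE z in lborel. z \<in> box (B1, A1) (B2, A2) --> sw w z = bv (snd z) + ss z"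
  unfolding bv_def ss_def by (rule slice_representation[OF _ si al(4,5,6) AB(1)])
 then have "AE z in lborel \<Otimes>\<^sub>M lborel. z \<in> box (B1, A1) (B2, A2) --> sw w z = bv (snd z) + ss z"
  unfolding lborel_prod .
 from lborel_pair.AE_pair[OF this]
 have rep': "AE y in lborel. AE x in lborel. (y, x) \<in> box (B1, A1) (B2, A2) --> w (x, y) = bv x + ss (y, x)"
  by (simp add: sw_def)
 define c where "c = ennreal ((B2 - B1) / (l1 - k1)) * nsq g'"
 have g2: "(\<lambda>z. ennreal ((g' z)\<^sup>2)) \<in> borel_measurable borel" "(\<lambda>z. ennreal ((g z)\<^sup>2)) \<in> borel_measurable borel" using wm by simp_all
 have indm: "(\<lambda>z::pt. ind a b (fst z) :: real) \<in> borel_measurable borel" "(\<lambda>z::pt. ind a b (snd z) :: real) \<in> borel_measurable borel" for a b :: real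
  by (rule measurable_compose[OF borel_measurable_continuous_onI[OF continuous_on_fst[OF continuous_on_id]]]
   measurable_compose[OF borel_measurable_continuous_onI[OF continuous_on_snd[OF continuous_on_id]]]; simp)+
 have iw: "integrable lborel (\<lambda>z. ind k1 l1 (fst z) * w z)"
  by (rule Bochner_Integration.integrable_bound[OF i(1)]) (use wm indm in \<open>auto simp: indicator_def intro!: borel_measurable_times\<close>)
 have iw2: "integrable lborel (\<lambda>z. ind k2 l2 (fst z) * sw w z)"
  by (rule Bochner_Integration.integrable_bound[OF si(1)]) (use borel_measurable_integrable[OF si(1)] indm in \<open>auto simp: indicator_def intro!: borel_measurable_times\<close>)
 have ibv: "integrable lborel bv"
  using plane_integral(3)[OF iw2] unfolding bv_def slice_mean_def[abs_def] by simp
 have ibv': "integrable lborel (\<lambda>x. ind k1 l1 x * bv x)"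
  by (rule Bochner_Integration.integrable_bound[OF ibv]) (use borel_measurable_integrable[OF ibv] in \<open>auto simp: indicator_def\<close>)
 \<comment> \<open>the average of the vertical means over the horizontal segment is the mean over the small box\<close>
 have bv0: "(LINT x|lborel. ind k1 l1 x * bv x) = 0"
 proof -
  let ?f = "\<lambda>z. ind k1 l1 (fst z) * ind k2 l2 (snd z) * w z"
  have fm: "?f \<in> borel_measurable borel" using wm(1) indm by (intro borel_measurable_times) auto
  have fi: "integrable lborel ?f"
   by (rule Bochner_Integration.integrable_bound[OF i(1)]) (use fm in \<open>auto simp: indicator_def\<close>)
  have "(LINT x|lborel. LINT y|lborel. ?f (x, y)) = (LINT z|lborel. ?f (prod.swap z))"
   using plane_integral(1)[OF swap_integral(2)[OF fm, THEN iffD2, OF fi]] by simp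
  also have "\<dots> = 0" using swap_integral(1)[OF fm] mean by simp
  finally have 0: "(LINT x|lborel. LINT y|lborel. ?f (x, y)) = 0" .
  have "ind k1 l1 x * bv x = 1 / (l2 - k2) * (LINT y|lborel. ?f (x, y))" for x
  proof -
   have "(LINT y|lborel. ?f (x, y)) = (LINT y|lborel. ind k1 l1 x * (ind k2 l2 y * w (x, y)))"
    by (simp only: fst_conv snd_conv mult.assoc)
   then show ?thesis by (simp add: bv_def slice_mean_def sw_def)
  qed
  then show ?thesis using 0 by simp
 qed
 have ssm: "ss \<in> borel_measurable borel" unfolding ss_def by (rule slice_remainder_measurable[OF sm])
 have avb: "AE y in lborel. y \<in> {B1<..<B2} --> ennreal ((av y)\<^sup>2) \<le> c"
  using rep' plane_integral(2)[OF iw]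
 proof eventually_elim
  case (elim y)
  show ?case
  proof
   assume y: "y \<in> {B1<..<B2}"
   let ?s = "\<lambda>x. ind k1 l1 x * ss (y, x)"
   have sm': "?s \<in> borel_measurable borel" using section_measurable(2)[OF ssm] by (intro borel_measurable_times) auto
   have ae: "AE x in lborel. ind k1 l1 x * w (x, y) - ind k1 l1 x * bv x = ?s x"
    using elim(1)
   proof eventually_elim
    case (elim x)
    have "x \<in> {k1<..<l1} ==> (y, x) \<in> box (B1, A1) (B2, A2)"
     using y al by (auto simp: mem_box Basis_prod_def)
    then show ?case using elim by (auto simp: indicator_def)
   qed
   have iwy: "integrable lborel (\<lambda>x. ind k1 l1 x * w (x, y))" using elim(2) by simp
   have "(LINT x|lborel. ?s x) = (LINT x|lborel. ind k1 l1 x * w (x, y) - ind k1 l1 x * bv x)"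
    by (rule sym, rule integral_cong_AE[OF _ _ ae])
     (use borel_measurable_integrable[OF Bochner_Integration.integrable_diff[OF iwy ibv']] sm' in auto)
   also have "\<dots> = (l1 - k1) * av y"
    using Bochner_Integration.integral_diff[OF iwy ibv'] bv0 al(1) by (simp add: av_def slice_mean_def)
   finally have s: "(LINT x|lborel. ?s x) = (l1 - k1) * av y" .
   have "ennreal ((LINT x|lborel. ?s x)\<^sup>2) \<le> ennreal (l1 - k1) * (\<integral>\<^sup>+x. ennreal ((?s x)\<^sup>2) \<partial>lborel)"
    by (rule mean_square[OF sm' _ al(1)]) simp
   also have "(\<integral>\<^sup>+x. ennreal ((?s x)\<^sup>2) \<partial>lborel) \<le> (\<integral>\<^sup>+x. ennreal (B2 - B1) * (\<integral>\<^sup>+t. ennreal ((g' (x, t))\<^sup>2) \<partial>lborel) \<partial>lborel)"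
   proof (rule nn_integral_mono)
    fix x
    have "ennreal ((ss (y, x))\<^sup>2) \<le> ennreal (B2 - B1) * (\<integral>\<^sup>+t. ennreal ((sw g' (t, snd (y, x)))\<^sup>2) \<partial>lborel)"
     unfolding ss_def by (rule slice_remainder_square[OF sm _ al(4) AB(2)]) (use out(3) inU in \<open>auto simp: sw_def\<close>)
    moreover have "ennreal ((?s x)\<^sup>2) \<le> ennreal ((ss (y, x))\<^sup>2)" by (auto simp: indicator_def)
    ultimately show "ennreal ((?s x)\<^sup>2) \<le> ennreal (B2 - B1) * (\<integral>\<^sup>+t. ennreal ((g' (x, t))\<^sup>2) \<partial>lborel)"
     unfolding sw_def swap_simp snd_conv by (meson order_trans)
   qed
   also have "\<dots> = ennreal (B2 - B1) * nsq g'"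
   proof -
    have gs: "(\<lambda>z. ennreal ((g' (prod.swap z))\<^sup>2)) \<in> borel_measurable borel" using sm by (simp add: sw_def)
    have "(\<integral>\<^sup>+x. (\<integral>\<^sup>+t. ennreal ((g' (x, t))\<^sup>2) \<partial>lborel) \<partial>lborel) = nsq g'"
     using plane_nn_integral[OF gs] swap_nn_integral[OF g2(1)] by simp
    then show ?thesis using nn_section_measurable[OF gs] by (simp add: nn_integral_cmult)
   qed
   finally have "ennreal (((l1 - k1) * av y)\<^sup>2) \<le> ennreal (l1 - k1) * (ennreal (B2 - B1) * nsq g')"
    unfolding s by (simp add: mult_left_mono)
   then have "ennreal (1 / (l1 - k1)\<^sup>2) * ennreal (((l1 - k1) * av y)\<^sup>2) \<le>
     ennreal (1 / (l1 - k1)\<^sup>2) * (ennreal (l1 - k1) * (ennreal (B2 - B1) * nsq g'))"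
    by (rule mult_left_mono) simp
   moreover have "ennreal (1 / (l1 - k1)\<^sup>2) * ennreal (((l1 - k1) * av y)\<^sup>2) = ennreal ((av y)\<^sup>2)"
    using al(1) by (simp add: ennreal_mult[symmetric] power_mult_distrib)
   moreover have "ennreal (1 / (l1 - k1)\<^sup>2) * (ennreal (l1 - k1) * (ennreal (B2 - B1) * X)) = ennreal ((B2 - B1) / (l1 - k1)) * X" for X
   proof -
    have "ennreal p * (ennreal q * ennreal r) = ennreal (p * (q * r))" if "0 \<le> p" "0 \<le> q" "0 \<le> r" for p q r :: real
     using that by (simp add: ennreal_mult)
    from this[of "1 / (l1 - k1)\<^sup>2" "l1 - k1" "B2 - B1"]
    have "ennreal (1 / (l1 - k1)\<^sup>2) * (ennreal (l1 - k1) * ennreal (B2 - B1)) = ennreal (1 / (l1 - k1)\<^sup>2 * ((l1 - k1) * (B2 - B1)))"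
     using al AB by simp
    also have "1 / (l1 - k1)\<^sup>2 * ((l1 - k1) * (B2 - B1)) = (B2 - B1) / (l1 - k1)"
     using al(1) by (simp add: power2_eq_square)
    finally show ?thesis by (simp add: mult.assoc[symmetric])
   qed
   ultimately show "ennreal ((av y)\<^sup>2) \<le> c" by (simp add: c_def)
  qed
 qed
 define Q where "Q y = (\<integral>\<^sup>+t. ennreal ((g (t, y))\<^sup>2) \<partial>lborel)" for y
 have Qm: "Q \<in> borel_measurable borel" unfolding Q_def by (rule nn_section_measurable[OF g2(2)])
 have w2: "(\<lambda>z. ennreal ((w z)\<^sup>2)) \<in> borel_measurable borel" using wm(1) by simp
 have "nsq w = (\<integral>\<^sup>+y. \<integral>\<^sup>+x. ennreal ((w (x, y))\<^sup>2) \<partial>lborel \<partial>lborel)"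
  by (rule plane_nn_integral[OF w2, symmetric])
 also have "\<dots> \<le> (\<integral>\<^sup>+y. \<integral>\<^sup>+x. (2 * (indicator {B1<..<B2} y * c) + 2 * (ennreal (A2 - A1) * Q y)) * indicator {A1<..<A2} x \<partial>lborel \<partial>lborel)"
 proof (rule nn_integral_mono_AE)
  show "AE y in lborel. (\<integral>\<^sup>+x. ennreal ((w (x, y))\<^sup>2) \<partial>lborel) \<le>
   (\<integral>\<^sup>+x. (2 * (indicator {B1<..<B2} y * c) + 2 * (ennreal (A2 - A1) * Q y)) * indicator {A1<..<A2} x \<partial>lborel)"
   using avb AE_slice[OF rep]
  proof eventually_elim
   case (elim y)
   show ?case
   proof (rule nn_integral_mono_AE)
    show "AE x in lborel. ennreal ((w (x, y))\<^sup>2) \<le> (2 * (indicator {B1<..<B2} y * c) + 2 * (ennreal (A2 - A1) * Q y)) * indicator {A1<..<A2} x"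
     using elim(2)
    proof eventually_elim
     case x: (elim x)
     show ?case
     proof (cases "(x, y) \<in> box (A1, B1) (A2, B2)")
      case False
      then show ?thesis using out(1) by simp
     next
      case True
      then have xy: "x \<in> {A1<..<A2}" "y \<in> {B1<..<B2}" using inU by auto
      let ?r = "slice_remainder k1 l1 g (x, y)"
      have "ennreal (?r\<^sup>2) \<le> ennreal (A2 - A1) * Q (snd (x, y))"
       unfolding Q_def by (rule slice_remainder_square[OF wm(2) _ al(1) AB(1)]) (use out(2) inU in auto)
      then have r: "ennreal (?r\<^sup>2) \<le> ennreal (A2 - A1) * Q y" by simp
      have a: "ennreal ((av y)\<^sup>2) \<le> c" using elim(1) xy by blast
      have "(w (x, y))\<^sup>2 = (av y + ?r)\<^sup>2" using x True by simp
      also have "\<dots> \<le> 2 * (av y)\<^sup>2 + 2 * ?r\<^sup>2"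
       using sum_squares_bound[of "av y" ?r] by (simp add: power2_sum)
      finally have "ennreal ((w (x, y))\<^sup>2) \<le> ennreal (2 * (av y)\<^sup>2 + 2 * ?r\<^sup>2)" by (rule ennreal_leI)
      also have "\<dots> = 2 * ennreal ((av y)\<^sup>2) + 2 * ennreal (?r\<^sup>2)"
       by (simp add: ennreal_plus ennreal_mult)
      also have "\<dots> \<le> 2 * c + 2 * (ennreal (A2 - A1) * Q y)" by (intro add_mono mult_left_mono a r) auto
      finally show ?thesis using xy by simp
     qed
    qed
   qed
  qed
 qed
 also have "\<dots> = (\<integral>\<^sup>+y. (2 * (indicator {B1<..<B2} y * c) + 2 * (ennreal (A2 - A1) * Q y)) * ennreal (A2 - A1) \<partial>lborel)"
  using AB by (simp add: nn_integral_cmult)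
 also have "\<dots> = (2 * (ennreal (B2 - B1) * c) + 2 * (ennreal (A2 - A1) * (\<integral>\<^sup>+y. Q y \<partial>lborel))) * ennreal (A2 - A1)"
  using AB Qm by (simp add: nn_integral_multc nn_integral_add nn_integral_cmult)
 also have "(\<integral>\<^sup>+y. Q y \<partial>lborel) = nsq g"
  unfolding Q_def by (rule plane_nn_integral[OF g2(2)])
 also have "(2 * (ennreal (B2 - B1) * c) + 2 * (ennreal (A2 - A1) * X)) * ennreal (A2 - A1) =
   ennreal (2 * (A2 - A1)\<^sup>2) * X + ennreal (2 * (A2 - A1) * (B2 - B1)\<^sup>2 / (l1 - k1)) * nsq g'" for X
 proof -
  define t where "t = (B2 - B1) / (l1 - k1)"
  have t: "0 \<le> t" using al AB by (simp add: t_def)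
  have "2 * (ennreal (B2 - B1) * ennreal t) * ennreal (A2 - A1) = ennreal (2 * ((B2 - B1) * t) * (A2 - A1))"
   using t AB by (simp add: ennreal_mult)
  also have "2 * ((B2 - B1) * t) * (A2 - A1) = 2 * (A2 - A1) * (B2 - B1)\<^sup>2 / (l1 - k1)"
   by (simp add: t_def power2_eq_square)
  finally have 1: "2 * (ennreal (B2 - B1) * ennreal ((B2 - B1) / (l1 - k1))) * ennreal (A2 - A1) = ennreal (2 * (A2 - A1) * (B2 - B1)\<^sup>2 / (l1 - k1))"
   unfolding t_def .
  have 2: "2 * ennreal (A2 - A1) * ennreal (A2 - A1) = ennreal (2 * (A2 - A1)\<^sup>2)"
   using AB by (simp add: ennreal_mult power2_eq_square mult.assoc)
  show ?thesis unfolding 1[symmetric] 2[symmetric] c_def by (simp only: distrib_right distrib_left ac_simps)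
 qed
 finally show ?thesis .
qed

lemma L2_version:
 fixes U :: "pt set"
 assumes w: "L2 U w" and U: "open U" "emeasure lebesgue U < \<infinity>"
 obtains w' where "w' \<in> borel_measurable borel" "integrable lborel w'" "\<forall>z. z \<notin> U --> w' z = 0"
  "AE z in lebesgue. indicator U z * w z = w' z" "(\<integral>\<^sup>+z. ennreal ((w' z)\<^sup>2) \<partial>lborel) = ennreal ((L2_nrm U w)\<^sup>2)"
proof -
 have Us: "U \<in> sets lebesgue" using U(1) by simp
 have i1: "integrable lebesgue (\<lambda>z. indicator U z * w z)"
  using L2_integrable[OF w Us U(2)] by (simp add: set_integrable_def)
 have i2: "integrable lebesgue (\<lambda>z. indicator U z * (w z)\<^sup>2)"
  using w by (simp add: L2_def set_integrable_def)
 obtain f where f: "f \<in> borel_measurable borel" "integrable lborel f" "AE z in lborel. indicator U z * w z = f z"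
  by (rule lebesgue_borel_version[OF i1])
 define w' where "w' z = indicator U z * f z" for z
 have "(\<lambda>z. indicator U z :: real) \<in> borel_measurable borel" using U(1) by simp
 then have m: "w' \<in> borel_measurable borel" unfolding w'_def using f(1) by (intro borel_measurable_times)
 have il: "integrable lborel w'"
  by (rule Bochner_Integration.integrable_bound[OF f(2)]) (use m in \<open>auto simp: w'_def indicator_def\<close>)
 have ae: "AE z in lebesgue. indicator U z * w z = w' z"
  using AE_completion[OF f(3)] by eventually_elim (auto simp: w'_def indicator_def)
 have ae2: "AE z in lebesgue. indicator U z * (w z)\<^sup>2 = (w' z)\<^sup>2"
  using ae by eventually_elim (auto simp: w'_def indicator_def power_mult_distrib)
 have m2: "(\<lambda>z. (w' z)\<^sup>2) \<in> borel_measurable lborel" using m by simp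
 have "integrable lebesgue (\<lambda>z. (w' z)\<^sup>2)" using lebesgue_integral_AE(1)[OF ae2] i2 by blast
 then have il2: "integrable lborel (\<lambda>z. (w' z)\<^sup>2)" using integrable_completion[OF m2] by blast
 have "(\<integral>\<^sup>+z. ennreal ((w' z)\<^sup>2) \<partial>lborel) = ennreal (LINT z|lborel. (w' z)\<^sup>2)"
  by (rule nn_integral_eq_integral[OF il2]) simp
 also have "(LINT z|lborel. (w' z)\<^sup>2) = (LINT z|lebesgue. (w' z)\<^sup>2)" using integral_completion[OF m2] by simp
 also have "\<dots> = (L2_nrm U w)\<^sup>2"
  using lebesgue_integral_AE(2)[OF ae2] by (simp add: L2_nrm_sq set_lebesgue_integral_def)
 finally have sq: "(\<integral>\<^sup>+z. ennreal ((w' z)\<^sup>2) \<partial>lborel) = ennreal ((L2_nrm U w)\<^sup>2)" .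
 show ?thesis by (rule that[OF m il _ ae sq]) (simp add: w'_def)
qed

theorem poincare:
 fixes A1 A2 B1 B2 :: real
 defines "U \<equiv> box (A1, B1) (A2, B2)"
 assumes l2: "L2 U w" "L2 U g" "L2 U g'" and W: "weak_deriv U 1 0 w g" "weak_deriv U 0 1 w g'"
  and al: "\<alpha>1 < \<beta>1" "A1 < \<alpha>1" "\<beta>1 < A2" "\<alpha>2 < \<beta>2" "B1 < \<alpha>2" "\<beta>2 < B2"
  and mean: "(LINT z:cbox (\<alpha>1, \<alpha>2) (\<beta>1, \<beta>2)|lebesgue. w z) = 0"
 shows "(L2_nrm U w)\<^sup>2 \<le> 2 * (A2 - A1)\<^sup>2 * (L2_nrm U g)\<^sup>2 + 2 * (A2 - A1) * (B2 - B1)\<^sup>2 / (\<beta>1 - \<alpha>1) * (L2_nrm U g')\<^sup>2"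
proof -
 have U: "open U" "emeasure lebesgue U < \<infinity>"
  by (auto simp: U_def open_box emeasure_lborel_box_eq)
 obtain w' where w: "w' \<in> borel_measurable borel" "integrable lborel w'" "\<forall>z. z \<notin> U --> w' z = 0"
  "AE z in lebesgue. indicator U z * w z = w' z" "(\<integral>\<^sup>+z. ennreal ((w' z)\<^sup>2) \<partial>lborel) = ennreal ((L2_nrm U w)\<^sup>2)"
  by (rule L2_version[OF l2(1) U])
 obtain h where h: "h \<in> borel_measurable borel" "integrable lborel h" "\<forall>z. z \<notin> U --> h z = 0"
  "AE z in lebesgue. indicator U z * g z = h z" "(\<integral>\<^sup>+z. ennreal ((h z)\<^sup>2) \<partial>lborel) = ennreal ((L2_nrm U g)\<^sup>2)"
  by (rule L2_version[OF l2(2) U])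
 obtain h' where h': "h' \<in> borel_measurable borel" "integrable lborel h'" "\<forall>z. z \<notin> U --> h' z = 0"
  "AE z in lebesgue. indicator U z * g' z = h' z" "(\<integral>\<^sup>+z. ennreal ((h' z)\<^sup>2) \<partial>lborel) = ennreal ((L2_nrm U g')\<^sup>2)"
  by (rule L2_version[OF l2(3) U])
 have aes: "AE z in lebesgue. z \<in> U --> w z = w' z" "AE z in lebesgue. z \<in> U --> g z = h z" "AE z in lebesgue. z \<in> U --> g' z = h' z"
  subgoal using w(4) by eventually_elim auto
  subgoal using h(4) by eventually_elim auto
  subgoal using h'(4) by eventually_elim auto
  done
 have W': "weak_deriv U 1 0 w' h" "weak_deriv U 0 1 w' h'"
  by (rule weak_deriv_AE[OF aes(1,2) W(1)], rule weak_deriv_AE[OF aes(1,3) W(2)])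
 let ?c = "cbox (\<alpha>1, \<alpha>2) (\<beta>1, \<beta>2)"
 let ?i = "\<lambda>z. indicator {\<alpha>1<..<\<beta>1} (fst z) * indicator {\<alpha>2<..<\<beta>2} (snd z) * w' z"
 have sub: "?c \<subseteq> U" using al by (auto simp: U_def mem_box Basis_prod_def)
 have ib: "(indicator (box (\<alpha>1, \<alpha>2) (\<beta>1, \<beta>2)) z :: real) = indicator {\<alpha>1<..<\<beta>1} (fst z) * indicator {\<alpha>2<..<\<beta>2} (snd z)" for z :: pt
  by (cases z) (auto simp: mem_box Basis_prod_def indicator_def)
 have bm: "(\<lambda>z::pt. indicator (box (\<alpha>1, \<alpha>2) (\<beta>1, \<beta>2)) z :: real) \<in> borel_measurable borel"
  using open_box[of "(\<alpha>1, \<alpha>2)" "(\<beta>1, \<beta>2)"] by simp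
 have im: "?i \<in> borel_measurable lborel"
  unfolding ib[symmetric] using bm w(1) by (simp add: borel_measurable_times)
 have "AE z in lebesgue. indicator ?c z *\<^sub>R w z = ?i z"
  using w(4) AE_completion[OF cbox_box_AE[of "(\<alpha>1, \<alpha>2)" "(\<beta>1, \<beta>2)"]]
 proof eventually_elim
  case (elim z)
  have "indicator ?c z *\<^sub>R w z = indicator ?c z * (indicator U z * w z)" using sub by (auto simp: indicator_def)
  then show ?case unfolding elim ib by simp
 qed
 from lebesgue_integral_AE(2)[OF this] have "(LINT z|lebesgue. ?i z) = 0"
  using mean by (simp add: set_lebesgue_integral_def)
 then have m0: "(LINT z|lborel. ?i z) = 0" using integral_completion[OF im] by simp
 have "ennreal ((L2_nrm U w)\<^sup>2) \<le> ennreal (2 * (A2 - A1)\<^sup>2) * ennreal ((L2_nrm U g)\<^sup>2)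
  + ennreal (2 * (A2 - A1) * (B2 - B1)\<^sup>2 / (\<beta>1 - \<alpha>1)) * ennreal ((L2_nrm U g')\<^sup>2)"
  unfolding w(5)[symmetric] h(5)[symmetric] h'(5)[symmetric]
  by (rule poincare_borel[OF w(1) h(1) h'(1) w(2) h(2) h'(2) w(3)[unfolded U_def, rule_format] h(3)[unfolded U_def, rule_format] h'(3)[unfolded U_def, rule_format]
   W'[unfolded U_def] al m0])
 also have "\<dots> = ennreal (2 * (A2 - A1)\<^sup>2 * (L2_nrm U g)\<^sup>2 + 2 * (A2 - A1) * (B2 - B1)\<^sup>2 / (\<beta>1 - \<alpha>1) * (L2_nrm U g')\<^sup>2)"
  using al by (subst ennreal_plus) (auto simp: ennreal_mult[symmetric] intro!: divide_nonneg_nonneg mult_nonneg_nonneg)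
 finally show ?thesis
  using al by (subst (asm) ennreal_le_iff) (auto intro!: divide_nonneg_nonneg mult_nonneg_nonneg add_nonneg_nonneg)
qed

section \<open>Norms and seminorms\<close>

lemma L2_diff:
 assumes "L2 A f" "L2 A g"
 shows "L2 A (\<lambda>z. f z - g z)" "L2_nrm A (\<lambda>z. f z - g z) \<le> 2 * (L2_nrm A f + L2_nrm A g)"
proof -
 have f: "(\<lambda>z. indicator A z *\<^sub>R f z) \<in> borel_measurable lebesgue" "integrable lebesgue (\<lambda>z. indicator A z *\<^sub>R (f z)\<^sup>2)"
  and g: "(\<lambda>z. indicator A z *\<^sub>R g z) \<in> borel_measurable lebesgue" "integrable lebesgue (\<lambda>z. indicator A z *\<^sub>R (g z)\<^sup>2)"
  using assms by (auto simp: L2_def set_integrable_def set_borel_measurable_def)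
 have e: "(\<lambda>z. indicator A z *\<^sub>R (f z - g z)) = (\<lambda>z. indicator A z *\<^sub>R f z - indicator A z *\<^sub>R g z)"
  by (auto simp: algebra_simps)
 have m: "(\<lambda>z. indicator A z *\<^sub>R (f z - g z)) \<in> borel_measurable lebesgue"
  unfolding e using f(1) g(1) by (rule borel_measurable_diff)
 have e2: "(\<lambda>z. indicator A z *\<^sub>R (f z - g z)\<^sup>2) = (\<lambda>z. (indicator A z *\<^sub>R (f z - g z))\<^sup>2)"
  by (auto simp: indicator_def)
 have m2: "(\<lambda>z. indicator A z *\<^sub>R (f z - g z)\<^sup>2) \<in> borel_measurable lebesgue"
  unfolding e2 using m by (rule borel_measurable_power)
 have p: "(a - b)\<^sup>2 \<le> 2 * a\<^sup>2 + 2 * b\<^sup>2" for a b :: real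
  using zero_le_power2[of "a + b"] by (simp add: power2_sum power2_diff)
 have ib: "integrable lebesgue (\<lambda>z. 2 * (indicator A z *\<^sub>R (f z)\<^sup>2) + 2 * (indicator A z *\<^sub>R (g z)\<^sup>2))"
  using f(2) g(2) by (intro Bochner_Integration.integrable_add integrable_mult_right)
 have le: "indicator A z *\<^sub>R (f z - g z)\<^sup>2 \<le> 2 * (indicator A z *\<^sub>R (f z)\<^sup>2) + 2 * (indicator A z *\<^sub>R (g z)\<^sup>2)" for z
  using p by (auto simp: indicator_def)
 have i: "integrable lebesgue (\<lambda>z. indicator A z *\<^sub>R (f z - g z)\<^sup>2)"
  by (rule Bochner_Integration.integrable_bound[OF ib m2], rule always_eventually, rule allI)
   (use le in \<open>fastforce simp: indicator_def\<close>)
 show "L2 A (\<lambda>z. f z - g z)"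
  using m i by (simp add: L2_def set_integrable_def set_borel_measurable_def)
 have "(L2_nrm A (\<lambda>z. f z - g z))\<^sup>2 \<le> (LINT z|lebesgue. 2 * (indicator A z *\<^sub>R (f z)\<^sup>2) + 2 * (indicator A z *\<^sub>R (g z)\<^sup>2))"
  unfolding L2_nrm_sq set_lebesgue_integral_def by (rule integral_mono[OF i ib le])
 also have "\<dots> = 2 * (L2_nrm A f)\<^sup>2 + 2 * (L2_nrm A g)\<^sup>2"
  unfolding L2_nrm_sq set_lebesgue_integral_def
  using Bochner_Integration.integral_add[OF integrable_mult_right[OF f(2)] integrable_mult_right[OF g(2)], of 2 2]
  by (simp only: integral_mult_right_zero)
 also have "\<dots> \<le> (2 * (L2_nrm A f + L2_nrm A g))\<^sup>2"
 proof -
  have "0 \<le> a ==> 0 \<le> b ==> 2 * a\<^sup>2 + 2 * b\<^sup>2 \<le> (2 * (a + b))\<^sup>2" for a b :: real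
   by (simp add: power2_eq_square algebra_simps)
  then show ?thesis using L2_nrm_nonneg by blast
 qed
 finally show "L2_nrm A (\<lambda>z. f z - g z) \<le> 2 * (L2_nrm A f + L2_nrm A g)"
  by (rule power2_le_imp_le) (simp add: L2_nrm_nonneg)
qed

lemma L2_continuous:
 assumes "continuous_on UNIV f" "bounded U" "U \<in> sets lebesgue"
 shows "L2 U f"
proof -
 obtain a where a: "U \<subseteq> cbox (-a) a" using bounded_subset_cbox_symmetric[OF assms(2)] by blast
 have "set_borel_measurable lebesgue (cbox (-a) a) f"
  using absolutely_integrable_continuous[OF continuous_on_subset[OF assms(1)], of "-a" a]
  unfolding set_integrable_def set_borel_measurable_def by (intro borel_measurable_integrable) simp
 moreover have "set_integrable lebesgue (cbox (-a) a) (\<lambda>z. (f z)\<^sup>2)"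
  by (intro absolutely_integrable_continuous continuous_on_power continuous_on_subset[OF assms(1)]) simp
 ultimately have "L2 (cbox (-a) a) f" by (simp add: L2_def)
 then show ?thesis using L2_subset(1) a assms(3) by blast
qed

lemma L2_nrm_bound:
 assumes "L2 A f" "A \<in> sets lebesgue" "emeasure lebesgue A < \<infinity>" "\<And>z. z \<in> A ==> \<bar>f z\<bar> \<le> B"
 shows "L2_nrm A f \<le> \<bar>B\<bar> * sqrt (measure lebesgue A)"
proof -
 have i: "integrable lebesgue (\<lambda>z. B\<^sup>2 * indicator A z)"
  using assms by (intro integrable_mult_right integrable_real_indicator) auto
 have "(L2_nrm A f)\<^sup>2 \<le> (LINT z|lebesgue. B\<^sup>2 * indicator A z)"
  unfolding L2_nrm_sq set_lebesgue_integral_def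
 proof (rule integral_mono[OF _ i])
  show "integrable lebesgue (\<lambda>z. indicator A z *\<^sub>R (f z)\<^sup>2)" using assms(1) by (simp add: L2_def set_integrable_def)
  show "indicator A z *\<^sub>R (f z)\<^sup>2 \<le> B\<^sup>2 * indicator A z" for z
   using assms(4)[of z] power_mono[of "\<bar>f z\<bar>" B 2] by (cases "z \<in> A") auto
 qed
 also have "\<dots> = (\<bar>B\<bar> * sqrt (measure lebesgue A))\<^sup>2" by (simp add: power_mult_distrib)
 finally show ?thesis by (rule power2_le_imp_le) simp
qed

text \<open>The frontier of a box is a null set.\<close>

lemma L2_cbox_box: "L2 (cbox a b) f \<longleftrightarrow> L2 (box a b) f" "L2_nrm (cbox a b) f = L2_nrm (box a b) f" for a b :: pt
proof -
 have i: "AE z in lebesgue. indicator (cbox a b) z = (indicator (box a b) z :: real)"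
  by (rule AE_completion[OF cbox_box_AE])
 have 1: "AE z in lebesgue. indicator (cbox a b) z *\<^sub>R f z = indicator (box a b) z *\<^sub>R f z" using i by eventually_elim simp
 have rev: "AE z in lebesgue. indicator (box a b) z *\<^sub>R f z = indicator (cbox a b) z *\<^sub>R f z" using i by eventually_elim simp
 have 2: "AE z in lebesgue. indicator (cbox a b) z *\<^sub>R (f z)\<^sup>2 = indicator (box a b) z *\<^sub>R (f z)\<^sup>2" using i by eventually_elim simp
 show "L2 (cbox a b) f \<longleftrightarrow> L2 (box a b) f"
  unfolding L2_def set_integrable_def set_borel_measurable_def
  using lebesgue_integral_AE(1)[OF 2] lebesgue_measurable_AE[OF _ 1] lebesgue_measurable_AE[OF _ rev] by blast
 show "L2_nrm (cbox a b) f = L2_nrm (box a b) f"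
  unfolding L2_nrm_def set_lebesgue_integral_def using lebesgue_integral_AE(2)[OF 2] by simp
qed

text \<open>The choice of weak derivatives in the seminorm is immaterial, as they are unique up to null sets.\<close>

lemma Hseminorm_eq:
 assumes "\<And>i. i \<le> k ==> weak_deriv (interior A) i (k - i) v (D i)"
 shows "Hseminorm k A v = sqrt (\<Sum>i\<le>k. (L2_nrm (interior A) (D i))\<^sup>2)"
proof -
 have "L2_nrm (interior A) (SOME g. weak_deriv (interior A) i (k - i) v g) = L2_nrm (interior A) (D i)" if "i \<le> k" for i
  by (rule L2_AE(2)[OF weak_deriv_unique[OF open_interior someI[of "weak_deriv (interior A) i (k - i) v"]]])
   (rule assms[OF that], rule assms[OF that])
 then show ?thesis unfolding Hseminorm_def by simp
qed

lemma Hseminorm_le: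
 assumes D: "\<And>i. i \<le> k ==> weak_deriv (interior A) i (k - i) v (D i)" and B: "\<And>i. i \<le> k ==> L2_nrm (interior A) (D i) \<le> B"
 shows "Hseminorm k A v \<le> real (Suc k) * B"
proof -
 have B0: "0 \<le> B" using B[of 0] L2_nrm_nonneg order_trans by blast
 have "(\<Sum>i\<le>k. (L2_nrm (interior A) (D i))\<^sup>2) \<le> (\<Sum>i\<le>k. B\<^sup>2)"
  using B L2_nrm_nonneg by (intro sum_mono power_mono) auto
 also have "\<dots> = real (Suc k) * B\<^sup>2" by simp
 also have "\<dots> \<le> (real (Suc k))\<^sup>2 * B\<^sup>2"
  by (rule mult_right_mono) (auto simp: power2_eq_square)
 also have "\<dots> = (real (Suc k) * B)\<^sup>2" by (simp only: power_mult_distrib)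
 finally have le: "(\<Sum>i\<le>k. (L2_nrm (interior A) (D i))\<^sup>2) \<le> (real (Suc k) * B)\<^sup>2" .
 have "Hseminorm k A v = sqrt (\<Sum>i\<le>k. (L2_nrm (interior A) (D i))\<^sup>2)"
  by (rule Hseminorm_eq) (rule D)
 also have "\<dots> \<le> real (Suc k) * B"
  by (rule real_le_lsqrt[OF _ le]) (use B0 in simp)
 finally show ?thesis .
qed

lemma L2_nrm_le_Hseminorm:
 assumes "\<And>i. i \<le> k ==> weak_deriv (interior A) i (k - i) v (D i)" "i \<le> k"
 shows "L2_nrm (interior A) (D i) \<le> Hseminorm k A v"
proof -
 have "(L2_nrm (interior A) (D i))\<^sup>2 \<le> (\<Sum>i\<le>k. (L2_nrm (interior A) (D i))\<^sup>2)"
  using assms(2) by (intro member_le_sum) auto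
 moreover have "Hseminorm k A v = sqrt (\<Sum>i\<le>k. (L2_nrm (interior A) (D i))\<^sup>2)"
  by (rule Hseminorm_eq) (rule assms(1))
 ultimately show ?thesis by (simp only: real_le_rsqrt)
qed

section \<open>Scaled quadratics\<close>

text \<open>Bounds the values of the polynomial on the cell to which its coordinates are scaled.\<close>

definition csize :: "coeffs => real" where
 "csize = (\<lambda>(A, B, C, D, E, F). \<bar>A\<bar> + \<bar>B\<bar> + \<bar>C\<bar> + \<bar>D\<bar> + \<bar>E\<bar> + \<bar>F\<bar>)"

lemma csize_nonneg: "0 \<le> csize c" by (cases c) (simp add: csize_def)

lemma csize_add: "csize (c + d) \<le> csize c + csize d"
proof -
 obtain A B C D E F where c: "c = (A, B, C, D, E, F)" by (metis surj_pair)
 obtain A' B' C' D' E' F' where d: "d = (A', B', C', D', E', F')" by (metis surj_pair)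
 show ?thesis
  using abs_triangle_ineq[of A A'] abs_triangle_ineq[of B B'] abs_triangle_ineq[of C C']
   abs_triangle_ineq[of D D'] abs_triangle_ineq[of E E'] abs_triangle_ineq[of F F']
  unfolding c d csize_def plus_prod_def fst_conv snd_conv prod.case by linarith
qed

lemma csize_scale: "csize (a *\<^sub>R c) = \<bar>a\<bar> * csize c"
 by (cases c) (simp add: csize_def abs_mult distrib_left)

lemma spoly_add: "spoly x0 y0 w h (c + d) z = spoly x0 y0 w h c z + spoly x0 y0 w h d z"
 by (cases c; cases d; cases z)
  (simp only: spoly_def Let_def plus_prod_def fst_conv snd_conv prod.case distrib_right add.assoc add.left_commute add.commute)

lemma spoly_scale: "spoly x0 y0 w h (a *\<^sub>R c) z = a * spoly x0 y0 w h c z"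
 by (cases c; cases z) (simp add: spoly_def Let_def distrib_left mult.assoc)

lemma spoly_zero: "spoly x0 y0 w h 0 z = 0"
 by (cases z) (simp add: spoly_def Let_def zero_prod_def)

lemma spoly_sum: "spoly x0 y0 w h (\<Sum>i\<in>I. a i *\<^sub>R c i) z = (\<Sum>i\<in>I. a i * spoly x0 y0 w h (c i) z)"
 by (induction I rule: infinite_finite_induct) (simp_all add: spoly_add spoly_scale spoly_zero)

lemma csize_sum: "csize (\<Sum>i\<in>I. a i *\<^sub>R c i) \<le> (\<Sum>i\<in>I. \<bar>a i\<bar> * csize (c i))"
proof (induction I rule: infinite_finite_induct)
 case (insert i I)
 then show ?case using csize_add[of "a i *\<^sub>R c i" "\<Sum>i\<in>I. a i *\<^sub>R c i"] by (simp add: csize_scale)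
qed (simp_all add: csize_def zero_prod_def)

lemma csize_derivative:
 assumes "0 < w" shows "csize (dxc w c) \<le> 2 / w * csize c" "csize (dyc w c) \<le> 2 / w * csize c"
proof -
 obtain A B C D E F where c: "c = (A, B, C, D, E, F)" by (metis surj_pair)
 have "csize (dxc w c) = (\<bar>B\<bar> + 2 * \<bar>D\<bar> + \<bar>E\<bar>) / w" "csize (dyc w c) = (\<bar>C\<bar> + \<bar>E\<bar> + 2 * \<bar>F\<bar>) / w"
  using assms by (simp_all add: csize_def dxc_def dyc_def c abs_mult add_divide_distrib)
 moreover have "(\<bar>B\<bar> + 2 * \<bar>D\<bar> + \<bar>E\<bar>) / w \<le> (2 * csize c) / w" "(\<bar>C\<bar> + \<bar>E\<bar> + 2 * \<bar>F\<bar>) / w \<le> (2 * csize c) / w"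
  using assms by (intro divide_right_mono; simp add: csize_def c)+
 ultimately show "csize (dxc w c) \<le> 2 / w * csize c" "csize (dyc w c) \<le> 2 / w * csize c" by simp_all
qed

lemma csize_derivatives:
 assumes "0 < w" "0 < h" "2 / w \<le> \<mu>" "2 / h \<le> \<mu>"
 shows "csize ((dxc w ^^ i) ((dyc h ^^ j) c)) \<le> \<mu> ^ (i + j) * csize c"
proof -
 have m: "0 \<le> \<mu>" using assms by (meson divide_nonneg_pos order_trans zero_le_numeral)
 have y: "csize ((dyc h ^^ j) c) \<le> \<mu> ^ j * csize c"
 proof (induction j)
  case (Suc j)
  have "csize ((dyc h ^^ Suc j) c) \<le> 2 / h * csize ((dyc h ^^ j) c)" using csize_derivative(2)[OF assms(2)] by simp
  also have "\<dots> \<le> \<mu> * (\<mu> ^ j * csize c)" using assms m Suc csize_nonneg by (intro mult_mono) auto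
  finally show ?case by (simp add: mult.assoc)
 qed simp
 show ?thesis
 proof (induction i)
  case 0
  then show ?case using y by simp
 next
  case (Suc i)
  have "csize ((dxc w ^^ Suc i) ((dyc h ^^ j) c)) \<le> 2 / w * csize ((dxc w ^^ i) ((dyc h ^^ j) c))" using csize_derivative(1)[OF assms(1)] by simp
  also have "\<dots> \<le> \<mu> * (\<mu> ^ (i + j) * csize c)" using assms m Suc csize_nonneg by (intro mult_mono) auto
  finally show ?case by (simp add: mult.assoc)
 qed
qed

lemma spoly_bound:
 assumes z: "z \<in> region T" and n: "nondegenerate T"
 shows "\<bar>spoly (fst (fst T)) (snd (fst T)) (width T) (height T) c z\<bar> \<le> csize c"
proof -
 obtain x y where xy: "z = (x, y)" by (cases z)
 obtain A B C D E F where c: "c = (A, B, C, D, E, F)" by (metis surj_pair)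
 define s t where "s = (x - fst (fst T)) / width T" and "t = (y - snd (fst T)) / height T"
 have st: "0 \<le> s" "s \<le> 1" "0 \<le> t" "t \<le> 1"
  using z n by (auto simp: mem_region xy s_def t_def width_def height_def nondegenerate_def divide_le_eq)
 have st2: "0 \<le> s\<^sup>2" "s\<^sup>2 \<le> 1" "0 \<le> t\<^sup>2" "t\<^sup>2 \<le> 1" "0 \<le> s * t" "s * t \<le> 1"
  using st by (auto simp: power_le_one mult_le_one)
 have b: "\<bar>X * u\<bar> \<le> \<bar>X\<bar>" if "0 \<le> u" "u \<le> 1" for X u :: real
  using that mult_left_mono[of u 1 "\<bar>X\<bar>"] by (simp add: abs_mult)
 have "spoly (fst (fst T)) (snd (fst T)) (width T) (height T) c z = A + B * s + C * t + D * s\<^sup>2 + E * (s * t) + F * t\<^sup>2"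
  by (simp add: spoly_def c xy s_def t_def Let_def mult.assoc)
 also have "\<bar>\<dots>\<bar> \<le> \<bar>A\<bar> + \<bar>B * s\<bar> + \<bar>C * t\<bar> + \<bar>D * s\<^sup>2\<bar> + \<bar>E * (s * t)\<bar> + \<bar>F * t\<^sup>2\<bar>"
  by (intro order_trans[OF abs_triangle_ineq] add_right_mono order_refl)
 also have "\<dots> \<le> csize c"
  unfolding csize_def c prod.case by (intro add_mono order_refl b st st2)
 finally show ?thesis .
qed

lemma spoly_L2:
 assumes n: "nondegenerate T" and \<mu>: "2 / width T \<le> \<mu>" "2 / height T \<le> \<mu>"
 defines "p \<equiv> spoly (fst (fst T)) (snd (fst T)) (width T) (height T)"
 shows "L2 (interior (region T)) (p c)"
  "L2_nrm (interior (region T)) (p ((dxc (width T) ^^ i) ((dyc (height T) ^^ j) c))) \<le> \<mu> ^ (i + j) * csize c * diam_cell T"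
proof -
 let ?T = "interior (region T)" and ?c = "(dxc (width T) ^^ i) ((dyc (height T) ^^ j) c)"
 have wh: "0 < width T" "0 < height T" using n by (auto simp: nondegenerate_def width_def height_def)
 have b: "bounded ?T" "?T \<in> sets lebesgue" by (auto simp: region_def)
 have l2: "L2 ?T (p c)" for c unfolding p_def by (rule L2_continuous[OF spoly_continuous b])
 then show "L2 ?T (p c)" .
 have sub: "?T \<subseteq> region T" by (rule interior_subset)
 have e: "emeasure lebesgue ?T < \<infinity>"
  using emeasure_mono[OF sub region_measurable(1)] region_measurable(3) by (rule le_less_trans)
 have c0: "\<bar>csize ?c\<bar> \<le> \<mu> ^ (i + j) * csize c"
  using csize_derivatives[OF wh \<mu>] csize_nonneg by simp
 have m: "sqrt (measure lebesgue (region T)) \<le> diam_cell T"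
 proof (rule real_le_lsqrt)
  show "measure lebesgue (region T) \<le> (diam_cell T)\<^sup>2"
   unfolding measure_region[OF n] power2_eq_square diam_cell_def using wh by (intro mult_mono) auto
 qed (use wh in \<open>auto simp: diam_cell_def\<close>)
 have "L2_nrm (region T) (p ?c) \<le> \<bar>csize ?c\<bar> * sqrt (measure lebesgue (region T))"
  by (rule L2_nrm_bound[OF L2_continuous region_measurable(1,3)])
   (auto simp: p_def spoly_continuous region_def spoly_bound[OF _ n, unfolded region_def])
 also have "\<dots> \<le> \<mu> ^ (i + j) * csize c * diam_cell T"
  using c0 m by (intro mult_mono) (auto intro: order_trans[OF abs_ge_zero c0])
 finally have "L2_nrm (region T) (p ?c) \<le> \<mu> ^ (i + j) * csize c * diam_cell T" .
 then show "L2_nrm ?T (p ?c) \<le> \<mu> ^ (i + j) * csize c * diam_cell T"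
  using L2_cbox_box(2)[of "fst T" "snd T" "p ?c"] by (simp add: region_def)
qed

section \<open>Approximation by quadratics\<close>

lemma L2_nrm_mono: "L2 A f ==> B \<subseteq> A ==> B \<in> sets lebesgue ==> L2_nrm B f \<le> L2_nrm A f"
 unfolding L2_nrm_def using L2_subset(2) by (rule real_sqrt_le_mono)

lemma cell_mean_spoly:
 assumes "nondegenerate K"
 defines "u \<equiv> (fst (fst K) + fst (snd K)) / 2" and "v \<equiv> (snd (fst K) + snd (snd K)) / 2"
 shows "cell_mean K (spoly u v 1 1 (A, B, C, D, E, F)) = A + D * (width K)\<^sup>2 / 12 + F * (height K)\<^sup>2 / 12"
proof -
 have "spoly u v 1 1 (A, B, C, D, E, F) =
  quad (A - B * u - C * v + D * u\<^sup>2 + E * u * v + F * v\<^sup>2) (B - 2 * D * u - E * v) (C - E * u - 2 * F * v) D E F"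
  by (rule ext) (auto simp: spoly_def quad_def Let_def power2_eq_square algebra_simps)
 then show ?thesis
  using cell_mean_quad[OF assms(1), folded u_def v_def] by (simp add: power2_eq_square algebra_simps)
qed

text \<open>The moments determine the coefficients from the top degree downwards; the squares have mean
  \<open>width\<^sup>2 / 12\<close> and \<open>height\<^sup>2 / 12\<close> over a cell centred at the origin. If all moments of order at least \<open>s\<close>
  vanish, the polynomial has degree less than \<open>s\<close>.\<close>

lemma mean_polynomial:
 fixes m :: "nat => nat => real"
 assumes n: "nondegenerate K"
 defines "u \<equiv> (fst (fst K) + fst (snd K)) / 2" and "v \<equiv> (snd (fst K) + snd (snd K)) / 2"
 obtains c where
  "\<forall>i j. i + j \<le> 2 --> cell_mean K (spoly u v 1 1 ((dxc 1 ^^ i) ((dyc 1 ^^ j) c))) = m i j"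
  "\<forall>i j. i + j \<le> 3 --> (\<forall>i' j'. i + j \<le> i' + j' --> m i' j' = 0) --> (dxc 1 ^^ i) ((dyc 1 ^^ j) c) = 0"
proof -
 define c where "c = (m 0 0 - m 2 0 / 2 * (width K)\<^sup>2 / 12 - m 0 2 / 2 * (height K)\<^sup>2 / 12, m 1 0, m 0 1, m 2 0 / 2, m 1 1, m 0 2 / 2)"
 note M = cell_mean_spoly[OF n, folded u_def v_def]
 have 1: "cell_mean K (spoly u v 1 1 ((dxc 1 ^^ i) ((dyc 1 ^^ j) c))) = m i j" if "i + j \<le> 2" for i j
 proof -
  have "i = 0 \<and> j = 0 \<or> i = 1 \<and> j = 0 \<or> i = 2 \<and> j = 0 \<or> i = 0 \<and> j = 1 \<or> i = 1 \<and> j = 1 \<or> i = 0 \<and> j = 2"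
   using that by presburger
  then consider "i = 0" "j = 0" | "i = 1" "j = 0" | "i = 2" "j = 0" | "i = 0" "j = 1" | "i = 1" "j = 1" | "i = 0" "j = 2"
   by argo
  then show ?thesis
   by cases (simp_all add: c_def M dxc_def dyc_def numeral_2_eq_2)
 qed
 have 2: "(dxc 1 ^^ i) ((dyc 1 ^^ j) c) = 0"
  if "i + j \<le> 3" and m: "\<And>i' j'. i + j \<le> i' + j' ==> m i' j' = 0" for i j
 proof -
  have "i = 0 \<and> j = 0 \<or> i = 1 \<and> j = 0 \<or> i = 2 \<and> j = 0 \<or> i = 0 \<and> j = 1 \<or> i = 1 \<and> j = 1 \<or> i = 0 \<and> j = 2
   \<or> i = 3 \<and> j = 0 \<or> i = 2 \<and> j = 1 \<or> i = 1 \<and> j = 2 \<or> i = 0 \<and> j = 3"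
   using that(1) by presburger
  then consider "i = 0" "j = 0" | "i = 1" "j = 0" | "i = 2" "j = 0" | "i = 0" "j = 1" | "i = 1" "j = 1" | "i = 0" "j = 2"
   | "i = 3" "j = 0" | "i = 2" "j = 1" | "i = 1" "j = 2" | "i = 0" "j = 3"
   by argo
  then show ?thesis
   using m[of 0 0] m[of 1 0] m[of 0 1] m[of 2 0] m[of 1 1] m[of 0 2]
   by cases (simp_all add: c_def dxc_def dyc_def numeral_2_eq_2 numeral_3_eq_3 zero_prod_def)
 qed
 show ?thesis by (rule that[of c]) (use 1 2 in blast)+
qed

lemma iterate_bound:
 fixes N :: "nat => nat => real"
 assumes step: "\<And>i j. i + j < s ==> (N i j)\<^sup>2 \<le> P * ((N (Suc i) j)\<^sup>2 + (N i (Suc j))\<^sup>2)"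
  and top: "\<And>i j. i + j = s ==> N i j \<le> S" and N: "\<And>i j. 0 \<le> N i j"
  and \<rho>: "0 \<le> \<rho>" "2 * P \<le> \<rho>\<^sup>2" "0 \<le> P"
 shows "i + j \<le> s ==> N i j \<le> \<rho> ^ (s - (i + j)) * S"
proof (induction "s - (i + j)" arbitrary: i j)
 case 0
 then show ?case using top[of i j] by simp
next
 case (Suc k)
 have S: "0 \<le> S" using top[of s 0] N[of s 0] by simp
 have k: "s - (Suc i + j) = k" "s - (i + Suc j) = k" "i + j < s" "s - (i + j) = Suc k" using Suc by auto
 have b: "N (Suc i) j \<le> \<rho> ^ k * S" "N i (Suc j) \<le> \<rho> ^ k * S"
  using Suc.hyps(1)[of "Suc i" j] Suc.hyps(1)[of i "Suc j"] k by auto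
 have "(N i j)\<^sup>2 \<le> P * ((\<rho> ^ k * S)\<^sup>2 + (\<rho> ^ k * S)\<^sup>2)"
  using step[OF k(3)] by (rule order_trans) (intro mult_left_mono add_mono power_mono b N \<rho>)
 also have "\<dots> = (2 * P) * (\<rho> ^ k * S)\<^sup>2" by simp
 also have "\<dots> \<le> \<rho>\<^sup>2 * (\<rho> ^ k * S)\<^sup>2" using \<rho> by (intro mult_right_mono) auto
 also have "\<dots> = (\<rho> ^ Suc k * S)\<^sup>2" by (simp add: power_mult_distrib mult.assoc)
 finally show ?case unfolding k(4) by (rule power2_le_imp_le) (use \<rho> S in simp)
qed

text \<open>The errors \<open>w i j\<close> of the derivatives have mean zero over \<open>K\<close> as long as \<open>i + j < s\<close>, so the Poincare
  inequality passes from order \<open>k\<close> to order \<open>k + 1\<close>; at order \<open>s\<close> the polynomial has disappeared.\<close>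

lemma polynomial_error:
 fixes A1 A2 B1 B2 u v :: real and D :: "nat => nat => pt => real" and c :: coeffs
 defines "R \<equiv> box (A1, B1) (A2, B2)"
 defines "w \<equiv> \<lambda>i j z. D i j z - spoly u v 1 1 ((dxc 1 ^^ i) ((dyc 1 ^^ j) c)) z"
 assumes s: "s \<le> 3" and D: "\<And>i j. i + j \<le> s ==> weak_deriv V i j f (D i j)" "\<And>i j. i + j \<le> s ==> L2 V (D i j)"
  and K: "nondegenerate K" "A1 < fst (fst K)" "fst (snd K) < A2" "B1 < snd (fst K)" "snd (snd K) < B2"
  and c: "\<And>i j. i + j < s ==> cell_mean K (spoly u v 1 1 ((dxc 1 ^^ i) ((dyc 1 ^^ j) c))) = cell_mean K (D i j)"
   "\<And>i j. i + j = s ==> (dxc 1 ^^ i) ((dyc 1 ^^ j) c) = 0"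
  and R: "R \<subseteq> V" and S: "\<And>i j. i + j = s ==> L2_nrm V (D i j) \<le> S"
  and P: "2 * (A2 - A1)\<^sup>2 \<le> P" "2 * (A2 - A1) * (B2 - B1)\<^sup>2 / width K \<le> P" and \<rho>: "0 \<le> \<rho>" "2 * P \<le> \<rho>\<^sup>2"
  and ij: "i + j \<le> s"
 shows "weak_deriv R i j (\<lambda>z. f z - spoly u v 1 1 c z) (w i j)" "L2 R (w i j)"
  "L2_nrm R (w i j) \<le> \<rho> ^ (s - (i + j)) * S"
proof -
 have Rm: "R \<in> sets lebesgue" "bounded R" by (auto simp: R_def)
 have wd: "weak_deriv R i j (\<lambda>z. f z - spoly u v 1 1 c z) (w i j)" if "i + j \<le> s" for i j
  unfolding w_def by (rule weak_deriv_mono[OF weak_deriv_diff[OF D(1)[OF that] spoly_weak_deriv] R])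
 have pl: "L2 R (spoly u v 1 1 d)" for d by (rule L2_continuous[OF spoly_continuous Rm(2,1)])
 have Dl: "L2 R (D i j)" if "i + j \<le> s" for i j by (rule L2_subset(1)[OF D(2)[OF that] R Rm(1)])
 have wl: "L2 R (w i j)" if "i + j \<le> s" for i j
  unfolding w_def by (rule L2_diff(1)[OF Dl[OF that] pl])
 show "weak_deriv R i j (\<lambda>z. f z - spoly u v 1 1 c z) (w i j)" "L2 R (w i j)" by (rule wd[OF ij], rule wl[OF ij])
 have KR: "region K \<subseteq> R" using K by (auto simp: mem_region R_def mem_box Basis_prod_def)
 have P0: "0 \<le> P" using P(1) by (rule order_trans[rotated]) simp
 have AB: "0 \<le> A2 - A1" using K by (simp add: nondegenerate_def)
 show "L2_nrm R (w i j) \<le> \<rho> ^ (s - (i + j)) * S"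
 proof (rule iterate_bound[where N = "\<lambda>i j. L2_nrm R (w i j)", OF _ _ L2_nrm_nonneg \<rho> P0 ij])
  fix i j assume ij: "i + j < s"
  have l: "i + j \<le> s" "Suc i + j \<le> s" "i + Suc j \<le> s" using ij by auto
  have ii: "set_integrable lebesgue (region K) (D i j)" "set_integrable lebesgue (region K) (spoly u v 1 1 ((dxc 1 ^^ i) ((dyc 1 ^^ j) c)))"
   by (rule L2_integrable[OF L2_subset(1)[OF Dl[OF l(1)] KR region_measurable(1)] region_measurable(1,3)],
     rule L2_integrable[OF L2_subset(1)[OF pl KR region_measurable(1)] region_measurable(1,3)])
  have "cell_mean K (w i j) = 0"
   unfolding w_def cell_mean_linear[OF ii] c(1)[OF ij] by simp
  then have "(LINT z:region K|lebesgue. w i j z) = 0"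
   using measure_region[OF K(1)] K(1) by (simp add: cell_mean_def nondegenerate_def width_def height_def)
  then have mean: "(LINT z:cbox (fst (fst K), snd (fst K)) (fst (snd K), snd (snd K))|lebesgue. w i j z) = 0"
   by (simp add: region_def)
  have "(L2_nrm R (w i j))\<^sup>2 \<le> 2 * (A2 - A1)\<^sup>2 * (L2_nrm R (w (Suc i) j))\<^sup>2
   + 2 * (A2 - A1) * (B2 - B1)\<^sup>2 / (fst (snd K) - fst (fst K)) * (L2_nrm R (w i (Suc j)))\<^sup>2"
   unfolding R_def
   by (rule poincare[OF wl[OF l(1), unfolded R_def] wl[OF l(2), unfolded R_def] wl[OF l(3), unfolded R_def]
    weak_deriv_step(1)[OF wd[OF l(1)] wd[OF l(2)], unfolded R_def] weak_deriv_step(2)[OF wd[OF l(1)] wd[OF l(3)], unfolded R_def] _ K(2,3) _ K(4,5) mean])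
    (use K(1) in \<open>auto simp: nondegenerate_def\<close>)
  also have "\<dots> \<le> P * (L2_nrm R (w (Suc i) j))\<^sup>2 + P * (L2_nrm R (w i (Suc j)))\<^sup>2"
   using P unfolding width_def by (intro add_mono mult_right_mono) auto
  finally show "(L2_nrm R (w i j))\<^sup>2 \<le> P * ((L2_nrm R (w (Suc i) j))\<^sup>2 + (L2_nrm R (w i (Suc j)))\<^sup>2)"
   by (simp add: distrib_left)
 next
  fix i j assume ij: "i + j = s"
  have "w i j = D i j" unfolding w_def c(2)[OF ij] by (simp add: spoly_zero)
  then show "L2_nrm R (w i j) \<le> S"
   using L2_nrm_mono[OF D(2) R Rm(1), of i j] S[OF ij] ij by simp
 qed
qed

text \<open>The coefficients of a tensor product piece in coordinates scaled to the cell.\<close>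

definition tensor_coeffs :: "real => real => triple => triple => coeffs" where
 "tensor_coeffs w h = (\<lambda>(q0, q1, k) (r0, r1, m).
   let a = k * w\<^sup>2 * (r0 + r1) / 2; b = m * h\<^sup>2 * (q0 + q1) / 2 in
   (q0 * r0, q1 * r0 - q0 * r0 - a, q0 * r1 - q0 * r0 - b, a, q0 * r0 - q1 * r0 - q0 * r1 + q1 * r1, b))"

lemma tensor_spoly:
 assumes "0 < w" "0 < h"
 shows "tensor x0 (x0 + w) y0 (y0 + h) q r = spoly x0 y0 w h (tensor_coeffs w h q r)"
proof (rule ext)
 fix z :: pt
 obtain q0 q1 k r0 r1 m x y where qr: "q = (q0, q1, k)" "r = (r0, r1, m)" "z = (x, y)" by (metis surj_pair)
 define s t where "s = (x - x0) / w" and "t = (y - y0) / h"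
 have xy: "x = x0 + s * w" "y = y0 + t * h" using assms by (simp_all add: s_def t_def)
 have e: "(x0 + s * w - x0) / w = s" "(y0 + t * h - y0) / h = t" "(x0 + s * w - x0) / (x0 + w - x0) = s" "(y0 + t * h - y0) / (y0 + h - y0) = t"
  using assms by simp_all
 have f: "x0 + s * w - x0 = s * w" "x0 + s * w - (x0 + w) = (s - 1) * w" "y0 + t * h - y0 = t * h" "y0 + t * h - (y0 + h) = (t - 1) * h"
  by (simp_all add: algebra_simps)
 show "tensor x0 (x0 + w) y0 (y0 + h) q r z = spoly x0 y0 w h (tensor_coeffs w h q r) z"
  unfolding qr tensor_def interpolant_def spoly_def tensor_coeffs_def xy prod.case Let_def e
  unfolding f by (simp add: algebra_simps power2_eq_square add_divide_distrib diff_divide_distrib)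
qed

lemma tensor_coeffs_size:
 assumes "\<bar>fst q\<bar> \<le> 1 \<and> \<bar>fst (snd q)\<bar> \<le> 1 \<and> \<bar>snd (snd q)\<bar> * w\<^sup>2 \<le> 2" "\<bar>fst r\<bar> \<le> 1 \<and> \<bar>fst (snd r)\<bar> \<le> 1 \<and> \<bar>snd (snd r)\<bar> * h\<^sup>2 \<le> 2"
 shows "csize (tensor_coeffs w h q r) \<le> 17"
proof -
 obtain q0 q1 k r0 r1 m where qr: "q = (q0, q1, k)" "r = (r0, r1, m)" by (metis surj_pair)
 have b: "\<bar>q0\<bar> \<le> 1" "\<bar>q1\<bar> \<le> 1" "\<bar>k * w\<^sup>2\<bar> \<le> 2" "\<bar>r0\<bar> \<le> 1" "\<bar>r1\<bar> \<le> 1" "\<bar>m * h\<^sup>2\<bar> \<le> 2"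
  using assms by (auto simp: qr abs_mult)
 have p: "\<bar>x * y\<bar> \<le> X * Y" if "\<bar>x\<bar> \<le> X" "\<bar>y\<bar> \<le> Y" for x y X Y :: real
  unfolding abs_mult using that by (intro mult_mono) auto
 define a c where "a = k * w\<^sup>2 * (r0 + r1) / 2" and "c = m * h\<^sup>2 * (q0 + q1) / 2"
 have "\<bar>r0 + r1\<bar> \<le> 2" "\<bar>q0 + q1\<bar> \<le> 2" using b by linarith+
 then have ac: "\<bar>a\<bar> \<le> 2" "\<bar>c\<bar> \<le> 2" using p[OF b(3), of "r0 + r1" 2] p[OF b(6), of "q0 + q1" 2] by (simp_all add: a_def c_def)
 have pr: "\<bar>q0 * r0\<bar> \<le> 1" "\<bar>q1 * r0\<bar> \<le> 1" "\<bar>q0 * r1\<bar> \<le> 1" "\<bar>q1 * r1\<bar> \<le> 1"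
  using p[OF b(1,4)] p[OF b(2,4)] p[OF b(1,5)] p[OF b(2,5)] by simp_all
 have "\<bar>q1 * r0 - q0 * r0 - a\<bar> \<le> 4" "\<bar>q0 * r1 - q0 * r0 - c\<bar> \<le> 4" "\<bar>q0 * r0 - q1 * r0 - q0 * r1 + q1 * r1\<bar> \<le> 4"
  using pr ac by linarith+
 then have "\<bar>q0 * r0\<bar> + \<bar>q1 * r0 - q0 * r0 - a\<bar> + \<bar>q0 * r1 - q0 * r0 - c\<bar> + \<bar>a\<bar> + \<bar>q0 * r0 - q1 * r0 - q0 * r1 + q1 * r1\<bar> + \<bar>c\<bar> \<le> 17"
  using pr ac by linarith
 then show ?thesis by (simp add: csize_def tensor_coeffs_def qr a_def c_def Let_def)
qed

section \<open>Stability and approximation\<close>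

context patch_center
begin

lemma patch_cbox: "patch L H K = cbox (X (-1), Y (-1)) (X 2, Y 2)"
proof -
 have x: "X (-1) < X 0" "X 0 < X 1" "X 1 < X 2" "Y (-1) < Y 0" "Y 0 < Y 1" "Y 1 < Y 2"
  using knots(2)[of "-1"] knots(2)[of 0] knots(2)[of 1] knots(4)[of "-1"] knots(4)[of 0] knots(4)[of 1] by simp_all
 have a: "(\<exists>\<sigma>\<in>offs. X \<sigma> \<le> a \<and> a \<le> X (\<sigma> + 1)) \<longleftrightarrow> X (-1) \<le> a \<and> a \<le> X 2"
  "(\<exists>\<tau>\<in>offs. Y \<tau> \<le> a \<and> a \<le> Y (\<tau> + 1)) \<longleftrightarrow> Y (-1) \<le> a \<and> a \<le> Y 2" for a
  using x by auto
 have "z \<in> patch L H K \<longleftrightarrow> (\<exists>\<sigma>\<in>offs. X \<sigma> \<le> fst z \<and> fst z \<le> X (\<sigma> + 1)) \<and> (\<exists>\<tau>\<in>offs. Y \<tau> \<le> snd z \<and> snd z \<le> Y (\<tau> + 1))" for z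
  unfolding patch_def UN_iff mem_region patch_cell_def fst_conv snd_conv by blast
 then have "z \<in> patch L H K \<longleftrightarrow> X (-1) \<le> fst z \<and> fst z \<le> X 2 \<and> Y (-1) \<le> snd z \<and> snd z \<le> Y 2" for z
  unfolding a by blast
 then show ?thesis by (auto simp: mem_box Basis_prod_def)
qed

lemma patch_extent: "X 2 - X (-1) = L K (-1) + L K 0 + L K 1" "Y 2 - Y (-1) = H K (-1) + H K 0 + H K 1"
 using knots(1)[of "-1"] knots(1)[of 0] knots(1)[of 1] knots(3)[of "-1"] knots(3)[of 0] knots(3)[of 1] by simp_all

lemma patch_cell_inside:
 assumes "\<sigma> \<in> offs" "\<tau> \<in> offs"
 defines "S \<equiv> patch_cell L H K \<sigma> \<tau>"
 shows "region S \<subseteq> patch L H K" "X (-1) \<le> fst (fst S)" "fst (snd S) \<le> X 2" "Y (-1) \<le> snd (fst S)" "snd (snd S) \<le> Y 2"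
proof -
 show "region S \<subseteq> patch L H K" using assms unfolding patch_def S_def by blast
 have x: "X (-1) < X 0" "X 0 < X 1" "X 1 < X 2" "Y (-1) < Y 0" "Y 0 < Y 1" "Y 1 < Y 2"
  using knots(2)[of "-1"] knots(2)[of 0] knots(2)[of 1] knots(4)[of "-1"] knots(4)[of 0] knots(4)[of 1] by simp_all
 show "X (-1) \<le> fst (fst S)" "fst (snd S) \<le> X 2" "Y (-1) \<le> snd (fst S)" "snd (snd S) \<le> Y 2"
  using assms(1,2) x by (auto simp: S_def patch_cell_def)
qed

lemma lam_L2_bound:
 assumes f: "L2 (patch L H K) f" and e: "0 < e" "\<And>\<alpha>. \<alpha> \<in> offs ==> e \<le> L K \<alpha> \<and> e \<le> H K \<alpha>"
 shows "\<bar>lam L H K f\<bar> \<le> 9 * (L2_nrm (patch L H K) f / e)"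
proof (rule lam_bound)
 fix \<sigma> \<tau> assume o: "\<sigma> \<in> offs" "\<tau> \<in> offs"
 let ?S = "patch_cell L H K \<sigma> \<tau>"
 note S = patch_cell_coords[OF o] patch_cell_inside(1)[OF o]
 have "\<bar>cell_mean ?S f\<bar> \<le> L2_nrm (region ?S) f / sqrt (width ?S * height ?S)"
  by (rule cell_mean_bound[OF S(1) L2_subset(1)[OF f S(5) region_measurable(1)]])
 also have "\<dots> \<le> L2_nrm (patch L H K) f / e"
 proof (rule frac_le[OF L2_nrm_nonneg L2_nrm_mono[OF f S(5) region_measurable(1)] e(1)])
  show "e \<le> sqrt (width ?S * height ?S)"
   unfolding S(2,3) power2_eq_square[symmetric]
  proof (rule real_le_rsqrt)
   show "e\<^sup>2 \<le> L K \<sigma> * H K \<tau>"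
    unfolding power2_eq_square using e(1) e(2)[OF o(1)] e(2)[OF o(2)] by (intro mult_mono) auto
  qed
 qed
 finally show "\<bar>cell_mean ?S f\<bar> \<le> L2_nrm (patch L H K) f / e" .
qed

end

context extended_mesh
begin

text \<open>The ratio of the sides of a cell is half the ratio of diameter and inradius, and it is at least 1.\<close>

definition \<kappa> :: real where "\<kappa> = max 1 (\<gamma>0 / 2)"

lemma \<kappa>_ge: "1 \<le> \<kappa>" by (simp add: \<kappa>_def)

lemma aspect:
 assumes "K \<in> C" "\<alpha> \<in> offs" "\<beta> \<in> offs"
 shows "L K \<alpha> \<le> \<kappa> * H K \<beta>" "H K \<beta> \<le> \<kappa> * L K \<alpha>"
proof -
 have p: "0 < L K \<alpha>" "0 < H K \<beta>" using sizes[OF assms(1)] assms(2,3) by auto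
 have "shape_regular \<gamma>0 (pc K \<alpha> \<beta>)" using ext assms unfolding extended_patches_def by blast
 then have "max (L K \<alpha>) (H K \<beta>) / (min (L K \<alpha>) (H K \<beta>) / 2) \<le> \<gamma>0"
  unfolding shape_regular_def diam_cell_def inradius_def patch_lengths[OF assms] .
 then have "max (L K \<alpha>) (H K \<beta>) \<le> \<gamma>0 / 2 * min (L K \<alpha>) (H K \<beta>)"
  using p by (simp add: divide_le_eq split: if_splits)
 also have "\<dots> \<le> \<kappa> * min (L K \<alpha>) (H K \<beta>)"
  using p by (intro mult_right_mono) (auto simp: \<kappa>_def)
 finally have *: "max (L K \<alpha>) (H K \<beta>) \<le> \<kappa> * min (L K \<alpha>) (H K \<beta>)" .
 have "\<kappa> * min (L K \<alpha>) (H K \<beta>) \<le> \<kappa> * H K \<beta>" "\<kappa> * min (L K \<alpha>) (H K \<beta>) \<le> \<kappa> * L K \<alpha>"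
  using \<kappa>_ge by (intro mult_left_mono; simp)+
 then show "L K \<alpha> \<le> \<kappa> * H K \<beta>" "H K \<beta> \<le> \<kappa> * L K \<alpha>" using * by linarith+
qed

text \<open>Each cell of a patch shares its row or its column with a cell that shares the other one with \<open>T\<close>.\<close>

lemma patch_sizes:
 assumes K: "K \<in> C" "pc K \<sigma> \<tau> = T" "\<sigma> \<in> offs" "\<tau> \<in> offs" and \<alpha>: "\<alpha> \<in> offs"
 shows "L K \<alpha> \<le> \<kappa> * diam_cell T" "H K \<alpha> \<le> \<kappa> * diam_cell T"
  "diam_cell T / \<kappa>\<^sup>2 \<le> L K \<alpha>" "diam_cell T / \<kappa>\<^sup>2 \<le> H K \<alpha>" "diam_cell T \<le> \<kappa> * width T" "diam_cell T \<le> \<kappa> * height T" "0 < diam_cell T"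
proof -
 have T: "width T = L K \<sigma>" "height T = H K \<tau>" using patch_lengths[OF K(1,3,4)] K(2) by auto
 have p: "0 < L K \<sigma>" "0 < H K \<tau>" "0 < L K \<alpha>" "0 < H K \<alpha>" using sizes[OF K(1)] K \<alpha> by auto
 have h: "L K \<sigma> \<le> diam_cell T" "H K \<tau> \<le> diam_cell T" by (auto simp: diam_cell_def T)
 have \<kappa>0: "0 \<le> \<kappa>" "0 < \<kappa>" using \<kappa>_ge by auto
 note a = aspect[OF K(1,3,4)] aspect[OF K(1) \<alpha> K(4)] aspect[OF K(1,3) \<alpha>]
 show "L K \<alpha> \<le> \<kappa> * diam_cell T" "H K \<alpha> \<le> \<kappa> * diam_cell T"
  using a(3) a(6) mult_left_mono[OF h(2) \<kappa>0(1)] mult_left_mono[OF h(1) \<kappa>0(1)] by linarith+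
 have w: "L K \<sigma> \<le> \<kappa> * L K \<sigma>" "H K \<tau> \<le> \<kappa> * H K \<tau>" using p \<kappa>_ge by simp_all
 show 1: "diam_cell T \<le> \<kappa> * width T" "diam_cell T \<le> \<kappa> * height T" unfolding diam_cell_def T using a(1,2) w by auto
 show "0 < diam_cell T" using p h by linarith
 have "diam_cell T \<le> \<kappa> * (\<kappa> * L K \<alpha>)" using 1(2) mult_left_mono[OF a(4) \<kappa>0(1)] by (simp add: T)
 then show "diam_cell T / \<kappa>\<^sup>2 \<le> L K \<alpha>" using \<kappa>0(2) by (simp add: divide_le_eq power2_eq_square ac_simps)
 have "diam_cell T \<le> \<kappa> * (\<kappa> * H K \<alpha>)" using 1(1) mult_left_mono[OF a(5) \<kappa>0(1)] by (simp add: T)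
 then show "diam_cell T / \<kappa>\<^sup>2 \<le> H K \<alpha>" using \<kappa>0(2) by (simp add: divide_le_eq power2_eq_square ac_simps)
qed

lemma patch_in_Delta:
 assumes "K \<in> C" "pc K \<sigma> \<tau> = T" "\<sigma> \<in> offs" "\<tau> \<in> offs"
 shows "patch L H K \<subseteq> Delta \<Omega> G L H T" "region T \<subseteq> patch L H K"
proof -
 interpret patch_center L H K by (rule center[OF assms(1)])
 show *: "region T \<subseteq> patch L H K" using patch_cell_inside(1)[OF assms(3,4)] assms(2) by simp
 show "patch L H K \<subseteq> Delta \<Omega> G L H T" unfolding Delta_def using assms(1) * by blast
qed

text \<open>Nine pieces, each of coefficient size at most 17, give the factor 153; a derivative costs a factor
  \<open>2\<close> over the smaller side of the cell.\<close>

theorem piece_bound: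
 assumes T: "T \<in> G" and k: "i + j \<le> k"
  and I: "\<And>z. z \<in> interior (region T) ==> F z = (\<Sum>\<sigma>\<in>offs. \<Sum>\<tau>\<in>offs. l \<sigma> \<tau> *
    tensor_on T (q \<sigma> \<tau>) (r \<sigma> \<tau>) z)"
  and q: "\<And>\<sigma> \<tau>. \<sigma> \<in> offs ==> \<tau> \<in> offs ==> tame (width T) (q \<sigma> \<tau>)"
  and r: "\<And>\<sigma> \<tau>. \<sigma> \<in> offs ==> \<tau> \<in> offs ==> tame (height T) (r \<sigma> \<tau>)"
  and M: "\<And>\<sigma> \<tau>. \<sigma> \<in> offs ==> \<tau> \<in> offs ==> \<bar>l \<sigma> \<tau>\<bar> \<le> M"
 obtains g where "weak_deriv (interior (region T)) i j F g" "L2 (interior (region T)) g"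
  "L2_nrm (interior (region T)) g \<le> (2 * \<kappa> / diam_cell T) ^ (i + j) * (153 * M) * diam_cell T"
proof -
 have n: "nondegenerate T" using nondeg T by blast
 define x0 y0 w h where "x0 = fst (fst T)" and "y0 = snd (fst T)" and "w = width T" and "h = height T"
 have wh: "0 < w" "0 < h" "fst (snd T) = x0 + w" "snd (snd T) = y0 + h"
  using n by (auto simp: nondegenerate_def width_def height_def x0_def y0_def w_def h_def)
 define I where "I = (offs \<times> offs :: (int \<times> int) set)"
 define cc where "cc = (\<Sum>p\<in>I. l (fst p) (snd p) *\<^sub>R tensor_coeffs w h (q (fst p) (snd p)) (r (fst p) (snd p)))"
 have e: "F z = spoly x0 y0 w h cc z" if "z \<in> interior (region T)" for z
  unfolding assms(3)[OF that] wh(3,4) x0_def[symmetric] y0_def[symmetric] tensor_spoly[OF wh(1,2)] cc_def spoly_sum I_def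
  by (simp add: sum.cartesian_product case_prod_beta')
 have M0: "0 \<le> M" using M[of 0 0] by (auto intro: order_trans[OF abs_ge_zero])
 have "csize cc \<le> (\<Sum>p\<in>I. \<bar>l (fst p) (snd p)\<bar> * csize (tensor_coeffs w h (q (fst p) (snd p)) (r (fst p) (snd p))))"
  unfolding cc_def by (rule csize_sum)
 also have "\<dots> \<le> (\<Sum>p\<in>I. M * 17)"
 proof (rule sum_mono)
  fix p assume "p \<in> I"
  then have o: "fst p \<in> offs" "snd p \<in> offs" by (auto simp: I_def)
  show "\<bar>l (fst p) (snd p)\<bar> * csize (tensor_coeffs w h (q (fst p) (snd p)) (r (fst p) (snd p))) \<le> M * 17"
   by (intro mult_mono M[OF o] tensor_coeffs_size[OF q[OF o, folded w_def] r[OF o, folded h_def]] csize_nonneg M0)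
 qed
 also have "\<dots> = 153 * M" by (simp add: I_def card_cartesian_product)
 finally have cs: "csize cc \<le> 153 * M" .
 have TC: "T \<in> C" "pc T 0 0 = T" using G_subset_C[OF T] patch_center.patch_cell_coords(4)[OF center[OF G_subset_C[OF T]], of 0 0] by auto
 note ps = patch_sizes[OF TC, of 0]
 have \<kappa>0: "0 < \<kappa>" using \<kappa>_ge by simp
 define \<mu> where "\<mu> = 2 * \<kappa> / diam_cell T"
 have \<mu>: "2 / width T \<le> \<mu>" "2 / height T \<le> \<mu>" "0 \<le> \<mu>"
  using ps(5,6,7) \<kappa>0 wh(1,2) by (auto simp: \<mu>_def w_def h_def divide_le_eq le_divide_eq ac_simps)
 let ?g = "spoly x0 y0 w h ((dxc w ^^ i) ((dyc h ^^ j) cc))"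
 have ae: "AE z in lebesgue. z \<in> interior (region T) --> spoly x0 y0 w h cc z = F z"
  by (rule always_eventually) (use e in simp)
 have 1: "weak_deriv (interior (region T)) i j F ?g"
  by (rule weak_deriv_AE[OF ae _ spoly_weak_deriv]) simp
 have 2: "L2 (interior (region T)) ?g"
  unfolding x0_def y0_def w_def h_def by (rule spoly_L2(1)[OF n \<mu>(1,2)])
 have "L2_nrm (interior (region T)) ?g \<le> \<mu> ^ (i + j) * csize cc * diam_cell T"
  unfolding x0_def y0_def w_def h_def by (rule spoly_L2(2)[OF n \<mu>(1,2)])
 also have "\<dots> \<le> \<mu> ^ (i + j) * (153 * M) * diam_cell T"
  using cs \<mu>(3) ps(7) by (intro mult_right_mono mult_left_mono) auto
 finally show ?thesis using that[OF 1 2] unfolding \<mu>_def by blast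
qed

lemma region_AE: "AE z in lebesgue. z \<in> region T --> z \<in> interior (region T)"
 using AE_completion[OF cbox_box_AE[of "fst T" "snd T"]]
 by eventually_elim (auto simp: region_def indicator_def split: if_splits)

theorem interp_cong:
 assumes T: "T \<in> G" and ae: "AE z in lebesgue. z \<in> Delta \<Omega> G L H T --> v z = v' z"
 shows "AE z in lebesgue. z \<in> region T --> Ih v z = Ih v' z"
proof (rule local_interpolant[OF T])
 fix K q r
 assume K: "\<And>\<sigma> \<tau>. \<sigma> \<in> offs ==> \<tau> \<in> offs ==> K \<sigma> \<tau> \<in> C \<and> pc (K \<sigma> \<tau>) (-\<sigma>) (-\<tau>) = T"
  and I: "\<And>v z. z \<in> interior (region T) ==> Ih v z = (\<Sum>\<sigma>\<in>offs. \<Sum>\<tau>\<in>offs. lam L H (K \<sigma> \<tau>) v *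
   tensor_on T (q \<sigma> \<tau>) (r \<sigma> \<tau>) z)"
 have l: "lam L H (K \<sigma> \<tau>) v = lam L H (K \<sigma> \<tau>) v'" if o: "\<sigma> \<in> offs" "\<tau> \<in> offs" for \<sigma> \<tau>
 proof (rule patch_center.lam_cong[OF center])
  show "K \<sigma> \<tau> \<in> C" using K[OF o] by blast
  have "patch L H (K \<sigma> \<tau>) \<subseteq> Delta \<Omega> G L H T" using K[OF o] o by (intro patch_in_Delta(1)[of _ "-\<sigma>" "-\<tau>"]) auto
  then show "AE x in lebesgue. x \<in> patch L H (K \<sigma> \<tau>) --> v x = v' x" using ae by (auto elim!: eventually_mono)
 qed
 show ?thesis
  using region_AE[of T]
 proof eventually_elim
  case (elim z)
  show ?case
  proof
   assume "z \<in> region T"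
   then have z: "z \<in> interior (region T)" using elim by blast
   show "Ih v z = Ih v' z"
    unfolding I[OF z] by (intro sum.cong refl) (simp only: l)
  qed
 qed
qed

lemma interp_P2:
 assumes "T \<in> G" "p \<in> P2" "z \<in> interior (region T)"
 shows "Ih p z = p z"
proof (rule local_interpolant[OF assms(1)])
 assume Q: "\<And>p z. p \<in> P2 ==> z \<in> interior (region T) ==> Ih p z = p z"
 show "Ih p z = p z" by (rule Q[OF assms(2,3)])
qed

text \<open>The constant 1377 is the factor 153 of \<open>piece_bound\<close> times the bound 9 of the functionals.\<close>

theorem stability:
 assumes T: "T \<in> G" and k: "k \<le> 2" and v: "L2 (Delta \<Omega> G L H T) v"
 shows "Hspace k (region T) (Ih v)"
  "Hseminorm k (region T) (Ih v) \<le> 4 * ((2 * \<kappa>) ^ 3 * (1377 * \<kappa>\<^sup>2)) * diam_cell T powi (- int k) * L2_nrm (Delta \<Omega> G L H T) v"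
proof -
 define N h where "N = L2_nrm (Delta \<Omega> G L H T) v" and "h = diam_cell T"
 obtain K q r where K: "\<And>\<sigma> \<tau>. \<sigma> \<in> offs ==> \<tau> \<in> offs ==> K \<sigma> \<tau> \<in> C \<and> pc (K \<sigma> \<tau>) (-\<sigma>) (-\<tau>) = T"
  and I: "\<And>v z. z \<in> interior (region T) ==> Ih v z = (\<Sum>\<sigma>\<in>offs. \<Sum>\<tau>\<in>offs. lam L H (K \<sigma> \<tau>) v *
   tensor_on T (q \<sigma> \<tau>) (r \<sigma> \<tau>) z)"
  and q: "\<And>\<sigma> \<tau>. \<sigma> \<in> offs ==> \<tau> \<in> offs ==> tame (width T) (q \<sigma> \<tau>)"
  and r: "\<And>\<sigma> \<tau>. \<sigma> \<in> offs ==> \<tau> \<in> offs ==> tame (height T) (r \<sigma> \<tau>)"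
  by (rule local_interpolant[OF T]) blast
 have \<kappa>0: "0 < \<kappa>" "1 \<le> 2 * \<kappa>" using \<kappa>_ge by auto
 have h: "0 < h" using patch_sizes(7)[of "K 0 0" 0 0 T 0] K[of 0 0] by (simp add: h_def)
 define M where "M = 9 * (N / (h / \<kappa>\<^sup>2))"
 have N0: "0 \<le> N" by (simp add: N_def L2_nrm_nonneg)
 have M: "\<bar>lam L H (K \<sigma> \<tau>) v\<bar> \<le> M" if o: "\<sigma> \<in> offs" "\<tau> \<in> offs" for \<sigma> \<tau>
 proof -
  have o': "-\<sigma> \<in> offs" "-\<tau> \<in> offs" using o by auto
  have KC: "K \<sigma> \<tau> \<in> C" "pc (K \<sigma> \<tau>) (-\<sigma>) (-\<tau>) = T" using K[OF o] by auto
  interpret pa: patch_center L H "K \<sigma> \<tau>" by (rule center[OF KC(1)])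
  note sub = patch_in_Delta(1)[OF KC o']
  have ps: "patch L H (K \<sigma> \<tau>) \<in> sets lebesgue" by (simp add: pa.patch_cbox)
  have "\<bar>lam L H (K \<sigma> \<tau>) v\<bar> \<le> 9 * (L2_nrm (patch L H (K \<sigma> \<tau>)) v / (h / \<kappa>\<^sup>2))"
   by (rule pa.lam_L2_bound[OF L2_subset(1)[OF v sub ps]])
    (use h \<kappa>0 patch_sizes(3,4)[OF KC o'] in \<open>auto simp: h_def\<close>)
  also have "\<dots> \<le> M"
   unfolding M_def N_def using h \<kappa>0 by (intro mult_left_mono divide_right_mono L2_nrm_mono[OF v sub ps]) auto
  finally show ?thesis .
 qed
 have P: "\<exists>g. weak_deriv (interior (region T)) i j (Ih v) g \<and> L2 (interior (region T)) g
   \<and> L2_nrm (interior (region T)) g \<le> (2 * \<kappa> / h) ^ (i + j) * (153 * M) * h" for i j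
  by (rule piece_bound[OF T order_refl I q r M, of i j]) (auto simp: h_def)
 show "Hspace k (region T) (Ih v)" unfolding Hspace_def using P by blast
 have "\<forall>i. \<exists>g. weak_deriv (interior (region T)) i (k - i) (Ih v) g
   \<and> L2_nrm (interior (region T)) g \<le> (2 * \<kappa> / h) ^ (i + (k - i)) * (153 * M) * h"
  using P by blast
 then obtain D where D': "\<forall>i. weak_deriv (interior (region T)) i (k - i) (Ih v) (D i)
   \<and> L2_nrm (interior (region T)) (D i) \<le> (2 * \<kappa> / h) ^ (i + (k - i)) * (153 * M) * h"
  by (rule choice[THEN exE])
 note D = conjunct1[OF spec[OF D']] conjunct2[OF spec[OF D']]
 have B: "L2_nrm (interior (region T)) (D i) \<le> (2 * \<kappa> / h) ^ k * (153 * M) * h" if "i \<le> k" for i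
  using D(2)[of i] that by simp
 have "Hseminorm k (region T) (Ih v) \<le> real (Suc k) * ((2 * \<kappa> / h) ^ k * (153 * M) * h)"
  by (rule Hseminorm_le[OF D(1) B])
 also have "(2 * \<kappa> / h) ^ k * (153 * M) * h = (2 * \<kappa>) ^ k * (1377 * \<kappa>\<^sup>2) * (N / h ^ k)"
  using h \<kappa>0 by (simp add: M_def power_divide field_simps)
 also have "real (Suc k) * \<dots> \<le> 4 * ((2 * \<kappa>) ^ 3 * (1377 * \<kappa>\<^sup>2) * (N / h ^ k))"
  using k h N0 \<kappa>0 \<kappa>_ge by (intro mult_mono power_increasing mult_nonneg_nonneg divide_nonneg_nonneg) auto
 also have "\<dots> = 4 * ((2 * \<kappa>) ^ 3 * (1377 * \<kappa>\<^sup>2)) * h powi (- int k) * N"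
  by (simp add: power_int_minus field_simps)
 finally show "Hseminorm k (region T) (Ih v) \<le> 4 * ((2 * \<kappa>) ^ 3 * (1377 * \<kappa>\<^sup>2)) * diam_cell T powi (- int k) * L2_nrm (Delta \<Omega> G L H T) v"
  unfolding N_def h_def .
qed

text \<open>The error of the interpolant is \<open>e - Ih e\<close> with \<open>e = v - p\<close>, as quadratics are reproduced. Here \<open>e\<close> is
  bounded by \<open>polynomial_error\<close> and \<open>Ih e\<close> by its size on the patches. The same polynomial \<open>p\<close> serves all nine
  patches, since its moments are taken over a part of \<open>T\<close>.\<close>

theorem approximation:
 assumes T: "T \<in> G" and s: "s \<le> 3" "k \<le> s" and v: "Hspace s (Delta \<Omega> G L H T) v"
 shows "Hspace k (region T) (\<lambda>z. v z - Ih v z)"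
  "Hseminorm k (region T) (\<lambda>z. v z - Ih v z) \<le>
   8 * ((18 * \<kappa> ^ 4) ^ 3 + (2 * \<kappa>) ^ 3 * (1377 * \<kappa>\<^sup>2) * (18 * \<kappa> ^ 4) ^ 3) * diam_cell T ^ (s - k) * Hseminorm s (Delta \<Omega> G L H T) v"
proof -
 define V where "V = interior (Delta \<Omega> G L H T)"
 define h S where "h = diam_cell T" and "S = Hseminorm s (Delta \<Omega> G L H T) v"
 define R where "R = interior (region T)"
 obtain K q r where K: "\<And>\<sigma> \<tau>. \<sigma> \<in> offs ==> \<tau> \<in> offs ==> K \<sigma> \<tau> \<in> C \<and> pc (K \<sigma> \<tau>) (-\<sigma>) (-\<tau>) = T"
  and I: "\<And>v z. z \<in> interior (region T) ==> Ih v z = (\<Sum>\<sigma>\<in>offs. \<Sum>\<tau>\<in>offs. lam L H (K \<sigma> \<tau>) v *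
   tensor_on T (q \<sigma> \<tau>) (r \<sigma> \<tau>) z)"
  and q: "\<And>\<sigma> \<tau>. \<sigma> \<in> offs ==> \<tau> \<in> offs ==> tame (width T) (q \<sigma> \<tau>)"
  and r: "\<And>\<sigma> \<tau>. \<sigma> \<in> offs ==> \<tau> \<in> offs ==> tame (height T) (r \<sigma> \<tau>)"
  and Q: "\<And>p z. p \<in> P2 ==> z \<in> interior (region T) ==> Ih p z = p z"
  by (rule local_interpolant[OF T]) blast
 have \<kappa>0: "0 < \<kappa>" "1 \<le> 2 * \<kappa>" "1 \<le> \<kappa>" using \<kappa>_ge by auto
 have K0: "K 0 0 \<in> C" "pc (K 0 0) 0 0 = T" using K[of 0 0] by auto
 note dims = patch_sizes(5,6,7)[OF K0, of 0, simplified, folded h_def]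
 have h: "0 < h" by (rule dims(3))
 have n: "nondegenerate T" using nondeg T by blast
 have wT: "0 < width T" "0 < height T" using n by (auto simp: nondegenerate_def width_def height_def)
 obtain D where D: "\<And>i j. i + j \<le> s ==> weak_deriv V i j v (D i j)" "\<And>i j. i + j \<le> s ==> L2 V (D i j)"
  using v unfolding Hspace_def V_def by metis
 have S0: "L2_nrm V (D i j) \<le> S" if "i + j = s" for i j
 proof -
  have "L2_nrm V (D i (s - i)) \<le> S"
   unfolding V_def S_def by (rule L2_nrm_le_Hseminorm[where D = "\<lambda>i. D i (s - i)"]) (use D(1) that in \<open>auto simp: V_def\<close>)
  moreover have "s - i = j" using that by simp
  ultimately show ?thesis by simp
 qed
 have Spos: "0 \<le> S" using S0[of s 0] L2_nrm_nonneg[of V "D s 0"] by simp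
 \<comment> \<open>strictly inside every patch that contains T, and still comparable to T\<close>
 define E where "E = ((fst (fst T) + width T / 3, snd (fst T) + height T / 3), (fst (snd T) - width T / 3, snd (snd T) - height T / 3))"
 have E: "nondegenerate E" "width E = width T / 3" using wT by (auto simp: E_def nondegenerate_def width_def height_def field_simps)
 define x y where "x = (fst (fst E) + fst (snd E)) / 2" and "y = (snd (fst E) + snd (snd E)) / 2"
 obtain c where c: "\<forall>i j. i + j \<le> 2 --> cell_mean E (spoly x y 1 1 ((dxc 1 ^^ i) ((dyc 1 ^^ j) c))) = (if i + j < s then cell_mean E (D i j) else 0)"
  "\<forall>i j. i + j \<le> 3 --> (\<forall>i' j'. i + j \<le> i' + j' --> (if i' + j' < s then cell_mean E (D i' j') else 0) = 0) --> (dxc 1 ^^ i) ((dyc 1 ^^ j) c) = 0"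
  unfolding x_def y_def by (rule mean_polynomial[OF E(1), where m = "\<lambda>i j. if i + j < s then cell_mean E (D i j) else 0"]) blast
 have c1: "cell_mean E (spoly x y 1 1 ((dxc 1 ^^ i) ((dyc 1 ^^ j) c))) = cell_mean E (D i j)" if "i + j < s" for i j
  using c(1) that s by simp
 have c2: "(dxc 1 ^^ i) ((dyc 1 ^^ j) c) = 0" if "i + j = s" for i j
  by (rule c(2)[rule_format]) (use that s in auto)
 define p where "p = spoly x y 1 1 c"
 define e where "e z = v z - p z" for z
 define w where "w i j z = D i j z - spoly x y 1 1 ((dxc 1 ^^ i) ((dyc 1 ^^ j) c)) z" for i j z
 \<comment> \<open>twice the constant of the Poincare inequality on a patch is at most \<open>\<rho>\<^sup>2\<close>\<close>
 define \<rho> where "\<rho> = 18 * \<kappa> ^ 4 * h"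
 have pP: "p \<in> P2"
 proof -
  obtain A B C' D' E' F where cc: "c = (A, B, C', D', E', F)" by (metis surj_pair)
  have "p = quad (A - B * x - C' * y + D' * x\<^sup>2 + E' * x * y + F * y\<^sup>2) (B - 2 * D' * x - E' * y) (C' - E' * x - 2 * F * y) D' E' F"
   by (rule HOL.ext) (auto simp: p_def cc spoly_def quad_def Let_def power2_eq_square algebra_simps)
  then show ?thesis unfolding P2_iff by blast
 qed
 have err: "weak_deriv (interior (patch L H (K \<sigma> \<tau>))) i j e (w i j) \<and> L2 (interior (patch L H (K \<sigma> \<tau>))) (w i j)
   \<and> L2_nrm (interior (patch L H (K \<sigma> \<tau>))) (w i j) \<le> \<rho> ^ (s - (i + j)) * S"
  if o: "\<sigma> \<in> offs" "\<tau> \<in> offs" and ij: "i + j \<le> s" for \<sigma> \<tau> i j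
 proof -
  have o': "-\<sigma> \<in> offs" "-\<tau> \<in> offs" using o by auto
  have KC: "K \<sigma> \<tau> \<in> C" "pc (K \<sigma> \<tau>) (-\<sigma>) (-\<tau>) = T" using K[OF o] by auto
  interpret pa: patch_center L H "K \<sigma> \<tau>" by (rule center[OF KC(1)])
  note sub = patch_in_Delta(1)[OF KC o']
  note ins = pa.patch_cell_inside(2-5)[OF o', unfolded KC(2)]
  have b: "L (K \<sigma> \<tau>) \<alpha> \<le> \<kappa> * h" "H (K \<sigma> \<tau>) \<alpha> \<le> \<kappa> * h" if "\<alpha> \<in> offs" for \<alpha>
   using patch_sizes(1,2)[OF KC o' that] by (auto simp: h_def)
  define a d where "a = pa.X 2 - pa.X (-1)" and "d = pa.Y 2 - pa.Y (-1)"
  have ad: "a \<le> 3 * \<kappa> * h" "d \<le> 3 * \<kappa> * h" "0 \<le> a" "0 \<le> d"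
   using b[of "-1"] b[of 0] b[of 1] ins wT pa.patch_extent by (auto simp: a_def d_def width_def height_def)
  define P where "P = 162 * \<kappa> ^ 4 * h\<^sup>2"
  have a2: "a\<^sup>2 \<le> (3 * \<kappa> * h)\<^sup>2" "d\<^sup>2 \<le> (3 * \<kappa> * h)\<^sup>2" using ad by (auto intro!: power_mono)
  have P1: "2 * a\<^sup>2 \<le> P"
  proof -
   have "2 * a\<^sup>2 \<le> 18 * (\<kappa>\<^sup>2 * h\<^sup>2)" using a2(1) by (simp add: power_mult_distrib ac_simps)
   also have "\<dots> \<le> 162 * (\<kappa> ^ 4 * h\<^sup>2)"
   proof -
    have "\<kappa>\<^sup>2 * h\<^sup>2 \<le> \<kappa> ^ 4 * h\<^sup>2" using \<kappa>0(3) by (intro mult_right_mono power_increasing) auto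
    moreover have "0 \<le> \<kappa> ^ 4 * h\<^sup>2" by simp
    ultimately show ?thesis by linarith
   qed
   finally show ?thesis by (simp add: P_def)
  qed
  have P2: "2 * a * d\<^sup>2 / width E \<le> P"
  proof -
   have "2 * a * d\<^sup>2 \<le> 2 * (3 * \<kappa> * h) * (3 * \<kappa> * h)\<^sup>2" using ad a2 \<kappa>0 h by (intro mult_mono) auto
   also have "\<dots> = 54 * \<kappa> ^ 3 * h\<^sup>2 * h" by (simp add: power2_eq_square power3_eq_cube)
   also have "\<dots> \<le> 54 * \<kappa> ^ 3 * h\<^sup>2 * (\<kappa> * width T)" using dims(1) \<kappa>0 by (intro mult_left_mono) auto
   also have "\<dots> = P * width E" by (simp add: P_def E(2) power_numeral_reduce)
   finally have le: "2 * a * d\<^sup>2 \<le> P * width E" .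
   have "0 < width E" using wT E(2) by simp
   from pos_divide_le_eq[OF this] show ?thesis using le by blast
  qed
  have \<rho>P: "2 * P \<le> \<rho>\<^sup>2"
  proof -
   have "2 * P = 324 * (\<kappa> ^ 4 * h\<^sup>2)" by (simp add: P_def)
   also have "\<dots> \<le> 324 * (\<kappa> ^ 8 * h\<^sup>2)" using \<kappa>0 by (intro mult_left_mono mult_right_mono power_increasing) auto
   also have "\<dots> = \<rho>\<^sup>2" by (simp add: \<rho>_def power_mult_distrib power_mult[symmetric])
   finally show ?thesis .
  qed
  have \<rho>0: "0 \<le> \<rho>" using \<kappa>0 h by (simp add: \<rho>_def)
  have EI: "pa.X (-1) < fst (fst E)" "fst (snd E) < pa.X 2" "pa.Y (-1) < snd (fst E)" "snd (snd E) < pa.Y 2"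
   using ins wT by (auto simp: E_def)
  have ip: "interior (patch L H (K \<sigma> \<tau>)) = box (pa.X (-1), pa.Y (-1)) (pa.X 2, pa.Y 2)"
   by (simp add: pa.patch_cbox)
  have iV: "box (pa.X (-1), pa.Y (-1)) (pa.X 2, pa.Y 2) \<subseteq> V"
   unfolding ip[symmetric] V_def by (rule interior_mono[OF sub])
  note pe = polynomial_error[OF s(1) D(1) D(2) E(1) EI c1 c2 iV S0 P1[unfolded a_def] P2[unfolded a_def d_def] \<rho>0 \<rho>P ij]
  show ?thesis unfolding ip e_def[abs_def] p_def w_def[abs_def] using pe by blast
 qed
 have R_sub: "R \<subseteq> interior (patch L H (K 0 0))"
  unfolding R_def using patch_in_Delta(2)[OF K0] by (intro interior_mono) simp
 have Rm: "R \<in> sets lebesgue" by (simp add: R_def)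
 have errT: "weak_deriv R i j e (w i j)" "L2 R (w i j)" "L2_nrm R (w i j) \<le> \<rho> ^ (s - (i + j)) * S" if "i + j \<le> s" for i j
 proof -
  have z: "(0::int) \<in> offs" by simp
  note e0 = err[OF z z that]
  show "weak_deriv R i j e (w i j)" by (rule weak_deriv_mono[OF conjunct1[OF e0] R_sub])
  show "L2 R (w i j)" by (rule L2_subset(1)[OF conjunct1[OF conjunct2[OF e0]] R_sub Rm])
  show "L2_nrm R (w i j) \<le> \<rho> ^ (s - (i + j)) * S"
   by (rule order_trans[OF L2_nrm_mono[OF conjunct1[OF conjunct2[OF e0]] R_sub Rm] conjunct2[OF conjunct2[OF e0]]])
 qed
 define M where "M = 9 * (\<rho> ^ s * S / (h / \<kappa>\<^sup>2))"
 have lamE: "\<bar>lam L H (K \<sigma> \<tau>) e\<bar> \<le> M \<and> lam L H (K \<sigma> \<tau>) e = lam L H (K \<sigma> \<tau>) v - lam L H (K \<sigma> \<tau>) p"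
  if o: "\<sigma> \<in> offs" "\<tau> \<in> offs" for \<sigma> \<tau>
 proof -
  have o': "-\<sigma> \<in> offs" "-\<tau> \<in> offs" using o by auto
  have KC: "K \<sigma> \<tau> \<in> C" "pc (K \<sigma> \<tau>) (-\<sigma>) (-\<tau>) = T" using K[OF o] by auto
  interpret pa: patch_center L H "K \<sigma> \<tau>" by (rule center[OF KC(1)])
  let ?P = "interior (patch L H (K \<sigma> \<tau>))"
  have e0: "weak_deriv ?P 0 0 e (w 0 0)" "L2 ?P (w 0 0)" "L2_nrm ?P (w 0 0) \<le> \<rho> ^ s * S" using err[OF o, of 0 0] by auto
  note ae = weak_deriv_0[OF e0(1) open_interior]
  have eP: "L2 ?P e" "L2_nrm ?P e \<le> \<rho> ^ s * S" using L2_AE[OF ae] e0(2,3) by simp_all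
  have ip: "?P = box (pa.X (-1), pa.Y (-1)) (pa.X 2, pa.Y 2)" by (simp add: pa.patch_cbox)
  have eQ: "L2 (patch L H (K \<sigma> \<tau>)) e" "L2_nrm (patch L H (K \<sigma> \<tau>)) e \<le> \<rho> ^ s * S"
   using eP unfolding ip pa.patch_cbox L2_cbox_box by simp_all
  have "\<bar>lam L H (K \<sigma> \<tau>) e\<bar> \<le> 9 * (L2_nrm (patch L H (K \<sigma> \<tau>)) e / (h / \<kappa>\<^sup>2))"
   by (rule pa.lam_L2_bound[OF eQ(1)]) (use h \<kappa>0 patch_sizes(3,4)[OF KC o'] in \<open>auto simp: h_def\<close>)
  also have "\<dots> \<le> M" unfolding M_def using h \<kappa>0 by (intro mult_left_mono divide_right_mono eQ(2)) auto
  finally have 1: "\<bar>lam L H (K \<sigma> \<tau>) e\<bar> \<le> M" .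
  have pb: "L2 (patch L H (K \<sigma> \<tau>)) p" unfolding p_def pa.patch_cbox by (rule L2_continuous[OF spoly_continuous]) auto
  have "L2 V v" by (rule L2_AE(1)[OF weak_deriv_0[OF D(1)[of 0 0]], THEN iffD1]) (use D(2)[of 0 0] in \<open>auto simp: V_def\<close>)
  then have "L2 ?P v"
   by (rule L2_subset(1)) (auto simp: V_def intro!: interior_mono[OF patch_in_Delta(1)[OF KC o'], THEN subsetD])
  then have "L2 (box (pa.X (-1), pa.Y (-1)) (pa.X 2, pa.Y 2)) v" unfolding ip .
  then have vb: "L2 (patch L H (K \<sigma> \<tau>)) v" by (simp only: pa.patch_cbox L2_cbox_box)
  have i: "set_integrable lebesgue (region (pc (K \<sigma> \<tau>) \<alpha> \<beta>)) f" if "\<alpha> \<in> offs" "\<beta> \<in> offs" "L2 (patch L H (K \<sigma> \<tau>)) f" for \<alpha> \<beta> f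
   by (rule L2_integrable[OF L2_subset(1)[OF that(3) pa.patch_cell_inside(1)[OF that(1,2)] region_measurable(1)] region_measurable(1,3)])
  have "lam L H (K \<sigma> \<tau>) (\<lambda>z. v z - p z) = lam L H (K \<sigma> \<tau>) v - lam L H (K \<sigma> \<tau>) p"
   by (rule pa.lam_diff) (use i vb pb in blast)
  then show ?thesis using 1 unfolding e_def[abs_def] by blast
 qed
 have ie: "Ih e z = Ih v z - p z" if z: "z \<in> interior (region T)" for z
 proof -
  have "Ih e z = Ih v z - Ih p z"
   unfolding I[OF z] sum_subtractf[symmetric]
   by (intro sum.cong refl) (simp only: lamE left_diff_distrib)
  then show ?thesis using Q[OF pP z] by simp
 qed
 define F where "F z = v z - Ih v z" for z
 have aeF: "AE z in lebesgue. z \<in> R --> e z - Ih e z = F z"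
  by (rule always_eventually) (simp add: R_def ie e_def F_def)
 have P: "\<exists>g. weak_deriv R i j F g \<and> L2 R g \<and> L2_nrm R g \<le> 2 * (\<rho> ^ (s - (i + j)) * S + (2 * \<kappa> / h) ^ (i + j) * (153 * M) * h)"
  if ij: "i + j \<le> s" for i j
 proof -
  obtain g where g: "weak_deriv R i j (Ih e) g" "L2 R g" "L2_nrm R g \<le> (2 * \<kappa> / h) ^ (i + j) * (153 * M) * h"
   unfolding R_def h_def by (rule piece_bound[OF T order_refl I q r conjunct1[OF lamE], of i j])
  have "weak_deriv R i j F (\<lambda>z. w i j z - g z)"
   by (rule weak_deriv_AE[OF aeF _ weak_deriv_diff[OF errT(1)[OF ij] g(1)]]) simp
  moreover note L2_diff[OF errT(2)[OF ij] g(2)]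
  ultimately show ?thesis using errT(3)[OF ij] g(3) by (intro exI[of _ "\<lambda>z. w i j z - g z"]) auto
 qed
 show "Hspace k (region T) (\<lambda>z. v z - Ih v z)"
  unfolding Hspace_def F_def[symmetric] R_def[symmetric] using P s(2) by (meson le_trans)
 have "\<forall>i. \<exists>g. i \<le> k --> weak_deriv R i (k - i) F g \<and> L2_nrm R g \<le> 2 * (\<rho> ^ (s - k) * S + (2 * \<kappa> / h) ^ k * (153 * M) * h)"
 proof
  fix i show "\<exists>g. i \<le> k --> weak_deriv R i (k - i) F g \<and> L2_nrm R g \<le> 2 * (\<rho> ^ (s - k) * S + (2 * \<kappa> / h) ^ k * (153 * M) * h)"
   using P[of i "k - i"] s(2) by (cases "i \<le> k") auto
 qed
 then obtain g where g: "\<forall>i. i \<le> k --> weak_deriv R i (k - i) F (g i) \<and> L2_nrm R (g i) \<le> 2 * (\<rho> ^ (s - k) * S + (2 * \<kappa> / h) ^ k * (153 * M) * h)"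
  by (rule choice[THEN exE])
 have "Hseminorm k (region T) F \<le> real (Suc k) * (2 * (\<rho> ^ (s - k) * S + (2 * \<kappa> / h) ^ k * (153 * M) * h))"
  by (rule Hseminorm_le[where D = g]) (use g in \<open>auto simp: R_def\<close>)
 also have "\<dots> \<le> 4 * (2 * ((18 * \<kappa> ^ 4) ^ 3 * h ^ (s - k) * S + (2 * \<kappa>) ^ 3 * (1377 * \<kappa>\<^sup>2) * (18 * \<kappa> ^ 4) ^ 3 * h ^ (s - k) * S))"
 proof -
  have \<kappa>4: "1 \<le> 18 * \<kappa> ^ 4" using one_le_power[OF \<kappa>0(3), of 4] by simp
  have 1: "\<rho> ^ (s - k) * S \<le> (18 * \<kappa> ^ 4) ^ 3 * h ^ (s - k) * S"
   unfolding \<rho>_def power_mult_distrib[of "18 * \<kappa> ^ 4"] using s Spos h \<kappa>4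
   by (intro mult_right_mono power_increasing) auto
  have "(2 * \<kappa> / h) ^ k * (153 * M) * h = (2 * \<kappa>) ^ k * (1377 * \<kappa>\<^sup>2) * (18 * \<kappa> ^ 4) ^ s * (h ^ s / h ^ k) * S"
   unfolding M_def \<rho>_def power_mult_distrib[of "18 * \<kappa> ^ 4"] power_divide using h \<kappa>0 by (simp add: divide_simps)
  also have "h ^ s / h ^ k = h ^ (s - k)" using power_diff[of h k s] h s(2) by simp
  also have "(2 * \<kappa>) ^ k * (1377 * \<kappa>\<^sup>2) * (18 * \<kappa> ^ 4) ^ s * h ^ (s - k) * S \<le> (2 * \<kappa>) ^ 3 * (1377 * \<kappa>\<^sup>2) * (18 * \<kappa> ^ 4) ^ 3 * h ^ (s - k) * S"
   using s Spos h \<kappa>0 \<kappa>4 by (intro mult_right_mono mult_mono power_increasing) auto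
  finally have 2: "(2 * \<kappa> / h) ^ k * (153 * M) * h \<le> (2 * \<kappa>) ^ 3 * (1377 * \<kappa>\<^sup>2) * (18 * \<kappa> ^ 4) ^ 3 * h ^ (s - k) * S" .
  have 0: "0 \<le> (18 * \<kappa> ^ 4) ^ 3 * h ^ (s - k) * S + (2 * \<kappa>) ^ 3 * (1377 * \<kappa>\<^sup>2) * (18 * \<kappa> ^ 4) ^ 3 * h ^ (s - k) * S"
   using Spos h \<kappa>0 by (intro add_nonneg_nonneg mult_nonneg_nonneg) auto
  have "real (Suc k) \<le> 4" using s by simp
  then have "real (Suc k) * (2 * ((18 * \<kappa> ^ 4) ^ 3 * h ^ (s - k) * S + (2 * \<kappa>) ^ 3 * (1377 * \<kappa>\<^sup>2) * (18 * \<kappa> ^ 4) ^ 3 * h ^ (s - k) * S))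
   \<le> 4 * (2 * ((18 * \<kappa> ^ 4) ^ 3 * h ^ (s - k) * S + (2 * \<kappa>) ^ 3 * (1377 * \<kappa>\<^sup>2) * (18 * \<kappa> ^ 4) ^ 3 * h ^ (s - k) * S))"
   using 0 by (intro mult_right_mono) auto
  moreover have "real (Suc k) * (2 * (\<rho> ^ (s - k) * S + (2 * \<kappa> / h) ^ k * (153 * M) * h))
   \<le> real (Suc k) * (2 * ((18 * \<kappa> ^ 4) ^ 3 * h ^ (s - k) * S + (2 * \<kappa>) ^ 3 * (1377 * \<kappa>\<^sup>2) * (18 * \<kappa> ^ 4) ^ 3 * h ^ (s - k) * S))"
   using 1 2 by (intro mult_left_mono add_mono) auto
  ultimately show ?thesis by (rule order_trans[rotated])
 qed
 also have "\<dots> = 8 * ((18 * \<kappa> ^ 4) ^ 3 + (2 * \<kappa>) ^ 3 * (1377 * \<kappa>\<^sup>2) * (18 * \<kappa> ^ 4) ^ 3) * h ^ (s - k) * S"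
  by (simp only: distrib_left distrib_right mult.assoc[symmetric])
 finally show "Hseminorm k (region T) (\<lambda>z. v z - Ih v z) \<le>
   8 * ((18 * \<kappa> ^ 4) ^ 3 + (2 * \<kappa>) ^ 3 * (1377 * \<kappa>\<^sup>2) * (18 * \<kappa> ^ 4) ^ 3) * diam_cell T ^ (s - k) * Hseminorm s (Delta \<Omega> G L H T) v"
  unfolding F_def h_def S_def .
qed

end

section \<open>The interpolation error\<close>

theorem lemma3p11:
  fixes \<gamma>0 :: real
  shows "\<exists>C>0. \<forall>\<Omega> G L H. rectangular_grid \<gamma>0 \<Omega> G \<and> extended_patches \<gamma>0 \<Omega> G L H \<longrightarrow>
    (\<forall>T\<in>G.
      (\<forall>v. set_integrable lebesgue (extended_region \<Omega> G L H) v \<and>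
           (\<exists>p\<in>P2. AE x in lebesgue. x \<in> Delta \<Omega> G L H T \<longrightarrow> v x = p x) \<longrightarrow>
           (AE x in lebesgue. x \<in> region T \<longrightarrow> interp \<Omega> G L H v x = v x)) \<and>
      (\<forall>k\<le>2. \<forall>v. set_integrable lebesgue (extended_region \<Omega> G L H) v \<and>
           L2 (Delta \<Omega> G L H T) v \<longrightarrow>
           Hspace k (region T) (interp \<Omega> G L H v) \<and>
           Hseminorm k (region T) (interp \<Omega> G L H v)
             \<le> C * diam_cell T powi (- int k) * L2_nrm (Delta \<Omega> G L H T) v) \<and>
      (\<forall>s\<le>3. \<forall>k\<le>s. \<forall>v. Hspace s (Delta \<Omega> G L H T) v \<longrightarrow>
           Hspace k (region T) (\<lambda>x. v x - interp \<Omega> G L H v x) \<and>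
           Hseminorm k (region T) (\<lambda>x. v x - interp \<Omega> G L H v x)
             \<le> C * diam_cell T ^ (s - k) * Hseminorm s (Delta \<Omega> G L H T) v) \<and>
      (\<forall>v v'. (AE x in lebesgue. x \<in> Delta \<Omega> G L H T \<longrightarrow> v x = v' x) \<longrightarrow>
           (AE x in lebesgue. x \<in> region T \<longrightarrow> interp \<Omega> G L H v x = interp \<Omega> G L H v' x)))"
proof -
  define \<eta> :: real where "\<eta> = max 1 (\<gamma>0 / 2)"
  define C1 C2 where "C1 = 4 * ((2 * \<eta>) ^ 3 * (1377 * \<eta>\<^sup>2))"
    and "C2 = 8 * ((18 * \<eta> ^ 4) ^ 3 + (2 * \<eta>) ^ 3 * (1377 * \<eta>\<^sup>2) * (18 * \<eta> ^ 4) ^ 3)"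
  have \<eta>: "1 \<le> \<eta>" by (simp add: \<eta>_def)
  have C: "0 \<le> C1" "0 \<le> C2" using \<eta> by (auto simp: C1_def C2_def intro!: add_nonneg_nonneg mult_nonneg_nonneg)
  show ?thesis
  proof (rule exI[of _ "C1 + C2 + 1"], rule conjI, goal_cases)
    case 1
    show ?case using C by simp
  next
    case 2
    show ?case
    proof (intro allI impI ballI, goal_cases)
      case (1 \<Omega> G L H T)
      then have T: "T \<in> G" by blast
      interpret extended_mesh \<gamma>0 \<Omega> G L H by unfold_locales (use 1 in auto)
      have k: "\<kappa> = \<eta>" by (simp add: \<eta>_def \<kappa>_def)
      have T0: "T \<in> C" "pc T 0 0 = T" using G_subset_C[OF T] patch_center.patch_cell_coords(4)[OF center[OF G_subset_C[OF T]], of 0 0] by auto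
      have h: "0 < diam_cell T" using patch_sizes(7)[OF T0, of 0] by simp
      have D: "region T \<subseteq> Delta \<Omega> G L H T" using patch_in_Delta[OF T0] by auto
      show ?case
      proof (intro conjI allI impI, goal_cases)
        case (1 v)
        then obtain p where p: "p \<in> P2" "AE x in lebesgue. x \<in> Delta \<Omega> G L H T \<longrightarrow> v x = p x" by blast
        have "AE x in lebesgue. x \<in> region T \<longrightarrow> interp \<Omega> G L H p x = p x"
          using region_AE[of T] by eventually_elim (use interp_P2[OF T p(1)] in blast)
        then show ?case
          using interp_cong[OF T p(2)] p(2) by eventually_elim (use D in auto)
      next
        case (2 k v)
        then show ?case using stability(1)[OF T] by blast
      next
        case (3 k v)
        then have "Hseminorm k (region T) (interp \<Omega> G L H v) \<le> C1 * diam_cell T powi (- int k) * L2_nrm (Delta \<Omega> G L H T) v"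
          using stability(2)[OF T] unfolding k C1_def by blast
        also have "\<dots> \<le> (C1 + C2 + 1) * diam_cell T powi (- int k) * L2_nrm (Delta \<Omega> G L H T) v"
          using C h L2_nrm_nonneg by (intro mult_right_mono) auto
        finally show ?case .
      next
        case (4 s k v)
        then show ?case using approximation(1)[OF T] by blast
      next
        case (5 s k v)
        then have "Hseminorm k (region T) (\<lambda>x. v x - interp \<Omega> G L H v x) \<le> C2 * diam_cell T ^ (s - k) * Hseminorm s (Delta \<Omega> G L H T) v"
          using approximation(2)[OF T] unfolding k C2_def by blast
        also have "\<dots> \<le> (C1 + C2 + 1) * diam_cell T ^ (s - k) * Hseminorm s (Delta \<Omega> G L H T) v"
          using C h by (intro mult_right_mono) (auto simp: Hseminorm_def intro!: sum_nonneg)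
        finally show ?case .
      next
        case (6 v v')
        show ?case by (rule interp_cong[OF T 6])
      qed
    qed
  qed
qed

end
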